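(* Assume Conditions A and B. Then for each $N\in\mathbb N$ and each $\mathbf s\in\mathcal O_d$ there is an $\mathbf H^{-\mathbf s}$-valued random variable $\mathcal J^N$ on $(\Omega,\mathcal F,P)$ such that for every $\varphi\in C_c^\infty(U\times\mathbb R^d,\mathbb R^d)$, $\langle\mathcal J^N(\omega),\varphi\rangle=[J^N(\varphi)](\omega)$ for $P$-a.e. $\omega$. In other words, $\mathcal J^N$ is a pathwise realization of $\{\varphi\mapsto J^N(\varphi)\}$.
   Context: Fix $T>0$, $d,m\in\mathbb N$. For a Polish space $(S,d_S)$, $\mathcal P(S)$ is the space of Borel probability measures on $S$ with the topology of weak convergence, and $\mathcal P_1(S)=\{\mu\in\mathcal P(S):\int d_S(x,x_0)\mu(dx)<\infty\}$ with the Wasserstein-1 metric $d_1(\mu,\nu)=\sup\{|\int f\,d\mu-\int f\,d\nu|: f:S\to\mathbb R \text{ 1-Lipschitz}\}$. Let $(\Omega,\mathcal F,P,\{\mathcal F(t)\}_{0\le t\le T})$ be a filtered probability space satisfying the usual conditions, supporting independent $m$-dimensional $\{\mathcal F(t)\}$-Brownian motions $W_1,W_2,\dots$. Let $\varepsilon_N\in(0,1]$ with $\varepsilon_N\downarrow 0$. Given $b:\mathbb R^d\times\mathcal P_1(\mathbb R^d)\to\mathbb R^d$, $\sigma:\mathbb R^d\times\mathcal P_1(\mathbb R^d)\to\mathbb R^{d\times m}$ and deterministic initial points $x_j^N\in\mathbb R^d$, the processes $X_j^N$, $1\le j\le N$, solve $X_j^N(t)=x_j^N+\int_0^t b(X_j^N(s),V^N(s))\,ds+\varepsilon_N\int_0^t\sigma(X_j^N(s),V^N(s))\,dW_j(s)$,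 where $V^N(t)=\frac1N\sum_{j=1}^N\delta_{X_j^N(t)}$. Condition A: there is $L<\infty$ such that $|b(x,\mu)-b(y,\nu)|+|\sigma(x,\mu)-\sigma(y,\nu)|\le L(|x-y|+d_1(\mu,\nu))$ and $|\sigma(x,\mu)|\le L$ for all $x,y\in\mathbb R^d$, $\mu,\nu\in\mathcal P_1(\mathbb R^d)$. Condition B: (i) there is $\mu_0\in\mathcal P(\mathbb R^d)$ with $\frac1N\sum_{j=1}^N\delta_{x_j^N}\to\mu_0$ weakly; (ii) $\sup_N\frac1N\sum_{j=1}^N|x_j^N|^2<\infty$. Sobolev spaces: fix $a<0<T<b$, $U=(a,b)$, and $\mathcal O_d=(\tfrac12,1)\times(\tfrac d2+1,\infty)$. For $s\ge0$, $H^s(\mathbb R^d,\mathbb R^d)$ is the space of $f\in L^2$ with $\|f\|_s^2=\int_{\mathbb R^d}|\hat f(\xi)|^2(1+|\xi|^2)^s d\xi<\infty$, $\hat f(\xi)=\int e^{-2\pi i\xi\cdot x}f(x)dx$. For $\mathbf s=(s_1,s_2)\in\mathcal O_d$, $\mathbf H^{\mathbf s}$ is the Hilbert space of $f:U\times\mathbb R^d\to\mathbb R^d$ with $\|f\|_{\mathbf s}^2=\int_U\|f(u,\cdot)\|_{s_2}^2du+\int_U\int_U\frac{\|f(u,\cdot)-f(v,\cdot)\|_{s_2}^2}{|u-v|^{1+2s_1}}du\,dv<\infty$; $\mathbf H^{-\mathbf s}$ is its dual with norm $\|F\|_{-\mathbf s}=\sup_{\varphi\in C_c^\infty(U\times\mathbb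 R^d,\mathbb R^d)}|\langle F,\varphi\rangle|/\|\varphi\|_{\mathbf s}$. Stochastic current: for $\varphi\in C_c^\infty(U\times\mathbb R^d,\mathbb R^d)$, $J^N(\varphi)=\frac1N\sum_{j=1}^N\int_0^T\varphi(t,X_j^N(t))\circ dX_j^N(t)$ (Stratonovich integral), defined a.s. for each fixed $\varphi$. A pathwise realization of a family $\{\varphi\mapsto J(\varphi)\}$ of such a.s.-defined random variables is an $\mathbf H^{-\mathbf s}$-valued random variable $\mathcal J$ with $\langle\mathcal J,\varphi\rangle=J(\varphi)$ a.s. for every $\varphi\in C_c^\infty(U\times\mathbb R^d,\mathbb R^d)$. *)

theory Defs
  imports "HOL-Analysis.Analysis" "HOL-Probability.Probability"
begin

definition partition_of :: "real \<Rightarrow> real \<Rightarrow> real list \<Rightarrow> bool" where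
  "partition_of a c p \<longleftrightarrow> p \<noteq> [] \<and> hd p = a \<and> last p = c \<and> sorted_wrt (<) p"

definition mesh :: "real list \<Rightarrow> real" where
  "mesh p = foldr max (map (\<lambda>i. p ! Suc i - p ! i) [0..<length p - 1]) 0"

definition conv_in_prob ::
  "'w measure \<Rightarrow> real \<Rightarrow> real \<Rightarrow> (real list \<Rightarrow> 'w \<Rightarrow> 'b::real_normed_vector) \<Rightarrow> ('w \<Rightarrow> 'b) \<Rightarrow> bool" where
  "conv_in_prob M a c S Y \<longleftrightarrow> Y \<in> borel_measurable M \<and>
     (\<forall>e>0. \<forall>\<delta>>0. \<exists>\<eta>>0. \<forall>p. partition_of a c p \<and> mesh p < \<eta> \<longrightarrow>
        measure M {\<omega>\<in>space M. dist (S p \<omega>) (Y \<omega>) > e} < \<delta>)"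

definition ito_sum ::
  "(real \<Rightarrow> 'w \<Rightarrow> real^'m^'d) \<Rightarrow> (real \<Rightarrow> 'w \<Rightarrow> real^'m) \<Rightarrow> real list \<Rightarrow> 'w \<Rightarrow> real^'d" where
  "ito_sum H W p \<omega> = (\<Sum>i<length p - 1. H (p ! i) \<omega> *v (W (p ! Suc i) \<omega> - W (p ! i) \<omega>))"

definition strat_sum ::
  "(real \<times> (real^'d) \<Rightarrow> real^'d) \<Rightarrow> (real \<Rightarrow> 'w \<Rightarrow> real^'d) \<Rightarrow> real list \<Rightarrow> 'w \<Rightarrow> real" where
  "strat_sum \<phi> X p \<omega> = (\<Sum>i<length p - 1.
      ((\<phi> (p ! i, X (p ! i) \<omega>) + \<phi> (p ! Suc i, X (p ! Suc i) \<omega>)) /\<^sub>R 2)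
        \<bullet> (X (p ! Suc i) \<omega> - X (p ! i) \<omega>))"

definition usual_filtered_prob_space :: "'w measure \<Rightarrow> (real \<Rightarrow> 'w measure) \<Rightarrow> real \<Rightarrow> bool" where
  "usual_filtered_prob_space M F T \<longleftrightarrow> prob_space M \<and> complete_measure M \<and>
     (\<forall>t\<in>{0..T}. space (F t) = space M \<and> sets (F t) \<subseteq> sets M) \<and>
     (\<forall>s\<in>{0..T}. \<forall>t\<in>{0..T}. s \<le> t \<longrightarrow> sets (F s) \<subseteq> sets (F t)) \<and>
     (\<forall>N\<in>sets M. measure M N = 0 \<longrightarrow> N \<in> sets (F 0)) \<and>
     (\<forall>t\<in>{0..<T}. sets (F t) = (\<Inter>s\<in>{t<..T}. sets (F s)))"

definition F_brownian :: "'w measure \<Rightarrow> (real \<Rightarrow> 'w measure) \<Rightarrow> real \<Rightarrow> (real \<Rightarrow> 'w \<Rightarrow> real^'m) \<Rightarrow> bool" where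
  "F_brownian M F T W \<longleftrightarrow>
     (\<forall>\<omega>\<in>space M. W 0 \<omega> = 0 \<and> continuous_on {0..T} (\<lambda>t. W t \<omega>)) \<and>
     (\<forall>t\<in>{0..T}. W t \<in> borel_measurable (F t)) \<and>
     (\<forall>s\<in>{0..T}. \<forall>t\<in>{0..T}. s < t \<longrightarrow>
        (\<forall>A\<in>sets (F s). \<forall>B\<in>sets borel.
           measure M (A \<inter> {\<omega>\<in>space M. W t \<omega> - W s \<omega> \<in> B})
             = measure M A * measure M {\<omega>\<in>space M. W t \<omega> - W s \<omega> \<in> B}) \<and>
        distr M borel (\<lambda>\<omega>. W t \<omega> - W s \<omega>)
          = density lborel (\<lambda>x. ennreal (\<Prod>i\<in>UNIV. normal_density 0 (sqrt (t - s)) (x $ i))))"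

definition empirical :: "nat \<Rightarrow> (nat \<Rightarrow> 'a::euclidean_space) \<Rightarrow> 'a measure" where
  "empirical N x = distr (uniform_count_measure {1..N}) borel x"

definition P1 :: "'a::euclidean_space measure set" where
  "P1 = {\<mu>. prob_space \<mu> \<and> sets \<mu> = sets borel \<and> integrable \<mu> norm}"

definition W1 :: "'a::euclidean_space measure \<Rightarrow> 'a measure \<Rightarrow> real" where
  "W1 \<mu> \<nu> = (SUP f\<in>{f. 1-lipschitz_on UNIV f}. \<bar>integral\<^sup>L \<mu> f - integral\<^sup>L \<nu> f\<bar>)"

definition weak_conv :: "(nat \<Rightarrow> 'a::euclidean_space measure) \<Rightarrow> 'a measure \<Rightarrow> bool" where
  "weak_conv \<mu>s \<mu> \<longleftrightarrow> (\<forall>f::'a \<Rightarrow> real. continuous_on UNIV f \<and> bounded (range f) \<longrightarrow>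
      (\<lambda>n. integral\<^sup>L (\<mu>s n) f) \<longlonglongrightarrow> integral\<^sup>L \<mu> f)"

definition particle_system ::
  "'w measure \<Rightarrow> (real \<Rightarrow> 'w measure) \<Rightarrow> real \<Rightarrow> (nat \<Rightarrow> real \<Rightarrow> 'w \<Rightarrow> real^'m)
   \<Rightarrow> (real^'d \<Rightarrow> (real^'d) measure \<Rightarrow> real^'d) \<Rightarrow> (real^'d \<Rightarrow> (real^'d) measure \<Rightarrow> real^'m^'d)
   \<Rightarrow> real \<Rightarrow> (nat \<Rightarrow> real^'d) \<Rightarrow> nat \<Rightarrow> (nat \<Rightarrow> real \<Rightarrow> 'w \<Rightarrow> real^'d) \<Rightarrow> bool" where
  "particle_system M F T W b \<sigma> eps x N X \<longleftrightarrow>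
     (\<forall>j\<in>{1..N}.
        (\<forall>t\<in>{0..T}. X j t \<in> borel_measurable (F t)) \<and>
        (\<forall>\<omega>\<in>space M. continuous_on {0..T} (\<lambda>t. X j t \<omega>)) \<and>
        (\<forall>t\<in>{0..T}. \<exists>I.
           conv_in_prob M 0 t
             (ito_sum (\<lambda>s \<omega>. \<sigma> (X j s \<omega>) (empirical N (\<lambda>k. X k s \<omega>))) (W j)) I \<and>
           (AE \<omega> in M. X j t \<omega> = x j
               + integral {0..t} (\<lambda>s. b (X j s \<omega>) (empirical N (\<lambda>k. X k s \<omega>)))
               + eps *\<^sub>R I \<omega>)))"

fun pderivs :: "'a::euclidean_space list \<Rightarrow> ('a \<Rightarrow> 'b::real_normed_vector) \<Rightarrow> 'a \<Rightarrow> 'b" where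
  "pderivs [] f = f"
| "pderivs (v # vs) f = (\<lambda>z. vector_derivative (\<lambda>t. pderivs vs f (z + t *\<^sub>R v)) (at 0))"

definition smooth_on :: "'a::euclidean_space set \<Rightarrow> ('a \<Rightarrow> 'b::real_normed_vector) \<Rightarrow> bool" where
  "smooth_on S f \<longleftrightarrow> (\<forall>vs\<in>lists Basis. continuous_on S (pderivs vs f) \<and>
      (\<forall>v\<in>Basis. \<forall>z\<in>S. ((\<lambda>t. pderivs vs f (z + t *\<^sub>R v)) has_vector_derivative
                           pderivs (v # vs) f z) (at 0)))"

definition test_fun :: "real \<Rightarrow> real \<Rightarrow> (real \<times> (real^'d) \<Rightarrow> real^'d) \<Rightarrow> bool" where
  "test_fun a c \<phi> \<longleftrightarrow> smooth_on ({a<..<c} \<times> UNIV) \<phi> \<and>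
     compact (closure {z. \<phi> z \<noteq> 0}) \<and> closure {z. \<phi> z \<noteq> 0} \<subseteq> {a<..<c} \<times> UNIV \<and>
     (\<forall>z. z \<notin> {a<..<c} \<times> UNIV \<longrightarrow> \<phi> z = 0)"

definition fourier_comp :: "(real^'d \<Rightarrow> real^'d) \<Rightarrow> 'd \<Rightarrow> real^'d \<Rightarrow> complex" where
  "fourier_comp f k \<xi> = integral\<^sup>L lborel (\<lambda>x. cis (- 2 * pi * (\<xi> \<bullet> x)) * complex_of_real (f x $ k))"

definition Hs_norm2 :: "real \<Rightarrow> (real^'d \<Rightarrow> real^'d) \<Rightarrow> ennreal" where
  "Hs_norm2 s f = (\<integral>\<^sup>+ \<xi>. ennreal ((\<Sum>k\<in>UNIV. (cmod (fourier_comp f k \<xi>))\<^sup>2) * (1 + (norm \<xi>)\<^sup>2) powr s) \<partial>lborel)"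

definition Hbold_norm2 :: "real \<Rightarrow> real \<Rightarrow> real \<Rightarrow> real \<Rightarrow> (real \<times> (real^'d) \<Rightarrow> real^'d) \<Rightarrow> ennreal" where
  "Hbold_norm2 a c s1 s2 f =
     (\<integral>\<^sup>+ u\<in>{a<..<c}. Hs_norm2 s2 (\<lambda>x. f (u, x)) \<partial>lborel)
   + (\<integral>\<^sup>+ u\<in>{a<..<c}. (\<integral>\<^sup>+ v\<in>{a<..<c}.
        Hs_norm2 s2 (\<lambda>x. f (u, x) - f (v, x)) / ennreal (\<bar>u - v\<bar> powr (1 + 2 * s1)) \<partial>lborel) \<partial>lborel)"

text \<open>Elements of the dual H^{-s}: linear functionals on C_c^infinity bounded w.r.t. the
  H^s norm (equivalently, by density, continuous linear functionals on H^s).\<close>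
definition Hneg :: "real \<Rightarrow> real \<Rightarrow> real \<Rightarrow> real \<Rightarrow> ((real \<times> (real^'d) \<Rightarrow> real^'d) \<Rightarrow> real) \<Rightarrow> bool" where
  "Hneg a c s1 s2 G \<longleftrightarrow>
     (\<forall>\<phi> \<psi>. test_fun a c \<phi> \<and> test_fun a c \<psi> \<longrightarrow> G (\<lambda>z. \<phi> z + \<psi> z) = G \<phi> + G \<psi>) \<and>
     (\<forall>\<phi> r. test_fun a c \<phi> \<longrightarrow> G (\<lambda>z. r *\<^sub>R \<phi> z) = r * G \<phi>) \<and>
     (\<exists>C. \<forall>\<phi>. test_fun a c \<phi> \<longrightarrow> ennreal ((G \<phi>)\<^sup>2) \<le> ennreal C * Hbold_norm2 a c s1 s2 \<phi>)"

end

theory Submission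
 imports Defs
begin

text \<open>
 For one particle write dX = b dt + eps sigma dW. The Stratonovich integral of \<open>\<phi>(t, X)\<close> splits into the drift
 integral, an Ito correction and an Ito integral. The first two are integrals over time of point evaluations of
 \<open>\<phi>\<close> and of its first derivatives at X, so they are bounded path by path by Sobolev embedding (this is where
 \<open>s2 > d/2 + 1\<close> enters). For the Ito integral, average \<open>\<phi>\<close> in time over dyadic intervals of length \<open>T / 2^k\<close> and
 replace the integrator by its increments on a much finer grid. The resulting functional is a finite random
 combination of point evaluations of \<open>\<phi>\<close>; by Plancherel its dual norm in space is an explicit double sum over point
 masses, whose expectation is computed frequency by frequency with the Ito isometry. Passing from k to k + 1 costs
 a factor \<open>2 powr (1/2 - s1)\<close>, summable as \<open>s1 > 1/2\<close>, so almost surely these functionals converge for all \<open>\<phi>\<close>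
 simultaneously, off a null set that does not depend on \<open>\<phi>\<close>. The limit is bounded on the Sobolev space. That it
 is the Stratonovich integral for each fixed \<open>\<phi>\<close> follows from a second-order Taylor expansion of \<open>\<phi>\<close> along
 partitions and mean-square estimates for the increments.
\<close>

text \<open>The obstacle is the order of quantifiers: each Stratonovich integral is fixed only off a
  null set of its own, while one null set has to serve all test functions. Randomness and test
  function are therefore separated before anything is averaged over the probability space. Every
  increment of the scheme satisfies 2|x| <= v * (th + H / th) with v random and free of
  \<open>\<phi>\<close>, H the squared Sobolev norm and th > 0 arbitrary. Such bounds are linear in
  the energies, so they add over time intervals and over levels, and it is enough that the
  expectations of the energies are summable. The parameter th is optimised once, after all levels
  have been summed, which restores a quadratic bound. The coefficients are continuous in mean square
  without a rate, so the grids cannot be refined at a fixed ratio: \<open>\<nu> k\<close> is read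
  off a modulus of continuity. The equation supplies a separate limit in probability for each time
  and nothing pathwise about the noise. The martingale part is therefore taken to be X minus the
  drift, and L2 bounds for Ito sums are carried over to it by Fatou's lemma. The drift is unbounded,
  but only its continuity along one path is used.\<close>

abbreviation "meas M \<equiv> borel_measurable M"

section \<open>Fourier inversion and point evaluations\<close>

lemma borel_measurable_cis[measurable (raw)]:
 "f \<in> meas M ==> (%x. cis (f x)) \<in> meas M"
 unfolding cis_conv_exp by measurable

lemma borel_measurable_vec_component[measurable (raw)]:
 fixes f :: "'a => ('b::real_normed_vector)^'n"
 assumes "f \<in> meas M"
 shows "(%x. f x $ k) \<in> meas M"
 using measurable_compose[OF assms, of "%x. x $ k" borel] by (simp add: borel_measurable_continuous_onI continuous_on_component)

lemma lborel_affine_integral: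
 fixes f :: "'a::euclidean_space => 'b::{banach, second_countable_topology}"
 assumes c: "c ~= 0" and [measurable]: "f \<in> meas borel"
 shows integrable_lborel_affine: "integrable lborel (%x. f (t + c *\<^sub>R x)) \<longleftrightarrow> integrable lborel f"
  and integral_lborel_affine: "(\<integral>x. f x \<partial>lborel) = \<bar>c\<bar> ^ DIM('a) *\<^sub>R (\<integral>x. f (t + c *\<^sub>R x) \<partial>lborel)" (is ?C1)
proof -
 let ?q0 = "%x. \<bar>c\<bar> ^ DIM('a) *\<^sub>R f (t + c *\<^sub>R x)"
 let ?q1 = "%x. f (t + c *\<^sub>R x)"
 note aff = lborel_affine[OF c, of t]
 have *: "\<bar>c\<bar> ^ DIM('a) ~= 0" using c by simp
 show "integrable lborel ?q1 \<longleftrightarrow> integrable lborel f"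
 proof -
  have "integrable lborel f \<longleftrightarrow> integrable lborel ?q0"
   by (subst aff, subst integrable_density) (use * in \<open>auto simp: integrable_distr_eq\<close>)
  also have "... \<longleftrightarrow> integrable lborel ?q1"
  proof
   assume "integrable lborel ?q0"
   then have "integrable lborel (%x. inverse (\<bar>c\<bar> ^ DIM('a)) *\<^sub>R \<bar>c\<bar> ^ DIM('a) *\<^sub>R f (t + c *\<^sub>R x))"
    by (rule integrable_scaleR_right)
   then show "integrable lborel ?q1" using c by simp
  qed auto
  finally show ?thesis by simp
 qed
 show ?C1
  by (subst aff, subst integral_density) (use * in \<open>auto simp: integral_distr\<close>)
qed

lemma lborel_prod_Basis:
 fixes f :: "'a::euclidean_space => real => 'b::{real_normed_field,banach,second_countable_topology}"
 assumes int: "!!b. b \<in> Basis ==> integrable lborel (f b)"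
 shows integrable_lborel_prod_Basis: "integrable lborel (%x::'a. \<Prod>b\<in>Basis. f b (x \<bullet> b))" (is ?C1)
  and integral_lborel_prod_Basis:
   "(\<integral>x. (\<Prod>b\<in>Basis. f b (x \<bullet> b)) \<partial>(lborel::'a measure)) = (\<Prod>b\<in>Basis. integral\<^sup>L lborel (f b))" (is ?C2)
proof -
 interpret product_sigma_finite "%b::'a. lborel :: real measure" ..
 have [measurable]: "f b \<in> meas borel" if "b \<in> Basis" for b
  using borel_measurable_integrable[OF int[OF that]] by simp
 have m: "(%x::'a. \<Prod>b\<in>Basis. f b (x \<bullet> b)) \<in> meas borel" by measurable
 have s: "(\<Prod>b\<in>Basis. f b ((\<Sum>c\<in>Basis. g c *\<^sub>R c) \<bullet> b)) = (\<Prod>b\<in>Basis. f b (g b))" for g :: "'a => real"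
  by (rule prod.cong) auto
 show ?C1
  unfolding lborel_eq[where 'a='a] using product_integrable_prod[OF finite_Basis int]
  by (subst integrable_distr_eq) (auto simp: s m)
 show ?C2
  unfolding lborel_eq[where 'a='a] using product_integral_prod[OF finite_Basis int]
  by (subst integral_distr) (auto simp: s m)
qed

section \<open>Gaussian kernels and their transforms\<close>

lemma fourier_std_normal:
 "integrable lborel (%x. cis (t * x) * complex_of_real (std_normal_density x))"
 "(\<integral>x. cis (t * x) * complex_of_real (std_normal_density x) \<partial>lborel) = complex_of_real (exp (- (t^2 / 2)))"
proof -
 let ?q0 = "\<integral>x. cis (t * x) * complex_of_real (std_normal_density x) \<partial>lborel"
 have 1: "integrable lborel (%x. std_normal_density x)" by simp
 show "integrable lborel (%x. cis (t * x) * complex_of_real (std_normal_density x))"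
  by (rule Bochner_Integration.integrable_bound[OF 1]) (auto simp: norm_mult)
 have "char std_normal_distribution t = ?q0"
  unfolding char_def
  by (subst integral_density) (auto simp: scaleR_conv_of_real cis_conv_exp mult_ac)
 then show "?q0 = complex_of_real (exp (- (t^2 / 2)))"
  by (simp add: char_std_normal_distribution)
qed

definition gauss :: "'a::euclidean_space => real" where
 "gauss z = (\<Prod>b\<in>Basis. std_normal_density (z \<bullet> b))"

lemma gauss_measurable[measurable]: "gauss \<in> meas borel"
 unfolding gauss_def by measurable

lemma gauss_nonneg: "0 <= gauss z"
 unfolding gauss_def by (intro prod_nonneg) auto

lemma gauss_eq: "gauss (z::'a::euclidean_space) = (1 / sqrt (2*pi)) ^ DIM('a) * exp (- (norm z)\<^sup>2 / 2)"
proof -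
 let ?q0 = "\<Sum>b\<in>Basis. - (z \<bullet> b)\<^sup>2 / 2"
 have "gauss z = (\<Prod>b\<in>(Basis::'a set). (1 / sqrt (2*pi)) * exp (- (z \<bullet> b)\<^sup>2 / 2))"
  unfolding gauss_def by (simp add: std_normal_density_def)
 also have "... = (1 / sqrt (2*pi)) ^ DIM('a) * exp ?q0"
  by (simp only: prod.distrib exp_sum[OF finite_Basis] prod_constant)
 also have "?q0 = - (norm z)\<^sup>2 / 2"
  unfolding power2_norm_eq_inner euclidean_inner[of z z]
  by (simp add: sum_negf sum_divide_distrib[symmetric] power2_eq_square)
 finally show ?thesis .
qed

lemma gauss_integrable: "integrable lborel (gauss :: 'a::euclidean_space => real)"
 and gauss_integral: "integral\<^sup>L lborel (gauss :: 'a::euclidean_space => real) = 1"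
proof -
 have "integrable lborel (%x. std_normal_density x)" by simp
 note * = lborel_prod_Basis[where f="%_. std_normal_density", OF this]
 show "integrable lborel (gauss :: 'a => real)" using *(1) by (simp add: gauss_def[abs_def])
 show "integral\<^sup>L lborel (gauss :: 'a => real) = 1" using *(2) by (simp add: gauss_def[abs_def])
qed

text \<open>Both the phase and the density are products over coordinates, so this is the
  characteristic function of the standard normal law, one coordinate at a time.\<close>

lemma fourier_gauss:
 fixes z :: "'a::euclidean_space"
 shows "(\<integral>xi. cis (xi \<bullet> z) * complex_of_real (gauss xi) \<partial>lborel) = complex_of_real (exp (- (norm z)\<^sup>2 / 2))"
proof -
 let ?q0 = "%b xi. (z \<bullet> b) * (xi \<bullet> b)"
 let ?q1 = "\<Sum>b\<in>Basis. - (z \<bullet> b)\<^sup>2 / 2"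
 have c: "cis (xi \<bullet> z) = (\<Prod>b\<in>Basis. cis (?q0 b xi))" for xi
 proof -
  have "(\<Prod>b\<in>Basis. cis (?q0 b xi)) = exp (\<Sum>b\<in>Basis. \<i> * complex_of_real (?q0 b xi))"
   by (simp add: cis_conv_exp exp_sum)
  also have "... = cis (xi \<bullet> z)"
   by (simp add: cis_conv_exp euclidean_inner[of xi z] sum_distrib_left mult_ac)
  finally show ?thesis by simp
 qed
 have "(\<integral>xi. cis (xi \<bullet> z) * complex_of_real (gauss xi) \<partial>lborel) =
  (\<integral>xi. (\<Prod>b\<in>Basis. cis (?q0 b xi) * complex_of_real (std_normal_density (xi \<bullet> b))) \<partial>lborel)"
  by (simp add: c gauss_def prod.distrib)
 also have "... = (\<Prod>b\<in>Basis. complex_of_real (exp (- ((z \<bullet> b)^2 / 2))))"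
  using integral_lborel_prod_Basis[where 'a='a and f="%b x. cis ((z \<bullet> b) * x) * complex_of_real (std_normal_density x)"] fourier_std_normal by auto
 also have "... = complex_of_real (exp ?q1)"
  by (simp add: exp_sum)
 also have "?q1 = - (norm z)\<^sup>2 / 2"
  unfolding power2_norm_eq_inner euclidean_inner[of z z]
  by (simp add: sum_negf sum_divide_distrib[symmetric] power2_eq_square)
 finally show ?thesis .
qed

text \<open>The scalar version of \<open>fourier_comp\<close>: applied to the k-th component of a
  vector field it is the same integral.\<close>

definition fourier :: "('a::euclidean_space => real) => 'a => complex" where
 "fourier f xi = (\<integral>y. cis (- 2 * pi * (xi \<bullet> y)) * complex_of_real (f y) \<partial>lborel)"

lemma fourier_measurable:
 assumes [measurable]: "f \<in> meas borel"
 shows "fourier f \<in> meas borel"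
 unfolding fourier_def by measurable

lemma integrable_cis_mult:
 fixes f :: "'a::euclidean_space => real"
 assumes "integrable lborel f" and [measurable]: "g \<in> meas borel"
 shows "integrable lborel (%y. cis (g y) * complex_of_real (f y))"
proof (rule Bochner_Integration.integrable_bound[OF assms(1)])
 have [measurable]: "f \<in> meas borel" using assms(1) by simp
 show "(%y. cis (g y) * complex_of_real (f y)) \<in> meas lborel"
  by measurable
qed (auto simp: norm_mult)

text \<open>Since \<open>gauss\<close> is, up to scaling, its own Fourier transform, inserting the damping factor turns
 Fourier inversion into a convolution with an approximate identity.\<close>

lemma fourier_damped_inversion:
 fixes f :: "'a::euclidean_space => real" and r :: real
 assumes r: "r > 0" and int: "integrable lborel f"
 shows "(\<integral>xi. fourier f xi * cis (2 * pi * (xi \<bullet> x)) * complex_of_real (exp (- (norm xi / r)\<^sup>2 / 2)) \<partial>lborel)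
   = complex_of_real (\<integral>z. f (x + (1 / (2 * pi * r)) *\<^sub>R z) * gauss z \<partial>lborel)"
proof -
 let ?q0 = "%xi x y. 2 * pi * (xi \<bullet> (x - y))"
 let ?q1 = "%r x y. (2 * pi * r) ^ DIM('a) * gauss ((2 * pi * r) *\<^sub>R (x - y))"
 let ?q2 = "%xi x. 2 * pi * (xi \<bullet> x)"
 let ?q3 = "%z E lborel. \<integral>xi. cis (2 * pi * (xi \<bullet> z)) * complex_of_real (E xi) \<partial>lborel"
 let ?q4 = "%x f E. %(y, xi). cis (?q0 xi x y) * complex_of_real (f y * E xi)"
 have fm[measurable]: "f \<in> meas borel" using int by simp
 define E where "E xi = exp (- (norm xi / r)\<^sup>2 / 2)" for xi :: 'a
 have Em[measurable]: "E \<in> meas borel" unfolding E_def by measurable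
 have E_eq: "E xi = sqrt (2*pi) ^ DIM('a) * gauss ((1/r) *\<^sub>R xi)" for xi
  using r unfolding E_def gauss_eq by (simp add: power_divide power_one_over)
 have Eint: "integrable lborel E"
  unfolding E_eq[abs_def] using r gauss_integrable[where 'a='a]
   integrable_lborel_affine[where c="1/r" and t=0 and f="gauss::'a=>real"] by auto
 \<comment> \<open>The transform of the damping factor is a normal density of width 1 / (2 pi r),
   the approximate identity of the convolution.\<close>
 have Eft: "(?q3 z E lborel)
   = complex_of_real ((2 * pi * r) ^ DIM('a) * gauss ((2 * pi * r) *\<^sub>R z))" for z :: 'a
 proof -
  have "(?q3 z E lborel)
   = (\<integral>xi. r^DIM('a) *\<^sub>R (cis (2 * pi * ((r *\<^sub>R xi) \<bullet> z)) * complex_of_real (E (r *\<^sub>R xi))) \<partial>lborel)"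
   using r by (subst integral_lborel_affine[where c=r and t=0]) auto
  also have "... = (\<integral>xi. complex_of_real ((r * sqrt (2*pi)) ^ DIM('a)) * (cis (xi \<bullet> ((2*pi*r) *\<^sub>R z)) * complex_of_real (gauss xi)) \<partial>lborel)"
   using r by (simp add: E_eq scaleR_conv_of_real power_mult_distrib mult_ac)
  also have "... = complex_of_real ((r * sqrt (2*pi)) ^ DIM('a)) * complex_of_real (exp (- (norm ((2*pi*r) *\<^sub>R z))\<^sup>2 / 2))"
   using fourier_gauss[of "(2*pi*r) *\<^sub>R z"] by simp
  also have "... = complex_of_real ((r * sqrt (2*pi)) ^ DIM('a) * exp (- (norm ((2*pi*r) *\<^sub>R z))\<^sup>2 / 2))"
   by simp
  also have "(r * sqrt (2*pi)) ^ DIM('a) = (2 * pi * r) ^ DIM('a) * (1 / sqrt (2*pi)) ^ DIM('a)"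
   unfolding power_mult_distrib[symmetric] by (rule arg_cong[where f="%x. x ^ DIM('a)"]) (simp add: field_simps)
  finally show ?thesis unfolding gauss_eq by (simp only: mult.assoc)
 qed
 \<comment> \<open>Without the factor \<open>E\<close> the integrand has no decay in xi; the damping
   is what makes Fubini applicable.\<close>
 have pint: "integrable (lborel \<Otimes>\<^sub>M lborel) (?q4 x f E)"
 proof (rule lborel_pair.Fubini_integrable)
  show "(?q4 x f E) \<in> meas (lborel \<Otimes>\<^sub>M lborel)"
   by measurable
  have "integrable lborel (%y. norm (f y) * (\<integral>xi. norm (E xi) \<partial>lborel))"
   using int by auto
  then show "integrable lborel (%y. \<integral>xi. norm (case (y, xi) of (y, xi) => cis (?q0 xi x y) * complex_of_real (f y * E xi)) \<partial>lborel)"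
   by (simp add: norm_mult abs_mult)
  show "AE y in lborel. integrable lborel (%xi. case (y, xi) of (y, xi) => cis (?q0 xi x y) * complex_of_real (f y * E xi))"
  proof (intro AE_I2)
   fix y
   have "integrable lborel (%xi. f y * E xi)" using Eint by simp
   from integrable_cis_mult[OF this, of "%xi. 2 * pi * (xi \<bullet> (x - y))"]
   show "integrable lborel (%xi. case (y, xi) of (y, xi) => cis (?q0 xi x y) * complex_of_real (f y * E xi))"
    by simp
  qed
 qed
 have "(\<integral>xi. fourier f xi * cis (?q2 xi x) * complex_of_real (E xi) \<partial>lborel)
  = (\<integral>xi. (\<integral>y. cis (?q0 xi x y) * complex_of_real (f y * E xi) \<partial>lborel) \<partial>lborel)"
 proof (rule Bochner_Integration.integral_cong[OF refl])
  fix xi :: 'a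
  have "fourier f xi * cis (?q2 xi x) * complex_of_real (E xi)
    = (\<integral>y. cis (- 2 * pi * (xi \<bullet> y)) * complex_of_real (f y) * (cis (?q2 xi x) * complex_of_real (E xi)) \<partial>lborel)"
   unfolding fourier_def by (subst integral_mult_left_zero) (simp add: mult.assoc)
  also have "... = (\<integral>y. cis (?q0 xi x y) * complex_of_real (f y * E xi) \<partial>lborel)"
  proof (rule Bochner_Integration.integral_cong[OF refl])
   fix y
   have "cis (?q0 xi x y) = cis (- 2 * pi * (xi \<bullet> y)) * cis (?q2 xi x)"
    by (simp add: cis_mult inner_diff_right algebra_simps)
   then show "cis (- 2 * pi * (xi \<bullet> y)) * complex_of_real (f y) * (cis (?q2 xi x) * complex_of_real (E xi)) =
    cis (?q0 xi x y) * complex_of_real (f y * E xi)" by simp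
  qed
  finally show "fourier f xi * cis (?q2 xi x) * complex_of_real (E xi) = (\<integral>y. cis (?q0 xi x y) * complex_of_real (f y * E xi) \<partial>lborel)" .
 qed
 also have "... = (\<integral>y. (\<integral>xi. cis (?q0 xi x y) * complex_of_real (f y * E xi) \<partial>lborel) \<partial>lborel)"
  using lborel_pair.Fubini_integral[OF pint] by simp
 also have "... = (\<integral>y. complex_of_real (f y * (?q1 r x y)) \<partial>lborel)"
 proof (rule Bochner_Integration.integral_cong[OF refl])
  fix y
  have "(\<integral>xi. cis (?q0 xi x y) * complex_of_real (f y * E xi) \<partial>lborel)
   = (\<integral>xi. complex_of_real (f y) * (cis (?q0 xi x y) * complex_of_real (E xi)) \<partial>lborel)"
   by (simp add: mult_ac)
  then show "(\<integral>xi. cis (?q0 xi x y) * complex_of_real (f y * E xi) \<partial>lborel) =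
   complex_of_real (f y * (?q1 r x y))"
   by (simp add: Eft)
 qed
 also have "... = complex_of_real (\<integral>y. f y * (?q1 r x y) \<partial>lborel)"
  by (rule integral_complex_of_real)
 also have "(\<integral>y. f y * (?q1 r x y) \<partial>lborel)
  = (\<integral>z. f (x + (1 / (2 * pi * r)) *\<^sub>R z) * gauss z \<partial>lborel)"
 proof -
  \<comment> \<open>The width of the kernel. The substitution y = x + q z moves it into the argument
    of f, and evenness of \<open>gauss\<close> removes the sign.\<close>
  define q where "q = 1 / (2 * pi * r)"
  have q: "q > 0" "2 * pi * r = 1 / q" unfolding q_def using r by auto
  have ge: "gauss (- z) = gauss z" for z :: 'a by (simp add: gauss_eq)
  have "(\<integral>y. f y * ((1/q) ^ DIM('a) * gauss ((1/q) *\<^sub>R (x - y))) \<partial>lborel)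
   = (\<integral>z. q ^ DIM('a) * (f (x + q *\<^sub>R z) * ((1/q) ^ DIM('a) * gauss (- z))) \<partial>lborel)"
   using q by (subst integral_lborel_affine[where c=q and t=x]) auto
  also have "... = (\<integral>z. f (x + q *\<^sub>R z) * gauss z \<partial>lborel)"
  proof -
   define u where "u = q ^ DIM('a)"
   have u: "u > 0" "(1/q) ^ DIM('a) = 1 / u" unfolding u_def using q by (auto simp: power_one_over)
   have eq: "u * (f (x + q *\<^sub>R z) * ((1/u) * gauss (- z))) = f (x + q *\<^sub>R z) * gauss z" for z
    unfolding ge using u(1) by simp
   show ?thesis unfolding u(2) u_def[symmetric] by (simp only: eq)
  qed
  finally show ?thesis unfolding q_def[symmetric] unfolding q(2) .
 qed
 finally show ?thesis unfolding E_def .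
qed

text \<open>The damped integral is a Gaussian average of f around x whose width shrinks like 1 / n,
  and dominated convergence applies since f is bounded. Keeping the damping avoids having to
  integrate the transform itself.\<close>

lemma fourier_inversion_tendsto:
 fixes f :: "'a::euclidean_space => real"
 assumes int: "integrable lborel f" and cont: "continuous_on UNIV f" and bd: "!!x. \<bar>f x\<bar> <= B"
 shows "(%n. \<integral>xi. fourier f xi * cis (2 * pi * (xi \<bullet> x)) * complex_of_real (exp (- (norm xi / Suc n)\<^sup>2 / 2)) \<partial>lborel)
  \<longlonglongrightarrow> complex_of_real (f x)"
proof -
 let ?q0 = "%x n z. x + (1 / (2 * pi * Suc n)) *\<^sub>R z"
 have [measurable]: "f \<in> meas borel" using int by simp
 have "(%n. \<integral>z. f (?q0 x n z) * gauss z \<partial>lborel) \<longlonglongrightarrow> (\<integral>z. f x * gauss (z::'a) \<partial>lborel)"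
 proof (rule integral_dominated_convergence[where w="%z::'a. B * gauss z"])
  show "(%z::'a. f x * gauss z) \<in> meas lborel" by measurable
  show "(%z. f (?q0 x n z) * gauss z) \<in> meas lborel" for n by measurable
  show "AE z in lborel. (%n. f (?q0 x n z) * gauss z) \<longlonglongrightarrow> f x * gauss z"
  proof (intro AE_I2 tendsto_mult tendsto_const)
   fix z :: 'a
   have "(%n. 1 / (2 * pi * Suc n)) \<longlonglongrightarrow> 0"
    using tendsto_mult_left[OF LIMSEQ_inverse_real_of_nat, of "1/(2*pi)"] by (simp add: divide_simps mult_ac)
   then have "(%n. x + (1 / (2 * pi * Suc n)) *\<^sub>R z) \<longlonglongrightarrow> x + 0 *\<^sub>R z"
    by (intro tendsto_intros)
   moreover have "isCont f x" using cont by (simp add: continuous_on_eq_continuous_at)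
   ultimately show "(%n. f (?q0 x n z)) \<longlonglongrightarrow> f x"
    using isCont_tendsto_compose[of x f] by simp
  qed
  show "integrable lborel (%z::'a. B * gauss z)" using gauss_integrable by auto
  show "AE z in lborel. norm (f (?q0 x n z) * gauss z) <= B * gauss z" for n
   by (intro AE_I2) (auto simp: abs_mult gauss_nonneg intro!: mult_right_mono bd)
 qed
 then have "(%n. \<integral>z. f (?q0 x n z) * gauss z \<partial>lborel) \<longlonglongrightarrow> f x"
  by (simp add: gauss_integral)
 then have "(%n. complex_of_real (\<integral>z. f (?q0 x n z) * gauss z \<partial>lborel)) \<longlonglongrightarrow> complex_of_real (f x)"
  by (rule tendsto_of_real)
 then show ?thesis
  by (subst fourier_damped_inversion[OF _ int]) auto
qed

lemma gaussian_damping_integrable: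
 assumes "r > 0"
 shows "integrable lborel (%xi::'a::euclidean_space. exp (- (norm xi / r)\<^sup>2 / 2))"
proof -
 have "exp (- (norm xi / r)\<^sup>2 / 2) = sqrt (2*pi) ^ DIM('a) * gauss ((1/r) *\<^sub>R xi)" for xi :: 'a
  using assms unfolding gauss_eq by (simp add: power_divide power_one_over)
 then show ?thesis using assms gauss_integrable[where 'a='a]
   integrable_lborel_affine[where c="1/r" and t=0 and f="gauss::'a=>real"] by auto
qed

section \<open>Sobolev weights and dual norms of point masses\<close>

lemma nn_integral_powr_1d:
 assumes r: "r > 1/2"
 shows "(\<integral>\<^sup>+(x::real). ennreal ((1 + x^2) powr (-r)) \<partial>lborel) < \<infinity>"
proof -
 let ?q0 = "%x. (1 + x^2) powr (-r)"
 have hi: "((%x. x powr (-2*r)) has_integral -(1 powr (-2*r+1)/(-2*r+1))) {1::real..}"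
  using has_integral_powr_to_inf[of "-2*r" 1] r by simp
 have J: "(\<integral>\<^sup>+x. indicator {1::real..} x * ennreal (x powr (-2*r)) \<partial>lborel) < \<infinity>"
 proof -
  have "integral\<^sup>N lborel (%x. indicator {1::real..} x * (x powr (-2*r))) = ennreal (-(1 powr (-2*r+1)/(-2*r+1)))"
   by (rule nn_integral_has_integral_lebesgue[OF _ hi]) simp
  then show ?thesis by (simp add: ennreal_mult ennreal_indicator)
 qed
 have J': "(\<integral>\<^sup>+x. indicator {1::real..} (-x) * ennreal ((-x) powr (-2*r)) \<partial>lborel) < \<infinity>"
  using J nn_integral_real_affine[where c="-1" and t=0 and f="%x. indicator {1::real..} x * ennreal (x powr (-2*r))"] by auto
 have K: "(\<integral>\<^sup>+x. indicator {-1..1::real} x \<partial>lborel) < \<infinity>" by simp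
 have bd: "ennreal (?q0 x) <= indicator {-1..1::real} x +
   (indicator {1::real..} x * ennreal (x powr (-2*r)) + indicator {1::real..} (-x) * ennreal ((-x) powr (-2*r)))" for x :: real
 proof -
  have A: "(1 + y^2) powr (-r) <= y powr (-2*r)" if "y >= 1" for y :: real
  proof -
   have "y powr (-2*r) = (y powr 2) powr (-r)" by (simp add: powr_powr)
   also have "y powr 2 = y^2" using that by (simp add: powr_numeral)
   finally have "y powr (-2*r) = (y^2) powr (-r)" .
   moreover have "(1 + y^2) powr (-r) <= (y^2) powr (-r)" using that r by (intro powr_mono2') auto
   ultimately show ?thesis by simp
  qed
  consider "x >= 1" | "-x >= 1" | "-1 < x" "x < 1" by linarith
  then show ?thesis
  proof cases
   case 1
   then have "ennreal (?q0 x) <= indicator {1::real..} x * ennreal (x powr (-2*r))"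
    using A[OF 1] by (auto intro: ennreal_leI)
   then show ?thesis by (intro add_increasing add_increasing2) auto
  next
   case 2
   then have "ennreal (?q0 x) <= indicator {1::real..} (-x) * ennreal ((-x) powr (-2*r))"
    using A[OF 2] by (auto intro: ennreal_leI)
   then show ?thesis by (intro add_increasing) auto
  next
   case 3
   have "(1 + x^2) powr (-r) <= 1 powr (-r)" using r by (intro powr_mono2') auto
   then show ?thesis using 3 by (auto simp: indicator_def intro!: add_increasing2)
  qed
 qed
 have "(\<integral>\<^sup>+(x::real). ennreal (?q0 x) \<partial>lborel) <= (\<integral>\<^sup>+x. indicator {-1..1::real} x +
   (indicator {1::real..} x * ennreal (x powr (-2*r)) + indicator {1::real..} (-x) * ennreal ((-x) powr (-2*r))) \<partial>lborel)"
  by (rule nn_integral_mono) (rule bd)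
 also have "... < \<infinity>"
  using J J' K by (simp add: nn_integral_add)
 finally show ?thesis .
qed

text \<open>The squared norm of a Dirac mass in the dual of the space H^s.\<close>

definition weight_mass :: "'a::euclidean_space itself => real => ennreal" where
 "weight_mass _ s = (\<integral>\<^sup>+(xi::'a). ennreal ((1 + (norm xi)^2) powr (-s)) \<partial>lborel)"

text \<open>The weight dominates each of its coordinate versions, so distributing the exponent
  evenly bounds it by a product of one-dimensional weights of exponent s / d > 1/2, and Tonelli
  reduces to dimension one.\<close>

lemma weight_mass_finite:
 assumes s: "s > real DIM('a::euclidean_space) / 2"
 shows "weight_mass TYPE('a) s < \<infinity>"
proof -
 let ?d = "real DIM('a)"
 let ?q0 = "%xi. 1 + (norm xi)^2"
 have d: "?d > 0" by simp
 have bd: "(?q0 xi) powr (-s) <= (\<Prod>b\<in>Basis. (1 + (xi \<bullet> b)^2) powr (-(s/?d)))" for xi :: 'a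
 proof -
  have "(\<Prod>b\<in>(Basis::'a set). (?q0 xi) powr (-(s/?d))) <= (\<Prod>b\<in>Basis. (1 + (xi \<bullet> b)^2) powr (-(s/?d)))"
  proof (intro prod_mono conjI powr_mono2')
   fix b :: 'a assume "b \<in> Basis"
   then show "1 + (xi \<bullet> b)^2 <= 1 + (norm xi)^2"
    using Basis_le_norm[of b xi] by (auto simp: abs_le_square_iff[symmetric])
   have "0 <= s" using s d by linarith
   then show "- (s / ?d) <= 0" by simp
   show "0 < 1 + (xi \<bullet> b)^2" by (smt (verit) zero_le_power2)
  qed auto
  also have "(\<Prod>b\<in>(Basis::'a set). (?q0 xi) powr (-(s/?d))) = (?q0 xi) powr (-s)"
  proof -
   have p: "0 < 1 + (norm xi)^2" by (smt (verit) zero_le_power2)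
   have "((?q0 xi) powr - (s / ?d)) ^ DIM('a) = (?q0 xi) powr (- (s / ?d) * ?d)"
    using p by (subst powr_realpow[symmetric]) (auto simp: powr_powr)
   then show ?thesis using d by simp
  qed
  finally show ?thesis .
 qed
 have "weight_mass TYPE('a) s <= (\<integral>\<^sup>+(xi::'a). (\<Prod>b\<in>Basis. ennreal ((1 + (xi \<bullet> b)^2) powr (-(s/?d)))) \<partial>lborel)"
  unfolding weight_mass_def using bd by (intro nn_integral_mono) (simp add: prod_ennreal ennreal_leI)
 also have "... = (\<Prod>b\<in>(Basis::'a set). (\<integral>\<^sup>+x. ennreal ((1 + x^2) powr (-(s/?d))) \<partial>lborel))"
  by (rule nn_integral_lborel_prod) auto
 also have "... < \<infinity>"
  using s d nn_integral_powr_1d[of "s/?d"] by (simp add: less_top[symmetric] power_eq_top_ennreal field_simps)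
 finally show ?thesis .
qed

definition energy :: "real => 'i set => ('i => real^'d) => ('i => real^'d) => ennreal" where
 "energy s A x c = (\<integral>\<^sup>+xi. ennreal ((\<Sum>k\<in>UNIV. (cmod (\<Sum>i\<in>A. complex_of_real (c i $ k) * cis (2 * pi * (xi \<bullet> x i))))^2)
   * (1 + (norm xi)^2) powr (-s)) \<partial>lborel)"

lemma norm_fourier_le:
 assumes "integrable lborel f"
 shows "cmod (fourier f xi) <= (\<integral>y. \<bar>f y\<bar> \<partial>lborel)"
proof -
 have "cmod (fourier f xi) <= (\<integral>y. cmod (cis (- 2 * pi * (xi \<bullet> y)) * complex_of_real (f y)) \<partial>lborel)"
  unfolding fourier_def by (rule integral_norm_bound)
 then show ?thesis by (simp add: norm_mult)
qed

lemma sum_prod_le_sqrt: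
 fixes a b :: "'k => real"
 assumes "finite K"
 shows "(\<Sum>k\<in>K. a k * b k) <= sqrt (\<Sum>k\<in>K. (a k)^2) * sqrt (\<Sum>k\<in>K. (b k)^2)"
proof -
 have "(\<Sum>k\<in>K. a k * b k)^2 <= (\<Sum>k\<in>K. (a k)^2) * (\<Sum>k\<in>K. (b k)^2)"
  by (rule Cauchy_Schwarz_ineq_sum)
 then show ?thesis using real_le_rsqrt by (fastforce simp: real_sqrt_mult[symmetric])
qed

text \<open>The energy is the squared dual norm of the combination of point evaluations.\<close>

lemma point_functional_bound:
 fixes f :: "real^'d => real^'d" and x c :: "'i => real^'d"
 assumes int: "!!k. integrable lborel (%x. f x $ k)" and cont: "continuous_on UNIV f" and bd: "!!x. norm (f x) <= B"
  and A: "finite A"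
 shows "ennreal ((\<Sum>i\<in>A. c i \<bullet> f (x i))^2) <= Hs_norm2 s f * energy s A x c"
proof -
 define F where "F k = fourier (%x. f x $ k)" for k
 define l where "l k xi = (\<Sum>i\<in>A. complex_of_real (c i $ k) * cis (2 * pi * (xi \<bullet> x i)))" for k and xi :: "real^'d"
 define E where "E n xi = exp (- (norm xi / Suc n)\<^sup>2 / 2)" for n and xi :: "real^'d"
 define I where "I n = (\<Sum>i\<in>A. \<Sum>k\<in>UNIV. complex_of_real (c i $ k) *
   (\<integral>xi. F k xi * cis (2 * pi * (xi \<bullet> x i)) * complex_of_real (E n xi) \<partial>lborel))" for n
 have [measurable]: "(%x. f x $ k) \<in> meas borel" for k
  using borel_measurable_integrable[OF int[of k]] by simp
 have Fm[measurable]: "F k \<in> meas borel" for k unfolding F_def by (rule fourier_measurable) simp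
 have [measurable]: "E n \<in> meas borel" "l k \<in> meas borel" for n k
  unfolding E_def l_def by measurable
 have lim: "I \<longlonglongrightarrow> complex_of_real (\<Sum>i\<in>A. c i \<bullet> f (x i))"
 proof -
  have "I \<longlonglongrightarrow> (\<Sum>i\<in>A. \<Sum>k\<in>UNIV. complex_of_real (c i $ k) * complex_of_real (f (x i) $ k))"
   unfolding I_def F_def E_def
  proof (intro tendsto_sum tendsto_mult tendsto_const fourier_inversion_tendsto[where B=B])
   show "continuous_on UNIV (%x. f x $ k)" for k using cont by (intro continuous_intros)
   show "\<bar>f x $ k\<bar> <= B" for x k using component_le_norm_cart[of "f x" k] bd[of x] by linarith
  qed (rule int)
  then show ?thesis by (simp add: inner_vec_def)
 qed
 \<comment> \<open>The transform is only known to be bounded; integrability comes from the damping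
   alone.\<close>
 have intE: "integrable lborel (%xi. F k xi * g xi * complex_of_real (E n xi))"
  if [measurable]: "g \<in> meas borel" and g: "!!xi. cmod (g xi) <= G" for k n g G
 proof (rule Bochner_Integration.integrable_bound[where f="%xi. (\<integral>y. \<bar>f y $ k\<bar> \<partial>lborel) * G * E n xi"])
  have "integrable lborel (E n)" unfolding E_def by (rule gaussian_damping_integrable) simp
  then show "integrable lborel (%xi. (\<integral>y. \<bar>f y $ k\<bar> \<partial>lborel) * G * E n xi)" by simp
  show "AE xi in lborel. norm (F k xi * g xi * complex_of_real (E n xi)) <= norm ((\<integral>y. \<bar>f y $ k\<bar> \<partial>lborel) * G * E n xi)"
  proof (rule AE_I2)
   fix xi
   have "cmod (F k xi) * cmod (g xi) * E n xi <= (\<integral>y. \<bar>f y $ k\<bar> \<partial>lborel) * G * E n xi"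
    unfolding F_def using norm_fourier_le[OF int, of k xi] g[of xi]
    by (intro mult_right_mono mult_mono) (auto simp: E_def)
   moreover have "0 <= G" using g[of xi] norm_ge_zero[of "g xi"] by linarith
   ultimately show "norm (F k xi * g xi * complex_of_real (E n xi)) <= norm ((\<integral>y. \<bar>f y $ k\<bar> \<partial>lborel) * G * E n xi)"
    by (simp add: norm_mult E_def abs_mult)
  qed
 qed measurable
 have I_eq: "I n = (\<integral>xi. (\<Sum>k\<in>UNIV. F k xi * l k xi) * complex_of_real (E n xi) \<partial>lborel)" for n
 proof -
  have "I n = (\<Sum>i\<in>A. \<Sum>k\<in>UNIV. (\<integral>xi. complex_of_real (c i $ k) * (F k xi * cis (2 * pi * (xi \<bullet> x i)) * complex_of_real (E n xi)) \<partial>lborel))"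
   unfolding I_def by simp
  also have "... = (\<integral>xi. (\<Sum>i\<in>A. \<Sum>k\<in>UNIV. complex_of_real (c i $ k) * (F k xi * cis (2 * pi * (xi \<bullet> x i)) * complex_of_real (E n xi))) \<partial>lborel)"
   by (subst Bochner_Integration.integral_sum | intro Bochner_Integration.integrable_sum integrable_mult_right intE[where G=1] | simp)+
  also have "... = (\<integral>xi. (\<Sum>k\<in>UNIV. F k xi * l k xi) * complex_of_real (E n xi) \<partial>lborel)"
   unfolding l_def
   by (subst sum.swap) (simp add: sum_distrib_left sum_distrib_right mult_ac)
  finally show ?thesis .
 qed
 define P where "P xi = sqrt ((\<Sum>k\<in>UNIV. (cmod (F k xi))^2) * (1 + (norm xi)^2) powr s)" for xi
 define Q where "Q xi = sqrt ((\<Sum>k\<in>UNIV. (cmod (l k xi))^2) * (1 + (norm xi)^2) powr (-s))" for xi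
 have [measurable]: "P \<in> meas borel" "Q \<in> meas borel" unfolding P_def Q_def by measurable
 have P2: "(\<integral>\<^sup>+xi. (ennreal (P xi))^2 \<partial>lborel) = Hs_norm2 s f"
  unfolding Hs_norm2_def P_def F_def fourier_comp_def fourier_def
  by (intro nn_integral_cong) (simp add: ennreal_power sum_nonneg)
 have Q2: "(\<integral>\<^sup>+xi. (ennreal (Q xi))^2 \<partial>lborel) = energy s A x c"
  unfolding energy_def Q_def l_def
  by (intro nn_integral_cong) (simp add: ennreal_power sum_nonneg)
 \<comment> \<open>The weight is split as (1 + |xi|^2)^s times its inverse before Cauchy-Schwarz,
   and the damping is estimated by 1. The bound is thus uniform in n and survives the limit.\<close>
 have bnd: "ennreal ((cmod (I n))^2) <= Hs_norm2 s f * energy s A x c" for n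
 proof -
  have "ennreal (cmod (I n)) <= (\<integral>\<^sup>+xi. norm ((\<Sum>k\<in>UNIV. F k xi * l k xi) * complex_of_real (E n xi)) \<partial>lborel)"
  \<comment> \<open>If the integrand were not integrable, the Bochner integral would be 0 by
    convention and the estimate trivial.\<close>
  proof (cases "integrable lborel (%xi. (\<Sum>k\<in>UNIV. F k xi * l k xi) * complex_of_real (E n xi))")
   case True then show ?thesis unfolding I_eq by (rule integral_norm_bound_ennreal)
  qed (simp add: I_eq not_integrable_integral_eq)
  also have "... <= (\<integral>\<^sup>+xi. ennreal (P xi) * ennreal (Q xi) \<partial>lborel)"
  proof (rule nn_integral_mono)
   fix xi
   have "norm ((\<Sum>k\<in>UNIV. F k xi * l k xi) * complex_of_real (E n xi)) <= norm (\<Sum>k\<in>UNIV. F k xi * l k xi)"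
    by (simp add: norm_mult E_def mult_left_le)
   also have "... <= (\<Sum>k\<in>UNIV. cmod (F k xi) * cmod (l k xi))"
    by (rule order_trans[OF norm_sum]) (simp add: norm_mult)
   also have "... <= sqrt (\<Sum>k\<in>UNIV. (cmod (F k xi))^2) * sqrt (\<Sum>k\<in>UNIV. (cmod (l k xi))^2)"
    by (rule sum_prod_le_sqrt) simp
   also have "... = P xi * Q xi"
   proof -
    have "(1 + (norm xi)^2) powr s * (1 + (norm xi)^2) powr (-s) = 1"
     by (simp add: powr_add[symmetric] add_pos_nonneg powr_minus divide_simps)
      (smt (verit) zero_le_power2)
    then have "sqrt ((1 + (norm xi)^2) powr s) * sqrt ((1 + (norm xi)^2) powr (-s)) = 1"
     by (metis real_sqrt_mult real_sqrt_one)
    then show ?thesis unfolding P_def Q_def real_sqrt_mult by (simp add: mult_ac)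
   qed
   finally show "ennreal (norm ((\<Sum>k\<in>UNIV. F k xi * l k xi) * complex_of_real (E n xi))) <= ennreal (P xi) * ennreal (Q xi)"
    by (subst ennreal_mult[symmetric]) (auto simp: P_def Q_def sum_nonneg intro: ennreal_leI)
  qed
  finally have "ennreal (cmod (I n)) ^ 2 <= (\<integral>\<^sup>+xi. ennreal (P xi) * ennreal (Q xi) \<partial>lborel)^2"
   by (rule power_mono) simp
  also have "... <= Hs_norm2 s f * energy s A x c"
   unfolding P2[symmetric] Q2[symmetric] by (rule Cauchy_Schwarz_nn_integral) auto
  finally show ?thesis by (simp add: ennreal_power)
 qed
 have "(%n. ennreal ((cmod (I n))^2)) \<longlonglongrightarrow> ennreal ((cmod (complex_of_real (\<Sum>i\<in>A. c i \<bullet> f (x i))))^2)"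
  by (intro tendsto_ennrealI tendsto_power tendsto_norm lim)
 then have "ennreal ((cmod (complex_of_real (\<Sum>i\<in>A. c i \<bullet> f (x i))))^2) <= Hs_norm2 s f * energy s A x c"
  by (rule LIMSEQ_le_const2) (use bnd in blast)
 then show ?thesis by (simp only: norm_of_real power2_abs)
qed

lemma norm_cis_diff_le: "cmod (cis a - cis b) <= \<bar>a - b\<bar>"
proof -
 have "(cmod (cis a - cis b))^2 = (cos a - cos b)^2 + (sin a - sin b)^2"
  by (simp add: cmod_def)
 also have "... = 2 - 2 * cos (a - b)"
  using sin_cos_squared_add[of a] sin_cos_squared_add[of b] by (simp add: cos_diff power2_eq_square algebra_simps)
 also have "... = 4 * (sin ((a - b)/2))^2"
 proof -
  have "cos (a - b) = 1 - 2 * (sin ((a - b)/2))^2"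
   using cos_double_sin[of "(a - b)/2"] by (simp only: mult_2 field_sum_of_halves)
  then show ?thesis by simp
 qed
 also have "... <= 4 * ((a - b)/2)^2"
  using abs_sin_x_le_abs_x[of "(a - b)/2"] by (simp only: abs_le_square_iff mult_le_cancel_left_pos zero_less_numeral)
 also have "... = \<bar>a - b\<bar>\<^sup>2" by (simp add: power2_eq_square)
 finally show ?thesis by (rule power2_le_imp_le) simp
qed

lemma energy_singleton: "energy s {i} (x :: 'i => real^'d) c = ennreal ((norm (c i))^2) * weight_mass TYPE(real^'d) s"
proof -
 have "(\<Sum>k\<in>UNIV. (cmod (\<Sum>i\<in>{i}. complex_of_real (c i $ k) * cis (2 * pi * (xi \<bullet> x i))))^2) = (norm (c i))^2" for xi
  by (simp add: norm_mult power2_norm_eq_inner inner_vec_def power2_eq_square[symmetric])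
 then show ?thesis unfolding energy_def weight_mass_def
  by (simp add: nn_integral_cmult[symmetric] ennreal_mult)
qed

text \<open>The two phases of a dipole differ by at most 2 pi |xi| times its width. The factor
  |xi|^2 is absorbed by one power of the weight, which is why s drops to s - 1. Applied to
  difference quotients, this controls first derivatives.\<close>

lemma energy_difference:
 fixes y :: "bool => real^'d"
 shows "energy s UNIV y (%t. if t then v else - v)
  <= ennreal ((norm v)^2 * (2 * pi * norm (y True - y False))^2) * weight_mass TYPE(real^'d) (s - 1)"
proof -
 let ?q0 = "%k xi. \<Sum>i\<in>UNIV. complex_of_real ((if i then v else - v) $ k) * cis (2 * pi * (xi \<bullet> y i))"
 let ?q1 = "2 * pi * norm (y True - y False)"
 let ?q2 = "%xi. 1 + (norm xi)^2"
 let ?q3 = "%xi. \<Sum>k\<in>UNIV. (cmod (?q0 k xi))^2"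
 let ?q4 = "%xi. cis (2 * pi * (xi \<bullet> y True)) - cis (2 * pi * (xi \<bullet> y False))"
 have "(?q3 xi) * (?q2 xi) powr (-s)
  <= (norm v)^2 * ?q1^2 * (?q2 xi) powr (-(s-1))" for xi
 proof -
  define D where "D = cmod (?q4 xi)"
  have "D <= \<bar>2 * pi * (xi \<bullet> y True) - 2 * pi * (xi \<bullet> y False)\<bar>" unfolding D_def by (rule norm_cis_diff_le)
  also have "... = 2 * pi * \<bar>xi \<bullet> (y True - y False)\<bar>"
   by (simp add: inner_diff_right right_diff_distrib[symmetric] abs_mult)
  also have "... <= 2 * pi * (norm xi * norm (y True - y False))"
   by (intro mult_left_mono Cauchy_Schwarz_ineq2) auto
  finally have "D <= ?q1 * norm xi" by (simp add: mult_ac)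
  then have "D^2 <= (?q1 * norm xi)^2"
   by (rule power_mono) (simp add: D_def)
  also have "... <= ?q1^2 * (?q2 xi)"
   by (subst power_mult_distrib) (intro mult_left_mono, auto)
  finally have D: "D^2 <= ?q1^2 * (?q2 xi)" .
  have e: "(?q0 k xi)
   = complex_of_real (v $ k) * (?q4 xi)" for k
   by (simp add: UNIV_bool algebra_simps)
  have "(?q3 xi) = (norm v)^2 * D^2"
   unfolding e by (simp add: norm_mult power_mult_distrib D_def sum_distrib_right[symmetric] power2_norm_eq_inner[of v] inner_vec_def power2_eq_square[symmetric])
  then have "(?q3 xi) * (?q2 xi) powr (-s)
   <= (norm v)^2 * (?q1^2 * (?q2 xi)) * (?q2 xi) powr (-s)"
   using D by (simp add: mult_left_mono mult_right_mono)
  also have "... = (norm v)^2 * ?q1^2 * ((?q2 xi) powr 1 * (?q2 xi) powr (-s))"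
   by (simp add: mult_ac)
  also have "(?q2 xi) powr 1 * (?q2 xi) powr (-s) = (?q2 xi) powr (-(s-1))"
   by (simp only: powr_add[symmetric]) simp
  finally show ?thesis .
 qed
 then have "energy s UNIV y (%t. if t then v else - v) <= (\<integral>\<^sup>+(xi::real^'d). ennreal ((norm v)^2 * ?q1^2 * (?q2 xi) powr (-(s-1))) \<partial>lborel)"
  unfolding energy_def by (intro nn_integral_mono ennreal_leI)
 also have "... = ennreal ((norm v)^2 * ?q1^2) * weight_mass TYPE(real^'d) (s - 1)"
  unfolding weight_mass_def by (simp add: nn_integral_cmult[symmetric] ennreal_mult)
 finally show ?thesis .
qed

section \<open>Test functions and their Sobolev norms\<close>

text \<open>The reference vector \<open>e\<close> lets one lemma serve twice: \<open>e\<close> = 0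
  gives Lipschitz bounds, and \<open>e\<close> the derivative at the base point gives Taylor
  remainders.\<close>

lemma directional_mvt:
 fixes g :: "'a::euclidean_space => 'b::euclidean_space"
 assumes d: "!!z. ((%t. g (z + t *\<^sub>R v)) has_vector_derivative D z) (at 0)"
  and bd: "!!t. \<bar>t\<bar> <= \<bar>s\<bar> ==> norm (D (z + t *\<^sub>R v) - e) <= C"
 shows "norm (g (z + s *\<^sub>R v) - g z - s *\<^sub>R e) <= C * \<bar>s\<bar>"
proof -
 let ?q0 = "%z r. z + r *\<^sub>R v"
 let ?q1 = "{-\<bar>s\<bar>..\<bar>s\<bar>}"
 have d': "((%t. g (z + t *\<^sub>R v) - t *\<^sub>R e) has_derivative (%h. h *\<^sub>R (D (?q0 z r) - e))) (at r within ?q1)" for r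
 proof -
  have "((%t. g ((?q0 z r) + t *\<^sub>R v)) has_vector_derivative D (?q0 z r)) (at (r - r))"
   using d[of "z + r *\<^sub>R v"] by simp
  then have "((%t. g ((?q0 z r) + t *\<^sub>R v)) \<circ> (%t. t - r) has_vector_derivative (1 *\<^sub>R D (?q0 z r))) (at r)"
   by (intro vector_diff_chain_at) (auto intro!: derivative_eq_intros)
  then have "((%t. g (z + t *\<^sub>R v)) has_vector_derivative D (?q0 z r)) (at r)"
   by (simp add: o_def algebra_simps)
  then have "((%t. g (z + t *\<^sub>R v) - t *\<^sub>R e) has_vector_derivative (D (?q0 z r) - e)) (at r)"
   by (auto intro!: derivative_eq_intros)
  then show ?thesis
   unfolding has_vector_derivative_def by (rule has_derivative_at_withinI)
 qed
 have "norm ((g (z + s *\<^sub>R v) - s *\<^sub>R e) - (g (z + 0 *\<^sub>R v) - 0 *\<^sub>R e)) <= C * norm (s - 0)"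
 proof (rule differentiable_bound[where S="?q1" and f'="%r h. h *\<^sub>R (D (?q0 z r) - e)"])
  show "onorm (%h. h *\<^sub>R (D (?q0 z r) - e)) <= C" if "r \<in> ?q1" for r
  proof -
   have *: "norm (D (?q0 z r) - e) <= C" using bd[of r] that by auto
   then have "0 <= C" using norm_ge_zero order_trans by blast
   then show ?thesis using * by (intro onorm_bound) (auto simp: mult.commute[of C] intro: mult_left_mono)
  qed
 qed (auto intro: d')
 then show ?thesis by (simp add: algebra_simps)
qed

text \<open>The increment is built up one coordinate at a time, so that only partial derivatives
  occur; these are all that \<open>smooth_on\<close> offers.\<close>

lemma partials_lipschitz:
 fixes g :: "'a::euclidean_space => 'b::euclidean_space"
 assumes d: "!!z b. b \<in> Basis ==> ((%t. g (z + t *\<^sub>R b)) has_vector_derivative D b z) (at 0)"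
  and bd: "!!z b. b \<in> Basis ==> norm (D b z) <= C"
 shows "norm (g (z + h) - g z) <= C * (\<Sum>b\<in>Basis. \<bar>h \<bullet> b\<bar>)"
proof -
 let ?q0 = "%B. \<Sum>b\<in>B. \<bar>h \<bullet> b\<bar>"
 have "norm (g (z + (\<Sum>b\<in>B. (h \<bullet> b) *\<^sub>R b)) - g z) <= C * (?q0 B)" if "B \<subseteq> Basis" for B
  using finite_subset[OF that finite_Basis] that
 proof (induction B rule: finite_induct)
  case (insert b B)
  let ?w = "z + (\<Sum>b\<in>B. (h \<bullet> b) *\<^sub>R b)"
  have "norm (g (?w + (h \<bullet> b) *\<^sub>R b) - g ?w - (h \<bullet> b) *\<^sub>R 0) <= C * \<bar>h \<bullet> b\<bar>"
   using insert.prems by (intro directional_mvt[where D="D b"]) (auto intro: d bd)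
  then have "norm (g (?w + (h \<bullet> b) *\<^sub>R b) - g ?w) + norm (g ?w - g z) <= C * \<bar>h \<bullet> b\<bar> + C * (?q0 B)"
   using insert.IH insert.prems by (intro add_mono) auto
  then have "norm (g (?w + (h \<bullet> b) *\<^sub>R b) - g z) <= C * \<bar>h \<bullet> b\<bar> + C * (?q0 B)"
   using norm_triangle_ineq[of "g (?w + (h \<bullet> b) *\<^sub>R b) - g ?w" "g ?w - g z"] by simp
  then show ?case using insert.hyps by (simp add: algebra_simps)
 qed simp
 from this[of Basis] show ?thesis by (simp add: euclidean_representation)
qed

text \<open>Coordinates are changed one after the other; at each stage the partial derivative at the
  intermediate point is replaced by the one at z, at a cost bounded by the second partial
  derivatives.\<close>

lemma partials_taylor:
 fixes g :: "'a::euclidean_space => 'b::euclidean_space"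
 assumes d: "!!z b. b \<in> Basis ==> ((%t. g (z + t *\<^sub>R b)) has_vector_derivative D b z) (at 0)"
  and d2: "!!z b c. b \<in> Basis ==> c \<in> Basis ==> ((%t. D b (z + t *\<^sub>R c)) has_vector_derivative D2 c b z) (at 0)"
  and bd: "!!z b c. b \<in> Basis ==> c \<in> Basis ==> norm (D2 c b z) <= C"
 shows "norm (g (z + h) - g z - (\<Sum>b\<in>Basis. (h \<bullet> b) *\<^sub>R D b z)) <= C * (\<Sum>b\<in>Basis. \<bar>h \<bullet> b\<bar>)^2"
proof -
 let ?q0 = "%B. \<Sum>b\<in>B. (h \<bullet> b) *\<^sub>R b"
 let ?q1 = "%B. \<Sum>b\<in>B. \<bar>h \<bullet> b\<bar>"
 let ?q2 = "%B z. \<Sum>b\<in>B. (h \<bullet> b) *\<^sub>R D b z"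
 have "Basis ~= ({} :: 'a set)" by simp
 then have C: "0 <= C" using bd norm_ge_zero order_trans by blast
 have lip: "norm (D b (z + k) - D b z) <= C * (\<Sum>b\<in>Basis. \<bar>k \<bullet> b\<bar>)" if "b \<in> Basis" for b k z
  by (rule partials_lipschitz[where D="%c. D2 c b"]) (auto intro: d2 bd that)
 let ?S = "\<Sum>b\<in>Basis. \<bar>h \<bullet> b\<bar>"
 have S: "(?q1 B) <= ?S" if "B \<subseteq> Basis" for B using that by (intro sum_mono2) auto
 have "norm (g (z + (?q0 B)) - g z - (?q2 B z)) <= C * ?S * (?q1 B)" if "B \<subseteq> Basis" for B
  using finite_subset[OF that finite_Basis] that
 proof (induction B rule: finite_induct)
  case (insert b B)
  let ?w = "z + (?q0 B)"
  have b: "b \<in> Basis" using insert.prems by simp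
  have "norm (g (?w + (h \<bullet> b) *\<^sub>R b) - g ?w - (h \<bullet> b) *\<^sub>R D b z) <= (C * ?S) * \<bar>h \<bullet> b\<bar>"
  proof (rule directional_mvt[where D="D b"])
   fix t assume t: "\<bar>t\<bar> <= \<bar>h \<bullet> b\<bar>"
   let ?k = "(?q0 B) + t *\<^sub>R b"
   \<comment> \<open>All intermediate displacements stay in the box spanned by h, so their
     coordinate sum never exceeds that of h.\<close>
   have kc: "\<bar>?k \<bullet> c\<bar> <= \<bar>h \<bullet> c\<bar>" if c: "c \<in> Basis" for c
   proof -
    have "(?q0 B) \<bullet> c = (\<Sum>b\<in>B. if b = c then h \<bullet> c else 0)"
     unfolding inner_sum_left using insert.prems c by (intro sum.cong) (auto simp: inner_Basis)
    also have "... = (if c \<in> B then h \<bullet> c else 0)" using insert.hyps by (simp add: sum.delta)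
    finally have "?k \<bullet> c = (if c \<in> B then h \<bullet> c else 0) + t * (if b = c then 1 else 0)"
     using b c by (simp add: inner_add_left inner_Basis)
    then show ?thesis using insert.hyps t by (auto split: if_splits)
   qed
   have "norm (D b (z + ?k) - D b z) <= C * (\<Sum>b\<in>Basis. \<bar>?k \<bullet> b\<bar>)" by (rule lip[OF b])
   also have "... <= C * ?S" by (intro mult_left_mono sum_mono kc C)
   finally show "norm (D b (?w + t *\<^sub>R b) - D b z) <= C * ?S" by (simp add: add.assoc)
  qed (use d b in auto)
  then have "norm (g (?w + (h \<bullet> b) *\<^sub>R b) - g ?w - (h \<bullet> b) *\<^sub>R D b z)
    + norm (g ?w - g z - (?q2 B z)) <= C * ?S * \<bar>h \<bullet> b\<bar> + C * ?S * (?q1 B)"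
   using insert.IH insert.prems by (intro add_mono) auto
  then have "norm ((g (?w + (h \<bullet> b) *\<^sub>R b) - g ?w - (h \<bullet> b) *\<^sub>R D b z) + (g ?w - g z - (?q2 B z)))
    <= C * ?S * \<bar>h \<bullet> b\<bar> + C * ?S * (?q1 B)"
   by (rule order_trans[OF norm_triangle_ineq])
  then show ?case using insert.hyps by (simp add: algebra_simps)
 qed simp
 from this[of Basis] show ?thesis by (simp add: euclidean_representation power2_eq_square mult.assoc)
qed

lemma integrable_continuous_bounded_support:
 fixes f :: "'a::euclidean_space => real"
 assumes cont: "continuous_on UNIV f" and bd: "!!x. \<bar>f x\<bar> <= B" and supp: "!!x. norm x > R ==> f x = 0"
 shows "integrable lborel f" "(\<integral>x. \<bar>f x\<bar> \<partial>lborel) <= B * measure lborel (cball (0::'a) R)"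
proof -
 let ?q0 = "\<integral>x. \<bar>f x\<bar> \<partial>lborel"
 have [measurable]: "f \<in> meas borel" using cont by (rule borel_measurable_continuous_onI)
 have i: "integrable lborel (%x. B * indicator (cball (0::'a) R) x)"
  using emeasure_compact_finite[OF compact_cball, of "0::'a" R] by (intro integrable_mult_right integrable_real_indicator) auto
 have le: "\<bar>f x\<bar> <= B * indicator (cball (0::'a) R) x" for x
  using bd[of x] supp[of x] by (auto simp: indicator_def)
 show f: "integrable lborel f"
  by (rule Bochner_Integration.integrable_bound[OF i]) (use le in \<open>auto simp: intro: order_trans[OF _ abs_ge_self]\<close>)
 have "?q0 <= (\<integral>x. B * indicator (cball (0::'a) R) x \<partial>lborel)"
  by (rule integral_mono) (use f i le in auto)
 then show "?q0 <= B * measure lborel (cball (0::'a) R)" by simp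
qed

text \<open>No integration by parts: a translation multiplies the transform by a phase, so the
  transform of a difference quotient is explicit, and dominated convergence lets the step tend to
  0.\<close>

lemma fourier_partial_derivative:
 fixes f f' :: "'a::euclidean_space => real"
 assumes cont: "continuous_on UNIV f" and supp: "!!x. norm x > R ==> f x = 0"
  and der: "!!x. ((%t. f (x + t *\<^sub>R b)) has_vector_derivative f' x) (at 0)"
  and bd: "!!x. \<bar>f' x\<bar> <= C" and fbd: "!!x. \<bar>f x\<bar> <= B" and b: "norm b = 1"
  and cont': "continuous_on UNIV f'"
 shows "fourier f' xi = 2 * pi * \<i> * complex_of_real (xi \<bullet> b) * fourier f xi"
proof -
 let ?q0 = "%y. - 2 * pi * (xi \<bullet> y)"
 let ?q1 = "%h n. 2 * pi * (xi \<bullet> b) * h n"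
 let ?q2 = "%h n y. cis (- 2 * pi * (xi \<bullet> (h n *\<^sub>R b + y))) * complex_of_real (f (h n *\<^sub>R b + y))"
 let ?q3 = "%y h n. y + h n *\<^sub>R b"
 let ?q4 = "%q lborel. %n. \<integral>y. cis (?q0 y) * complex_of_real (q n y) \<partial>lborel"
 have [measurable]: "f \<in> meas borel" "f' \<in> meas borel"
  using cont cont' by (auto intro: borel_measurable_continuous_onI)
 have fi: "integrable lborel f" by (rule integrable_continuous_bounded_support[OF cont fbd supp])
 define h where "h n = 1 / real (Suc n)" for n
 have h: "h n > 0" "h n <= 1" for n unfolding h_def by auto
 have h0: "h \<longlonglongrightarrow> 0" unfolding h_def[abs_def] using LIMSEQ_inverse_real_of_nat by (simp add: divide_inverse)
 have h0': "filterlim h (at 0) sequentially"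
  using h0 h(1) by (auto simp: filterlim_at intro!: always_eventually) (metis less_irrefl)
 define q where "q n x = (f (x + h n *\<^sub>R b) - f x) / h n" for n x
 have "(?q4 q lborel) \<longlonglongrightarrow> fourier f' xi"
  unfolding fourier_def
 proof (rule integral_dominated_convergence[where w="%y::'a. C * indicator (cball 0 (R+1)) y"])
  show "AE y in lborel. (%n. cis (?q0 y) * complex_of_real (q n y)) \<longlonglongrightarrow> cis (?q0 y) * complex_of_real (f' y)"
  proof (intro AE_I2 tendsto_mult tendsto_const tendsto_of_real)
   fix y
   have "((%t. f (y + t *\<^sub>R b)) has_field_derivative f' y) (at 0)"
    using der[of y] by (simp add: has_real_derivative_iff_has_vector_derivative)
   then have "((%t. (f (y + t *\<^sub>R b) - f y) / t) \<longlongrightarrow> f' y) (at 0)"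
    unfolding has_field_derivative_iff by simp
   from filterlim_compose[OF this h0'] show "(%n. q n y) \<longlonglongrightarrow> f' y" unfolding q_def .
  qed
  \<comment> \<open>The steps are at most 1, so all difference quotients live in the ball of radius
    R + 1.\<close>
  show "integrable lborel (%y::'a. C * indicator (cball 0 (R+1)) y)"
   using emeasure_compact_finite[OF compact_cball, of "0::'a" "R+1"] by (intro integrable_mult_right integrable_real_indicator) auto
  show "AE y in lborel. norm (cis (?q0 y) * complex_of_real (q n y)) <= C * indicator (cball 0 (R+1)) y" for n
  proof (rule AE_I2)
   fix y :: 'a
   have "\<bar>f (?q3 y h n) - f y\<bar> <= C * h n"
    using directional_mvt[where g=f and D=f' and e=0 and C=C and s="h n" and v=b and z=y, OF der] bd h(1)[of n] by simp
   then have 1: "\<bar>q n y\<bar> <= C" unfolding q_def using h(1)[of n] by (simp add: abs_divide divide_simps)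
   have 2: "q n y = 0" if "norm y > R + 1"
   proof -
    have "norm (h n *\<^sub>R b) <= 1" using h[of n] b by simp
    then have "norm (?q3 y h n) > R" using that norm_triangle_ineq2[of y "- h n *\<^sub>R b"] by (auto simp: norm_minus_cancel)
    then show ?thesis using supp[of y] supp[of "y + h n *\<^sub>R b"] that unfolding q_def by simp
   qed
   show "norm (cis (?q0 y) * complex_of_real (q n y)) <= C * indicator (cball 0 (R+1)) y"
    using 1 2 by (auto simp: norm_mult indicator_def)
  qed
 qed (unfold q_def, measurable)
 moreover have "(?q4 q lborel) \<longlonglongrightarrow> 2 * pi * \<i> * complex_of_real (xi \<bullet> b) * fourier f xi"
 proof -
  have eq: "(\<integral>y. cis (?q0 y) * complex_of_real (q n y) \<partial>lborel) = ((cis (?q1 h n) - 1) / h n) * fourier f xi" for n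
  proof -
   have i1: "integrable lborel (%y. cis (?q0 y) * complex_of_real (f y))"
    by (rule integrable_cis_mult[OF fi]) simp
   have "integrable lborel (%y. f (h n *\<^sub>R b + 1 *\<^sub>R y))" using fi by (subst integrable_lborel_affine) auto
   then have fi2: "integrable lborel (%y. f (?q3 y h n))" by (simp add: add.commute)
   have i2: "integrable lborel (%y. cis (?q0 y) * complex_of_real (f (?q3 y h n)))"
    by (rule integrable_cis_mult[OF fi2]) simp
   have sh: "(\<integral>y. cis (?q0 y) * complex_of_real (f (?q3 y h n)) \<partial>lborel) = cis (?q1 h n) * fourier f xi"
   proof -
    have "(\<integral>y. cis (?q1 h n) * (cis (?q0 y) * complex_of_real (f y)) \<partial>lborel)
     = (\<integral>y. cis (?q1 h n) * (?q2 h n y) \<partial>lborel)"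
     by (subst integral_lborel_affine[where c=1 and t="h n *\<^sub>R b"]) auto
    also have "... = (\<integral>y. cis (?q0 y) * complex_of_real (f (?q3 y h n)) \<partial>lborel)"
    proof (rule Bochner_Integration.integral_cong[OF refl])
     fix y
     have "cis (?q1 h n) * cis (- 2 * pi * (xi \<bullet> (h n *\<^sub>R b + y))) = cis (?q0 y)"
      by (simp add: cis_mult inner_add_right algebra_simps)
     then show "cis (?q1 h n) * (?q2 h n y)
      = cis (?q0 y) * complex_of_real (f (?q3 y h n))"
      by (simp add: mult.assoc[symmetric] add.commute)
    qed
    finally show ?thesis unfolding fourier_def by simp
   qed
   have "(\<integral>y. cis (?q0 y) * complex_of_real (q n y) \<partial>lborel)
    = (\<integral>y. (cis (?q0 y) * complex_of_real (f (?q3 y h n)) - cis (?q0 y) * complex_of_real (f y)) / h n \<partial>lborel)"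
    unfolding q_def by (intro Bochner_Integration.integral_cong refl) (simp add: algebra_simps diff_divide_distrib)
   also have "... = (cis (?q1 h n) * fourier f xi - fourier f xi) / h n"
    using i1 i2 sh by (simp add: fourier_def)
   finally show ?thesis by (simp add: algebra_simps)
  qed
  define w where "w = \<i> * complex_of_real (2 * pi * (xi \<bullet> b))"
  have "((%z. exp (w * z)) has_field_derivative w) (at 0)"
   by (auto intro!: derivative_eq_intros)
  then have "((%z. (exp (w * z) - 1) / z) \<longlongrightarrow> w) (at 0)"
   unfolding has_field_derivative_iff by simp
  moreover have "filterlim (%n. complex_of_real (h n)) (at 0) sequentially"
   using tendsto_of_real[OF h0, where 'a=complex] h(1) by (auto simp: filterlim_at intro!: always_eventually) (metis less_irrefl)
  ultimately have "(%n. (exp (w * complex_of_real (h n)) - 1) / complex_of_real (h n)) \<longlonglongrightarrow> w"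
   by (rule filterlim_compose)
  moreover have "exp (w * complex_of_real (h n)) = cis (?q1 h n)" for n
   by (simp add: w_def cis_conv_exp mult_ac)
  ultimately have "(%n. (cis (?q1 h n) - 1) / h n) \<longlonglongrightarrow> (2 * pi * (xi \<bullet> b)) *\<^sub>R \<i>"
   by (simp add: w_def scaleR_conv_of_real mult.commute)
  from tendsto_mult_right[OF this, of "fourier f xi"] show ?thesis
   unfolding eq by (simp add: scaleR_conv_of_real mult_ac)
 qed
 ultimately show ?thesis by (rule LIMSEQ_unique)
qed

section \<open>Slices of a test function: regularity, decay in frequency, finite norm\<close>

context
 fixes a c :: real and \<phi> :: "real \<times> (real^'d) => real^'d"
 assumes tf: "test_fun a c \<phi>"
begin

text \<open>The complement of the closed support is open, so near such a point the function vanishes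
  along every line and all iterated derivatives are 0 in turn.\<close>

lemma pderivs_zero_outside_support:
 "z \<notin> closure {z. \<phi> z ~= 0} ==> pderivs vs \<phi> z = 0"
proof (induction vs arbitrary: z)
 case Nil then show ?case using closure_subset[of "{z. \<phi> z ~= 0}"] by auto
next
 case (Cons v vs)
 let ?K = "closure {z. \<phi> z ~= 0}"
 have o: "open ((%t::real. z + t *\<^sub>R v) -` (- ?K))"
  by (intro open_vimage continuous_intros) auto
 have "((%t. pderivs vs \<phi> (z + t *\<^sub>R v)) has_vector_derivative 0) (at 0)"
  by (rule has_vector_derivative_transform_within_open[OF has_vector_derivative_const[of 0] o])
   (use Cons in auto)
 then show ?case by (simp add: vector_derivative_at)
qed

text \<open>\<open>smooth_on\<close> gives continuity only on the open strip. Off the support the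
  derivative is 0, and these two open sets cover the whole space.\<close>

lemma pderivs_continuous:
 assumes vs: "vs \<in> lists Basis"
 shows "continuous_on UNIV (pderivs vs \<phi>)"
proof -
 let ?K = "closure {z. \<phi> z ~= 0}"
 have "continuous_on ({a<..<c} \<times> UNIV) (pderivs vs \<phi>)"
  using tf vs unfolding test_fun_def smooth_on_def by auto
 moreover have "continuous_on (- ?K) (pderivs vs \<phi>)"
  by (rule continuous_on_eq[OF continuous_on_const[of _ 0]]) (simp add: pderivs_zero_outside_support)
 moreover have "({a<..<c} \<times> UNIV) \<union> (- ?K) = UNIV"
  using tf unfolding test_fun_def by auto
 ultimately show ?thesis
  by (metis continuous_on_open_Un open_Compl closed_closure open_Times open_greaterThanLessThan open_UNIV)
qed

lemma pderivs_has_derivative: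
 assumes vs: "vs \<in> lists Basis" and v: "v \<in> Basis"
 shows "((%t. pderivs vs \<phi> (z + t *\<^sub>R v)) has_vector_derivative pderivs (v # vs) \<phi> z) (at 0)"
proof (cases "z \<in> {a<..<c} \<times> UNIV")
 case True
 have "smooth_on ({a<..<c} \<times> UNIV) \<phi>" using tf unfolding test_fun_def by blast
 then show ?thesis using vs v True unfolding smooth_on_def by blast
next
 case False
 let ?K = "closure {z. \<phi> z ~= 0}"
 have z: "z \<notin> ?K" using False tf unfolding test_fun_def by auto
 have o: "open ((%t::real. z + t *\<^sub>R v) -` (- ?K))"
  by (intro open_vimage continuous_intros) auto
 have "((%t. pderivs vs \<phi> (z + t *\<^sub>R v)) has_vector_derivative 0) (at 0)"
  by (rule has_vector_derivative_transform_within_open[OF has_vector_derivative_const[of 0] o])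
   (use z pderivs_zero_outside_support in auto)
 then show ?thesis using pderivs_zero_outside_support[OF z, of "v # vs"] by simp
qed

lemma pderivs_bounded:
 assumes vs: "vs \<in> lists Basis"
 shows "\<exists>B\<ge>0. \<forall>z. norm (pderivs vs \<phi> z) <= B"
proof -
 let ?K = "closure {z. \<phi> z ~= 0}"
 have "compact (pderivs vs \<phi> ` ?K)"
  using tf by (intro compact_continuous_image continuous_on_subset[OF pderivs_continuous[OF vs]]) (auto simp: test_fun_def)
 then obtain B where B: "!!z. z \<in> ?K ==> norm (pderivs vs \<phi> z) <= B"
  using compact_imp_bounded bounded_iff by (metis imageI)
 have "norm (pderivs vs \<phi> z) <= max B 0" for z
  using B[of z] pderivs_zero_outside_support[of z vs] by (cases "z \<in> ?K") auto
 then show ?thesis by (intro exI[of _ "max B 0"]) auto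
qed

lemma test_fun_support_radius:
 "\<exists>R>0. \<forall>u x vs. norm x > R --> pderivs vs \<phi> (u, x) = 0"
proof -
 have "bounded (closure {z. \<phi> z ~= 0})" using tf compact_imp_bounded unfolding test_fun_def by blast
 then obtain R where R: "R > 0" "!!z. z \<in> closure {z. \<phi> z ~= 0} ==> norm z <= R"
  by (auto simp: bounded_pos)
 have "pderivs vs \<phi> (u, x) = 0" if "norm x > R" for u x vs
 proof (rule pderivs_zero_outside_support)
  show "(u, x) \<notin> closure {z. \<phi> z ~= 0}"
   using R(2)[of "(u,x)"] that norm_snd_le[of x u] by fastforce
 qed
 then show ?thesis using R(1) by blast
qed

lemma test_fun_zero_outside: "u \<notin> {a<..<c} ==> \<phi> (u, x) = 0"
 using tf unfolding test_fun_def by auto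

lemma test_fun_continuous: "continuous_on UNIV \<phi>"
 using pderivs_continuous[of "[]"] by simp

lemma test_fun_measurable[measurable]: "\<phi> \<in> meas borel"
 using test_fun_continuous by (rule borel_measurable_continuous_onI)

lemma test_fun_lipschitz:
 "\<exists>C\<ge>0. \<forall>z h. norm (\<phi> (z + h) - \<phi> z) <= C * norm h"
proof -
 let ?q0 = "%b z. pderivs [b] \<phi> z"
 have "\<exists>B. \<forall>b\<in>Basis. \<forall>z. norm (?q0 b z) <= B"
 proof -
  have "\<forall>b\<in>Basis. \<exists>B\<ge>0. \<forall>z. norm (?q0 b z) <= B" using pderivs_bounded by (auto simp del: pderivs.simps)
  then obtain B where B: "!!b z. b \<in> Basis ==> 0 <= B b \<and> norm (?q0 b z) <= B b" by metis
  have "norm (?q0 b z) <= (\<Sum>b\<in>Basis. B b)" if "b \<in> Basis" for b z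
   using B[OF that, of z] B member_le_sum[OF that, of B] by force
  then show ?thesis by blast
 qed
 then obtain B where B: "!!b z. b \<in> Basis ==> norm (?q0 b z) <= B" by blast
 obtain b0 :: "real \<times> (real^'d)" where "b0 \<in> Basis" using nonempty_Basis by blast
 then have B0: "0 <= B" using B norm_ge_zero order_trans by blast
 have "norm (\<phi> (z + h) - \<phi> z) <= (B * real DIM(real \<times> (real^'d))) * norm h" for z h
 proof -
  have "norm (\<phi> (z + h) - \<phi> z) <= B * (\<Sum>b\<in>Basis. \<bar>h \<bullet> b\<bar>)"
   by (rule partials_lipschitz[where D="%b. pderivs [b] \<phi>"]) (use B pderivs_has_derivative[of "[]"] in auto)
  also have "... <= B * (\<Sum>b\<in>(Basis :: (real \<times> (real^'d)) set). norm h)"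
   using B0 by (intro mult_left_mono sum_mono Basis_le_norm) auto
  finally show ?thesis by (simp add: mult_ac)
 qed
 then show ?thesis using B0 by (intro exI[of _ "B * real DIM(real \<times> (real^'d))"]) auto
qed

text \<open>Second order in space but only first order in time: the time derivative is moved into
  the remainder, because a term of size s times an increment of X is negligible along
  partitions.\<close>

lemma test_fun_taylor:
 "\<exists>C\<ge>0. \<forall>t x s h. norm (\<phi> (t + s, x + h) - \<phi> (t, x) - (\<Sum>b\<in>Basis. (h \<bullet> b) *\<^sub>R pderivs [(0, b)] \<phi> (t, x)))
   <= C * (\<bar>s\<bar> + s^2 + (norm h)^2)"
proof -
 let ?B = "Basis :: (real \<times> (real^'d)) set"
 let ?q0 = "%s h. \<Sum>b\<in>?B. \<bar>(s, h) \<bullet> b\<bar>"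
 let ?q1 = "%s h. s^2 + (norm h)^2"
 have "\<forall>b\<in>?B. \<forall>c\<in>?B. \<exists>B\<ge>0. \<forall>z. norm (pderivs [c, b] \<phi> z) <= B" using pderivs_bounded by (auto simp del: pderivs.simps)
 then obtain B where B: "!!b c z. b \<in> ?B ==> c \<in> ?B ==> 0 <= B b c \<and> norm (pderivs [c, b] \<phi> z) <= B b c" by metis
 define M where "M = (\<Sum>b\<in>?B. \<Sum>c\<in>?B. B b c)"
 have M: "norm (pderivs [c, b] \<phi> z) <= M" if "b \<in> ?B" "c \<in> ?B" for b c z
 proof -
  have "B b c <= (\<Sum>c\<in>?B. B b c)" using that B by (intro member_le_sum) auto
  also have "... <= M" unfolding M_def using that B by (intro member_le_sum[of b ?B "%b. \<Sum>c\<in>?B. B b c"]) (auto intro!: sum_nonneg)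
  finally show ?thesis using B[OF that, of z] by linarith
 qed
 have M0: "0 <= M" unfolding M_def using B by (intro sum_nonneg) auto
 obtain M1 where M1: "0 <= M1" "!!z. norm (pderivs [(1, 0)] \<phi> z) <= M1"
  using pderivs_bounded[of "[(1,0)]"] by (auto simp: Basis_prod_def simp del: pderivs.simps)
 define d where "d = real DIM(real \<times> (real^'d))"
 have "norm (\<phi> (t + s, x + h) - \<phi> (t, x) - (\<Sum>b\<in>Basis. (h \<bullet> b) *\<^sub>R pderivs [(0, b)] \<phi> (t, x)))
   <= (M * d^2 + M1) * (\<bar>s\<bar> + s^2 + (norm h)^2)" for t x s h
 proof -
  let ?P = "\<Sum>b\<in>Basis. (h \<bullet> b) *\<^sub>R pderivs [(0, b)] \<phi> (t, x)"
  have T: "norm (\<phi> ((t, x) + (s, h)) - \<phi> (t, x) - (\<Sum>b\<in>?B. ((s, h) \<bullet> b) *\<^sub>R pderivs [b] \<phi> (t, x))) <= M * (?q0 s h)^2"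
  proof (rule partials_taylor[where D="%b. pderivs [b] \<phi>" and ?D2.0="%c b. pderivs [c, b] \<phi>"])
   show "((%t. \<phi> (z + t *\<^sub>R b)) has_vector_derivative pderivs [b] \<phi> z) (at 0)" if "b \<in> ?B" for b z
    using pderivs_has_derivative[of "[]" b z] that by simp
   show "((%t. pderivs [b] \<phi> (z + t *\<^sub>R c)) has_vector_derivative pderivs [c, b] \<phi> z) (at 0)" if "b \<in> ?B" "c \<in> ?B" for b c z
    by (rule pderivs_has_derivative) (use that in auto)
  qed (rule M)
  have sum_split: "(\<Sum>b\<in>?B. F b) = F (1, 0) + (\<Sum>b\<in>Basis. F (0, b))" for F :: "_ => real^'d"
  proof -
   have "(\<Sum>b\<in>?B. F b) = (\<Sum>b\<in>(%u. (u, 0)) ` (Basis::real set). F b) + (\<Sum>b\<in>(%v. (0, v)) ` Basis. F b)"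
    unfolding Basis_prod_def by (rule sum.union_disjoint) auto
   then show ?thesis by (simp add: sum.reindex inj_on_def)
  qed
  have S: "(\<Sum>b\<in>?B. ((s, h) \<bullet> b) *\<^sub>R pderivs [b] \<phi> (t, x)) = s *\<^sub>R pderivs [(1, 0)] \<phi> (t, x) + ?P"
   unfolding sum_split by (simp del: pderivs.simps)
  have "(?q0 s h) <= d * norm (s, h)"
   unfolding d_def using sum_bounded_above[of ?B "%b. \<bar>(s, h) \<bullet> b\<bar>" "norm (s,h)"] Basis_le_norm[of _ "(s,h)"] by simp
  then have "(?q0 s h)^2 <= (d * norm (s, h))^2" by (intro power_mono sum_nonneg) auto
  also have "... = d^2 * (?q1 s h)" by (simp add: power_mult_distrib norm_Pair)
  finally have "M * (?q0 s h)^2 <= M * (d^2 * (?q1 s h))" using M0 by (rule mult_left_mono)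
  with T have "norm (\<phi> (t + s, x + h) - \<phi> (t, x) - (s *\<^sub>R pderivs [(1, 0)] \<phi> (t, x) + ?P)) <= M * (d^2 * (?q1 s h))"
   unfolding S by simp
  moreover have "norm (s *\<^sub>R pderivs [(1, 0)] \<phi> (t, x)) <= M1 * \<bar>s\<bar>"
   using M1(2)[of "(t,x)"] by (simp del: pderivs.simps add: mult.commute[of M1] mult_left_mono)
  moreover have "norm (\<phi> (t + s, x + h) - \<phi> (t, x) - ?P) \<le>
   norm (\<phi> (t + s, x + h) - \<phi> (t, x) - (s *\<^sub>R pderivs [(1, 0)] \<phi> (t, x) + ?P)) + norm (s *\<^sub>R pderivs [(1, 0)] \<phi> (t, x))"
   by (rule order_trans[OF _ norm_triangle_ineq]) (simp add: algebra_simps)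
  ultimately have "norm (\<phi> (t + s, x + h) - \<phi> (t, x) - ?P) <= M * d^2 * (?q1 s h) + M1 * \<bar>s\<bar>" by (simp add: mult.assoc)
  also have "... <= (M * d^2 + M1) * (\<bar>s\<bar> + s^2 + (norm h)^2)"
   using M0 M1(1) by (simp add: algebra_simps add_nonneg_nonneg)
  finally show ?thesis .
 qed
 then show ?thesis using M0 M1(1) by (intro exI[of _ "M * d^2 + M1"]) auto
qed

lemma test_fun_slice:
 fixes u v :: real
 shows "continuous_on UNIV (%x. \<phi> (u, x) - \<phi> (v, x))" "integrable lborel (%x. (\<phi> (u, x) - \<phi> (v, x)) $ k)"
  "\<exists>B. \<forall>x. norm (\<phi> (u, x) - \<phi> (v, x)) <= B"
proof -
 let ?q0 = "%u x. \<phi> (u, x) - \<phi> (v, x)"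
 show 1: "continuous_on UNIV (%x. \<phi> (u, x) - \<phi> (v, x))"
  by (intro continuous_intros continuous_on_compose2[OF test_fun_continuous]) auto
 obtain B where B: "!!z. norm (\<phi> z) <= B" using pderivs_bounded[of "[]"] by auto
 have 2: "norm (?q0 u x) <= 2 * B" for x
  using norm_triangle_ineq4[of "\<phi> (u,x)" "\<phi> (v,x)"] B[of "(u,x)"] B[of "(v,x)"] by linarith
 then show "\<exists>B. \<forall>x. norm (?q0 u x) <= B" by blast
 obtain R where R: "!!u x. norm x > R ==> \<phi> (u, x) = 0" using test_fun_support_radius by (metis pderivs.simps(1))
 show "integrable lborel (%x. (?q0 u x) $ k)"
 proof (rule integrable_continuous_bounded_support[where R=R])
  show "continuous_on UNIV (%x. (?q0 u x) $ k)"
   by (rule bounded_linear.continuous_on[OF bounded_linear_vec_nth 1])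
  show "\<bar>(?q0 u x) $ k\<bar> <= 2 * B" for x
   using component_le_norm_cart[of "\<phi> (u, x) - \<phi> (v, x)" k] 2[of x] by linarith
 qed (simp add: R)
qed

text \<open>Differences of time slices are used throughout, so that one bound gives both the decay in frequency and the
 Lipschitz dependence on time.\<close>

lemma fourier_slice_decay:
 assumes b: "b \<in> Basis"
 shows "\<exists>C\<ge>0. \<forall>u v xi. cmod (fourier (%x. (\<phi> (u, x) - \<phi> (v, x)) $ k) xi) * \<bar>2 * pi * (xi \<bullet> b)\<bar> ^ m <= C * \<bar>u - v\<bar>"
proof -
 define w where "w = (0::real, b)"
 have w: "w \<in> Basis" using b unfolding w_def Basis_prod_def by auto
 have rl: "replicate i w \<in> lists Basis" for i using w by (induction i) auto
 define g where "g u v i x = (pderivs (replicate i w) \<phi> (u, x) - pderivs (replicate i w) \<phi> (v, x)) $ k" for u v i x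
 obtain R where R: "!!u x vs. norm x > R ==> pderivs vs \<phi> (u, x) = 0" using test_fun_support_radius by metis
 have gcont: "continuous_on UNIV (g u v i)" for u v i
  unfolding g_def by (intro continuous_intros continuous_on_compose2[OF pderivs_continuous[OF rl]]) auto
 have gbd: "\<exists>B. \<forall>x. \<bar>g u v i x\<bar> <= B" for u v i
 proof -
  obtain B where B: "!!z. norm (pderivs (replicate i w) \<phi> z) <= B" using pderivs_bounded[OF rl] by metis
  have "\<bar>g u v i x\<bar> <= 2 * B" for x
   unfolding g_def using component_le_norm_cart[of "pderivs (replicate i w) \<phi> (u, x) - pderivs (replicate i w) \<phi> (v, x)" k]
    norm_triangle_ineq4[of "pderivs (replicate i w) \<phi> (u, x)" "pderivs (replicate i w) \<phi> (v, x)"] B[of "(u,x)"] B[of "(v,x)"] by linarith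
  then show ?thesis by blast
 qed
 have gder: "((%t. g u v i (x + t *\<^sub>R b)) has_vector_derivative g u v (Suc i) x) (at 0)" for u v i x
 proof -
  have "((%t. pderivs (replicate i w) \<phi> ((u, x) + t *\<^sub>R w) - pderivs (replicate i w) \<phi> ((v, x) + t *\<^sub>R w)) has_vector_derivative
    (pderivs (w # replicate i w) \<phi> (u, x) - pderivs (w # replicate i w) \<phi> (v, x))) (at 0)"
   by (intro has_vector_derivative_diff pderivs_has_derivative rl w)
  from bounded_linear.has_vector_derivative[OF bounded_linear_vec_nth[of k] this]
  show ?thesis unfolding g_def replicate_Suc by (simp add: w_def del: pderivs.simps)
 qed
 have rec: "fourier (g u v (Suc i)) xi = 2 * pi * \<i> * complex_of_real (xi \<bullet> b) * fourier (g u v i) xi" for u v i xi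
 proof -
  obtain B where B: "!!x. \<bar>g u v i x\<bar> <= B" using gbd by blast
  obtain C where C: "!!x. \<bar>g u v (Suc i) x\<bar> <= C" using gbd by blast
  show ?thesis
  proof (rule fourier_partial_derivative)
   show "norm b = 1" using b by simp
   show "g u v i x = 0" if "norm x > R" for x unfolding g_def using R[OF that] by simp
  qed (rule gcont gder B C)+
 qed
 have pow: "cmod (fourier (g u v i) xi) = \<bar>2 * pi * (xi \<bullet> b)\<bar> ^ i * cmod (fourier (g u v 0) xi)" for u v i xi
  by (induction i) (simp_all add: rec norm_mult abs_mult mult_ac)
 have e: "(1::real, 0::real^'d) \<in> Basis" by (auto simp: Basis_prod_def)
 then have rl': "(1, 0) # replicate m w \<in> lists Basis" using rl by auto
 obtain B where B: "B >= 0" "!!z. norm (pderivs ((1, 0) # replicate m w) \<phi> z) <= B" using pderivs_bounded[OF rl'] by metis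
 \<comment> \<open>One further derivative, in time, yields the factor |u - v|.\<close>
 have gl: "\<bar>g u v m x\<bar> <= B * \<bar>u - v\<bar>" for u v x
 proof -
  have "norm (pderivs (replicate m w) \<phi> ((v, x) + (u - v) *\<^sub>R (1, 0)) - pderivs (replicate m w) \<phi> (v, x) - (u - v) *\<^sub>R 0) <= B * \<bar>u - v\<bar>"
   by (rule directional_mvt[where D="pderivs ((1, 0) # replicate m w) \<phi>"])
    (use pderivs_has_derivative[OF rl[of m] e] B(2) in \<open>auto simp del: pderivs.simps\<close>)
  then show ?thesis
   unfolding g_def using component_le_norm_cart[of "pderivs (replicate m w) \<phi> (u, x) - pderivs (replicate m w) \<phi> (v, x)" k] by simp
 qed
 define C where "C = B * measure lborel (cball (0::real^'d) R)"
 have "cmod (fourier (%x. (\<phi> (u, x) - \<phi> (v, x)) $ k) xi) * \<bar>2 * pi * (xi \<bullet> b)\<bar> ^ m <= C * \<bar>u - v\<bar>" for u v xi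
 proof -
  have g0: "(%x. (\<phi> (u, x) - \<phi> (v, x)) $ k) = g u v 0" by (simp add: g_def fun_eq_iff)
  have z: "g u v m x = 0" if "norm x > R" for x unfolding g_def using R[OF that] by simp
  note I = integrable_continuous_bounded_support[OF gcont gl z]
  have "cmod (fourier (g u v m) xi) <= (\<integral>y. \<bar>g u v m y\<bar> \<partial>lborel)" by (rule norm_fourier_le[OF I(1)])
  also have "... <= B * \<bar>u - v\<bar> * measure lborel (cball (0::real^'d) R)" by (rule I(2))
  finally show ?thesis unfolding pow[of u v m] g0 by (simp add: C_def mult_ac)
 qed
 moreover have "C >= 0" unfolding C_def using B(1) by simp
 ultimately show ?thesis by blast
qed

text \<open>The norm of xi is comparable to its largest coordinate, so at each frequency decay in a
  single well-chosen direction suffices.\<close>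

lemma fourier_slice_decay_radial:
 "\<exists>C\<ge>0. \<forall>u v xi. cmod (fourier (%x. (\<phi> (u, x) - \<phi> (v, x)) $ k) xi) <= C * \<bar>u - v\<bar> * (1 + (norm xi)^2) powr (- real m)"
proof -
 let ?F = "%u v. fourier (%x. (\<phi> (u, x) - \<phi> (v, x)) $ k)"
 let ?q0 = "%xi. 1 + (norm xi)^2"
 let ?q1 = "%xi. %b. \<bar>2 * pi * (xi \<bullet> b)\<bar>"
 have "\<forall>b\<in>(Basis::(real^'d) set). \<exists>C\<ge>0. \<forall>u v xi. cmod (?F u v xi) * \<bar>2 * pi * (xi \<bullet> b)\<bar> ^ (2*m) <= C * \<bar>u - v\<bar>"
  using fourier_slice_decay by blast
 from bchoice[OF this] obtain C where "\<forall>b\<in>(Basis::(real^'d) set). 0 <= C b \<and> (\<forall>u v xi. cmod (?F u v xi) * \<bar>2 * pi * (xi \<bullet> b)\<bar> ^ (2*m) <= C b * \<bar>u - v\<bar>)" ..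
 then have C: "0 <= C b \<and> cmod (?F u v xi) * \<bar>2 * pi * (xi \<bullet> b)\<bar> ^ (2*m) <= C b * \<bar>u - v\<bar>" if "b \<in> Basis" for b u v xi
  using that by blast
 obtain b0 :: "real^'d" where b0: "b0 \<in> Basis" using nonempty_Basis by blast
 obtain C0 where C0: "C0 >= 0" "!!u v xi. cmod (?F u v xi) * \<bar>2 * pi * (xi \<bullet> b0)\<bar> ^ 0 <= C0 * \<bar>u - v\<bar>"
  using fourier_slice_decay[OF b0, of k 0] by blast
 define S where "S = C0 + (\<Sum>b\<in>(Basis::(real^'d) set). C b)"
 have S0: "S >= 0" unfolding S_def using C0 C by (auto intro!: add_nonneg_nonneg sum_nonneg)
 have Cb: "C b <= S" if "b \<in> Basis" for b
  unfolding S_def using C0(1) member_le_sum[OF that, of C] C by force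
 have C0S: "C0 <= S" unfolding S_def using C by (auto intro!: sum_nonneg)
 define d where "d = 1 + real DIM(real^'d)"
 have main: "cmod (?F u v xi) <= S * d ^ (2*m) * \<bar>u - v\<bar> * (?q0 xi) powr (- real m)" for u v xi
 proof -
  \<comment> \<open>The maximum is attained: either at 1, where the zero-order bound
    \<open>C0\<close> applies, or at a coordinate b, where the bound with exponent 2 m
    applies.\<close>
  define Q where "Q = Max (insert 1 ((?q1 xi) ` Basis))"
  have Q1: "Q >= 1" "!!b. b \<in> Basis ==> \<bar>2 * pi * (xi \<bullet> b)\<bar> <= Q" unfolding Q_def by (auto simp del: Max_insert intro!: Max_ge)
  have "Q \<in> insert 1 ((?q1 xi) ` Basis)" unfolding Q_def by (rule Max_in) auto
  then have FQ: "cmod (?F u v xi) * Q ^ (2*m) <= S * \<bar>u - v\<bar>"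
  proof
   assume "Q = 1" then show ?thesis using C0(2)[of u v xi] C0S by (smt (verit) mult_right_mono abs_ge_zero power_0 power_one mult_1_right)
  next
   assume "Q \<in> (?q1 xi) ` Basis"
   then obtain b where b: "b \<in> Basis" "Q = \<bar>2 * pi * (xi \<bullet> b)\<bar>" by auto
   then show ?thesis using C[OF b(1), of u v xi] Cb[OF b(1)] by (smt (verit) mult_right_mono abs_ge_zero)
  qed
  have "norm xi <= (\<Sum>b\<in>Basis. \<bar>xi \<bullet> b\<bar>)" by (rule norm_le_l1)
  also have "... <= (\<Sum>b\<in>(Basis::(real^'d) set). Q)"
  proof (rule sum_mono)
   fix b :: "real^'d" assume b: "b \<in> Basis"
   have "1 * \<bar>xi \<bullet> b\<bar> <= (2 * pi) * \<bar>xi \<bullet> b\<bar>" using pi_gt3 by (intro mult_right_mono) auto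
   then show "\<bar>xi \<bullet> b\<bar> <= Q" using Q1(2)[OF b] by (simp add: abs_mult)
  qed
  finally have nQ: "1 + norm xi <= d * Q" unfolding d_def using Q1(1) by (simp add: algebra_simps)
  have "1 + (norm xi)^2 <= (1 + norm xi)^2" by (simp add: power2_eq_square algebra_simps)
  also have "... <= (d * Q)^2" using nQ by (intro power_mono) auto
  finally have "(?q0 xi) ^ m <= ((d * Q)^2) ^ m" by (intro power_mono) auto
  then have P: "(?q0 xi) ^ m <= d ^ (2*m) * Q ^ (2*m)" by (simp add: power_mult power_mult_distrib)
  have "cmod (?F u v xi) * (?q0 xi) ^ m <= cmod (?F u v xi) * (d ^ (2*m) * Q ^ (2*m))"
   by (intro mult_left_mono P) auto
  also have "... = d ^ (2*m) * (cmod (?F u v xi) * Q ^ (2*m))" by simp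
  also have "... <= d ^ (2*m) * (S * \<bar>u - v\<bar>)" by (intro mult_left_mono FQ) (simp add: d_def)
  finally have fin: "cmod (?F u v xi) * (?q0 xi) ^ m <= S * d ^ (2*m) * \<bar>u - v\<bar>" by (simp add: mult_ac)
  have p: "0 < 1 + (norm xi)^2" by (smt (verit) zero_le_power2)
  have pm: "(?q0 xi) powr (- real m) = inverse ((?q0 xi) ^ m)"
   using p by (simp add: powr_minus powr_realpow)
  show ?thesis unfolding pm using fin p by (simp add: divide_simps)
 qed
 have "S * d ^ (2*m) >= 0" using S0 unfolding d_def by simp
 with main show ?thesis by (intro exI[of _ "S * d ^ (2*m)"] conjI allI)
qed

text \<open>The rate of decay m is free; it is taken so large that the weight left over, of exponent
  2 m - s, is integrable.\<close>

lemma Hs_norm2_slice_lipschitz: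
 "\<exists>C\<ge>0. \<forall>u v. Hs_norm2 s (%x. \<phi> (u, x) - \<phi> (v, x)) <= ennreal (C * (u - v)^2)"
proof -
 obtain m :: nat where m: "real m > s + real DIM(real^'d) + 1" using reals_Archimedean2 by blast
 let ?F = "%k u v. fourier (%x. (\<phi> (u, x) - \<phi> (v, x)) $ k)"
 have "\<forall>k. \<exists>C\<ge>0. \<forall>u v xi. cmod (?F k u v xi) <= C * \<bar>u - v\<bar> * (1 + (norm xi)^2) powr (- real m)"
  using fourier_slice_decay_radial by blast
 from choice[OF this] obtain C where "\<forall>k. C k >= 0 \<and> (\<forall>u v xi. cmod (?F k u v xi) <= C k * \<bar>u - v\<bar> * (1 + (norm xi)^2) powr (- real m))" ..
 then have C: "C k >= 0" "cmod (?F k u v xi) <= C k * \<bar>u - v\<bar> * (1 + (norm xi)^2) powr (- real m)" for k u v xi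
  by blast+
 define S where "S = (\<Sum>k\<in>UNIV. (C k)^2)"
 let ?q = "2 * real m - s"
 have fin: "weight_mass TYPE(real^'d) ?q < \<infinity>"
  by (rule weight_mass_finite) (use m in simp)
 then obtain w where w: "weight_mass TYPE(real^'d) ?q = ennreal w" "w >= 0"
  by (metis ennreal_cases infinity_ennreal_def less_irrefl)
 have "Hs_norm2 s (%x. \<phi> (u, x) - \<phi> (v, x)) <= ennreal ((S * w) * (u - v)^2)" for u v
 proof -
  have "(\<Sum>k\<in>UNIV. (cmod (?F k u v xi))^2) * (1 + (norm xi)^2) powr s <= S * (u - v)^2 * (1 + (norm xi)^2) powr (- ?q)" for xi
  proof -
   have "(cmod (?F k u v xi))^2 <= (C k)^2 * (u - v)^2 * (1 + (norm xi)^2) powr (- 2 * real m)" for k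
   proof -
    have "(cmod (?F k u v xi))^2 <= (C k * \<bar>u - v\<bar> * (1 + (norm xi)^2) powr (- real m))^2" by (intro power_mono C) auto
    also have "... = (C k)^2 * (u - v)^2 * ((1 + (norm xi)^2) powr (- real m) * (1 + (norm xi)^2) powr (- real m))"
     by (simp add: power_mult_distrib power2_eq_square)
    also have "(1 + (norm xi)^2) powr (- real m) * (1 + (norm xi)^2) powr (- real m) = (1 + (norm xi)^2) powr (- 2 * real m)"
     by (simp add: powr_add[symmetric])
    finally show ?thesis .
   qed
   then have "(\<Sum>k\<in>UNIV. (cmod (?F k u v xi))^2) <= (\<Sum>k\<in>UNIV. (C k)^2 * (u - v)^2 * (1 + (norm xi)^2) powr (- 2 * real m))"
    by (intro sum_mono)
   also have "... = S * (u - v)^2 * (1 + (norm xi)^2) powr (- 2 * real m)" unfolding S_def by (simp add: sum_distrib_right)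
   finally have "(\<Sum>k\<in>UNIV. (cmod (?F k u v xi))^2) * (1 + (norm xi)^2) powr s <= S * (u - v)^2 * ((1 + (norm xi)^2) powr (- 2 * real m) * (1 + (norm xi)^2) powr s)"
    by (simp add: mult_right_mono mult.assoc[symmetric])
   then show ?thesis by (simp add: powr_add[symmetric])
  qed
  then have "Hs_norm2 s (%x. \<phi> (u, x) - \<phi> (v, x)) <= (\<integral>\<^sup>+(xi::real^'d). ennreal (S * (u - v)^2 * (1 + (norm xi)^2) powr (- ?q)) \<partial>lborel)"
   unfolding Hs_norm2_def fourier_comp_def fourier_def by (intro nn_integral_mono ennreal_leI)
  also have "... = ennreal (S * (u - v)^2) * weight_mass TYPE(real^'d) ?q"
   unfolding weight_mass_def by (subst nn_integral_cmult[symmetric]) (auto simp: ennreal_mult S_def sum_nonneg)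
  also have "... = ennreal ((S * w) * (u - v)^2)"
   unfolding w using w(2) by (subst ennreal_mult[symmetric]) (auto simp: S_def sum_nonneg mult_ac)
  finally show ?thesis .
 qed
 moreover have "S * w >= 0" using w(2) unfolding S_def by (auto intro!: mult_nonneg_nonneg sum_nonneg)
 ultimately show ?thesis by blast
qed

text \<open>The slice at time a vanishes, so each slice is a difference of slices and the Lipschitz
  bound applies with |u - a| <= c - a.\<close>

lemma Hs_norm2_slice_bounded: "\<exists>C\<ge>0. \<forall>u. Hs_norm2 s (%x. \<phi> (u, x)) <= ennreal C"
proof -
 obtain C where C: "C >= 0" "!!u v. Hs_norm2 s (%x. \<phi> (u, x) - \<phi> (v, x)) <= ennreal (C * (u - v)^2)"
  using Hs_norm2_slice_lipschitz by blast
 have "Hs_norm2 s (%x. \<phi> (u, x)) <= ennreal (C * (c - a)^2)" for u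
 proof (cases "u \<in> {a<..<c}")
  case True
  have "Hs_norm2 s (%x. \<phi> (u, x)) <= ennreal (C * (u - a)^2)" using C(2)[of u a] test_fun_zero_outside[of a] by simp
  also have "... <= ennreal (C * (c - a)^2)" using True C(1) by (intro ennreal_leI mult_left_mono power_mono) auto
  finally show ?thesis .
 next
  case False
  then show ?thesis using C(2)[of u u] test_fun_zero_outside[of u] by simp
 qed
 then show ?thesis using C(1) by (intro exI[of _ "C * (c - a)^2"]) auto
qed

text \<open>By the Lipschitz bound the double integrand is at most a constant times |u - v|^(1 - 2
  s1), which is integrable near the diagonal because s1 < 1.\<close>

lemma Hbold_norm2_finite:
 assumes s1: "s1 < 1"
 shows "Hbold_norm2 a c s1 s2 \<phi> < \<infinity>"
proof -
 let ?q0 = "%u v. %x. \<phi> (u, x) - \<phi> (v, x)"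
 let ?q1 = "%u v. \<bar>u - v\<bar> powr (1 + 2 * s1)"
 obtain C where C: "C >= 0" "!!u. Hs_norm2 s2 (%x. \<phi> (u, x)) <= ennreal C" using Hs_norm2_slice_bounded by blast
 obtain D where D: "D >= 0" "!!u v. Hs_norm2 s2 (?q0 u v) <= ennreal (D * (u - v)^2)"
  using Hs_norm2_slice_lipschitz by blast
 have 1: "(\<integral>\<^sup>+ u\<in>{a<..<c}. Hs_norm2 s2 (%x. \<phi> (u, x)) \<partial>lborel) < \<infinity>"
 proof -
  have "(\<integral>\<^sup>+ u\<in>{a<..<c}. Hs_norm2 s2 (%x. \<phi> (u, x)) \<partial>lborel) <= (\<integral>\<^sup>+ u\<in>{a<..<c}. ennreal C \<partial>lborel)"
   by (intro nn_integral_mono mult_right_mono C) auto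
  also have "... < \<infinity>" by (cases "a <= c") (auto simp: nn_integral_cmult_indicator ennreal_mult_less_top)
  finally show ?thesis .
 qed
 define l where "l = max (c - a) 1"
 define e where "e = 1 - 2 * s1"
 have e: "e > -1" unfolding e_def using s1 by simp
 \<comment> \<open>A one-sided profile of the singularity; its translate and its reflected translate
   cover v < u and v > u.\<close>
 define G where "G w = indicator {0..l} w * ennreal (w powr e)" for w :: real
 have [measurable]: "G \<in> meas borel" unfolding G_def by measurable
 have Gi: "(\<integral>\<^sup>+ w. G w \<partial>lborel) < \<infinity>"
 proof -
  have hi: "((%x. x powr e) has_integral (l powr (e + 1) / (e + 1))) {0..l}"
   by (rule has_integral_powr_from_0) (use e in \<open>auto simp: l_def\<close>)
  have "integral\<^sup>N lborel (%x. indicator {0..l} x * (x powr e)) = ennreal (l powr (e + 1) / (e + 1))"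
   by (rule nn_integral_has_integral_lebesgue[OF _ hi]) simp
  then show ?thesis unfolding G_def by (simp add: ennreal_mult ennreal_indicator)
 qed
 define K where "K = (\<integral>\<^sup>+ w. G w \<partial>lborel)"
 have 2: "(\<integral>\<^sup>+ v\<in>{a<..<c}. Hs_norm2 s2 (?q0 u v) / ennreal (?q1 u v) \<partial>lborel) <= ennreal D * (K + K)"
  if u: "u \<in> {a<..<c}" for u
 proof -
  have pt: "Hs_norm2 s2 (?q0 u v) / ennreal (?q1 u v) * indicator {a<..<c} v <= ennreal D * (G (u + (-1) * v) + G (-u + 1 * v))" for v
  proof (cases "v \<in> {a<..<c} \<and> u ~= v")
   case True
   have ab: "\<bar>u - v\<bar> > 0" using True by simp
   have "Hs_norm2 s2 (?q0 u v) / ennreal (?q1 u v) <= ennreal (D * (u - v)^2) / ennreal (?q1 u v)"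
    by (rule divide_right_mono_ennreal[OF D(2)])
   also have "... = ennreal (D * (u - v)^2 / \<bar>u - v\<bar> powr (1 + 2 * s1))"
    using D(1) ab by (intro divide_ennreal) auto
   also have "D * (u - v)^2 / \<bar>u - v\<bar> powr (1 + 2 * s1) = D * \<bar>u - v\<bar> powr e"
   proof -
    have "(u - v)^2 = \<bar>u - v\<bar> powr 2" using ab by simp
    then have "(u - v)^2 / \<bar>u - v\<bar> powr (1 + 2 * s1) = \<bar>u - v\<bar> powr (2 - (1 + 2 * s1))" by (simp only: powr_diff)
    then have "D * ((u - v)^2 / \<bar>u - v\<bar> powr (1 + 2 * s1)) = D * \<bar>u - v\<bar> powr e" by (simp add: e_def)
    then show ?thesis by (simp only: times_divide_eq_right)
   qed
   also have "ennreal (D * \<bar>u - v\<bar> powr e) = ennreal D * ennreal (\<bar>u - v\<bar> powr e)" using D(1) by (simp add: ennreal_mult)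
   also have "... <= ennreal D * (G (u + (-1) * v) + G (-u + 1 * v))"
   proof (rule mult_left_mono)
    have "\<bar>u - v\<bar> <= l" using True u unfolding l_def by auto
    then show "ennreal (\<bar>u - v\<bar> powr e) <= G (u + (-1) * v) + G (-u + 1 * v)"
     using ab by (cases "u > v") (auto simp: G_def indicator_def)
   qed simp
   finally show ?thesis using True by simp
  next
   case False
   \<comment> \<open>On the diagonal the quotient reads 0 / 0, which is 0 in
     \<open>ennreal\<close>.\<close>
   have "Hs_norm2 s2 (%x. \<phi> (u, x) - \<phi> (u, x)) = 0" using D(2)[of u u] by simp
   with False show ?thesis by (auto simp: indicator_def)
  qed
  have Ga: "(\<integral>\<^sup>+ v. G (u + (-1) * v) \<partial>lborel) = K" "(\<integral>\<^sup>+ v. G (-u + 1 * v) \<partial>lborel) = K"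
   unfolding K_def using nn_integral_real_affine[of G "-1" u] nn_integral_real_affine[of G "1" "-u"] by simp_all
  have "(\<integral>\<^sup>+ v\<in>{a<..<c}. Hs_norm2 s2 (?q0 u v) / ennreal (?q1 u v) \<partial>lborel)
    <= (\<integral>\<^sup>+ v. ennreal D * (G (u + (-1) * v) + G (-u + 1 * v)) \<partial>lborel)"
   by (rule nn_integral_mono) (rule pt)
  also have "... = ennreal D * (K + K)"
   by (subst nn_integral_cmult, measurable) (subst nn_integral_add, measurable, simp only: Ga)
  finally show ?thesis .
 qed
 have "(\<integral>\<^sup>+ u\<in>{a<..<c}. (\<integral>\<^sup>+ v\<in>{a<..<c}.
    Hs_norm2 s2 (?q0 u v) / ennreal (?q1 u v) \<partial>lborel) \<partial>lborel)
   <= (\<integral>\<^sup>+ u\<in>{a<..<c}. ennreal D * (K + K) \<partial>lborel)"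
  using 2 by (intro nn_integral_mono) (auto simp: indicator_def)
 also have "... < \<infinity>"
  using Gi unfolding K_def[symmetric] by (cases "a <= c") (auto simp: nn_integral_cmult_indicator ennreal_mult_less_top)
 finally show ?thesis using 1 unfolding Hbold_norm2_def by simp
qed

lemma Hs_norm2_slice_measurable:
 "(%(u, v). Hs_norm2 s (%x. \<phi> (u, x) - \<phi> (v, x))) \<in> meas (borel \<Otimes>\<^sub>M borel)"
proof -
 let ?q0 = "borel \<Otimes>\<^sub>M borel"
 let ?q1 = "%k. %p. cis (- 2 * pi * (snd (fst p) \<bullet> snd p)) * complex_of_real (\<phi> (fst (fst (fst p)), snd p) $ k - \<phi> (snd (fst (fst p)), snd p) $ k)"
 let ?q2 = "?q0 \<Otimes>\<^sub>M borel"
 let ?q3 = "%G w. %((u, v), xi). ennreal ((\<Sum>k\<in>UNIV. (cmod (G u v k xi))^2) * w xi)"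
 define w where "w xi = (1 + (norm xi)^2) powr s" for xi :: "real^'d"
 have [measurable]: "w \<in> meas borel" unfolding w_def by measurable
 define G where "G u v k xi = fourier_comp (%x. \<phi> (u, x) - \<phi> (v, x)) k xi" for u v k xi
 have \<phi>k[measurable]: "(%z. \<phi> z $ k) \<in> meas ?q0" for k
  unfolding borel_prod by measurable
 have "(?q1 k)
   \<in> meas (?q2 \<Otimes>\<^sub>M borel)" for k
  by measurable
 then have m: "(?q1 k)
   \<in> meas (?q2 \<Otimes>\<^sub>M lborel)" for k
  by (simp cong: measurable_cong_sets)
 have G: "(%((u, v), xi). G u v k xi) \<in> meas ?q2" for k
  unfolding G_def fourier_comp_def
  using lborel.borel_measurable_lebesgue_integral[of "%((u, v), xi) x. cis (- 2 * pi * (xi \<bullet> x)) * complex_of_real (\<phi> (u, x) $ k - \<phi> (v, x) $ k)", of "?q0 \<Otimes>\<^sub>M borel"] m[of k]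
  by (simp add: case_prod_unfold)
 then have "(?q3 G w) \<in> meas ?q2"
  unfolding case_prod_unfold by measurable
 then have "(?q3 G w) \<in> meas (?q0 \<Otimes>\<^sub>M lborel)"
  by (simp cong: measurable_cong_sets)
 then show ?thesis
  unfolding Hs_norm2_def G_def w_def
  using lborel.borel_measurable_nn_integral[of "%(u, v) xi. ennreal ((\<Sum>k\<in>UNIV. (cmod (fourier_comp (%x. \<phi> (u, x) - \<phi> (v, x)) k xi))^2) * (1 + (norm xi)^2) powr s)" "borel \<Otimes>\<^sub>M borel"]
  by (simp add: case_prod_unfold)
qed

lemma test_fun_point_bound:
 "ennreal ((v \<bullet> \<phi> (u, x))^2) <= Hs_norm2 s (%x. \<phi> (u, x)) * (ennreal ((norm v)^2) * weight_mass TYPE(real^'d) s)"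
proof -
 have za: "\<phi> (a, y) = 0" for y using test_fun_zero_outside[of a] by simp
 then have z: "(%x. \<phi> (u, x) - \<phi> (a, x)) = (%x. \<phi> (u, x))" by simp
 obtain B where "!!x. norm (\<phi> (u, x) - \<phi> (a, x)) <= B" using test_fun_slice(3)[of u a] by blast
 from point_functional_bound[OF test_fun_slice(2) test_fun_slice(1) this, where A="{()}" and x="%_. x" and c="%_. v" and s=s]
 show ?thesis unfolding z energy_singleton by (simp add: za)
qed

text \<open>A difference quotient is a dipole of width h with coefficient v / h, and its energy
  bound does not depend on h. The estimate therefore passes to the derivative as h tends to
  0.\<close>

lemma test_fun_partial_bound:
 assumes b: "b \<in> Basis"
 shows "ennreal ((v \<bullet> pderivs [(0, b)] \<phi> (u, x))^2)
  <= Hs_norm2 s (%x. \<phi> (u, x)) * (ennreal ((norm v)^2 * (2 * pi)^2) * weight_mass TYPE(real^'d) (s - 1))"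
proof -
 let ?q0 = "%x. \<phi> (u, x)"
 let ?q1 = "%x h. (\<phi> (u, x + h *\<^sub>R b) - \<phi> (u, x)) /\<^sub>R h"
 let ?q2 = "%x h n. (\<phi> (u, x + h n *\<^sub>R b) - \<phi> (u, x)) /\<^sub>R h n"
 let ?q3 = "%s. ennreal ((norm v)^2 * (2 * pi)^2) * weight_mass TYPE(real^'d) (s - 1)"
 let ?q4 = "%x. %t. v \<bullet> \<phi> (u, x + t *\<^sub>R b)"
 have za: "\<phi> (a, y) = 0" for y using test_fun_zero_outside[of a] by simp
 then have z: "(%x. \<phi> (u, x) - \<phi> (a, x)) = ?q0" by simp
 obtain B where B: "!!x. norm (\<phi> (u, x) - \<phi> (a, x)) <= B" using test_fun_slice(3)[of u a] by blast
 have q: "ennreal ((v \<bullet> (?q1 x h))^2)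
  <= Hs_norm2 s ?q0 * (?q3 s)" if h: "h > 0" for h
 proof -
  let ?y = "%t. if t then x + h *\<^sub>R b else x" and ?c = "%t. if t then v /\<^sub>R h else - (v /\<^sub>R h)"
  have "(\<Sum>t\<in>UNIV. ?c t \<bullet> \<phi> (u, ?y t)) = v \<bullet> (?q1 x h)"
   by (simp add: UNIV_bool inner_diff_right algebra_simps)
  then have "ennreal ((v \<bullet> (?q1 x h))^2) <= Hs_norm2 s ?q0 * energy s UNIV ?y ?c"
   using point_functional_bound[OF test_fun_slice(2) test_fun_slice(1) B, where A="UNIV::bool set" and x="?y" and c="?c" and s=s]
   unfolding z by (simp add: za)
  also have "... <= Hs_norm2 s ?q0 * (ennreal ((norm (v /\<^sub>R h))^2 * (2 * pi * norm (?y True - ?y False))^2) * weight_mass TYPE(real^'d) (s - 1))"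
   by (intro mult_left_mono energy_difference) simp
  also have "(norm (v /\<^sub>R h))^2 * (2 * pi * norm (?y True - ?y False))^2 = (norm v)^2 * (2 * pi)^2"
   using h b by (simp add: power_mult_distrib power_divide field_simps)
  finally show ?thesis .
 qed
 define D where "D = pderivs [(0, b)] \<phi> (u, x)"
 define h where "h n = 1 / real (Suc n)" for n
 have "h \<longlonglongrightarrow> 0" unfolding h_def[abs_def] using LIMSEQ_inverse_real_of_nat by (simp add: divide_inverse)
 then have h0: "filterlim h (at 0) sequentially" by (auto simp: filterlim_at h_def intro!: always_eventually)
 have "((%t. \<phi> ((u, x) + t *\<^sub>R (0, b))) has_vector_derivative D) (at 0)"
  unfolding D_def using pderivs_has_derivative[of "[]" "(0, b)" "(u, x)"] b by (auto simp: Basis_prod_def)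
 then have "((?q4 x) has_vector_derivative v \<bullet> D) (at 0)"
  using bounded_linear.has_vector_derivative[OF bounded_linear_inner_right[of v]] by simp
 then have "((?q4 x) has_field_derivative v \<bullet> D) (at 0)"
  by (simp add: has_real_derivative_iff_has_vector_derivative)
 then have "((%t. (v \<bullet> \<phi> (u, x + t *\<^sub>R b) - v \<bullet> \<phi> (u, x)) / t) \<longlongrightarrow> v \<bullet> D) (at 0)"
  unfolding has_field_derivative_iff by simp
 from filterlim_compose[OF this h0]
 have lim: "(%n. v \<bullet> (?q2 x h n)) \<longlonglongrightarrow> v \<bullet> D"
  by (simp add: inner_diff_right divide_inverse mult.commute)
 have "(%n. ennreal ((v \<bullet> (?q2 x h n))^2)) \<longlonglongrightarrow> ennreal ((v \<bullet> D)^2)"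
  by (intro tendsto_ennrealI tendsto_power lim)
 then show ?thesis unfolding D_def[symmetric]
 proof (rule LIMSEQ_le_const2)
  have "h n > 0" for n unfolding h_def by simp
  then show "\<exists>N. \<forall>n\<ge>N. ennreal ((v \<bullet> (?q2 x h n))^2)
   <= Hs_norm2 s ?q0 * (?q3 s)"
   using q by blast
 qed
qed

end

lemma pderivs_add_test_fun:
 assumes "test_fun a c \<phi>" "test_fun a c \<psi>" "w \<in> Basis"
 shows "pderivs [w] (%z. \<phi> z + \<psi> z) z = pderivs [w] \<phi> z + pderivs [w] \<psi> z"
proof -
 have "((%t. \<phi> (z + t *\<^sub>R w) + \<psi> (z + t *\<^sub>R w)) has_vector_derivative pderivs [w] \<phi> z + pderivs [w] \<psi> z) (at 0)"
  using pderivs_has_derivative[OF assms(1), of "[]" w z] pderivs_has_derivative[OF assms(2), of "[]" w z] assms(3)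
  by (intro has_vector_derivative_add) auto
 then show ?thesis by (simp add: vector_derivative_at)
qed

lemma pderivs_scale_test_fun:
 assumes "test_fun a c \<phi>" "w \<in> Basis"
 shows "pderivs [w] (%z. r *\<^sub>R \<phi> z) z = r *\<^sub>R pderivs [w] \<phi> z"
proof -
 have "((%t. \<phi> (z + t *\<^sub>R w)) has_vector_derivative pderivs [w] \<phi> z) (at 0)"
  using pderivs_has_derivative[OF assms(1), of "[]" w z] assms(2) by auto
 from bounded_linear.has_vector_derivative[OF bounded_linear_scaleR_right[of r] this]
 show ?thesis by (simp add: vector_derivative_at)
qed

section \<open>Brownian increments and simple stochastic integrals\<close>

text \<open>Translates products over \<open>Basis\<close> into products over coordinates;
  \<open>THE\<close> recovers the index of a basis vector.\<close>

lemma prod_Basis_vec: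
 fixes f :: "'m::finite => real => real"
 shows "(\<Prod>b\<in>(Basis::(real^'m) set). f (THE i. b = axis i 1) (x \<bullet> b)) = (\<Prod>i\<in>UNIV. f i (x $ i))"
proof -
 have B: "(Basis::(real^'m) set) = (%i. axis i 1) ` UNIV" by (auto simp: Basis_vec_def)
 have inj: "inj (%i::'m. axis i (1::real))" by (auto simp: inj_on_def axis_eq_axis)
 have t: "(THE j. axis i (1::real) = axis j 1) = i" for i :: 'm by (rule the_equality) (auto simp: axis_eq_axis)
 show ?thesis unfolding B prod.reindex[OF inj] o_def t by (simp add: inner_axis)
qed

lemma lborel_prod_vec:
 fixes f :: "'m::finite => real => real"
 assumes int: "!!i. integrable lborel (f i)"
 shows "integrable lborel (%x::real^'m. \<Prod>i\<in>UNIV. f i (x $ i))" (is ?C1)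
  "(\<integral>x. (\<Prod>i\<in>UNIV. f i (x $ i)) \<partial>(lborel::(real^'m) measure)) = (\<Prod>i\<in>UNIV. integral\<^sup>L lborel (f i))" (is ?C2)
proof -
 have B: "(Basis::(real^'m) set) = (%i. axis i 1) ` UNIV" by (auto simp: Basis_vec_def)
 have inj: "inj (%i::'m. axis i (1::real))" by (auto simp: inj_on_def axis_eq_axis)
 have t: "(THE j. axis i (1::real) = axis j 1) = i" for i :: 'm by (rule the_equality) (auto simp: axis_eq_axis)
 note * = lborel_prod_Basis[where 'a="real^'m" and f="%b. f (THE i. b = axis i 1)", OF int]
 show ?C1
  using *(1) unfolding prod_Basis_vec .
 have "(\<Prod>b\<in>(Basis::(real^'m) set). integral\<^sup>L lborel (f (THE i. b = axis i 1))) = (\<Prod>i\<in>UNIV. integral\<^sup>L lborel (f i))"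
  unfolding B prod.reindex[OF inj] o_def t ..
 then show ?C2
  using *(2) unfolding prod_Basis_vec by simp
qed

section \<open>Moments and independence of Brownian increments\<close>

locale brownian = prob_space M for M :: "'w measure" +
 fixes F :: "real => 'w measure" and T :: real and W :: "real => 'w => real^'m"
 assumes filt: "usual_filtered_prob_space M F T" and BM: "F_brownian M F T W" and T_pos: "0 < T"
begin

lemma F_space: "t \<in> {0..T} ==> space (F t) = space M"
 and F_subalgebra: "t \<in> {0..T} ==> subalgebra M (F t)"
 and F_mono: "0 <= s ==> s <= t ==> t <= T ==> subalgebra (F t) (F s)"
proof -
 have 1: "\<forall>t\<in>{0..T}. space (F t) = space M \<and> sets (F t) \<subseteq> sets M"
  and 2: "\<forall>s\<in>{0..T}. \<forall>t\<in>{0..T}. s <= t --> sets (F s) \<subseteq> sets (F t)"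
  by (rule filt[unfolded usual_filtered_prob_space_def, THEN conjunct2, THEN conjunct2, THEN conjunct1])
   (rule filt[unfolded usual_filtered_prob_space_def, THEN conjunct2, THEN conjunct2, THEN conjunct2, THEN conjunct1])
 show "space (F t) = space M" if "t \<in> {0..T}" for t using 1 that by blast
 show "subalgebra M (F t)" if "t \<in> {0..T}" for t using 1 that unfolding subalgebra_def by blast
 show "subalgebra (F t) (F s)" if "0 <= s" "s <= t" "t <= T" for s t
  using 1 2 that unfolding subalgebra_def by simp
qed

lemma F_measurable_mono:
 "f \<in> meas (F s) ==> 0 <= s ==> s <= t ==> t <= T ==> f \<in> meas (F t)"
 by (rule measurable_from_subalg[OF F_mono])

lemma F_measurable_M: "f \<in> meas (F s) ==> 0 <= s ==> s <= T ==> f \<in> meas M"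
 by (rule measurable_from_subalg[OF F_subalgebra]) auto

definition inc :: "real => real => 'w => real^'m" where "inc s t w = W t w - W s w"

lemma inc_F: "0 <= s ==> s <= t ==> t <= T ==> inc s t \<in> meas (F t)"
proof -
 assume st: "0 <= s" "s <= t" "t <= T"
 have "\<forall>t\<in>{0..T}. W t \<in> meas (F t)" by (rule BM[unfolded F_brownian_def, THEN conjunct2, THEN conjunct1])
 then have "W t \<in> meas (F t)" "W s \<in> meas (F s)" using st by auto
 then show ?thesis unfolding inc_def using F_measurable_mono[OF _ st, of "W s"] by (intro borel_measurable_diff)
qed

lemma inc_increments:
 assumes "0 <= s" "s < t" "t <= T"
 shows inc_indep_F: "A \<in> sets (F s) ==> B \<in> sets borel ==>
   prob (A \<inter> {w\<in>space M. inc s t w \<in> B}) = prob A * prob {w\<in>space M. inc s t w \<in> B}"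
  and inc_distr: "distr M borel (inc s t) = density lborel (%x. ennreal (\<Prod>i\<in>UNIV. normal_density 0 (sqrt (t - s)) (x $ i)))" (is ?C1)
proof -
 have "\<forall>s\<in>{0..T}. \<forall>t\<in>{0..T}. s < t -->
    (\<forall>A\<in>sets (F s). \<forall>B\<in>sets borel.
     measure M (A \<inter> {w\<in>space M. W t w - W s w \<in> B})
      = measure M A * measure M {w\<in>space M. W t w - W s w \<in> B}) \<and>
    distr M borel (%w. W t w - W s w)
     = density lborel (%x. ennreal (\<Prod>i\<in>UNIV. normal_density 0 (sqrt (t - s)) (x $ i)))"
  by (rule BM[unfolded F_brownian_def, THEN conjunct2, THEN conjunct2])
 from bspec[OF bspec[OF this, of s], of t] assms have *: "(\<forall>A\<in>sets (F s). \<forall>B\<in>sets borel.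
     measure M (A \<inter> {w\<in>space M. W t w - W s w \<in> B})
      = measure M A * measure M {w\<in>space M. W t w - W s w \<in> B}) \<and>
    distr M borel (%w. W t w - W s w)
     = density lborel (%x. ennreal (\<Prod>i\<in>UNIV. normal_density 0 (sqrt (t - s)) (x $ i)))" by simp
 show "A \<in> sets (F s) ==> B \<in> sets borel ==>
   prob (A \<inter> {w\<in>space M. inc s t w \<in> B}) = prob A * prob {w\<in>space M. inc s t w \<in> B}"
  unfolding inc_def using bspec[OF bspec[OF conjunct1[OF *]]] .
 show ?C1
  unfolding inc_def[abs_def] by (rule conjunct2[OF *])
qed

lemma inc_M: "0 <= s ==> s <= t ==> t <= T ==> inc s t \<in> meas M"
 by (rule F_measurable_M[OF inc_F]) auto

lemma inc_split: "inc s u w = inc s t w + inc t u w" by (simp add: inc_def)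

lemma inc_refl[simp]: "inc s s w = 0" by (simp add: inc_def)

lemma inc_prod_expectation:
 fixes f :: "'m => real => real"
 assumes st: "0 <= s" "s < t" "t <= T"
  and m: "!!i. f i \<in> meas borel"
  and int: "!!i. integrable lborel (%x. normal_density 0 (sqrt (t - s)) x * f i x)"
 shows "integrable M (%w. \<Prod>i\<in>UNIV. f i (inc s t w $ i))" (is ?C1)
  "expectation (%w. \<Prod>i\<in>UNIV. f i (inc s t w $ i)) = (\<Prod>i\<in>UNIV. \<integral>x. normal_density 0 (sqrt (t - s)) x * f i x \<partial>lborel)" (is ?C2)
proof -
 note [measurable] = m inc_M[of s t]
 have D: "distr M borel (inc s t) = density lborel (%x. ennreal (\<Prod>i\<in>UNIV. normal_density 0 (sqrt (t - s)) (x $ i)))"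
  by (rule inc_distr[OF st])
 have [measurable]: "inc s t \<in> meas M" using inc_M st by simp
 have fm: "(%x::real^'m. \<Prod>i\<in>UNIV. f i (x $ i)) \<in> meas borel" by measurable
 have dm: "(%x::real^'m. \<Prod>i\<in>UNIV. normal_density 0 (sqrt (t - s)) (x $ i)) \<in> meas borel" by measurable
 note L = lborel_prod_vec[where f="%i x. normal_density 0 (sqrt (t - s)) x * f i x", OF int]
 have "integrable M (%w. \<Prod>i\<in>UNIV. f i (inc s t w $ i)) \<longleftrightarrow> integrable (distr M borel (inc s t)) (%x. \<Prod>i\<in>UNIV. f i (x $ i))"
  by (subst integrable_distr_eq) (use fm in auto)
 also have "... \<longleftrightarrow> integrable lborel (%x. \<Prod>i\<in>UNIV. normal_density 0 (sqrt (t - s)) (x $ i) * f i (x $ i))"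
  unfolding D by (subst integrable_density) (use fm dm in \<open>auto simp: prod.distrib prod_nonneg\<close>)
 finally show ?C1 using L(1) by simp
 have "expectation (%w. \<Prod>i\<in>UNIV. f i (inc s t w $ i)) = integral\<^sup>L (distr M borel (inc s t)) (%x. \<Prod>i\<in>UNIV. f i (x $ i))"
  by (subst integral_distr) (use fm in auto)
 also have "... = (\<integral>x. (\<Prod>i\<in>UNIV. normal_density 0 (sqrt (t - s)) (x $ i) * f i (x $ i)) \<partial>(lborel::(real^'m) measure))"
  unfolding D by (subst integral_density) (use fm dm in \<open>auto simp: prod.distrib prod_nonneg\<close>)
 finally show ?C2
  using L(2) by simp
qed

lemma normal_moments:
 assumes "\<sigma> > 0"
 shows "integrable lborel (%x. normal_density 0 \<sigma> x * x ^ k)"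
  "(\<integral>x. normal_density 0 \<sigma> x * x ^ 0 \<partial>lborel) = 1"
  "(\<integral>x. normal_density 0 \<sigma> x * x ^ 1 \<partial>lborel) = 0"
  "(\<integral>x. normal_density 0 \<sigma> x * x ^ 2 \<partial>lborel) = \<sigma>^2"
  "(\<integral>x. normal_density 0 \<sigma> x * x ^ 4 \<partial>lborel) = 3 * \<sigma> ^ 4"
 using assms integrable_normal_moment[of \<sigma> 0 k] integral_normal_moment_odd[of \<sigma> 0 0]
  integral_normal_moment_even[of \<sigma> 0 0] integral_normal_moment_even[of \<sigma> 0 1] integral_normal_moment_even[of \<sigma> 0 2]
 by (auto simp: fact_numeral power_divide)

lemma inc_power_prod:
 assumes st: "0 <= s" "s < t" "t <= T"
 shows "integrable M (%w. \<Prod>i\<in>UNIV. (inc s t w $ i) ^ k i)"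
  "expectation (%w. \<Prod>i\<in>UNIV. (inc s t w $ i) ^ k i) = (\<Prod>i\<in>UNIV. \<integral>x. normal_density 0 (sqrt (t - s)) x * x ^ k i \<partial>lborel)"
 using inc_prod_expectation[OF st, of "%i x. x ^ k i"] normal_moments(1)[of "sqrt (t - s)"] st by auto

lemma inc_moment1:
 assumes st: "0 <= s" "s <= t" "t <= T"
 shows "integrable M (%w. inc s t w $ i)" "expectation (%w. inc s t w $ i) = 0"
proof -
 let ?q0 = "%w. inc s t w $ i"
 have e: "(\<Prod>j\<in>UNIV. (inc s t w $ j) ^ (if j = i then 1 else 0)) = inc s t w $ i" for w
  by (simp add: if_distrib prod.delta cong: if_cong)
 show "integrable M ?q0"
  using inc_power_prod(1)[of s t "%j. if j = i then 1 else 0"] st unfolding e by (cases "s = t") auto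
 show "expectation ?q0 = 0"
 proof (cases "s = t")
  case False
  then have "expectation ?q0 = (\<Prod>j\<in>UNIV. \<integral>x. normal_density 0 (sqrt (t - s)) x * x ^ (if j = i then 1 else 0) \<partial>lborel)"
   using inc_power_prod(2)[of s t "%j. if j = i then 1 else 0"] st unfolding e by simp
  also have "... = 0" using normal_moments(3)[of "sqrt (t - s)"] st False by (intro prod_zero) (auto intro!: bexI[of _ i])
  finally show ?thesis .
 qed simp
qed

lemma inc_moment2:
 assumes st: "0 <= s" "s <= t" "t <= T"
 shows "integrable M (%w. inc s t w $ i * inc s t w $ j)"
  "expectation (%w. inc s t w $ i * inc s t w $ j) = (if i = j then t - s else 0)"
proof -
 let ?q0 = "%w. inc s t w $ i * inc s t w $ j"
 \<comment> \<open>The exponent counts how often coordinate l occurs in the product, which treats i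
   = j and i ~= j alike.\<close>
 define k where "k l = (if l = i then 1 else 0) + (if l = j then 1 else (0::nat))" for l
 have e: "(\<Prod>l\<in>UNIV. (inc s t w $ l) ^ k l) = inc s t w $ i * inc s t w $ j" for w
 proof -
  have "(inc s t w $ l) ^ k l = (if l = i then inc s t w $ i else 1) * (if l = j then inc s t w $ j else 1)" for l
   by (auto simp: k_def)
  then show ?thesis by (simp add: prod.distrib prod.delta)
 qed
 show "integrable M ?q0"
  using inc_power_prod(1)[of s t k] st unfolding e by (cases "s = t") auto
 show "expectation ?q0 = (if i = j then t - s else 0)"
 proof (cases "s = t")
  case False
  note nm = normal_moments[of "sqrt (t - s)"]
  have p: "sqrt (t - s) > 0" using st False by simp
  have "expectation ?q0 = (\<Prod>l\<in>UNIV. \<integral>x. normal_density 0 (sqrt (t - s)) x * x ^ k l \<partial>lborel)"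
   using inc_power_prod(2)[of s t k] st False unfolding e by simp
  also have "... = (if i = j then t - s else 0)"
  proof (cases "i = j")
   case True
   have "(\<Prod>l\<in>UNIV. \<integral>x. normal_density 0 (sqrt (t - s)) x * x ^ k l \<partial>lborel) = (\<Prod>l\<in>UNIV. if l = i then t - s else 1)"
    using nm(2,4) p st True by (intro prod.cong refl) (auto simp: k_def numeral_2_eq_2[symmetric])
   then show ?thesis using True by (simp add: prod.delta)
  next
   case False
   have "(\<integral>x. normal_density 0 (sqrt (t - s)) x * x ^ k i \<partial>lborel) = 0" using nm(3) p False by (simp add: k_def)
   then show ?thesis using False by (auto intro!: prod_zero bexI[of _ i])
  qed
  finally show ?thesis .
 qed simp
qed

lemma inc_moment4:
 assumes st: "0 <= s" "s <= t" "t <= T"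
 shows "integrable M (%w. (inc s t w $ i) ^ 4)" "expectation (%w. (inc s t w $ i) ^ 4) = 3 * (t - s)^2"
proof -
 let ?q0 = "%w. (inc s t w $ i) ^ 4"
 define k where "k l = (if l = i then 4 else (0::nat))" for l
 have e: "(\<Prod>l\<in>UNIV. (inc s t w $ l) ^ k l) = (inc s t w $ i) ^ 4" for w
  unfolding k_def by (simp add: if_distrib prod.delta cong: if_cong)
 show "integrable M ?q0"
  using inc_power_prod(1)[of s t k] st unfolding e by (cases "s = t") auto
 show "expectation ?q0 = 3 * (t - s)^2"
 proof (cases "s = t")
  case False
  note nm = normal_moments[of "sqrt (t - s)"]
  have p: "sqrt (t - s) > 0" using st False by simp
  have q: "sqrt (t - s) ^ 4 = (t - s)^2" using st power_mult[of "sqrt (t - s)" 2 2] by simp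
  have "expectation ?q0 = (\<Prod>l\<in>UNIV. \<integral>x. normal_density 0 (sqrt (t - s)) x * x ^ k l \<partial>lborel)"
   using inc_power_prod(2)[of s t k] st False unfolding e by simp
  also have "... = (\<Prod>l\<in>UNIV. if l = i then 3 * (t - s)^2 else 1)"
   using nm(2,5) p q by (intro prod.cong refl) (auto simp: k_def)
  finally show ?thesis by (simp add: prod.delta)
 qed simp
qed

text \<open>The definition of a Brownian motion gives independence for single events only. Every
  event generated by a function of the increment is itself a preimage under the increment, so no
  generating system has to be extended.\<close>

lemma inc_indep:
 fixes Y :: "'w => real" and g :: "real^'m => real"
 assumes st: "0 <= s" "s < t" "t <= T" and Y: "Y \<in> meas (F s)" and g: "g \<in> meas borel"
 shows "indep_var borel Y borel (%w. g (inc s t w))"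
proof -
 let ?q0 = "%w. g (inc s t w)"
 have YM: "Y \<in> meas M" using F_measurable_M[OF Y] st by simp
 have iM: "inc s t \<in> meas M" using inc_M st by simp
 have gM: "?q0 \<in> meas M" using measurable_compose[OF iM g] .
 have sp: "space (F s) = space M" using F_space st by simp
 have Fs: "s \<in> {0..T}" "t \<in> {0..T}" using st by auto
 have ind: "prob (A \<inter> {w\<in>space M. inc s t w \<in> B}) = prob A * prob {w\<in>space M. inc s t w \<in> B}"
  if "A \<in> sets (F s)" "B \<in> sets borel" for A B
  by (rule inc_indep_F[OF st that])
 show ?thesis
  unfolding indep_var_eq
 proof (intro conjI YM gM)
  have 1: "sigma_sets (space M) {Y -` A \<inter> space M |A. A \<in> sets borel} \<subseteq> sets (F s)"
   using measurable_sets[OF Y] unfolding sp[symmetric] by (intro sets.sigma_sets_subset) auto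
  have 2: "\<exists>B\<in>sets borel. E = {w\<in>space M. inc s t w \<in> B}"
   if E: "E \<in> sigma_sets (space M) {?q0 -` A \<inter> space M |A. A \<in> sets borel}" for E
  proof -
   have "sigma_sets (space M) {?q0 -` A \<inter> space M |A. A \<in> sets borel} = sets (vimage_algebra (space M) ?q0 borel)"
    unfolding vimage_algebra_def by (rule sets_measure_of[symmetric]) auto
   also have "... = {?q0 -` A \<inter> space M |A. A \<in> sets borel}"
    by (rule sets_vimage_algebra2) auto
   finally obtain A where A: "A \<in> sets borel" "E = ?q0 -` A \<inter> space M" using E by auto
   have "g -` A \<in> sets borel" using measurable_sets[OF g A(1)] by simp
   then show ?thesis using A(2) by (intro bexI[of _ "g -` A"]) auto
  qed
  show "indep_set (sigma_sets (space M) {Y -` A \<inter> space M |A. A \<in> sets borel})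
   (sigma_sets (space M) {?q0 -` A \<inter> space M |A. A \<in> sets borel})"
  proof (rule indep_setI)
   show "sigma_sets (space M) {Y -` A \<inter> space M |A. A \<in> sets borel} \<subseteq> events"
    using 1 F_subalgebra[OF Fs(1)] unfolding subalgebra_def by blast
   show "sigma_sets (space M) {?q0 -` A \<inter> space M |A. A \<in> sets borel} \<subseteq> events"
    using measurable_sets[OF gM] by (intro sets.sigma_sets_subset) auto
   fix A E assume "A \<in> sigma_sets (space M) {Y -` A \<inter> space M |A. A \<in> sets borel}"
    and "E \<in> sigma_sets (space M) {?q0 -` A \<inter> space M |A. A \<in> sets borel}"
   then show "prob (A \<inter> E) = prob A * prob E" using 1 2[of E] ind by blast
  qed
 qed
qed

lemma inc_mult_expectation:
 fixes Y :: "'w => real" and g :: "real^'m => real"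
 assumes st: "0 <= s" "s <= t" "t <= T" and Y: "Y \<in> meas (F s)" and g: "g \<in> meas borel"
  and iY: "integrable M Y" and ig: "integrable M (%w. g (inc s t w))"
 shows "integrable M (%w. Y w * g (inc s t w))"
  "expectation (%w. Y w * g (inc s t w)) = expectation Y * expectation (%w. g (inc s t w))"
proof -
 let ?q0 = "%w. Y w * g (inc s t w)"
 let ?q1 = "%w. g (inc s t w)"
 have "integrable M ?q0 \<and> expectation ?q0 = expectation Y * expectation ?q1"
 proof (cases "s = t")
  case True then show ?thesis using iY by (simp add: prob_space)
 next
  case False
  then have "indep_var borel Y borel ?q1" using inc_indep[OF _ _ _ Y g] st by simp
  then show ?thesis using indep_var_integrable[OF _ iY ig] indep_var_lebesgue_integral[OF _ iY ig] by simp
 qed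
 then show "integrable M ?q0"
  "expectation ?q0 = expectation Y * expectation ?q1" by auto
qed

lemma inc_mult1:
 assumes st: "0 <= s" "s <= t" "t <= T" and Y: "Y \<in> meas (F s)" and iY: "integrable M Y"
 shows "integrable M (%w. Y w * inc s t w $ i)" "expectation (%w. Y w * inc s t w $ i) = 0"
 using inc_mult_expectation[OF st Y _ iY, of "%x. x $ i"] inc_moment1[OF st, of i] by auto

lemma inc_mult2:
 assumes st: "0 <= s" "s <= t" "t <= T" and Y: "Y \<in> meas (F s)" and iY: "integrable M Y"
 shows "integrable M (%w. Y w * (inc s t w $ i * inc s t w $ j))"
  "expectation (%w. Y w * (inc s t w $ i * inc s t w $ j)) = (if i = j then t - s else 0) * expectation Y"
 using inc_mult_expectation[OF st Y _ iY, of "%x. x $ i * x $ j"] inc_moment2[OF st, of i j] by auto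

lemma integrable_mult_bounded:
 fixes f g :: "'w => real"
 assumes f: "integrable M f" and g[measurable]: "g \<in> meas M" and b: "!!w. w \<in> space M ==> \<bar>g w\<bar> <= C"
 shows "integrable M (%w. g w * f w)"
proof (rule Bochner_Integration.integrable_bound[where f="%w. C * f w"])
 have [measurable]: "f \<in> meas M" using f by simp
 show "(%w. g w * f w) \<in> meas M" by measurable
 show "AE w in M. norm (g w * f w) <= norm (C * f w)"
 proof (rule AE_I2)
  fix w assume "w \<in> space M"
  then have "\<bar>g w\<bar> <= \<bar>C\<bar>" using b[of w] by linarith
  then show "norm (g w * f w) <= norm (C * f w)" by (simp add: abs_mult mult_right_mono)
 qed
qed (use f in auto)

section \<open>Ito isometry for families of overlapping intervals\<close>

definition overlap :: "real => real => real => real => real" where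
 "overlap a b c d = measure lborel ({a..<b} \<inter> {c..<d})"

lemma overlap_eq: "overlap a b c d = max 0 (min b d - max a c)"
proof -
 have "{a..<b} \<inter> {c..<d} = {max a c..<min b d}" by auto
 then show ?thesis unfolding overlap_def by (cases "max a c <= min b d") auto
qed

lemma overlap_commute: "overlap a b c d = overlap c d a b"
 unfolding overlap_def by (simp add: Int_commute)

text \<open>The intervals are cut at each other's end points. In every product of two pieces that do
  not coincide, the later increment is centred and independent of all other factors; the common
  piece contributes its length.\<close>

lemma inc_bilinear_scalar:
 fixes y z :: "'w => real"
 assumes ab: "0 <= a" "a <= b" "b <= T" and cd: "0 <= c" "c <= d" "d <= T"
  and y: "y \<in> meas (F a)" "!!w. w \<in> space M ==> \<bar>y w\<bar> <= C"
  and z: "z \<in> meas (F c)" "!!w. w \<in> space M ==> \<bar>z w\<bar> <= D"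
  and ac: "a <= c"
 shows "integrable M (%w. (y w * inc a b w $ i) * (z w * inc c d w $ j))"
  "expectation (%w. (y w * inc a b w $ i) * (z w * inc c d w $ j)) = (if i = j then overlap a b c d else 0) * expectation (%w. y w * z w)"
proof -
 let ?q0 = "%w. (y w * inc a b w $ i) * (z w * inc c d w $ j)"
 let ?q1 = "%w. y w * z w"
 let ?q2 = "if i = j then overlap a b c d else 0"
 have yM: "y \<in> meas M" and zM: "z \<in> meas M"
  using F_measurable_M[OF y(1)] F_measurable_M[OF z(1)] ab cd by auto
 have yi: "integrable M y" using yM y(2) by (intro integrable_const_bound[where B=C]) (auto intro!: AE_I2)
 have zi: "integrable M z" using zM z(2) by (intro integrable_const_bound[where B=D]) (auto intro!: AE_I2)
 have yzF: "?q1 \<in> meas (F c)"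
  using F_measurable_mono[OF y(1), of c] z(1) ab cd ac by auto
 have yzi: "integrable M ?q1" by (rule integrable_mult_bounded[OF zi yM y(2)])
 have compF: "(%w. inc s t w $ k) \<in> meas (F t)" if "0 <= s" "s <= t" "t <= T" for s t k
  using inc_F[OF that] by measurable
 \<comment> \<open>Covers the part of the first interval before c: everything but the last increment
   is known at time p >= c.\<close>
 have zero1: "integrable M (%w. (z w * (y w * inc a e w $ i)) * inc p q w $ j) \<and>
    expectation (%w. (z w * (y w * inc a e w $ i)) * inc p q w $ j) = 0"
  if "a <= e" "e <= c" "c <= p" "p <= q" "q <= T" for e p q
 proof -
  have e: "0 <= a" "a <= e" "e <= T" using that ab by auto
  have i1: "integrable M (%w. z w * (y w * inc a e w $ i))"
   by (rule integrable_mult_bounded[OF inc_mult1(1)[OF e y(1) yi] zM z(2)])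
  have m1: "(%w. z w * (y w * inc a e w $ i)) \<in> meas (F p)"
   using F_measurable_mono[OF z(1), of p] F_measurable_mono[OF y(1), of p] F_measurable_mono[OF compF[OF e], of p i] that e cd
   by (intro borel_measurable_times) auto
  show ?thesis using inc_mult1[OF _ _ _ m1 i1, of q j] that cd by auto
 qed
 \<comment> \<open>Covers two adjacent pieces after c, whichever of the two intervals reaches
   further.\<close>
 have zero2: "integrable M (%w. ((y w * z w) * inc c e w $ k) * inc e q w $ l) \<and>
    expectation (%w. ((y w * z w) * inc c e w $ k) * inc e q w $ l) = 0"
  if "c <= e" "e <= q" "q <= T" for e q k l
 proof -
  have e: "0 <= c" "c <= e" "e <= T" using that cd by auto
  have i1: "integrable M (%w. (y w * z w) * inc c e w $ k)" by (rule inc_mult1(1)[OF e yzF yzi])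
  have m1: "(%w. (y w * z w) * inc c e w $ k) \<in> meas (F e)"
   using F_measurable_mono[OF yzF, of e] compF[OF e, of k] e by (intro borel_measurable_times[of "%w. y w * z w"]) auto
  show ?thesis using inc_mult1[OF _ _ _ m1 i1, of q l] that cd by auto
 qed
 note sq = inc_mult2[OF _ _ _ yzF yzi]
 consider "b <= c" | "c <= b" "b <= d" | "c <= b" "d <= b" by linarith
 then have "integrable M ?q0 \<and>
  expectation ?q0 = ?q2 * expectation ?q1"
 proof cases
  case 1
  have e: "(y w * inc a b w $ i) * (z w * inc c d w $ j) = (z w * (y w * inc a b w $ i)) * inc c d w $ j" for w by simp
  have "overlap a b c d = 0" unfolding overlap_eq using 1 by auto
  then show ?thesis unfolding e using zero1[of b c d] 1 ab cd by auto
 next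
  case 2
  have e: "(y w * inc a b w $ i) * (z w * inc c d w $ j) =
    (z w * (y w * inc a c w $ i)) * inc c b w $ j + (z w * (y w * inc a c w $ i)) * inc b d w $ j
    + (y w * z w) * (inc c b w $ i * inc c b w $ j) + ((y w * z w) * inc c b w $ i) * inc b d w $ j" for w
   unfolding inc_split[of a b w c] inc_split[of c d w b] by (simp add: algebra_simps)
  have "overlap a b c d = b - c" unfolding overlap_eq using 2 ac by auto
  then show ?thesis unfolding e using zero1[of c c b] zero1[of c b d] zero2[of b d i j] sq[of b i j] 2 ab cd ac by auto
 next
  case 3
  have e: "(y w * inc a b w $ i) * (z w * inc c d w $ j) =
    (z w * (y w * inc a c w $ i)) * inc c d w $ j
    + (y w * z w) * (inc c d w $ i * inc c d w $ j) + ((y w * z w) * inc c d w $ j) * inc d b w $ i" for w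
   unfolding inc_split[of a b w c] inc_split[of c b w d] by (simp add: algebra_simps)
  have "overlap a b c d = d - c" unfolding overlap_eq using 3 ac cd by auto
  then show ?thesis unfolding e using zero1[of c c d] zero2[of d b j i] sq[of d i j] 3 ab cd ac by auto
 qed
 then show "integrable M ?q0"
  "expectation ?q0 = ?q2 * expectation ?q1"
  by auto
qed

lemma inc_bilinear:
 fixes h g :: "'w => real^'m"
 assumes ab: "0 <= a" "a <= b" "b <= T" and cd: "0 <= c" "c <= d" "d <= T"
  and h: "h \<in> meas (F a)" "!!w. w \<in> space M ==> norm (h w) <= C"
  and g: "g \<in> meas (F c)" "!!w. w \<in> space M ==> norm (g w) <= D"
 shows "integrable M (%w. (h w \<bullet> inc a b w) * (g w \<bullet> inc c d w))"
  "expectation (%w. (h w \<bullet> inc a b w) * (g w \<bullet> inc c d w)) = overlap a b c d * expectation (%w. h w \<bullet> g w)"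
proof -
 let ?q0 = "%h. %w. (h w \<bullet> inc a b w) * (g w \<bullet> inc c d w)"
 let ?q1 = "%w j. g w $ j * inc c d w $ j"
 let ?q2 = "%h w i. h w $ i * inc a b w $ i"
 have hm: "(%w. h w $ i) \<in> meas (F a)" and gm: "(%w. g w $ i) \<in> meas (F c)" for i
  using h(1) g(1) by measurable
 have hb: "\<bar>h w $ i\<bar> <= C" and gb: "\<bar>g w $ i\<bar> <= D" if "w \<in> space M" for i w
  using component_le_norm_cart[of "h w" i] h(2)[OF that] component_le_norm_cart[of "g w" i] g(2)[OF that] by linarith+
 have S: "integrable M (%w. (?q2 h w i) * (?q1 w j)) \<and>
  expectation (%w. (?q2 h w i) * (?q1 w j)) = (if i = j then overlap a b c d else 0) * expectation (%w. h w $ i * g w $ j)" for i j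
 proof (cases "a <= c")
  case True
  show ?thesis using inc_bilinear_scalar[OF ab cd hm hb gm gb True] by auto
 next
  case False
  then have "c <= a" by simp
  have e: "(?q2 h w i) * (?q1 w j) = (?q1 w j) * (?q2 h w i)"
   "h w $ i * g w $ j = g w $ j * h w $ i" for w by (rule mult.commute)+
  show ?thesis unfolding e overlap_commute[of a]
   using inc_bilinear_scalar[OF cd ab gm gb hm hb \<open>c <= a\<close>, of j j i i] by auto
 qed
 have e: "(h w \<bullet> inc a b w) * (g w \<bullet> inc c d w) = (\<Sum>i\<in>UNIV. \<Sum>j\<in>UNIV. (?q2 h w i) * (?q1 w j))" for w
  by (simp add: inner_vec_def sum_product)
 show "integrable M (?q0 h)"
  unfolding e using S by (intro Bochner_Integration.integrable_sum) auto
 have hgi: "integrable M (%w. h w $ i * g w $ i)" for i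
 proof -
  have "(%w. g w $ i) \<in> meas M" "(%w. h w $ i) \<in> meas M"
   using F_measurable_M[OF gm] F_measurable_M[OF hm] ab cd by auto
  moreover from this have "integrable M (%w. g w $ i)" using gb by (intro integrable_const_bound[where B=D]) (auto intro!: AE_I2)
  ultimately show ?thesis using hb by (intro integrable_mult_bounded[where C=C]) auto
 qed
 have "expectation (?q0 h) = (\<Sum>i\<in>UNIV. \<Sum>j\<in>UNIV. (if i = j then overlap a b c d else 0) * expectation (%w. h w $ i * g w $ j))"
  unfolding e using S by (simp add: Bochner_Integration.integral_sum)
 also have "... = (\<Sum>i\<in>UNIV. overlap a b c d * expectation (%w. h w $ i * g w $ i))"
  by (intro sum.cong refl) (simp add: if_distrib[where f="%x. x * _"] sum.delta cong: if_cong)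
 also have "... = overlap a b c d * expectation (%w. h w \<bullet> g w)"
  using hgi by (simp add: inner_vec_def sum_distrib_left Bochner_Integration.integral_sum)
 finally show "expectation (?q0 h) = overlap a b c d * expectation (%w. h w \<bullet> g w)" .
qed

text \<open>The bound may differ from index to index; it only secures integrability.\<close>

definition adapted_family :: "'i set => ('i => real) => ('i => real) => ('i => 'w => real^'m) => bool" where
 "adapted_family A a b h \<longleftrightarrow> (\<forall>i\<in>A. 0 <= a i \<and> a i <= b i \<and> b i <= T \<and> h i \<in> meas (F (a i)) \<and>
   (\<exists>C. \<forall>w\<in>space M. norm (h i w) <= C))"

text \<open>Half-open intervals make neighbours disjoint, and empty ones are harmless.\<close>

definition tiling :: "'i set => ('i => real) => ('i => real) => real set => bool" where
 "tiling A a b J \<longleftrightarrow> finite A \<and> (\<forall>i\<in>A. a i <= b i) \<and> disjoint_family_on (%i. {a i..<b i}) A \<and> (\<Union>i\<in>A. {a i..<b i}) = J"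

definition simple_integral :: "'i set => ('i => real) => ('i => real) => ('i => 'w => real^'m) => 'w => real" where
 "simple_integral A a b h w = (\<Sum>i\<in>A. h i w \<bullet> inc (a i) (b i) w)"

lemma adapted_familyD:
 assumes "adapted_family A a b h" "i \<in> A"
 obtains C where "0 <= a i" "a i <= b i" "b i <= T" "h i \<in> meas (F (a i))" "h i \<in> meas M"
  "!!w. w \<in> space M ==> norm (h i w) <= C"
proof -
 have 1: "0 <= a i" "a i <= b i" "b i <= T" "h i \<in> meas (F (a i))" and "\<exists>C. \<forall>w\<in>space M. norm (h i w) <= C"
  using assms unfolding adapted_family_def by blast+
 then obtain C where "!!w. w \<in> space M ==> norm (h i w) <= C" by blast
 moreover have "h i \<in> meas M" using F_measurable_M[OF 1(4)] 1(1,2,3) by linarith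
 ultimately show ?thesis using that 1 by blast
qed

lemma simple_integral_measurable:
 assumes "adapted_family A a b h"
 shows "simple_integral A a b h \<in> meas M"
 unfolding simple_integral_def
proof (rule borel_measurable_sum)
 fix i assume "i \<in> A"
 from adapted_familyD[OF assms this] have "0 <= a i" "a i <= b i" "b i <= T" and [measurable]: "h i \<in> meas M" by blast+
 with inc_M have [measurable]: "inc (a i) (b i) \<in> meas M" by blast
 show "(%w. h i w \<bullet> inc (a i) (b i) w) \<in> meas M" by measurable
qed

text \<open>The polarised isometry for two unrelated families: the overlaps take the place of a
  common refinement, which is never constructed.\<close>

lemma simple_integral_bilinear:
 assumes h: "adapted_family A a b h" and g: "adapted_family B c d g"
 shows "integrable M (%w. simple_integral A a b h w * simple_integral B c d g w)"
  "expectation (%w. simple_integral A a b h w * simple_integral B c d g w)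
   = (\<Sum>i\<in>A. \<Sum>j\<in>B. overlap (a i) (b i) (c j) (d j) * expectation (%w. h i w \<bullet> g j w))"
proof -
 let ?q0 = "%w. simple_integral A a b h w * simple_integral B c d g w"
 let ?q1 = "%i j. %w. (h i w \<bullet> inc (a i) (b i) w) * (g j w \<bullet> inc (c j) (d j) w)"
 have S: "integrable M (?q1 i j)
  \<and> expectation (?q1 i j) = overlap (a i) (b i) (c j) (d j) * expectation (%w. h i w \<bullet> g j w)"
  if i: "i \<in> A" and j: "j \<in> B" for i j
 proof -
  obtain C where C: "0 <= a i" "a i <= b i" "b i <= T" "h i \<in> meas (F (a i))" "!!w. w \<in> space M ==> norm (h i w) <= C"
   using adapted_familyD[OF h i] by metis
  obtain D where D: "0 <= c j" "c j <= d j" "d j <= T" "g j \<in> meas (F (c j))" "!!w. w \<in> space M ==> norm (g j w) <= D"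
   using adapted_familyD[OF g j] by metis
  show ?thesis using inc_bilinear[OF C(1-3) D(1-3) C(4,5) D(4,5)] by simp
 qed
 show "integrable M ?q0"
  unfolding simple_integral_def sum_product using S by (intro Bochner_Integration.integrable_sum) auto
 show "expectation ?q0
   = (\<Sum>i\<in>A. \<Sum>j\<in>B. overlap (a i) (b i) (c j) (d j) * expectation (%w. h i w \<bullet> g j w))"
  unfolding simple_integral_def sum_product
  using S by (simp add: Bochner_Integration.integral_sum Bochner_Integration.integrable_sum)
qed

lemma tiling_overlap_same:
 assumes "tiling A a b J" "i \<in> A" "j \<in> A"
 shows "overlap (a i) (b i) (a j) (b j) = (if i = j then b i - a i else 0)"
proof (cases "i = j")
 case True then show ?thesis using assms unfolding overlap_eq tiling_def by auto
next
 case False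
 then have e: "{a i..<b i} \<inter> {a j..<b j} = {}" using assms unfolding tiling_def disjoint_family_on_def by blast
 show ?thesis unfolding overlap_def e using False by simp
qed

lemma tiling_sum_overlap:
 assumes B: "tiling B c d J" and i: "{p..<q} \<subseteq> J" and pq: "p <= q"
 shows "(\<Sum>j\<in>B. overlap p q (c j) (d j)) = q - p"
proof -
 have fin: "finite B" using B unfolding tiling_def by simp
 have "q - p = measure lborel {p..<q}" using pq by simp
 also have "{p..<q} = (\<Union>j\<in>B. {p..<q} \<inter> {c j..<d j})"
 proof -
  have "(\<Union>j\<in>B. {c j..<d j}) = J" using B unfolding tiling_def by simp
  then show ?thesis using i by blast
 qed
 also have "measure lborel (\<Union>j\<in>B. {p..<q} \<inter> {c j..<d j}) = (\<Sum>j\<in>B. measure lborel ({p..<q} \<inter> {c j..<d j}))"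
 proof (rule measure_finite_Union[OF fin])
  show "disjoint_family_on (%j. {p..<q} \<inter> {c j..<d j}) B" using B unfolding tiling_def disjoint_family_on_def by blast
  show "emeasure lborel ({p..<q} \<inter> {c j..<d j}) ~= \<infinity>" for j
  proof -
   have "emeasure lborel ({p..<q} \<inter> {c j..<d j}) <= emeasure lborel {p..<q}" by (rule emeasure_mono) auto
   also have "... < \<infinity>" using pq by simp
   finally show ?thesis by simp
  qed
 qed auto
 finally show ?thesis unfolding overlap_def by simp
qed

theorem simple_integral_isometry:
 assumes h: "adapted_family A a b h" and A: "tiling A a b J"
 shows "integrable M (%w. (simple_integral A a b h w)^2)"
  "expectation (%w. (simple_integral A a b h w)^2) = (\<Sum>i\<in>A. (b i - a i) * expectation (%w. (norm (h i w))^2))"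
proof -
 let ?q0 = "%w. (simple_integral A a b h w)^2"
 have fin: "finite A" using A unfolding tiling_def by simp
 show "integrable M ?q0"
  unfolding power2_eq_square by (rule simple_integral_bilinear[OF h h])
 have "expectation ?q0 = (\<Sum>i\<in>A. \<Sum>j\<in>A. overlap (a i) (b i) (a j) (b j) * expectation (%w. h i w \<bullet> h j w))"
  unfolding power2_eq_square by (rule simple_integral_bilinear[OF h h])
 also have "... = (\<Sum>i\<in>A. \<Sum>j\<in>A. if i = j then (b i - a i) * expectation (%w. h i w \<bullet> h i w) else 0)"
  using tiling_overlap_same[OF A] by (intro sum.cong refl) auto
 finally show "expectation ?q0 = (\<Sum>i\<in>A. (b i - a i) * expectation (%w. (norm (h i w))^2))"
  using fin by (simp add: sum.delta power2_norm_eq_inner)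
qed

text \<open>For two tilings of the same set the overlaps have the interval lengths as row and column
  sums. Both isometries thus become double sums with the same weights as the mixed term, and the
  square is completed term by term.\<close>

theorem simple_integral_diff_isometry:
 assumes h: "adapted_family A a b h" and A: "tiling A a b J" and g: "adapted_family B c d g" and B: "tiling B c d J"
 shows "integrable M (%w. (simple_integral A a b h w - simple_integral B c d g w)^2)"
  "expectation (%w. (simple_integral A a b h w - simple_integral B c d g w)^2)
   = (\<Sum>i\<in>A. \<Sum>j\<in>B. overlap (a i) (b i) (c j) (d j) * expectation (%w. (norm (h i w - g j w))^2))"
proof -
 let ?I = "simple_integral A a b h" and ?K = "simple_integral B c d g"
 let ?q0 = "%i j. expectation (%w. (norm (h i w))^2) + expectation (%w. (norm (g j w))^2) - 2 * expectation (%w. h i w \<bullet> g j w)"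
 let ?q1 = "%a c. \<Sum>i\<in>A. \<Sum>j\<in>B. overlap (a i) (b i) (c j) (d j) * expectation (%w. (norm (h i w - g j w))^2)"
 let ?q2 = "%w. (?I w - ?K w)^2"
 have e: "(?I w - ?K w)^2 = (?I w)^2 + (?K w)^2 - 2 * (?I w * ?K w)" for w
  by (simp add: power2_eq_square algebra_simps)
 note i = simple_integral_isometry[OF h A] simple_integral_isometry[OF g B] simple_integral_bilinear[OF h g]
 show "integrable M ?q2" unfolding e using i by auto
 have o: "(b i - a i) * x = (\<Sum>j\<in>B. overlap (a i) (b i) (c j) (d j) * x)" if "i \<in> A" for i x
 proof -
  have "{a i..<b i} \<subseteq> J" "a i <= b i" using A that unfolding tiling_def by blast+
  from tiling_sum_overlap[OF B this] show ?thesis by (simp add: sum_distrib_right[symmetric])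
 qed
 have o': "(d j - c j) * x = (\<Sum>i\<in>A. overlap (a i) (b i) (c j) (d j) * x)" if "j \<in> B" for j x
 proof -
  have "{c j..<d j} \<subseteq> J" "c j <= d j" using B that unfolding tiling_def by blast+
  from tiling_sum_overlap[OF A this] show ?thesis by (simp add: sum_distrib_right[symmetric] overlap_commute[of "c j"])
 qed
 have "expectation ?q2 = expectation (%w. (?I w)^2) + expectation (%w. (?K w)^2) - 2 * expectation (%w. ?I w * ?K w)"
  unfolding e using i by simp
 also have "... = (\<Sum>i\<in>A. \<Sum>j\<in>B. overlap (a i) (b i) (c j) (d j) * expectation (%w. (norm (h i w))^2))
   + (\<Sum>j\<in>B. \<Sum>i\<in>A. overlap (a i) (b i) (c j) (d j) * expectation (%w. (norm (g j w))^2))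
   - 2 * (\<Sum>i\<in>A. \<Sum>j\<in>B. overlap (a i) (b i) (c j) (d j) * expectation (%w. h i w \<bullet> g j w))"
  unfolding i by (simp add: o o' cong: sum.cong)
 also have "... = (\<Sum>i\<in>A. \<Sum>j\<in>B. overlap (a i) (b i) (c j) (d j) * (?q0 i j))"
  unfolding sum.swap[of _ A B] by (simp add: sum.distrib[symmetric] sum_subtractf[symmetric] sum_distrib_left algebra_simps)
 also have "... = (?q1 a c)"
 proof (intro sum.cong refl)
  fix i j assume i: "i \<in> A" and j: "j \<in> B"
  obtain C where C: "h i \<in> meas M" "!!w. w \<in> space M ==> norm (h i w) <= C" using adapted_familyD[OF h i] by metis
  obtain D where D: "g j \<in> meas M" "!!w. w \<in> space M ==> norm (g j w) <= D" using adapted_familyD[OF g j] by metis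
  note [measurable] = C(1) D(1)
  have 1: "integrable M (%w. (norm (h i w))^2)"
   using C(2) by (intro integrable_const_bound[where B="C^2"]) (auto intro!: AE_I2 power_mono)
  have 2: "integrable M (%w. (norm (g j w))^2)"
   using D(2) by (intro integrable_const_bound[where B="D^2"]) (auto intro!: AE_I2 power_mono)
  have 3: "integrable M (%w. h i w \<bullet> g j w)"
  proof (intro integrable_const_bound[where B="C * D"] AE_I2)
   fix w assume w: "w \<in> space M"
   have "\<bar>h i w \<bullet> g j w\<bar> <= norm (h i w) * norm (g j w)" by (rule Cauchy_Schwarz_ineq2)
   also have "... <= C * D" using C(2)[OF w] D(2)[OF w] by (intro mult_mono) (auto intro: order_trans[OF norm_ge_zero])
   finally show "norm (h i w \<bullet> g j w) <= C * D" by simp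
  qed measurable
  have n: "(norm (h i w - g j w))^2 = (norm (h i w))^2 + (norm (g j w))^2 - 2 * (h i w \<bullet> g j w)" for w
   by (simp add: power2_norm_eq_inner algebra_simps inner_commute)
  show "overlap (a i) (b i) (c j) (d j) * (?q0 i j)
   = overlap (a i) (b i) (c j) (d j) * expectation (%w. (norm (h i w - g j w))^2)"
   unfolding n using 1 2 3 by simp
 qed
 finally show "expectation ?q2
   = (?q1 a c)" .
qed

end

section \<open>Bounds for averaged point functionals\<close>

text \<open>The inequality of arithmetic and geometric means, with a free parameter. It replaces a
  product by a sum, so that bounds for many intervals and levels can be added.\<close>

lemma young_ennreal:
 fixes x th :: real
 assumes x: "ennreal (x^2) <= N * E" and th: "th > 0"
 shows "ennreal (2 * \<bar>x\<bar>) <= ennreal th * E + N / ennreal th"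
proof (cases "E = \<infinity> \<or> N = \<infinity>")
 case True
 then show ?thesis using th by (auto simp: ennreal_mult_eq_top_iff ennreal_top_divide ennreal_mult_top)
next
 case False
 then obtain n e where ne: "N = ennreal n" "E = ennreal e" "n >= 0" "e >= 0"
  by (metis ennreal_cases infinity_ennreal_def)
 have "x^2 <= n * e" using x ne by (simp add: ennreal_mult[symmetric])
 moreover have "4 * (n * e) <= (th * e + n / th)^2"
 proof -
  have "(th * e + n / th)^2 - 4 * (n * e) = (th * e - n / th)^2"
   using th by (simp add: power2_eq_square field_simps)
  then show ?thesis by (smt (verit) zero_le_power2)
 qed
 ultimately have "(2 * \<bar>x\<bar>)^2 <= (th * e + n / th)^2" by (simp add: power_mult_distrib)
 then have "2 * \<bar>x\<bar> <= th * e + n / th"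
  using power2_le_imp_le ne th by (metis add_nonneg_nonneg divide_nonneg_pos less_imp_le mult_nonneg_nonneg)
 then have "ennreal (2 * \<bar>x\<bar>) <= ennreal (th * e + n / th)" by (rule ennreal_leI)
 also have "... = ennreal th * E + N / ennreal th"
  using ne th by (simp add: ennreal_mult divide_ennreal)
 finally show ?thesis .
qed

text \<open>The inverse of the previous step: th = sqrt h is optimal, and for h = 0 one lets th tend
  to 0.\<close>

lemma young_optimise_ennreal:
 fixes x A :: real
 assumes A: "A > 0" and bd: "!!th. th > 0 ==> ennreal (2 * \<bar>x\<bar>) <= ennreal A * (ennreal th + H / ennreal th)"
 shows "ennreal (x^2) <= ennreal (A^2) * H"
proof (cases "H = \<infinity>")
 case True then show ?thesis using A by (simp add: ennreal_mult_top)
next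
 case False
 then obtain h where h: "H = ennreal h" "h >= 0" by (metis ennreal_cases infinity_ennreal_def)
 have b: "2 * \<bar>x\<bar> <= A * (th + h / th)" if t: "th > 0" for th
 proof -
  have "ennreal A * (ennreal th + H / ennreal th) = ennreal (A * (th + h / th))"
   using h t A by (simp add: divide_ennreal ennreal_mult)
  then show ?thesis using bd[OF t] h t A by (simp add: ennreal_le_iff)
 qed
 have "\<bar>x\<bar> <= A * sqrt h"
 proof (cases "h = 0")
  case True
  have "\<bar>x\<bar> <= 0"
  proof (rule field_le_epsilon)
   fix e :: real assume "0 < e"
   then show "\<bar>x\<bar> <= 0 + e" using b[of "e / A"] True A by simp
  qed
  then show ?thesis using A True by simp
 next
  case False
  then have "sqrt h > 0" using h by simp
  from b[OF this] show ?thesis using h by (simp add: real_div_sqrt)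
 qed
 then have "\<bar>x\<bar>\<^sup>2 <= (A * sqrt h)^2" by (rule power_mono) simp
 then have "x^2 <= A^2 * h" using h by (simp add: power_mult_distrib)
 then show ?thesis using h by (simp add: ennreal_mult[symmetric] ennreal_leI)
qed

lemma ennreal_twice_abs_sum_le:
 fixes f :: "'j => real"
 shows "ennreal (2 * \<bar>\<Sum>j\<in>I. f j\<bar>) <= (\<Sum>j\<in>I. ennreal (2 * \<bar>f j\<bar>))"
proof -
 let ?q0 = "\<Sum>j\<in>I. 2 * \<bar>f j\<bar>"
 have "2 * \<bar>\<Sum>j\<in>I. f j\<bar> <= ?q0"
  unfolding sum_distrib_left[symmetric] by (intro mult_left_mono sum_abs) auto
 then have "ennreal (2 * \<bar>\<Sum>j\<in>I. f j\<bar>) <= ennreal ?q0" by (rule ennreal_leI)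
 then show ?thesis by (subst sum_ennreal) auto
qed

definition point_functional :: "'i set => ('i => real^'d) => ('i => real^'d) => (real^'d => real^'d) => real" where
 "point_functional A x c \<psi> = (\<Sum>i\<in>A. c i \<bullet> \<psi> (x i))"

lemma point_functional_diff:
 "point_functional A x c (%y. f y - g y) = point_functional A x c f - point_functional A x c g"
 unfolding point_functional_def by (simp add: inner_diff_right sum_subtractf)

context
 fixes a c :: real and \<phi> :: "real \<times> (real^'d) => real^'d"
 assumes tf: "test_fun a c \<phi>"
begin

lemma slice_measurable: "(%u. \<phi> (u, x)) \<in> meas borel"
 by (intro borel_measurable_continuous_onI continuous_on_compose2[OF test_fun_continuous[OF tf]] continuous_intros) auto

lemma slice_integrable: "set_integrable lborel {p..<q} (%u. \<phi> (u, x))"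
proof -
 obtain B where B: "!!z. norm (\<phi> z) <= B" using pderivs_bounded[OF tf, of "[]"] by auto
 show ?thesis unfolding set_integrable_def
 proof (rule Bochner_Integration.integrable_bound[where f="%u. B * indicator {p..<q} u"])
  have "emeasure lborel {p..<q} < \<infinity>" by (cases "p <= q") auto
  then show "integrable lborel (%u. B * indicator {p..<q} u)" by (intro integrable_mult_right integrable_real_indicator) auto
  show "(%u. indicat_real {p..<q} u *\<^sub>R \<phi> (u, x)) \<in> meas lborel" using slice_measurable by measurable
  have "0 <= B" using B norm_ge_zero order_trans by blast
  then show "AE u in lborel. norm (indicat_real {p..<q} u *\<^sub>R \<phi> (u, x)) <= norm (B * indicat_real {p..<q} u)"
   using B by (auto simp: indicator_def)
 qed
qed

lemma point_functional_slice_integrable: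
 "set_integrable lborel {p..<q} (%u. point_functional A x e (%y. \<phi> (u, y)))"
proof -
 have "integrable lborel (%u. \<Sum>i\<in>A. e i \<bullet> (indicat_real {p..<q} u *\<^sub>R \<phi> (u, x i)))"
  using slice_integrable unfolding set_integrable_def by (intro Bochner_Integration.integrable_sum integrable_inner_right) auto
 then show ?thesis unfolding set_integrable_def point_functional_def by (simp add: sum_distrib_left)
qed

lemma point_functional_slice_integral:
 "(LINT u:{p..<q}|lborel. point_functional A x e (%y. \<phi> (u, y))) = (\<Sum>i\<in>A. e i \<bullet> (LINT u:{p..<q}|lborel. \<phi> (u, x i)))"
proof -
 have "(LINT u:{p..<q}|lborel. point_functional A x e (%y. \<phi> (u, y))) = (\<integral>u. (\<Sum>i\<in>A. e i \<bullet> (indicat_real {p..<q} u *\<^sub>R \<phi> (u, x i))) \<partial>lborel)"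
  unfolding set_lebesgue_integral_def point_functional_def by (simp add: sum_distrib_left)
 also have "... = (\<Sum>i\<in>A. \<integral>u. e i \<bullet> (indicat_real {p..<q} u *\<^sub>R \<phi> (u, x i)) \<partial>lborel)"
  using slice_integrable unfolding set_integrable_def by (intro Bochner_Integration.integral_sum integrable_inner_right) auto
 also have "... = (\<Sum>i\<in>A. e i \<bullet> (LINT u:{p..<q}|lborel. \<phi> (u, x i)))"
  unfolding set_lebesgue_integral_def
  using slice_integrable unfolding set_integrable_def by (intro sum.cong refl integral_inner_right) auto
 finally show ?thesis .
qed

lemma point_functional_young:
 assumes A: "finite A" and th: "th > 0"
 shows "ennreal (2 * \<bar>point_functional A x e (%y. \<phi> (u, y) - \<phi> (v, y))\<bar>)
  <= ennreal th * energy s A x e + Hs_norm2 s (%y. \<phi> (u, y) - \<phi> (v, y)) / ennreal th"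
proof (rule young_ennreal[OF _ th])
 obtain B where "!!x. norm (\<phi> (u, x) - \<phi> (v, x)) <= B" using test_fun_slice(3)[OF tf, of u v] by blast
 from point_functional_bound[OF test_fun_slice(2)[OF tf] test_fun_slice(1)[OF tf] this A]
 show "ennreal ((point_functional A x e (%y. \<phi> (u, y) - \<phi> (v, y)))^2) <= Hs_norm2 s (%y. \<phi> (u, y) - \<phi> (v, y)) * energy s A x e"
  unfolding point_functional_def .
qed

lemma point_functional_young1:
 assumes A: "finite A" and th: "th > 0"
 shows "ennreal (2 * \<bar>point_functional A x e (%y. \<phi> (u, y))\<bar>)
  <= ennreal th * energy s A x e + Hs_norm2 s (%y. \<phi> (u, y)) / ennreal th"
 using point_functional_young[OF A th, of x e u a s] test_fun_zero_outside[OF tf, of a] by simp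

lemma Hs_norm2_slice_measurable1[measurable]: "(%u. Hs_norm2 s (%y. \<phi> (u, y))) \<in> meas borel"
proof -
 have "(%u. (u, a)) \<in> borel \<rightarrow>\<^sub>M borel \<Otimes>\<^sub>M borel" by measurable
 from measurable_compose[OF this Hs_norm2_slice_measurable[OF tf, of s]]
 show ?thesis using test_fun_zero_outside[OF tf, of a] by simp
qed

lemma ennreal_abs_set_integral_le:
 fixes f :: "real => real"
 assumes "set_integrable lborel S f"
 shows "ennreal \<bar>LINT u:S|lborel. f u\<bar> <= (\<integral>\<^sup>+u\<in>S. ennreal \<bar>f u\<bar> \<partial>lborel)"
proof -
 have "ennreal (norm (LINT u:S|lborel. f u)) <= (\<integral>\<^sup>+u. norm (indicator S u *\<^sub>R f u) \<partial>lborel)"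
  unfolding set_lebesgue_integral_def by (rule integral_norm_bound_ennreal) (use assms in \<open>simp add: set_integrable_def\<close>)
 also have "... = (\<integral>\<^sup>+u\<in>S. ennreal \<bar>f u\<bar> \<partial>lborel)"
  by (intro nn_integral_cong) (auto simp: indicator_def)
 finally show ?thesis by simp
qed

lemma nn_integral_disjoint_sum_le:
 fixes f :: "real => ennreal"
 assumes I: "finite I" and [measurable]: "f \<in> meas borel" "!!j. j \<in> I ==> B j \<in> sets borel"
  and d: "disjoint_family_on B I" and sub: "!!j. j \<in> I ==> B j \<subseteq> U" and U[measurable]: "U \<in> sets borel"
 shows "(\<Sum>j\<in>I. \<integral>\<^sup>+u\<in>B j. f u \<partial>lborel) <= (\<integral>\<^sup>+u\<in>U. f u \<partial>lborel)"
proof -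
 have "(\<Sum>j\<in>I. \<integral>\<^sup>+u\<in>B j. f u \<partial>lborel) = (\<integral>\<^sup>+u. (\<Sum>j\<in>I. f u * indicator (B j) u) \<partial>lborel)"
  by (rule nn_integral_sum[symmetric]) measurable
 also have "... = (\<integral>\<^sup>+u. f u * indicator (\<Union>j\<in>I. B j) u \<partial>lborel)"
  by (intro nn_integral_cong) (simp add: sum_distrib_left[symmetric] indicator_UN_disjoint[OF I d])
 also have "... <= (\<integral>\<^sup>+u\<in>U. f u \<partial>lborel)"
  using sub by (intro nn_integral_mono mult_left_mono) (auto simp: indicator_def)
 finally show ?thesis .
qed

lemma nn_integral_interval_affine:
 fixes h :: "real => ennreal" and K C :: ennreal
 assumes [measurable]: "h \<in> meas borel" and pq: "p <= q"
 shows "(\<integral>\<^sup>+v\<in>{p..<q}. (K + C * h v) \<partial>lborel) = K * ennreal (q - p) + C * (\<integral>\<^sup>+v\<in>{p..<q}. h v \<partial>lborel)"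
proof -
 have "(\<integral>\<^sup>+v\<in>{p..<q}. (K + C * h v) \<partial>lborel) = (\<integral>\<^sup>+v. K * indicator {p..<q} v + C * (h v * indicator {p..<q} v) \<partial>lborel)"
  by (intro nn_integral_cong) (auto simp: indicator_def)
 also have "... = K * ennreal (q - p) + C * (\<integral>\<^sup>+v\<in>{p..<q}. h v \<partial>lborel)"
  using pq by (simp add: nn_integral_add nn_integral_cmult nn_integral_cmult_indicator)
 finally show ?thesis .
qed

text \<open>The two estimates below bound the two kinds of increments of the approximation scheme: a change of the spatial
 functionals, and a halving of the intervals over which the test function is averaged in time.\<close>

lemma averaged_functionals_bound:
 fixes A :: "'j => 'i set"
 assumes I: "finite I" and A: "!!j. j \<in> I ==> finite (A j)" and l: "l > 0"
  and pq: "!!j. j \<in> I ==> q j - p j = l" "!!j. j \<in> I ==> {p j..<q j} \<subseteq> {a<..<c}"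
  and d: "disjoint_family_on (%j. {p j..<q j}) I" and th: "th > 0"
 shows "ennreal (2 * \<bar>\<Sum>j\<in>I. (1 / l) * (LINT u:{p j..<q j}|lborel. point_functional (A j) (x j) (e j) (%y. \<phi> (u, y)))\<bar>)
  <= ennreal th * (\<Sum>j\<in>I. energy s2 (A j) (x j) (e j)) + ennreal (1 / (l * th)) * Hbold_norm2 a c s1 s2 \<phi>"
proof -
 let ?E = "%j. energy s2 (A j) (x j) (e j)" and ?N = "%u. Hs_norm2 s2 (%y. \<phi> (u, y))"
 let ?f = "%j u. point_functional (A j) (x j) (e j) (%y. \<phi> (u, y))"
 have one: "ennreal (2 * \<bar>(1 / l) * (LINT u:{p j..<q j}|lborel. ?f j u)\<bar>)
   <= ennreal th * ?E j + ennreal (1 / (l * th)) * (\<integral>\<^sup>+u\<in>{p j..<q j}. ?N u \<partial>lborel)" if j: "j \<in> I" for j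
 proof -
  have "ennreal (2 * \<bar>(1 / l) * (LINT u:{p j..<q j}|lborel. ?f j u)\<bar>) = ennreal (1 / l) * ennreal \<bar>LINT u:{p j..<q j}|lborel. 2 * ?f j u\<bar>"
   using l by (simp add: abs_mult ennreal_mult[symmetric] mult_ac)
  also have "... <= ennreal (1 / l) * (\<integral>\<^sup>+u\<in>{p j..<q j}. ennreal \<bar>2 * ?f j u\<bar> \<partial>lborel)"
   by (intro mult_left_mono ennreal_abs_set_integral_le set_integrable_mult_right point_functional_slice_integrable) simp
  \<comment> \<open>Young's inequality is used for each time u separately. The energy does not
    depend on u, so averaging over an interval of length l returns it unchanged.\<close>
  also have "... <= ennreal (1 / l) * (\<integral>\<^sup>+u\<in>{p j..<q j}. (ennreal th * ?E j + ?N u / ennreal th) \<partial>lborel)"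
   using point_functional_young1[OF A[OF j] th, of "x j" "e j" _ s2]
   by (intro mult_left_mono nn_integral_mono mult_right_mono) (auto simp: abs_mult)
  also have "(\<integral>\<^sup>+u\<in>{p j..<q j}. (ennreal th * ?E j + ?N u / ennreal th) \<partial>lborel)
   = ennreal th * ?E j * ennreal l + (\<integral>\<^sup>+u\<in>{p j..<q j}. ?N u \<partial>lborel) / ennreal th"
   using nn_integral_interval_affine[OF Hs_norm2_slice_measurable1, of "p j" "q j" "ennreal th * ?E j" "inverse (ennreal th)" s2] pq(1)[OF j] l
   by (simp add: divide_ennreal_def mult.commute)
  also have "ennreal (1 / l) * (ennreal th * ?E j * ennreal l + (\<integral>\<^sup>+u\<in>{p j..<q j}. ?N u \<partial>lborel) / ennreal th)
   = ennreal th * ?E j + ennreal (1 / (l * th)) * (\<integral>\<^sup>+u\<in>{p j..<q j}. ?N u \<partial>lborel)"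
  proof -
   have 1: "ennreal (1 / l) * ennreal l = 1" using l by (simp add: ennreal_mult[symmetric])
   have 2: "ennreal (1 / l) * (y / ennreal th) = ennreal (1 / (l * th)) * y" for y
   proof -
    have "y / ennreal th = y * ennreal (1 / th)" using th by (simp add: divide_ennreal_def inverse_ennreal divide_inverse)
    moreover have "ennreal (1 / l) * ennreal (1 / th) = ennreal (1 / (l * th))" using l th by (simp add: ennreal_mult[symmetric])
    ultimately show ?thesis by (metis mult.assoc mult.commute)
   qed
   have "ennreal (1 / l) * (ennreal th * ?E j * ennreal l) = ennreal th * ?E j * (ennreal (1 / l) * ennreal l)" by (simp add: mult_ac)
   then show ?thesis unfolding distrib_left 2 1 by simp
  qed
  finally show ?thesis .
 qed
 have "ennreal (2 * \<bar>\<Sum>j\<in>I. (1 / l) * (LINT u:{p j..<q j}|lborel. ?f j u)\<bar>) <= (\<Sum>j\<in>I. ennreal (2 * \<bar>(1 / l) * (LINT u:{p j..<q j}|lborel. ?f j u)\<bar>))"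
  by (rule ennreal_twice_abs_sum_le)
 also have "... <= (\<Sum>j\<in>I. ennreal th * ?E j + ennreal (1 / (l * th)) * (\<integral>\<^sup>+u\<in>{p j..<q j}. ?N u \<partial>lborel))"
  by (rule sum_mono) (rule one)
 also have "... = ennreal th * (\<Sum>j\<in>I. ?E j) + ennreal (1 / (l * th)) * (\<Sum>j\<in>I. \<integral>\<^sup>+u\<in>{p j..<q j}. ?N u \<partial>lborel)"
  by (simp add: sum.distrib sum_distrib_left)
 also have "... <= ennreal th * (\<Sum>j\<in>I. ?E j) + ennreal (1 / (l * th)) * Hbold_norm2 a c s1 s2 \<phi>"
 proof (intro add_left_mono mult_left_mono)
  \<comment> \<open>Only the L2 part of the norm is used here; the fractional part is saved for the
    second estimate.\<close>
  have "(\<Sum>j\<in>I. \<integral>\<^sup>+u\<in>{p j..<q j}. ?N u \<partial>lborel) <= (\<integral>\<^sup>+u\<in>{a<..<c}. ?N u \<partial>lborel)"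
   by (rule nn_integral_disjoint_sum_le[OF I _ _ d]) (use pq(2) in auto)
  also have "... <= Hbold_norm2 a c s1 s2 \<phi>" unfolding Hbold_norm2_def by simp
  finally show "(\<Sum>j\<in>I. \<integral>\<^sup>+u\<in>{p j..<q j}. ?N u \<partial>lborel) <= Hbold_norm2 a c s1 s2 \<phi>" .
 qed simp
 finally show ?thesis .
qed

lemma averages_difference_bound:
 fixes A :: "'j => 'i set"
 assumes I: "finite I" and A: "!!j. j \<in> I ==> finite (A j)" and l: "l > 0" "l' > 0" and s1: "s1 > 0"
  and pq: "!!j. j \<in> I ==> q j - p j = l" "!!j. j \<in> I ==> {p j..<q j} \<subseteq> {a<..<c}"
  and pq': "!!j. j \<in> I ==> q' j - p' j = l'" "!!j. j \<in> I ==> {p' j..<q' j} \<subseteq> {p j..<q j}"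
  and d: "disjoint_family_on (%j. {p' j..<q' j}) I" and th: "th > 0"
 shows "ennreal (2 * \<bar>\<Sum>j\<in>I. (1 / l') * (LINT u:{p' j..<q' j}|lborel. point_functional (A j) (x j) (e j) (%y. \<phi> (u, y)))
    - (1 / l) * (LINT u:{p j..<q j}|lborel. point_functional (A j) (x j) (e j) (%y. \<phi> (u, y)))\<bar>)
  <= ennreal th * (\<Sum>j\<in>I. energy s2 (A j) (x j) (e j)) + ennreal (l powr (1 + 2 * s1) / (l * l' * th)) * Hbold_norm2 a c s1 s2 \<phi>"
proof -
 let ?E = "%j. energy s2 (A j) (x j) (e j)" and ?N = "%u v. Hs_norm2 s2 (%y. \<phi> (u, y) - \<phi> (v, y))"
 let ?f = "%j u. point_functional (A j) (x j) (e j) (%y. \<phi> (u, y))"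
 define G where "G u = (\<integral>\<^sup>+v\<in>{a<..<c}. ?N u v / ennreal (\<bar>u - v\<bar> powr (1 + 2 * s1)) \<partial>lborel)" for u
 have Nm[measurable]: "(%(u, v). ?N u v) \<in> meas (borel \<Otimes>\<^sub>M borel)" by (rule Hs_norm2_slice_measurable[OF tf])
 have Nm1[measurable]: "(%v. ?N u v) \<in> meas borel" for u
  using measurable_compose[OF _ Nm, of "%v. (u, v)" borel] by simp
 have "(%(u, v). ?N u v / ennreal (\<bar>u - v\<bar> powr (1 + 2 * s1)) * indicator {a<..<c} v) \<in> meas (borel \<Otimes>\<^sub>M borel)"
  by measurable
 then have "(%(u, v). ?N u v / ennreal (\<bar>u - v\<bar> powr (1 + 2 * s1)) * indicator {a<..<c} v) \<in> meas (borel \<Otimes>\<^sub>M lborel)"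
  by (simp cong: measurable_cong_sets)
 then have Gm[measurable]: "G \<in> meas borel"
  unfolding G_def using lborel.borel_measurable_nn_integral[of "%u v. ?N u v / ennreal (\<bar>u - v\<bar> powr (1 + 2 * s1)) * indicator {a<..<c} v" borel] by simp
 have N0: "?N u u = 0" for u
 proof -
  obtain D where "!!u v. ?N u v <= ennreal (D * (u - v)^2)" using Hs_norm2_slice_lipschitz[OF tf, of s2] by blast
  from this[of u u] show ?thesis by simp
 qed
 \<comment> \<open>Within an interval |u - v| <= l, so l^(1 + 2 s1) times the kernel of the
   fractional seminorm is at least 1. This is the source of the gain for short intervals.\<close>
 have inner: "(\<integral>\<^sup>+v\<in>{p j..<q j}. ?N u v \<partial>lborel) <= ennreal (l powr (1 + 2 * s1)) * G u" if j: "j \<in> I" and u: "u \<in> {p j..<q j}" for j u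
 proof -
  have "(\<integral>\<^sup>+v\<in>{p j..<q j}. ?N u v \<partial>lborel) <= (\<integral>\<^sup>+v. ennreal (l powr (1 + 2 * s1)) * (?N u v / ennreal (\<bar>u - v\<bar> powr (1 + 2 * s1)) * indicator {a<..<c} v) \<partial>lborel)"
  proof (rule nn_integral_mono)
   fix v
   show "?N u v * indicator {p j..<q j} v <= ennreal (l powr (1 + 2 * s1)) * (?N u v / ennreal (\<bar>u - v\<bar> powr (1 + 2 * s1)) * indicator {a<..<c} v)"
   proof (cases "v \<in> {p j..<q j} \<and> u ~= v")
    case True
    then have v: "v \<in> {p j..<q j}" "\<bar>u - v\<bar> > 0" by auto
    have "\<bar>u - v\<bar> <= l" using u v pq(1)[OF j] by auto
    then have le: "\<bar>u - v\<bar> powr (1 + 2 * s1) <= l powr (1 + 2 * s1)" using s1 by (intro powr_mono2) auto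
    have pp: "\<bar>u - v\<bar> powr (1 + 2 * s1) > 0" using v by simp
    have "?N u v = ennreal (\<bar>u - v\<bar> powr (1 + 2 * s1)) * (?N u v / ennreal (\<bar>u - v\<bar> powr (1 + 2 * s1)))"
     using pp by (simp add: ennreal_times_divide mult_divide_eq_ennreal mult.commute[of _ "?N u v"])
    also have "... <= ennreal (l powr (1 + 2 * s1)) * (?N u v / ennreal (\<bar>u - v\<bar> powr (1 + 2 * s1)))"
     using le by (intro mult_right_mono ennreal_leI) auto
    finally show ?thesis using v pq(2)[OF j] by (auto simp: indicator_def)
   next
    case False then show ?thesis using N0 by (auto simp: indicator_def)
   qed
  qed
  also have "... = ennreal (l powr (1 + 2 * s1)) * G u" unfolding G_def by (rule nn_integral_cmult) measurable
  finally show ?thesis .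
 qed
 define C where "C = l powr (1 + 2 * s1)"
 have C0: "C >= 0" unfolding C_def by simp
 have inner': "(\<integral>\<^sup>+v\<in>{p j..<q j}. ?N u v \<partial>lborel) <= ennreal C * G u" if "j \<in> I" "u \<in> {p j..<q j}" for j u
  unfolding C_def by (rule inner[OF that])
 have one: "ennreal (2 * \<bar>(1 / l') * (LINT u:{p' j..<q' j}|lborel. ?f j u) - (1 / l) * (LINT v:{p j..<q j}|lborel. ?f j v)\<bar>)
   <= ennreal th * ?E j + ennreal (C / (l * l' * th)) * (\<integral>\<^sup>+u\<in>{p' j..<q' j}. G u \<partial>lborel)" if j: "j \<in> I" for j
 proof -
  have pl: "p j <= q j" "p' j <= q' j" using pq(1)[OF j] pq'(1)[OF j] l by auto
  define Z where "Z = (LINT v:{p j..<q j}|lborel. ?f j v)"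
  have si: "set_integrable lborel {p j..<q j} (?f j)" "set_integrable lborel {p' j..<q' j} (?f j)"
   by (rule point_functional_slice_integrable)+
  have ci: "set_integrable lborel {r..<t} (%_. k :: real)" for r t k :: real
   unfolding set_integrable_def by (cases "r <= t") auto
  have c1: "(LINT v:{p j..<q j}|lborel. k) = l * k" for k :: real
   using pl pq(1)[OF j] by (simp add: set_lebesgue_integral_def mult.commute)
  have c2: "(LINT v:{p' j..<q' j}|lborel. k) = l' * k" for k :: real
   using pl pq'(1)[OF j] by (simp add: set_lebesgue_integral_def mult.commute)
  have step1: "(1 / l') * (LINT u:{p' j..<q' j}|lborel. ?f j u) - (1 / l) * Z = (1 / l') * (LINT u:{p' j..<q' j}|lborel. ?f j u - Z / l)"
  proof -
   have "(LINT u:{p' j..<q' j}|lborel. ?f j u - Z / l) = (LINT u:{p' j..<q' j}|lborel. ?f j u) - l' * (Z / l)"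
    using si(2) ci by (subst set_integral_diff) (auto simp: c2)
   then show ?thesis using l by (simp add: field_simps)
  qed
  \<comment> \<open>A value minus a mean is the mean of the differences, so the slice differences of
    the seminorm appear under the integral.\<close>
  have step2: "?f j u - Z / l = (1 / l) * (LINT v:{p j..<q j}|lborel. ?f j u - ?f j v)" for u
  proof -
   have "(LINT v:{p j..<q j}|lborel. ?f j u - ?f j v) = l * ?f j u - Z"
    using si(1) ci by (subst set_integral_diff) (auto simp: c1 Z_def)
   then show ?thesis using l by (simp add: field_simps)
  qed
  have step3: "ennreal (2 * \<bar>?f j u - Z / l\<bar>) <= ennreal th * ?E j + ennreal (C / (l * th)) * G u" if u: "u \<in> {p' j..<q' j}" for u
  proof -
   have uJ: "u \<in> {p j..<q j}" using u pq'(2)[OF j] by auto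
   have d': "?f j u - ?f j v = point_functional (A j) (x j) (e j) (%y. \<phi> (u, y) - \<phi> (v, y))" for v
    by (simp add: point_functional_diff)
   have "ennreal (2 * \<bar>?f j u - Z / l\<bar>) = ennreal (1 / l) * ennreal \<bar>LINT v:{p j..<q j}|lborel. 2 * (?f j u - ?f j v)\<bar>"
    unfolding step2 using l by (simp add: abs_mult ennreal_mult[symmetric] mult_ac del: right_diff_distrib_numeral)
   also have "... <= ennreal (1 / l) * (\<integral>\<^sup>+v\<in>{p j..<q j}. ennreal \<bar>2 * (?f j u - ?f j v)\<bar> \<partial>lborel)"
    by (intro mult_left_mono ennreal_abs_set_integral_le set_integrable_mult_right set_integral_diff ci si) simp
   also have "... <= ennreal (1 / l) * (\<integral>\<^sup>+v\<in>{p j..<q j}. (ennreal th * ?E j + ?N u v / ennreal th) \<partial>lborel)"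
    using point_functional_young[OF A[OF j] th, of "x j" "e j" u _ s2] unfolding d'
    by (intro mult_left_mono nn_integral_mono mult_right_mono) (auto simp: abs_mult)
   also have "(\<integral>\<^sup>+v\<in>{p j..<q j}. (ennreal th * ?E j + ?N u v / ennreal th) \<partial>lborel)
    = ennreal th * ?E j * ennreal l + (\<integral>\<^sup>+v\<in>{p j..<q j}. ?N u v \<partial>lborel) / ennreal th"
    using nn_integral_interval_affine[OF Nm1 pl(1), of "ennreal th * ?E j" "inverse (ennreal th)" u] pq(1)[OF j]
    by (simp add: divide_ennreal_def mult.commute)
   also have "... <= ennreal th * ?E j * ennreal l + (ennreal C * G u) / ennreal th"
    by (intro add_left_mono divide_right_mono_ennreal inner' j uJ)
   also have "ennreal (1 / l) * (ennreal th * ?E j * ennreal l + (ennreal C * G u) / ennreal th)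
    = ennreal th * ?E j + ennreal (C / (l * th)) * G u"
   proof -
    have 1: "ennreal (1 / l) * ennreal l = 1" using l by (simp add: ennreal_mult[symmetric])
    have 2: "ennreal (1 / l) * ((ennreal C * y) / ennreal th) = ennreal (C / (l * th)) * y" for y
    proof -
     have 3: "(ennreal C * y) / ennreal th = (ennreal C * y) * ennreal (1 / th)" using th by (simp add: divide_ennreal_def inverse_ennreal divide_inverse)
     have 4: "ennreal (1 / l) * ennreal C * ennreal (1 / th) = ennreal (C / (l * th))" using l th C0 by (simp add: ennreal_mult[symmetric])
     have "ennreal (1 / l) * ((ennreal C * y) / ennreal th) = ennreal (1 / l) * ennreal C * ennreal (1 / th) * y"
      unfolding 3 by (simp only: mult_ac)
     then show ?thesis by (simp only: 4)
    qed
    have "ennreal (1 / l) * (ennreal th * ?E j * ennreal l) = ennreal th * ?E j * (ennreal (1 / l) * ennreal l)" by (simp add: mult_ac)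
    then show ?thesis unfolding distrib_left 2 1 by simp
   qed
   finally show ?thesis by (simp add: mult_left_mono)
  qed
  have "ennreal (2 * \<bar>(1 / l') * (LINT u:{p' j..<q' j}|lborel. ?f j u) - (1 / l) * Z\<bar>)
    = ennreal (1 / l') * ennreal \<bar>LINT u:{p' j..<q' j}|lborel. 2 * (?f j u - Z / l)\<bar>"
   unfolding step1 using l by (simp add: abs_mult ennreal_mult[symmetric] mult_ac del: right_diff_distrib_numeral)
  also have "... <= ennreal (1 / l') * (\<integral>\<^sup>+u\<in>{p' j..<q' j}. ennreal \<bar>2 * (?f j u - Z / l)\<bar> \<partial>lborel)"
   by (intro mult_left_mono ennreal_abs_set_integral_le set_integrable_mult_right set_integral_diff ci si) simp
  also have "... <= ennreal (1 / l') * (\<integral>\<^sup>+u\<in>{p' j..<q' j}. (ennreal th * ?E j + ennreal (C / (l * th)) * G u) \<partial>lborel)"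
  proof (intro mult_left_mono nn_integral_mono)
   fix u
   have e2: "\<bar>2 * y\<bar> = 2 * \<bar>y\<bar>" for y :: real by (simp add: abs_mult)
   show "ennreal \<bar>2 * (?f j u - Z / l)\<bar> * indicator {p' j..<q' j} u <= (ennreal th * ?E j + ennreal (C / (l * th)) * G u) * indicator {p' j..<q' j} u"
    unfolding e2 using step3[of u] by (cases "u \<in> {p' j..<q' j}") (simp_all del: atLeastLessThan_iff right_diff_distrib_numeral)
  qed simp
  also have "(\<integral>\<^sup>+u\<in>{p' j..<q' j}. (ennreal th * ?E j + ennreal (C / (l * th)) * G u) \<partial>lborel)
   = ennreal th * ?E j * ennreal l' + ennreal (C / (l * th)) * (\<integral>\<^sup>+u\<in>{p' j..<q' j}. G u \<partial>lborel)"
   using nn_integral_interval_affine[OF Gm pl(2)] pq'(1)[OF j] by simp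
  also have "ennreal (1 / l') * (ennreal th * ?E j * ennreal l' + ennreal (C / (l * th)) * (\<integral>\<^sup>+u\<in>{p' j..<q' j}. G u \<partial>lborel))
   = ennreal th * ?E j + ennreal (C / (l * l' * th)) * (\<integral>\<^sup>+u\<in>{p' j..<q' j}. G u \<partial>lborel)"
  proof -
   have 1: "ennreal (1 / l') * ennreal l' = 1" using l by (simp add: ennreal_mult[symmetric])
   have 2: "ennreal (1 / l') * ennreal (C / (l * th)) = ennreal (C / (l * l' * th))"
    using l th C0 by (simp add: ennreal_mult[symmetric] field_simps)
   have 3: "ennreal (1 / l') * (ennreal th * ?E j * ennreal l') = ennreal th * ?E j * (ennreal (1 / l') * ennreal l')" by (simp add: mult_ac)
   show ?thesis by (simp only: distrib_left 3 1 mult_1_right) (simp only: mult.assoc[symmetric] 2)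
  qed
  finally show ?thesis unfolding Z_def .
 qed
 let ?D = "%j. (1 / l') * (LINT u:{p' j..<q' j}|lborel. ?f j u) - (1 / l) * (LINT u:{p j..<q j}|lborel. ?f j u)"
 have "ennreal (2 * \<bar>\<Sum>j\<in>I. ?D j\<bar>) <= (\<Sum>j\<in>I. ennreal (2 * \<bar>?D j\<bar>))"
  by (rule ennreal_twice_abs_sum_le)
 also have "... <= (\<Sum>j\<in>I. ennreal th * ?E j + ennreal (C / (l * l' * th)) * (\<integral>\<^sup>+u\<in>{p' j..<q' j}. G u \<partial>lborel))"
  by (rule sum_mono) (rule one)
 also have "... = ennreal th * (\<Sum>j\<in>I. ?E j) + ennreal (C / (l * l' * th)) * (\<Sum>j\<in>I. \<integral>\<^sup>+u\<in>{p' j..<q' j}. G u \<partial>lborel)"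
  by (simp add: sum.distrib sum_distrib_left)
 also have "... <= ennreal th * (\<Sum>j\<in>I. ?E j) + ennreal (C / (l * l' * th)) * Hbold_norm2 a c s1 s2 \<phi>"
 proof (intro add_left_mono mult_left_mono)
  have "(\<Sum>j\<in>I. \<integral>\<^sup>+u\<in>{p' j..<q' j}. G u \<partial>lborel) <= (\<integral>\<^sup>+u\<in>{a<..<c}. G u \<partial>lborel)"
  proof (rule nn_integral_disjoint_sum_le[OF I _ _ d])
   show "{p' j..<q' j} \<subseteq> {a<..<c}" if "j \<in> I" for j using pq(2)[OF that] pq'(2)[OF that] by blast
  qed simp_all
  also have "... <= Hbold_norm2 a c s1 s2 \<phi>" unfolding Hbold_norm2_def G_def by simp
  finally show "(\<Sum>j\<in>I. \<integral>\<^sup>+u\<in>{p' j..<q' j}. G u \<partial>lborel) <= Hbold_norm2 a c s1 s2 \<phi>" .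
 qed simp
 finally show ?thesis unfolding C_def .
qed

end

section \<open>Energy of the driven point functionals\<close>

text \<open>Otherwise there are pairs of times at distance tending to 0 with mean square above e;
  uniform continuity of each path and domination contradict this. No rate results, which later
  forces the grids to be chosen adaptively.\<close>

lemma (in finite_measure) mean_square_modulus:
 fixes Y :: "real => 'a => 'b::{real_normed_vector, second_countable_topology}"
 assumes Ym: "!!t. t \<in> {0..T} ==> Y t \<in> meas M"
  and cont: "!!x. x \<in> space M ==> continuous_on {0..T} (%t. Y t x)"
  and bd: "!!t x. t \<in> {0..T} ==> x \<in> space M ==> norm (Y t x) <= C"
  and e: "e > 0"
 shows "\<exists>\<eta>>0. \<forall>s\<in>{0..T}. \<forall>t\<in>{0..T}. \<bar>s - t\<bar> < \<eta> --> (\<integral>x. (norm (Y s x - Y t x))^2 \<partial>M) <= e"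
proof (rule ccontr)
 assume neg: "\<not> ?thesis"
 have "\<forall>n. \<exists>p. fst p \<in> {0..T} \<and> snd p \<in> {0..T} \<and> \<bar>fst p - snd p\<bar> < 1 / real (Suc n) \<and> (\<integral>x. (norm (Y (fst p) x - Y (snd p) x))^2 \<partial>M) > e"
 proof
  fix n
  have "0 < 1 / real (Suc n)" by simp
  with neg obtain s t where "s \<in> {0..T}" "t \<in> {0..T}" "\<bar>s - t\<bar> < 1 / real (Suc n)" "\<not> (\<integral>x. (norm (Y s x - Y t x))^2 \<partial>M) <= e"
   by blast
  then show "\<exists>p. fst p \<in> {0..T} \<and> snd p \<in> {0..T} \<and> \<bar>fst p - snd p\<bar> < 1 / real (Suc n) \<and> (\<integral>x. (norm (Y (fst p) x - Y (snd p) x))^2 \<partial>M) > e"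
   by (intro exI[of _ "(s, t)"]) auto
 qed
 from choice[OF this] obtain p where P: "\<forall>n. fst (p n) \<in> {0..T} \<and> snd (p n) \<in> {0..T} \<and> \<bar>fst (p n) - snd (p n)\<bar> < 1 / real (Suc n)
   \<and> (\<integral>x. (norm (Y (fst (p n)) x - Y (snd (p n)) x))^2 \<partial>M) > e" ..
 then have p: "fst (p n) \<in> {0..T}" "snd (p n) \<in> {0..T}" "\<bar>fst (p n) - snd (p n)\<bar> < 1 / real (Suc n)"
   "(\<integral>x. (norm (Y (fst (p n)) x - Y (snd (p n)) x))^2 \<partial>M) > e" for n by blast+
 note [measurable] = Ym[OF p(1)] Ym[OF p(2)]
 have d0: "(%n. dist (fst (p n)) (snd (p n))) \<longlonglongrightarrow> 0"
 proof (rule tendsto_sandwich[OF _ _ tendsto_const])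
  show "(%n. 1 / real (Suc n)) \<longlonglongrightarrow> 0" using LIMSEQ_inverse_real_of_nat by (simp add: divide_inverse)
  show "\<forall>\<^sub>F n in sequentially. dist (fst (p n)) (snd (p n)) <= 1 / real (Suc n)"
   using p(3) by (intro always_eventually) (auto simp: dist_real_def less_imp_le simp del: of_nat_Suc)
 qed auto
 have "(%n. \<integral>x. (norm (Y (fst (p n)) x - Y (snd (p n)) x))^2 \<partial>M) \<longlonglongrightarrow> (\<integral>x. 0 \<partial>M)"
 proof (rule integral_dominated_convergence[where w="%_. (2 * C)^2"])
  show "AE x in M. (%n. (norm (Y (fst (p n)) x - Y (snd (p n)) x))^2) \<longlonglongrightarrow> 0"
  proof (rule AE_I2)
   fix x assume x: "x \<in> space M"
   have "uniformly_continuous_on {0..T} (%t. Y t x)" by (rule compact_uniformly_continuous[OF cont[OF x]]) simp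
   then have u: "\<forall>z y. (\<forall>n. z n \<in> {0..T}) \<and> (\<forall>n. y n \<in> {0..T}) \<and> (%n. dist (z n) (y n)) \<longlonglongrightarrow> 0 -->
     (%n. dist (Y (z n) x) (Y (y n) x)) \<longlonglongrightarrow> 0"
    unfolding uniformly_continuous_on_sequentially .
   have "(%n. dist (Y (fst (p n)) x) (Y (snd (p n)) x)) \<longlonglongrightarrow> 0"
    by (rule u[rule_format, of "%n. fst (p n)" "%n. snd (p n)"]) (intro conjI allI p(1,2) d0)
   from tendsto_power[OF this, of 2] show "(%n. (norm (Y (fst (p n)) x - Y (snd (p n)) x))^2) \<longlonglongrightarrow> 0" by (simp add: dist_norm)
  qed
  show "AE x in M. norm ((norm (Y (fst (p n)) x - Y (snd (p n)) x))^2) <= (2 * C)^2" for n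
  proof (rule AE_I2)
   fix x assume x: "x \<in> space M"
   have "norm (Y (fst (p n)) x - Y (snd (p n)) x) <= 2 * C"
    using norm_triangle_ineq4[of "Y (fst (p n)) x" "Y (snd (p n)) x"] bd[OF p(1) x, of n] bd[OF p(2) x, of n] by linarith
   then have "(norm (Y (fst (p n)) x - Y (snd (p n)) x))^2 <= (2 * C)^2" by (rule power_mono) simp
   then show "norm ((norm (Y (fst (p n)) x - Y (snd (p n)) x))^2) <= (2 * C)^2" by simp
  qed
 qed auto
 then have "\<forall>\<^sub>F n in sequentially. (\<integral>x. (norm (Y (fst (p n)) x - Y (snd (p n)) x))^2 \<partial>M) < e"
  using e by (intro order_tendstoD(2)[where y=0]) auto
 then show False using p(4) by (auto simp: eventually_sequentially dest: less_asym)
qed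

lemma (in finite_measure) integrable_norm_diff_sq:
 fixes f g :: "'a => 'b::{real_normed_vector, second_countable_topology}"
 assumes [measurable]: "f \<in> meas M" "g \<in> meas M"
  and f: "!!x. x \<in> space M ==> norm (f x) <= C" and g: "!!x. x \<in> space M ==> norm (g x) <= C"
 shows "integrable M (%x. (norm (f x - g x))^2)"
proof (rule integrable_const_bound[where B="(2 * C)^2"])
 show "AE x in M. norm ((norm (f x - g x))^2) <= (2 * C)^2"
 proof (rule AE_I2)
  fix x assume x: "x \<in> space M"
  have "norm (f x - g x) <= 2 * C" using norm_triangle_ineq4[of "f x" "g x"] f[OF x] g[OF x] by linarith
  then have "(norm (f x - g x))^2 <= (2 * C)^2" by (rule power_mono) simp
  then show "norm ((norm (f x - g x))^2) <= (2 * C)^2" by simp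
 qed
qed measurable

lemma energy_re_im:
 "energy s A x c = (\<integral>\<^sup>+xi. ennreal ((\<Sum>k\<in>UNIV. (\<Sum>i\<in>A. c i $ k * cos (2 * pi * (xi \<bullet> x i)))^2 + (\<Sum>i\<in>A. c i $ k * sin (2 * pi * (xi \<bullet> x i)))^2)
   * (1 + (norm xi)^2) powr (-s)) \<partial>lborel)"
proof -
 have "(cmod (\<Sum>i\<in>A. complex_of_real (c i $ k) * cis (2 * pi * (xi \<bullet> x i))))^2
  = (\<Sum>i\<in>A. c i $ k * cos (2 * pi * (xi \<bullet> x i)))^2 + (\<Sum>i\<in>A. c i $ k * sin (2 * pi * (xi \<bullet> x i)))^2" for k xi
  unfolding cmod_power2 by (simp add: Re_sum Im_sum)
 then show ?thesis unfolding energy_def by simp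
qed

lemma grid_tiling:
 assumes h: "h > 0" and m: "m <= m'"
 shows "disjoint_family_on (%i. {real i * h..<(real i + 1) * h}) A"
  "(\<Union>i\<in>{m..<m'}. {real i * h..<(real i + 1) * h}) = {real m * h..<real m' * h}"
proof -
 let ?q0 = "%i. {real i * h..<(real i + 1) * h}"
 have *: "s \<in> (?q0 i) \<longleftrightarrow> s >= 0 \<and> i = nat \<lfloor>s / h\<rfloor>" for s i
 proof -
  have "s \<in> (?q0 i) \<longleftrightarrow> real i <= s / h \<and> s / h < real i + 1"
   using h by (simp add: pos_le_divide_eq pos_divide_less_eq)
  also have "... \<longleftrightarrow> s >= 0 \<and> \<lfloor>s / h\<rfloor> = int i"
   using h by (auto simp: floor_eq_iff) (metis of_nat_0_le_iff order_trans zero_le_divide_iff less_le_not_le)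
  also have "... \<longleftrightarrow> s >= 0 \<and> i = nat \<lfloor>s / h\<rfloor>" using h by auto
  finally show ?thesis .
 qed
 show "disjoint_family_on (%i. (?q0 i)) A"
  unfolding disjoint_family_on_def
 proof (intro ballI impI equals0I)
  fix m n s assume "m ~= n" "s \<in> {real m * h..<(real m + 1) * h} \<inter> {real n * h..<(real n + 1) * h}"
  then show False using *[of s m] *[of s n] by blast
 qed
 show "(\<Union>i\<in>{m..<m'}. (?q0 i)) = {real m * h..<real m' * h}"
 proof (intro set_eqI iffI)
  fix s assume "s \<in> (\<Union>i\<in>{m..<m'}. (?q0 i))"
  then obtain i where i: "m <= i" "i < m'" "real i * h <= s" "s < (real i + 1) * h" by auto
  have "real m * h <= real i * h" using i h by simp
  moreover have "(real i + 1) * h <= real m' * h" using i h by (intro mult_right_mono) auto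
  ultimately show "s \<in> {real m * h..<real m' * h}" using i by auto
 next
  fix s assume s: "s \<in> {real m * h..<real m' * h}"
  have "0 <= real m * h" using h by simp
  then have s0: "s >= 0" using s by auto
  define i where "i = nat \<lfloor>s / h\<rfloor>"
  have i: "s \<in> (?q0 i)" unfolding * i_def using s0 by simp
  have "real m * h < (real i + 1) * h" "real i * h < real m' * h" using i s by auto
  then have "m <= i" "i < m'" using h by auto
  then show "s \<in> (\<Union>i\<in>{m..<m'}. (?q0 i))" using i by auto
 qed
qed

lemma sum_double_range:
 fixes f :: "nat => 'a::comm_monoid_add"
 shows "(\<Sum>j<2 * m. f j) = (\<Sum>j<m. f (2 * j) + f (2 * j + 1))"
 by (induction m) (simp_all add: add.assoc)

text \<open>Only adaptedness, path continuity and a bounded \<open>S\<close> enter the energies; the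
  equation that links X to W is postponed to \<open>ito_process\<close>.\<close>

locale driven = brownian M F T W for M :: "'w measure" and F T and W :: "real => 'w => real^'m" +
 fixes X :: "real => 'w => real^'d" and S :: "real => 'w => real^'m^'d" and L :: real
 assumes X_adapted: "!!t. t \<in> {0..T} ==> X t \<in> meas (F t)"
  and X_cont: "!!w. w \<in> space M ==> continuous_on {0..T} (%t. X t w)"
  and S_adapted: "!!t. t \<in> {0..T} ==> S t \<in> meas (F t)"
  and S_cont: "!!w. w \<in> space M ==> continuous_on {0..T} (%t. S t w)"
  and S_bound: "!!t w. t \<in> {0..T} ==> w \<in> space M ==> norm (S t w) <= L"
begin

lemma X_M: "t \<in> {0..T} ==> X t \<in> meas M"
 using F_measurable_M[OF X_adapted] by simp

lemma S_M: "t \<in> {0..T} ==> S t \<in> meas M"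
 using F_measurable_M[OF S_adapted] by simp

lemma L_nonneg: "0 <= L"
proof -
 obtain w where "w \<in> space M" using not_empty by blast
 moreover have "0 \<in> {0..T}" using T_pos by simp
 ultimately have "norm (S 0 w) <= L" by (intro S_bound)
 then show ?thesis using norm_ge_zero[of "S 0 w"] by linarith
qed

text \<open>Real part of the k-th row of exp(2 pi i xi . X) S. Rows are the right unit because
  component k of S dW is the inner product of row k with dW, a scalar stochastic integral.\<close>

definition cos_row :: "real^'d => 'd => real => 'w => real^'m" where
 "cos_row xi k t w = cos (2 * pi * (xi \<bullet> X t w)) *\<^sub>R (S t w $ k)"

definition sin_row :: "real^'d => 'd => real => 'w => real^'m" where
 "sin_row xi k t w = sin (2 * pi * (xi \<bullet> X t w)) *\<^sub>R (S t w $ k)"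

text \<open>The complex matrix exp(2 pi i xi . X) S as a pair of real matrices; its squared norm
  adds up all rows.\<close>

definition wave :: "real => real^'d => 'w => (real^'m^'d) \<times> (real^'m^'d)" where
 "wave t xi w = (cos (2 * pi * (xi \<bullet> X t w)) *\<^sub>R S t w, sin (2 * pi * (xi \<bullet> X t w)) *\<^sub>R S t w)"

lemma wave_diff_rows:
 "(norm (wave t xi w - wave t' xi w))^2 = (\<Sum>k\<in>UNIV. (norm (cos_row xi k t w - cos_row xi k t' w))^2 + (norm (sin_row xi k t w - sin_row xi k t' w))^2)"
 unfolding wave_def cos_row_def sin_row_def
 by (simp add: norm_Pair power2_norm_eq_inner inner_vec_def[where 'a="real^'m"] sum.distrib add_nonneg_nonneg sum_nonneg)

lemma rows_norm: "(\<Sum>k\<in>UNIV. (norm (cos_row xi k t w))^2 + (norm (sin_row xi k t w))^2) = (norm (S t w))^2"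
proof -
 have "(norm (cos_row xi k t w))^2 + (norm (sin_row xi k t w))^2 = (norm (S t w $ k))^2" for k
  unfolding cos_row_def sin_row_def by (simp add: power_mult_distrib distrib_right[symmetric])
 then show ?thesis by (simp add: power2_norm_eq_inner inner_vec_def[where 'a="real^'m"])
qed

lemma row_adapted:
 assumes t: "t \<in> {0..T}"
 shows "cos_row xi k t \<in> meas (F t)" (is ?C1) "sin_row xi k t \<in> meas (F t)" (is ?C2)
proof -
 note [measurable] = X_adapted[OF t] S_adapted[OF t]
 show ?C1 ?C2
  unfolding cos_row_def sin_row_def by measurable
qed

lemma row_bound:
 assumes t: "t \<in> {0..T}" and w: "w \<in> space M"
 shows "norm (cos_row xi k t w) <= L" (is ?C1) "norm (sin_row xi k t w) <= L" (is ?C2)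
proof -
 have "norm (S t w $ k) <= norm (S t w)" by (rule Finite_Cartesian_Product.norm_nth_le)
 then have k: "norm (S t w $ k) <= L" using S_bound[OF t w] by linarith
 have "\<bar>cos z\<bar> * norm (S t w $ k) <= 1 * L" "\<bar>sin z\<bar> * norm (S t w $ k) <= 1 * L" for z
  using k by (intro mult_mono; simp)+
 then show ?C1 ?C2
  unfolding cos_row_def sin_row_def by simp_all
qed

lemma row_adapted_family:
 assumes "!!i. i \<in> A ==> 0 <= p i \<and> p i <= q i \<and> q i <= T"
 shows "adapted_family A p q (%i. cos_row xi k (p i))" (is ?C1) "adapted_family A p q (%i. sin_row xi k (p i))" (is ?C2)
proof -
 have pi: "p i \<in> {0..T}" if "i \<in> A" for i using assms[OF that] by auto
 show ?C1 ?C2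
  unfolding adapted_family_def using assms row_adapted[OF pi] row_bound[OF pi] by blast+
qed

definition coeff :: "('i => real) => ('i => real) => 'w => 'i => real^'d" where
 "coeff p q w i = S (p i) w *v inc (p i) (q i) w"

definition site :: "('i => real) => 'w => 'i => real^'d" where
 "site p w i = X (p i) w"

lemma coeff_rows:
 "(\<Sum>i\<in>A. coeff p q w i $ k * cos (2 * pi * (xi \<bullet> site p w i))) = simple_integral A p q (%i. cos_row xi k (p i)) w"
 "(\<Sum>i\<in>A. coeff p q w i $ k * sin (2 * pi * (xi \<bullet> site p w i))) = simple_integral A p q (%i. sin_row xi k (p i)) w"
 unfolding simple_integral_def coeff_def site_def cos_row_def sin_row_def
 by (simp_all add: matrix_vector_mul_component mult.commute)

definition weight :: "real => real^'d => real" where "weight s xi = (1 + (norm xi)^2) powr (-s)"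

lemma weight_measurable[measurable]: "weight s \<in> meas borel"
 unfolding weight_def by measurable

lemma weight_nonneg: "0 <= weight s xi" unfolding weight_def by simp

lemma simple_integral_row_measurable:
 assumes pq: "!!i. i \<in> A ==> 0 <= p i \<and> p i <= q i \<and> q i <= T"
 shows "(%(xi, w). simple_integral A p q (%i. cos_row xi k (p i)) w) \<in> meas (borel \<Otimes>\<^sub>M M)"
  "(%(xi, w). simple_integral A p q (%i. sin_row xi k (p i)) w) \<in> meas (borel \<Otimes>\<^sub>M M)"
proof -
 let ?q0 = "borel \<Otimes>\<^sub>M M"
 have "(%(xi, w). cos_row xi k (p i) w \<bullet> inc (p i) (q i) w) \<in> meas ?q0 \<and>
    (%(xi, w). sin_row xi k (p i) w \<bullet> inc (p i) (q i) w) \<in> meas ?q0" if i: "i \<in> A" for i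
 proof -
  have t: "p i \<in> {0..T}" using pq[OF i] by auto
  have [measurable]: "inc (p i) (q i) \<in> meas M" using inc_M pq[OF i] by auto
  note [measurable] = X_M[OF t] S_M[OF t]
  show ?thesis unfolding cos_row_def sin_row_def by measurable
 qed
 then show "(%(xi, w). simple_integral A p q (%i. cos_row xi k (p i)) w) \<in> meas ?q0"
  "(%(xi, w). simple_integral A p q (%i. sin_row xi k (p i)) w) \<in> meas ?q0"
  unfolding simple_integral_def case_prod_unfold by (intro borel_measurable_sum; auto simp: case_prod_unfold)+
qed

lemma borel_lborel_pair_measurable:
 "f \<in> meas (borel \<Otimes>\<^sub>M M) ==> f \<in> meas (lborel \<Otimes>\<^sub>M M)"
proof -
 have "sets (borel \<Otimes>\<^sub>M M) = sets (lborel \<Otimes>\<^sub>M M)" by (rule sets_pair_measure_cong) auto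
 then show "f \<in> meas (borel \<Otimes>\<^sub>M M) ==> f \<in> meas (lborel \<Otimes>\<^sub>M M)"
  by (simp cong: measurable_cong_sets)
qed

lemma energy_measurable:
 assumes pq: "!!i. i \<in> A ==> 0 <= p i \<and> p i <= q i \<and> q i <= T"
 shows "(%w. energy s A (site p w) (coeff p q w)) \<in> meas M" (is ?C1)
  and "(\<integral>\<^sup>+w. energy s A (site p w) (coeff p q w) \<partial>M) = (\<integral>\<^sup>+xi. \<integral>\<^sup>+w. ennreal ((\<Sum>k\<in>UNIV.
   (simple_integral A p q (%i. cos_row xi k (p i)) w)^2 + (simple_integral A p q (%i. sin_row xi k (p i)) w)^2) * weight s xi) \<partial>M \<partial>lborel)"
proof -
 define g where "g xi w = ennreal ((\<Sum>k\<in>UNIV.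
   (simple_integral A p q (%i. cos_row xi k (p i)) w)^2 + (simple_integral A p q (%i. sin_row xi k (p i)) w)^2) * weight s xi)" for xi w
 note [measurable] = simple_integral_row_measurable[OF pq, unfolded case_prod_unfold]
 have "(%z. g (fst z) (snd z)) \<in> meas (borel \<Otimes>\<^sub>M M)" unfolding g_def by measurable
 then have g: "case_prod g \<in> meas (lborel \<Otimes>\<^sub>M M)" by (intro borel_lborel_pair_measurable) (simp add: case_prod_unfold)
 have E: "energy s A (site p w) (coeff p q w) = (\<integral>\<^sup>+xi. g xi w \<partial>lborel)" for w
  unfolding energy_re_im coeff_rows g_def weight_def ..
 interpret P: pair_sigma_finite lborel M ..
 have g': "(%(w, xi). g xi w) \<in> meas (M \<Otimes>\<^sub>M lborel)" using measurable_pair_swap[OF g] by (simp add: case_prod_unfold)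
 show ?C1
  unfolding E by (rule lborel.borel_measurable_nn_integral[OF g'])
 show "(\<integral>\<^sup>+w. energy s A (site p w) (coeff p q w) \<partial>M) = (\<integral>\<^sup>+xi. \<integral>\<^sup>+w. g xi w \<partial>M \<partial>lborel)"
  unfolding E by (rule P.Fubini'[OF g])
qed

text \<open>At a fixed frequency the isometry applies to each row, and since cos^2 + sin^2 = 1 the
  frequency cancels. What remains is at most L^2 times the total length, integrated against the
  weight.\<close>

lemma energy_expectation:
 assumes pq: "!!i. i \<in> A ==> 0 <= p i \<and> p i <= q i \<and> q i <= T" and A: "tiling A p q J"
 shows "(\<integral>\<^sup>+w. energy s A (site p w) (coeff p q w) \<partial>M) <= ennreal (L^2 * (\<Sum>i\<in>A. q i - p i)) * weight_mass TYPE(real^'d) s"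
proof -
 let ?c = "%xi k. simple_integral A p q (%i. cos_row xi k (p i))" and ?s = "%xi k. simple_integral A p q (%i. sin_row xi k (p i))"
 let ?q0 = "%xi i. \<Sum>k\<in>UNIV. expectation (%w. (norm (cos_row xi k (p i) w))^2) + expectation (%w. (norm (sin_row xi k (p i) w))^2)"
 let ?q1 = "%xi w. \<Sum>k\<in>UNIV. (?c xi k w)^2 + (?s xi k w)^2"
 let ?q2 = "L^2 * (\<Sum>i\<in>A. q i - p i)"
 let ?q3 = "%xi k i. expectation (%w. (norm (cos_row xi k (p i) w))^2) + expectation (%w. (norm (sin_row xi k (p i) w))^2)"
 let ?q4 = "%xi. \<integral>\<^sup>+w. ennreal ((?q1 xi w) * weight s xi) \<partial>M"
 let ?q5 = "%xi. %w. (?q1 xi w) * weight s xi"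
 have fin: "finite A" using A unfolding tiling_def by simp
 have pt: "p i \<in> {0..T}" if "i \<in> A" for i using pq[OF that] by auto
 have one: "(?q4 xi) <= ennreal ?q2 * ennreal (weight s xi)" for xi
 proof -
  note I = simple_integral_isometry[OF row_adapted_family(1)[OF pq] A] simple_integral_isometry[OF row_adapted_family(2)[OF pq] A]
  have nn: "(?q4 xi)
   = ennreal (expectation (?q5 xi))"
   using I by (intro nn_integral_eq_integral) (auto intro!: Bochner_Integration.integrable_sum mult_nonneg_nonneg sum_nonneg weight_nonneg)
  have "expectation (?q5 xi)
   = (\<Sum>k\<in>UNIV. expectation (%w. (?c xi k w)^2) + expectation (%w. (?s xi k w)^2)) * weight s xi"
   using I by (simp add: Bochner_Integration.integral_sum Bochner_Integration.integral_add)
  also have "... = (\<Sum>k\<in>UNIV. \<Sum>i\<in>A. (q i - p i) * (?q3 xi k i)) * weight s xi"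
  proof -
   have "expectation (%w. (?c xi k w)^2) + expectation (%w. (?s xi k w)^2)
    = (\<Sum>i\<in>A. (q i - p i) * (?q3 xi k i))" for k
    using simple_integral_isometry(2)[OF row_adapted_family(1)[OF pq] A, of xi k] simple_integral_isometry(2)[OF row_adapted_family(2)[OF pq] A, of xi k]
    by (simp add: sum.distrib distrib_left)
   then show ?thesis by simp
  qed
  also have "... = (\<Sum>i\<in>A. (q i - p i) * (?q0 xi i)) * weight s xi"
   by (subst sum.swap) (simp add: sum_distrib_left)
  also have "... <= (\<Sum>i\<in>A. (q i - p i) * L^2) * weight s xi"
  proof (intro mult_right_mono sum_mono mult_left_mono weight_nonneg)
   fix i assume i: "i \<in> A"
   have m: "cos_row xi k (p i) \<in> meas M" "sin_row xi k (p i) \<in> meas M" for k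
    using F_measurable_M[OF row_adapted(1)[OF pt[OF i]]] F_measurable_M[OF row_adapted(2)[OF pt[OF i]]] pt[OF i] by auto
   have i1: "integrable M (%w. (norm (cos_row xi k (p i) w))^2)" "integrable M (%w. (norm (sin_row xi k (p i) w))^2)" for k
    using m row_bound[OF pt[OF i]] by (auto intro!: integrable_const_bound[where B="L^2"] AE_I2 power_mono)
   have "(?q0 xi i)
    = expectation (%w. \<Sum>k\<in>UNIV. (norm (cos_row xi k (p i) w))^2 + (norm (sin_row xi k (p i) w))^2)"
    using i1 by (simp add: Bochner_Integration.integral_sum Bochner_Integration.integral_add)
   also have "... <= L^2"
    unfolding rows_norm using S_M[OF pt[OF i]] S_bound[OF pt[OF i]]
    by (intro integral_le_const AE_I2 power_mono) (auto intro!: integrable_const_bound[where B="L^2"] AE_I2 power_mono)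
   finally show "(?q0 xi i) <= L^2" .
  qed (use pq in force)
  finally have "expectation (?q5 xi) <= ?q2 * weight s xi"
   by (simp add: sum_distrib_right[symmetric] mult.commute)
  moreover have "0 <= L^2 * (\<Sum>i\<in>A. q i - p i)" using pq by (intro mult_nonneg_nonneg sum_nonneg) force+
  ultimately show ?thesis unfolding nn by (subst ennreal_mult[symmetric]) (auto intro: ennreal_leI weight_nonneg)
 qed
 have "(\<integral>\<^sup>+w. energy s A (site p w) (coeff p q w) \<partial>M) = (\<integral>\<^sup>+xi. \<integral>\<^sup>+w. ennreal ((?q1 xi w) * weight s xi) \<partial>M \<partial>lborel)"
  by (rule energy_measurable(2)[OF pq])
 also have "... <= (\<integral>\<^sup>+xi. ennreal ?q2 * ennreal (weight s xi) \<partial>lborel)"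
  by (rule nn_integral_mono) (rule one)
 also have "... = ennreal ?q2 * weight_mass TYPE(real^'d) s"
  unfolding weight_mass_def weight_def[symmetric] by (rule nn_integral_cmult) measurable
 finally show ?thesis .
qed

text \<open>Mean squared distance, in the dual Sobolev norm, of the matrix-weighted point masses at
  times t and t'.\<close>

definition wave_dist :: "real => real => real => ennreal" where
 "wave_dist s t t' = (\<integral>\<^sup>+xi. (\<integral>\<^sup>+w. ennreal ((norm (wave t xi w - wave t' xi w))^2) \<partial>M) * ennreal (weight s xi) \<partial>lborel)"

lemma wave_measurable:
 assumes t: "t \<in> {0..T}"
 shows "(%(xi, w). wave t xi w) \<in> meas (borel \<Otimes>\<^sub>M M)"
proof -
 note [measurable] = X_M[OF t] S_M[OF t]
 show ?thesis unfolding wave_def by measurable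
qed

lemma wave_norm: "norm (wave t xi w) = norm (S t w)"
proof -
 have "(norm (wave t xi w))^2 = (norm (S t w))^2"
  unfolding wave_def by (simp add: norm_Pair power_mult_distrib distrib_right[symmetric])
 then show ?thesis by simp
qed

text \<open>Frequency space with the weight as density is a finite measure, precisely since s > d /
  2. On its product with the probability space the mean-square modulus applies to
  \<open>wave\<close>.\<close>

lemma wave_modulus:
 assumes s: "s > real CARD('d) / 2" and e: "e > 0"
 shows "\<exists>\<eta>>0. \<forall>t\<in>{0..T}. \<forall>t'\<in>{0..T}. \<bar>t - t'\<bar> < \<eta> --> wave_dist s t t' <= ennreal e"
proof -
 let ?q0 = "%\<mu>. \<mu> \<Otimes>\<^sub>M M"
 let ?q1 = "%t x t'. norm (wave t (fst x) (snd x) - wave t' (fst x) (snd x))"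
 define \<mu> where "\<mu> = density (lborel :: (real^'d) measure) (%xi. ennreal (weight s xi))"
 have m\<mu>: "sets \<mu> = sets borel" "space \<mu> = UNIV" unfolding \<mu>_def by auto
 have "weight_mass TYPE(real^'d) s < \<infinity>" by (rule weight_mass_finite) (use s in simp)
 then have fm: "finite_measure \<mu>"
  by (intro finite_measureI) (simp add: \<mu>_def emeasure_density weight_mass_def weight_def)
 interpret m\<mu>: finite_measure \<mu> by (rule fm)
 interpret P: pair_sigma_finite \<mu> M ..
 interpret PM: finite_measure "\<mu> \<Otimes>\<^sub>M M" by (intro finite_measure_pair_measure fm finite_measure_axioms)
 have sp: "sets (?q0 \<mu>) = sets (borel \<Otimes>\<^sub>M M)" using m\<mu>(1) by (intro sets_pair_measure_cong) auto
 have wm: "(%x. wave t (fst x) (snd x)) \<in> meas (?q0 \<mu>)" if "t \<in> {0..T}" for t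
  using wave_measurable[OF that] sp by (simp add: case_prod_unfold cong: measurable_cong_sets)
 have "\<exists>\<eta>>0. \<forall>t\<in>{0..T}. \<forall>t'\<in>{0..T}. \<bar>t - t'\<bar> < \<eta> --> (\<integral>x. (?q1 t x t')^2 \<partial>(?q0 \<mu>)) <= e"
 proof (rule PM.mean_square_modulus[OF wm _ _ e])
  fix x assume "x \<in> space (?q0 \<mu>)"
  then have x: "snd x \<in> space M" by (auto simp: space_pair_measure)
  show "continuous_on {0..T} (%t. wave t (fst x) (snd x))"
   unfolding wave_def using X_cont[OF x] S_cont[OF x] by (intro continuous_intros)
  show "norm (wave t (fst x) (snd x)) <= L" if "t \<in> {0..T}" for t
   unfolding wave_norm by (rule S_bound[OF that x])
 qed
 then obtain \<eta> where \<eta>: "\<eta> > 0" "!!t t'. t \<in> {0..T} ==> t' \<in> {0..T} ==> \<bar>t - t'\<bar> < \<eta> ==>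
   (\<integral>x. (?q1 t x t')^2 \<partial>(?q0 \<mu>)) <= e" by blast
 have "wave_dist s t t' <= ennreal e" if t: "t \<in> {0..T}" "t' \<in> {0..T}" "\<bar>t - t'\<bar> < \<eta>" for t t'
 proof -
  let ?g = "%x. (?q1 t x t')^2"
  note [measurable] = wm[OF t(1)] wm[OF t(2)]
  have gi: "integrable (?q0 \<mu>) ?g"
   using S_bound[OF t(1)] S_bound[OF t(2)]
   by (intro PM.integrable_norm_diff_sq[where C=L]) (auto simp: wave_norm space_pair_measure)
  have gm: "(%x. ennreal (?g x)) \<in> meas (?q0 \<mu>)" by measurable
  have gm': "(%x. ennreal (?g x)) \<in> meas (borel \<Otimes>\<^sub>M M)" using gm sp by (simp cong: measurable_cong_sets)
  have im: "(%xi. \<integral>\<^sup>+w. ennreal (?g (xi, w)) \<partial>M) \<in> meas borel"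
   by (rule borel_measurable_nn_integral) (use gm' in \<open>simp add: case_prod_unfold\<close>)
  have "wave_dist s t t' = (\<integral>\<^sup>+xi. ennreal (weight s xi) * (\<integral>\<^sup>+w. ennreal (?g (xi, w)) \<partial>M) \<partial>lborel)"
   unfolding wave_dist_def by (simp add: mult.commute)
  also have "... = (\<integral>\<^sup>+xi. (\<integral>\<^sup>+w. ennreal (?g (xi, w)) \<partial>M) \<partial>\<mu>)"
   unfolding \<mu>_def by (rule nn_integral_density[symmetric]) (use im in auto)
  also have "... = (\<integral>\<^sup>+x. ennreal (?g x) \<partial>(?q0 \<mu>))" by (rule nn_integral_fst[OF gm])
  also have "... = ennreal (\<integral>x. ?g x \<partial>(?q0 \<mu>))" by (rule nn_integral_eq_integral[OF gi]) simp
  also have "... <= ennreal e" by (intro ennreal_leI \<eta>(2) t)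
  finally show ?thesis .
 qed
 then show ?thesis using \<eta>(1) by blast
qed

text \<open>A difference of two point functionals is again one, over the disjoint sum of the index
  sets with the second coefficients negated. No sites have to be matched.\<close>

definition diff_energy :: "real => 'i set => ('i => real) => ('i => real) => 'j set => ('j => real) => ('j => real) => 'w => ennreal" where
 "diff_energy s A p q B p' q' w = energy s (A <+> B) (case_sum (site p w) (site p' w)) (case_sum (coeff p q w) (%j. - coeff p' q' w j))"

text \<open>The isometry for differences is used at each frequency; only overlapping cells count,
  each pair contributes at most e, and the overlaps add up to the total length.\<close>

lemma diff_energy_expectation:
 assumes pq: "!!i. i \<in> A ==> 0 <= p i \<and> p i <= q i \<and> q i <= T" and A: "tiling A p q J"
  and pq': "!!i. i \<in> B ==> 0 <= p' i \<and> p' i <= q' i \<and> q' i <= T" and B: "tiling B p' q' J"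
  and close: "!!i j. i \<in> A ==> j \<in> B ==> {p i..<q i} \<inter> {p' j..<q' j} ~= {} ==> wave_dist s (p i) (p' j) <= ennreal e" and e: "e >= 0"
 shows "(%w. diff_energy s A p q B p' q' w) \<in> meas M" (is ?C1)
  "(\<integral>\<^sup>+w. diff_energy s A p q B p' q' w \<partial>M) <= ennreal (e * (\<Sum>i\<in>A. q i - p i))" (is ?C2)
proof -
 let ?c = "%xi k w. simple_integral A p q (%i. cos_row xi k (p i)) w - simple_integral B p' q' (%i. cos_row xi k (p' i)) w"
 let ?s = "%xi k w. simple_integral A p q (%i. sin_row xi k (p i)) w - simple_integral B p' q' (%i. sin_row xi k (p' i)) w"
 let ?q0 = "%xi. \<Sum>k\<in>UNIV. expectation (%w. (?c xi k w)^2) + expectation (%w. (?s xi k w)^2)"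
 let ?q1 = "%xi w. \<Sum>k\<in>UNIV. (?c xi k w)^2 + (?s xi k w)^2"
 have fin: "finite A" "finite B" using A B unfolding tiling_def by auto
 have pt: "p i \<in> {0..T}" if "i \<in> A" for i using pq[OF that] by auto
 have pt': "p' i \<in> {0..T}" if "i \<in> B" for i using pq'[OF that] by auto
 define g where "g xi w = ennreal ((?q1 xi w) * weight s xi)" for xi w
 note [measurable] = simple_integral_row_measurable[OF pq, unfolded case_prod_unfold] simple_integral_row_measurable[OF pq', unfolded case_prod_unfold]
 have "(%z. g (fst z) (snd z)) \<in> meas (borel \<Otimes>\<^sub>M M)" unfolding g_def by measurable
 then have g: "case_prod g \<in> meas (lborel \<Otimes>\<^sub>M M)" by (intro borel_lborel_pair_measurable) (simp add: case_prod_unfold)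
 have E: "diff_energy s A p q B p' q' w = (\<integral>\<^sup>+xi. g xi w \<partial>lborel)" for w
  unfolding diff_energy_def energy_re_im g_def weight_def
  by (simp add: sum.Plus[OF fin] sum_negf coeff_rows)
 interpret P: pair_sigma_finite lborel M ..
 have g': "(%(w, xi). g xi w) \<in> meas (M \<Otimes>\<^sub>M lborel)" using measurable_pair_swap[OF g] by (simp add: case_prod_unfold)
 show ?C1
  unfolding E by (rule lborel.borel_measurable_nn_integral[OF g'])
 let ?o = "%i j. overlap (p i) (q i) (p' j) (q' j)"
 have o0: "0 <= ?o i j" for i j unfolding overlap_def by simp
 let ?W = "%xi i j. \<integral>\<^sup>+w. ennreal ((norm (wave (p i) xi w - wave (p' j) xi w))^2) \<partial>M"
 have one: "(\<integral>\<^sup>+w. g xi w \<partial>M) = (\<Sum>i\<in>A. \<Sum>j\<in>B. ennreal (?o i j) * (?W xi i j * ennreal (weight s xi)))" for xi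
 proof -
  note Ic = simple_integral_diff_isometry[OF row_adapted_family(1)[OF pq] A row_adapted_family(1)[OF pq'] B]
  note Is = simple_integral_diff_isometry[OF row_adapted_family(2)[OF pq] A row_adapted_family(2)[OF pq'] B]
  have ci: "integrable M (%w. (?c xi k w)^2)" and si: "integrable M (%w. (?s xi k w)^2)" for k
   using Ic(1)[of xi k xi k] Is(1)[of xi k xi k] by auto
  have "(\<integral>\<^sup>+w. g xi w \<partial>M) = ennreal (expectation (%w. (?q1 xi w) * weight s xi))"
   unfolding g_def using ci si by (intro nn_integral_eq_integral) (auto intro!: Bochner_Integration.integrable_sum mult_nonneg_nonneg sum_nonneg weight_nonneg)
  also have "expectation (%w. (?q1 xi w) * weight s xi)
   = (?q0 xi) * weight s xi"
   using ci si by (simp add: Bochner_Integration.integral_sum Bochner_Integration.integral_add)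
  also have "(?q0 xi)
   = (\<Sum>i\<in>A. \<Sum>j\<in>B. ?o i j * expectation (%w. (norm (wave (p i) xi w - wave (p' j) xi w))^2))"
  proof -
   let ?ec = "%k i j. expectation (%w. (norm (cos_row xi k (p i) w - cos_row xi k (p' j) w))^2)"
   let ?es = "%k i j. expectation (%w. (norm (sin_row xi k (p i) w - sin_row xi k (p' j) w))^2)"
   have "(?q0 xi)
    = (\<Sum>k\<in>UNIV. \<Sum>i\<in>A. \<Sum>j\<in>B. ?o i j * (?ec k i j + ?es k i j))"
    using Ic(2)[of xi _ xi] Is(2)[of xi _ xi] by (simp add: sum.distrib distrib_left)
   also have "... = (\<Sum>i\<in>A. \<Sum>j\<in>B. \<Sum>k\<in>UNIV. ?o i j * (?ec k i j + ?es k i j))"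
    by (subst sum.swap) (intro sum.cong refl sum.swap)
   also have "... = (\<Sum>i\<in>A. \<Sum>j\<in>B. ?o i j * expectation (%w. (norm (wave (p i) xi w - wave (p' j) xi w))^2))"
   proof (intro sum.cong refl)
    fix i j assume i: "i \<in> A" and j: "j \<in> B"
    have m: "cos_row xi k (p i) \<in> meas M" "sin_row xi k (p i) \<in> meas M"
     "cos_row xi k (p' j) \<in> meas M" "sin_row xi k (p' j) \<in> meas M" for k
     using F_measurable_M[OF row_adapted(1)[OF pt[OF i]]] F_measurable_M[OF row_adapted(2)[OF pt[OF i]]] pt[OF i]
      F_measurable_M[OF row_adapted(1)[OF pt'[OF j]]] F_measurable_M[OF row_adapted(2)[OF pt'[OF j]]] pt'[OF j] by auto
    have i1: "integrable M (%w. (norm (cos_row xi k (p i) w - cos_row xi k (p' j) w))^2)"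
     "integrable M (%w. (norm (sin_row xi k (p i) w - sin_row xi k (p' j) w))^2)" for k
     by (rule integrable_norm_diff_sq[where C=L], rule m, rule m, erule row_bound[OF pt[OF i]], erule row_bound[OF pt'[OF j]])+
    show "(\<Sum>k\<in>UNIV. ?o i j * (?ec k i j + ?es k i j)) = ?o i j * expectation (%w. (norm (wave (p i) xi w - wave (p' j) xi w))^2)"
     unfolding wave_diff_rows using i1 by (simp add: sum_distrib_left Bochner_Integration.integral_sum Bochner_Integration.integral_add)
   qed
   finally show ?thesis .
  qed
  also have "ennreal ((\<Sum>i\<in>A. \<Sum>j\<in>B. ?o i j * expectation (%w. (norm (wave (p i) xi w - wave (p' j) xi w))^2)) * weight s xi)
   = (\<Sum>i\<in>A. \<Sum>j\<in>B. ennreal (?o i j) * (ennreal (expectation (%w. (norm (wave (p i) xi w - wave (p' j) xi w))^2)) * ennreal (weight s xi)))"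
  proof -
   have nn: "0 <= ?o i j * (expectation (%w. (norm (wave (p i) xi w - wave (p' j) xi w))^2) * weight s xi)" for i j
    using o0 weight_nonneg by (intro mult_nonneg_nonneg) auto
   have t: "ennreal (?o i j) * (ennreal (expectation (%w. (norm (wave (p i) xi w - wave (p' j) xi w))^2)) * ennreal (weight s xi))
     = ennreal (?o i j * (expectation (%w. (norm (wave (p i) xi w - wave (p' j) xi w))^2) * weight s xi))" for i j
    by (simp add: ennreal_mult[symmetric] o0 weight_nonneg)
   show ?thesis unfolding t using nn by (simp add: sum_ennreal sum_nonneg sum_distrib_right mult.assoc)
  qed
  also have "... = (\<Sum>i\<in>A. \<Sum>j\<in>B. ennreal (?o i j) * (?W xi i j * ennreal (weight s xi)))"
  proof (intro sum.cong refl arg_cong2[where f="(*)"])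
   fix i j assume i: "i \<in> A" and j: "j \<in> B"
   have [measurable]: "wave (p i) xi \<in> meas M" "wave (p' j) xi \<in> meas M"
    using measurable_compose[OF _ wave_measurable[OF pt[OF i]], of "%w. (xi, w)" M] measurable_compose[OF _ wave_measurable[OF pt'[OF j]], of "%w. (xi, w)" M] by simp_all
   show "ennreal (expectation (%w. (norm (wave (p i) xi w - wave (p' j) xi w))^2)) = ?W xi i j"
    by (rule nn_integral_eq_integral[symmetric], rule integrable_norm_diff_sq[where C=L])
     (auto simp: wave_norm S_bound[OF pt[OF i]] S_bound[OF pt'[OF j]])
  qed
  finally show ?thesis .
 qed
 have Wm: "(%xi. ?W xi i j) \<in> meas borel" if i: "i \<in> A" and j: "j \<in> B" for i j
 proof (rule borel_measurable_nn_integral)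
  note [measurable] = wave_measurable[OF pt[OF i], unfolded case_prod_unfold] wave_measurable[OF pt'[OF j], unfolded case_prod_unfold]
  show "(%(xi, w). ennreal ((norm (wave (p i) xi w - wave (p' j) xi w))^2)) \<in> meas (borel \<Otimes>\<^sub>M M)"
   unfolding case_prod_unfold by measurable
 qed
 have "(\<integral>\<^sup>+w. diff_energy s A p q B p' q' w \<partial>M) = (\<integral>\<^sup>+xi. \<integral>\<^sup>+w. g xi w \<partial>M \<partial>lborel)"
  unfolding E by (rule P.Fubini'[OF g])
 also have "... = (\<integral>\<^sup>+xi. (\<Sum>i\<in>A. \<Sum>j\<in>B. ennreal (?o i j) * (?W xi i j * ennreal (weight s xi))) \<partial>lborel)"
  unfolding one ..
 also have "... = (\<Sum>i\<in>A. \<Sum>j\<in>B. ennreal (?o i j) * wave_dist s (p i) (p' j))"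
 proof -
  have "(\<integral>\<^sup>+xi. (\<Sum>i\<in>A. \<Sum>j\<in>B. ennreal (?o i j) * (?W xi i j * ennreal (weight s xi))) \<partial>lborel)
   = (\<Sum>i\<in>A. \<integral>\<^sup>+xi. (\<Sum>j\<in>B. ennreal (?o i j) * (?W xi i j * ennreal (weight s xi))) \<partial>lborel)"
   by (rule nn_integral_sum) (use Wm in \<open>auto intro!: borel_measurable_sum\<close>)
  also have "... = (\<Sum>i\<in>A. \<Sum>j\<in>B. \<integral>\<^sup>+xi. ennreal (?o i j) * (?W xi i j * ennreal (weight s xi)) \<partial>lborel)"
   by (intro sum.cong refl nn_integral_sum) (use Wm in auto)
  also have "... = (\<Sum>i\<in>A. \<Sum>j\<in>B. ennreal (?o i j) * wave_dist s (p i) (p' j))"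
   unfolding wave_dist_def by (intro sum.cong refl nn_integral_cmult) (use Wm in auto)
  finally show ?thesis .
 qed
 also have "... <= (\<Sum>i\<in>A. \<Sum>j\<in>B. ennreal (?o i j) * ennreal e)"
 proof (intro sum_mono)
  fix i j assume i: "i \<in> A" and j: "j \<in> B"
  show "ennreal (?o i j) * wave_dist s (p i) (p' j) <= ennreal (?o i j) * ennreal e"
  \<comment> \<open>The closeness assumption speaks of overlapping cells only; for all other pairs
    the overlap is 0.\<close>
  proof (cases "{p i..<q i} \<inter> {p' j..<q' j} = {}")
   case True then show ?thesis by (simp only: overlap_def) simp
  next
   case False then show ?thesis by (intro mult_left_mono close i j) auto
  qed
 qed
 also have "... = ennreal (e * (\<Sum>i\<in>A. q i - p i))"
 proof -
  have "(\<Sum>j\<in>B. ?o i j) = q i - p i" if i: "i \<in> A" for i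
   using A i pq[OF i] by (intro tiling_sum_overlap[OF B]) (auto simp: tiling_def)
  then have "(\<Sum>i\<in>A. \<Sum>j\<in>B. ?o i j * e) = (\<Sum>i\<in>A. (q i - p i) * e)"
   by (intro sum.cong refl) (simp add: sum_distrib_right[symmetric])
  then have "(\<Sum>i\<in>A. \<Sum>j\<in>B. ?o i j * e) = e * (\<Sum>i\<in>A. q i - p i)"
   by (simp add: sum_distrib_left mult.commute)
  moreover have "(\<Sum>i\<in>A. \<Sum>j\<in>B. ennreal (?o i j) * ennreal e) = ennreal (\<Sum>i\<in>A. \<Sum>j\<in>B. ?o i j * e)"
   by (simp add: ennreal_mult[symmetric] o0 e sum_ennreal sum_nonneg)
  ultimately show ?thesis by simp
 qed
 finally show ?C2 .
qed

end

section \<open>The approximation scheme\<close>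

text \<open>The norm of a matrix here is the Euclidean norm of its rows' norms, so Cauchy-Schwarz
  over the rows suffices.\<close>

lemma norm_vector_matrix_mult_le: "norm ((x::real^'n) v* (A::real^'m^'n)) <= norm x * norm A"
proof -
 have e: "x v* A = (\<Sum>i\<in>UNIV. x $ i *\<^sub>R A $ i)"
  by (simp add: vector_matrix_mult_def vec_eq_iff mult.commute)
 have "norm (x v* A) <= (\<Sum>i\<in>UNIV. \<bar>x $ i\<bar> * norm (A $ i))"
  unfolding e by (rule order_trans[OF norm_sum]) simp
 also have "... <= sqrt (\<Sum>i\<in>UNIV. \<bar>x $ i\<bar>\<^sup>2) * sqrt (\<Sum>i\<in>UNIV. (norm (A $ i))^2)"
  by (rule sum_prod_le_sqrt) simp
 also have "... = norm x * norm A" by (simp add: norm_vec_def L2_set_def)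
 finally show ?thesis .
qed

lemma bounded_bilinear_vector_matrix: "bounded_bilinear (%(x::real^'n) (A::real^'m^'n). x v* A)"
proof (rule bounded_bilinear.intro)
 show "\<exists>K. \<forall>(x::real^'n) (A::real^'m^'n). norm (x v* A) <= norm x * norm A * K"
  using norm_vector_matrix_mult_le by (intro exI[of _ 1]) auto
qed (simp_all add: vector_matrix_mult_def vec_eq_iff sum.distrib algebra_simps sum_distrib_left)

section \<open>Dyadic grids and the approximating functionals\<close>

context driven
begin

definition pnt :: "nat => nat => real" where "pnt n i = real i * (T / 2 ^ n)"
definition nxt :: "nat => nat => real" where "nxt n i = (real i + 1) * (T / 2 ^ n)"
text \<open>The fine cells of level n that make up the coarse cell j of level l; meaningful for l <=
  n.\<close>

definition grid :: "nat => nat => nat => nat set" where "grid n l j = {j * 2 ^ (n - l)..<(j + 1) * 2 ^ (n - l)}"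

lemma pnt_nxt_diff: "nxt n i - pnt n i = T / 2 ^ n"
 unfolding pnt_def nxt_def by (simp add: distrib_right add_divide_distrib)

lemma pnt_nxt_bounds: "i < 2 ^ n ==> 0 <= pnt n i \<and> pnt n i <= nxt n i \<and> nxt n i <= T"
proof -
 assume "i < 2 ^ n"
 then have "Suc i <= 2 ^ n" by simp
 then have "real (Suc i) <= real (2 ^ n)" by (rule of_nat_mono)
 then have "real i + 1 <= 2 ^ n" by simp
 then have "(real i + 1) * (T / 2 ^ n) <= 2 ^ n * (T / 2 ^ n)" using T_pos by (intro mult_right_mono) auto
 moreover have "0 < T / 2 ^ n" using T_pos by simp
 then have "pnt n i <= nxt n i" using pnt_nxt_diff[of n i] by linarith
 moreover have "0 <= pnt n i" unfolding pnt_def using T_pos by simp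
 ultimately show ?thesis unfolding nxt_def by simp
qed

lemma dyadic_coarse: "l <= n ==> T / 2 ^ l = 2 ^ (n - l) * (T / 2 ^ n)"
proof -
 assume "l <= n"
 then have "(2::real) ^ n = 2 ^ l * 2 ^ (n - l)" by (simp add: power_add[symmetric])
 then show ?thesis by simp
qed

lemma pnt_coarse: "l <= n ==> pnt l j = real (j * 2 ^ (n - l)) * (T / 2 ^ n)"
 unfolding pnt_def by (simp add: dyadic_coarse[of l n])

lemma nxt_coarse: "l <= n ==> nxt l j = real ((j + 1) * 2 ^ (n - l)) * (T / 2 ^ n)"
 unfolding nxt_def by (simp add: dyadic_coarse[of l n] distrib_right)

lemma grid_less: "l <= n ==> j < 2 ^ l ==> i \<in> grid n l j ==> i < 2 ^ n"
proof -
 assume a: "l <= n" "j < 2 ^ l" "i \<in> grid n l j"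
 have "i < (j + 1) * 2 ^ (n - l)" using a unfolding grid_def by simp
 also have "... <= 2 ^ l * 2 ^ (n - l)" using a by (intro mult_right_mono) auto
 also have "... = 2 ^ n" using a by (simp add: power_add[symmetric])
 finally show "i < 2 ^ n" .
qed

lemma grid_bounds: "l <= n ==> j < 2 ^ l ==> i \<in> grid n l j ==> 0 <= pnt n i \<and> pnt n i <= nxt n i \<and> nxt n i <= T"
 using grid_less pnt_nxt_bounds by blast

lemma dyadic_disjoint: "disjoint_family_on (%i. {pnt n i..<nxt n i}) A"
 unfolding pnt_def nxt_def by (rule grid_tiling(1)[of "T / 2 ^ n" 0 0]) (use T_pos in auto)

lemma dyadic_tiling:
 assumes "l <= n"
 shows "tiling (grid n l j) (pnt n) (nxt n) {pnt l j..<nxt l j}"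
 unfolding tiling_def
proof (intro conjI dyadic_disjoint)
 show "finite (grid n l j)" unfolding grid_def by simp
 show "\<forall>i\<in>grid n l j. pnt n i <= nxt n i" using pnt_nxt_diff T_pos by (metis diff_ge_0_iff_ge divide_nonneg_pos less_imp_le zero_less_power zero_less_numeral)
 show "(\<Union>i\<in>grid n l j. {pnt n i..<nxt n i}) = {pnt l j..<nxt l j}"
  unfolding pnt_coarse[OF assms] nxt_coarse[OF assms] grid_def unfolding pnt_def nxt_def
  by (rule grid_tiling(2)) (use T_pos in auto)
qed

lemma grid_length: "l <= n ==> (\<Sum>i\<in>grid n l j. nxt n i - pnt n i) = T / 2 ^ l"
 unfolding pnt_nxt_diff grid_def by (simp add: dyadic_coarse[of l n])

text \<open>Two levels are kept apart: n fixes the sites and Brownian increments, l the intervals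
  over which \<open>\<phi>\<close> is averaged in time. The scheme changes one of them at a
  time.\<close>

definition approx :: "nat => nat => (real \<times> (real^'d) => real^'d) => 'w => real" where
 "approx n l \<phi> w = (\<Sum>j<2 ^ l. (1 / (T / 2 ^ l)) * (LINT u:{pnt l j..<nxt l j}|lborel.
   point_functional (grid n l j) (site (pnt n) w) (coeff (pnt n) (nxt n) w) (%y. \<phi> (u, y))))"

definition grid_energy :: "real => nat => nat => 'w => ennreal" where
 "grid_energy s n l w = (\<Sum>j<2 ^ l. energy s (grid n l j) (site (pnt n) w) (coeff (pnt n) (nxt n) w))"

definition grid_diff_energy :: "real => nat => nat => nat => 'w => ennreal" where
 "grid_diff_energy s n n' l w = (\<Sum>j<2 ^ l. diff_energy s (grid n' l j) (pnt n') (nxt n') (grid n l j) (pnt n) (nxt n) w)"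

lemma point_functional_Plus:
 assumes "finite A" "finite B"
 shows "point_functional (A <+> B) (case_sum x x') (case_sum e (%j. - e' j)) \<psi> = point_functional A x e \<psi> - point_functional B x' e' \<psi>"
 unfolding point_functional_def by (simp add: sum.Plus[OF assms] sum_negf)

lemma finite_grid[simp]: "finite (grid n l j)" unfolding grid_def by simp

context
 fixes a c :: real and \<phi> :: "real \<times> (real^'d) => real^'d"
 assumes tf: "test_fun a c \<phi>" and U: "a < 0" "T < c"
begin

lemma dyadic_in_U: "j < 2 ^ l ==> {pnt l j..<nxt l j} \<subseteq> {a<..<c}"
 using pnt_nxt_bounds[of j l] U by auto

lemma approx_grid_change:
 assumes l: "l <= n" "l <= n'" and th: "th > 0"
 shows "ennreal (2 * \<bar>approx n' l \<phi> w - approx n l \<phi> w\<bar>)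
  <= ennreal th * grid_diff_energy s2 n n' l w + ennreal (1 / (T / 2 ^ l * th)) * Hbold_norm2 a c s1 s2 \<phi>"
proof -
 let ?x = "case_sum (site (pnt n') w) (site (pnt n) w)"
 let ?e = "case_sum (coeff (pnt n') (nxt n') w) (%j. - coeff (pnt n) (nxt n) w j)"
 have "approx n' l \<phi> w - approx n l \<phi> w = (\<Sum>j<2 ^ l. (1 / (T / 2 ^ l)) * (LINT u:{pnt l j..<nxt l j}|lborel.
   point_functional (grid n' l j <+> grid n l j) ?x ?e (%y. \<phi> (u, y))))"
  unfolding approx_def point_functional_Plus[OF finite_grid finite_grid] sum_subtractf[symmetric]
  by (intro sum.cong refl) (subst set_integral_diff, auto intro!: point_functional_slice_integrable[OF tf] simp: right_diff_distrib diff_divide_distrib)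
 then show ?thesis unfolding grid_diff_energy_def diff_energy_def
  using averaged_functionals_bound[OF tf, of "{..<2 ^ l}" "%j. grid n' l j <+> grid n l j" "T / 2 ^ l" "nxt l" "pnt l" th "%_. ?x" "%_. ?e" s2 s1]
   dyadic_in_U dyadic_disjoint th T_pos by (simp add: pnt_nxt_diff)
qed

lemma approx_bound:
 assumes l: "l <= n" and th: "th > 0"
 shows "ennreal (2 * \<bar>approx n l \<phi> w\<bar>)
  <= ennreal th * grid_energy s2 n l w + ennreal (1 / (T / 2 ^ l * th)) * Hbold_norm2 a c s1 s2 \<phi>"
 unfolding grid_energy_def approx_def
 using averaged_functionals_bound[OF tf, of "{..<2 ^ l}" "grid n l" "T / 2 ^ l" "nxt l" "pnt l" th "%_. site (pnt n) w" "%_. coeff (pnt n) (nxt n) w" s2 s1]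
  dyadic_in_U dyadic_disjoint th T_pos by (simp add: pnt_nxt_diff)

lemma grid_split:
 assumes "Suc l <= n"
 shows "point_functional (grid n l j) x e \<psi> = point_functional (grid n (Suc l) (2 * j)) x e \<psi> + point_functional (grid n (Suc l) (2 * j + 1)) x e \<psi>"
proof -
 have e: "n - l = Suc (n - Suc l)" using assms by simp
 have "grid n l j = grid n (Suc l) (2 * j) \<union> grid n (Suc l) (2 * j + 1)" "grid n (Suc l) (2 * j) \<inter> grid n (Suc l) (2 * j + 1) = {}"
  unfolding grid_def e by (auto simp: algebra_simps)
 then show ?thesis unfolding point_functional_def by (simp add: sum.union_disjoint)
qed

text \<open>With n fixed, the functional of a coarse cell splits into those of its two halves. Both
  levels then use the same point functionals, and only the averaging interval differs: a cell versus
  its parent.\<close>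

lemma approx_level_change:
 assumes l: "Suc l <= n" and th: "th > 0" and s1: "s1 > 0"
 shows "ennreal (2 * \<bar>approx n (Suc l) \<phi> w - approx n l \<phi> w\<bar>)
  <= ennreal th * grid_energy s2 n (Suc l) w + ennreal ((T / 2 ^ l) powr (1 + 2 * s1) / ((T / 2 ^ l) * (T / 2 ^ Suc l) * th)) * Hbold_norm2 a c s1 s2 \<phi>"
proof -
 let ?f = "%j u. point_functional (grid n (Suc l) j) (site (pnt n) w) (coeff (pnt n) (nxt n) w) (%y. \<phi> (u, y))"
 have "approx n l \<phi> w = (\<Sum>j<2 ^ l. (1 / (T / 2 ^ l)) * (LINT u:{pnt l j..<nxt l j}|lborel. ?f (2 * j) u) + (1 / (T / 2 ^ l)) * (LINT u:{pnt l j..<nxt l j}|lborel. ?f (2 * j + 1) u))"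
  unfolding approx_def grid_split[OF l]
  by (intro sum.cong refl) (subst set_integral_add, auto intro!: point_functional_slice_integrable[OF tf] simp: distrib_left add_divide_distrib)
 \<comment> \<open>The sum is reindexed by the children; \<open>j div 2\<close> is the parent of
   child j.\<close>
 also have "... = (\<Sum>j<2 * 2 ^ l. (1 / (T / 2 ^ l)) * (LINT u:{pnt l (j div 2)..<nxt l (j div 2)}|lborel. ?f j u))"
  unfolding sum_double_range by (intro sum.cong refl) simp
 finally have "approx n (Suc l) \<phi> w - approx n l \<phi> w = (\<Sum>j<2 ^ Suc l. (1 / (T / 2 ^ Suc l)) * (LINT u:{pnt (Suc l) j..<nxt (Suc l) j}|lborel. ?f j u)
    - (1 / (T / 2 ^ l)) * (LINT u:{pnt l (j div 2)..<nxt l (j div 2)}|lborel. ?f j u))"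
  unfolding approx_def by (simp add: sum_subtractf)
 moreover have sub: "{pnt (Suc l) j..<nxt (Suc l) j} \<subseteq> {pnt l (j div 2)..<nxt l (j div 2)}" for j
 proof -
  have h: "T / 2 ^ l = 2 * (T / 2 ^ Suc l)" by simp
  have "j div 2 * 2 <= j" "j + 1 <= (j div 2 + 1) * 2" by simp_all
  then have "real (j div 2 * 2) <= real j" "real (j + 1) <= real ((j div 2 + 1) * 2)" by (blast intro: of_nat_mono)+
  then have 1: "real (j div 2) * 2 <= real j" "real j + 1 <= (real (j div 2) + 1) * 2" by simp_all
  have "pnt l (j div 2) = (real (j div 2) * 2) * (T / 2 ^ Suc l)" "nxt l (j div 2) = ((real (j div 2) + 1) * 2) * (T / 2 ^ Suc l)"
   unfolding pnt_def nxt_def h by (simp_all only: mult.assoc)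
  then have "pnt l (j div 2) <= pnt (Suc l) j" "nxt (Suc l) j <= nxt l (j div 2)"
   using mult_right_mono[OF 1(1), of "T / 2 ^ Suc l"] mult_right_mono[OF 1(2), of "T / 2 ^ Suc l"] T_pos
   unfolding pnt_def[of "Suc l"] nxt_def[of "Suc l"] by simp_all
  then show ?thesis by auto
 qed
 moreover have "j div 2 < 2 ^ l" if "j < 2 ^ Suc l" for j :: nat using that by auto
 ultimately show ?thesis unfolding grid_energy_def
  using averages_difference_bound[OF tf, of "{..<2 ^ Suc l}" "grid n (Suc l)" "T / 2 ^ l" "T / 2 ^ Suc l" s1 "%j. nxt l (j div 2)" "%j. pnt l (j div 2)" "nxt (Suc l)" "pnt (Suc l)" th
   "%_. site (pnt n) w" "%_. coeff (pnt n) (nxt n) w" s2]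
   dyadic_in_U[of "_ div 2" l] dyadic_disjoint th T_pos s1 by (simp add: pnt_nxt_diff)
qed

definition mean_field :: "nat => nat => real^'d => real^'d" where
 "mean_field l j x = (1 / (T / 2 ^ l)) *\<^sub>R (LINT u:{pnt l j..<nxt l j}|lborel. \<phi> (u, x))"

lemma mean_field_measurable[measurable]: "mean_field l j \<in> meas borel"
proof -
 have "(%z. indicat_real {pnt l j..<nxt l j} (snd z) *\<^sub>R \<phi> (snd z, fst z)) \<in> meas (borel \<Otimes>\<^sub>M borel)"
 proof -
  have [measurable]: "\<phi> \<in> meas (borel \<Otimes>\<^sub>M borel)" unfolding borel_prod by (rule test_fun_measurable[OF tf])
  show ?thesis by measurable
 qed
 then have "(%(x, u). indicat_real {pnt l j..<nxt l j} u *\<^sub>R \<phi> (u, x)) \<in> meas (borel \<Otimes>\<^sub>M lborel)"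
  by (simp add: case_prod_unfold cong: measurable_cong_sets)
 from lborel.borel_measurable_lebesgue_integral[OF this]
 show ?thesis unfolding mean_field_def set_lebesgue_integral_def by (intro borel_measurable_scaleR) auto
qed

lemma mean_field_near:
 assumes lip: "!!z h. norm (\<phi> (z + h) - \<phi> z) <= C * norm h" and C: "C >= 0" and t: "t \<in> {pnt l j..<nxt l j}"
 shows "norm (mean_field l j x - \<phi> (t, x)) <= C * (T / 2 ^ l)"
proof -
 let ?J = "{pnt l j..<nxt l j}" and ?h = "T / 2 ^ l"
 let ?q0 = "LINT u:?J|lborel. \<phi> (u, x) - \<phi> (t, x)"
 let ?q1 = "%u. \<phi> (u, x) - \<phi> (t, x)"
 have h: "?h > 0" using T_pos by simp
 have m: "measure lborel ?J = ?h" using t pnt_nxt_diff[of l j] by simp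
 have ci: "set_integrable lborel ?J (%_. k)" for k :: "real^'d"
  unfolding set_integrable_def using t by (intro integrable_scaleR_left integrable_real_indicator) auto
 have "(LINT u:?J|lborel. \<phi> (t, x)) = ?h *\<^sub>R \<phi> (t, x)"
  using t m by (simp add: set_lebesgue_integral_def)
 then have "mean_field l j x - \<phi> (t, x) = (1 / ?h) *\<^sub>R ?q0"
  unfolding mean_field_def using h slice_integrable[OF tf] ci
  by (subst set_integral_diff) (auto simp: scaleR_diff_right)
 moreover have "norm ?q0 <= C * ?h * ?h"
 proof -
  have "norm ?q0 <= (LINT u:?J|lborel. norm (?q1 u))"
   by (rule set_integral_norm_bound) (intro set_integral_diff slice_integrable[OF tf] ci)
  also have "... <= (LINT u:?J|lborel. C * ?h)"
  proof (rule set_integral_mono)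
   show "set_integrable lborel ?J (%u. norm (?q1 u))"
    by (intro set_integrable_norm set_integral_diff slice_integrable[OF tf] ci)
   show "set_integrable lborel ?J (%u. C * ?h)" unfolding set_integrable_def using t by (intro integrable_scaleR_left integrable_real_indicator) auto
   fix u assume u: "u \<in> ?J"
   have "norm (\<phi> ((t, x) + (u - t, 0)) - \<phi> (t, x)) <= C * norm (u - t, 0 :: real^'d)" by (rule lip)
   also have "... <= C * ?h" using u t pnt_nxt_diff[of l j] C by (intro mult_left_mono) (auto simp: norm_Pair)
   finally show "norm (?q1 u) <= C * ?h" by simp
  qed
  also have "... = C * ?h * ?h" using t m by (simp add: set_lebesgue_integral_def)
  finally show ?thesis .
 qed
 ultimately show ?thesis using h by (simp add: divide_simps mult_ac)
qed

text \<open>Moving S to the side of the averaged test function exhibits \<open>approx\<close> as a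
  simple stochastic integral over pairs of a coarse cell and one of its fine cells, so that the
  isometry can later compare it with Ito sums.\<close>

definition approx_integrand :: "nat => nat => nat \<times> nat => 'w => real^'m" where
 "approx_integrand n l z w = mean_field l (fst z) (X (pnt n (snd z)) w) v* S (pnt n (snd z)) w"

lemma approx_eq_simple_integral:
 "approx n l \<phi> w = simple_integral (SIGMA j:{..<2 ^ l}. grid n l j) (%z. pnt n (snd z)) (%z. nxt n (snd z)) (approx_integrand n l) w"
proof -
 have "approx n l \<phi> w = (\<Sum>j<2 ^ l. \<Sum>i\<in>grid n l j. coeff (pnt n) (nxt n) w i \<bullet> mean_field l j (site (pnt n) w i))"
  unfolding approx_def point_functional_slice_integral[OF tf] mean_field_def by (simp add: sum_distrib_left sum_divide_distrib)
 also have "... = (\<Sum>j<2 ^ l. \<Sum>i\<in>grid n l j. approx_integrand n l (j, i) w \<bullet> inc (pnt n i) (nxt n i) w)"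
  unfolding approx_integrand_def coeff_def site_def fst_conv snd_conv dot_lmul_matrix by (intro sum.cong refl inner_commute)
 finally show ?thesis unfolding simple_integral_def by (simp add: sum.Sigma case_prod_unfold)
qed

lemma approx_tiling:
 assumes l: "l <= n"
 shows "tiling (SIGMA j:{..<2 ^ l}. grid n l j) (%z. pnt n (snd z)) (%z. nxt n (snd z)) {0..<T}"
 unfolding tiling_def
proof (intro conjI)
 show "finite (SIGMA j:{..<2 ^ l}. grid n l j)" by auto
 show "\<forall>i\<in>SIGMA j:{..<2 ^ l}. grid n l j. pnt n (snd i) <= nxt n (snd i)" using grid_bounds[OF l] by auto
 show "disjoint_family_on (%i. {pnt n (snd i)..<nxt n (snd i)}) (SIGMA j:{..<2 ^ l}. grid n l j)"
  unfolding disjoint_family_on_def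
 proof (intro ballI impI)
  fix z z' assume z: "z \<in> (SIGMA j:{..<2 ^ l}. grid n l j)" "z' \<in> (SIGMA j:{..<2 ^ l}. grid n l j)" "z ~= z'"
  have "snd z ~= snd z'"
  proof
   assume e: "snd z = snd z'"
   \<comment> \<open>A fine index determines its coarse cell, so distinct pairs have distinct fine
     indices.\<close>
   have "snd z div 2 ^ (n - l) = fst z" if "z \<in> (SIGMA j:{..<2 ^ l}. grid n l j)" for z
    using that unfolding grid_def by (auto intro!: div_nat_eqI simp: mult.commute)
   with z e show False by (metis prod_eqI)
  qed
  then show "{pnt n (snd z)..<nxt n (snd z)} \<inter> {pnt n (snd z')..<nxt n (snd z')} = {}"
   using dyadic_disjoint[of n UNIV] unfolding disjoint_family_on_def by blast
 qed
 have "(\<Union>i\<in>SIGMA j:{..<2 ^ l}. grid n l j. {pnt n (snd i)..<nxt n (snd i)}) = (\<Union>j\<in>{..<2 ^ l}. \<Union>i\<in>grid n l j. {pnt n i..<nxt n i})"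
  by (intro set_eqI) (simp only: UN_iff mem_Sigma_iff Bex_def split_paired_Ex fst_conv snd_conv, blast)
 also have "... = (\<Union>j\<in>{0..<2 ^ l}. {pnt l j..<nxt l j})" using dyadic_tiling[OF l] unfolding tiling_def by (simp add: atLeast0LessThan)
 also have "... = {0..<T}"
  unfolding pnt_def nxt_def by (subst grid_tiling(2)) (use T_pos in auto)
 finally show "(\<Union>i\<in>SIGMA j:{..<2 ^ l}. grid n l j. {pnt n (snd i)..<nxt n (snd i)}) = {0..<T}" .
qed

text \<open>The average extends over times after \<open>pnt n i\<close>, but it involves only the
  deterministic \<open>\<phi>\<close>; position and coefficient are taken at the present time, so
  nothing anticipates.\<close>

lemma approx_adapted:
 assumes l: "l <= n"
 shows "adapted_family (SIGMA j:{..<2 ^ l}. grid n l j) (%z. pnt n (snd z)) (%z. nxt n (snd z)) (approx_integrand n l)"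
 unfolding adapted_family_def
proof (intro ballI)
 fix z assume z: "z \<in> (SIGMA j:{..<2 ^ l}. grid n l j)"
 then have b: "0 <= pnt n (snd z)" "pnt n (snd z) <= nxt n (snd z)" "nxt n (snd z) <= T" using grid_bounds[OF l] by auto
 then have t: "pnt n (snd z) \<in> {0..T}" by auto
 note [measurable] = X_adapted[OF t] S_adapted[OF t]
 have m: "approx_integrand n l z \<in> meas (F (pnt n (snd z)))"
 proof -
  have "(%w. mean_field l (fst z) (X (pnt n (snd z)) w)) \<in> meas (F (pnt n (snd z)))" by measurable
  then have "(%w. \<Sum>k\<in>UNIV. mean_field l (fst z) (X (pnt n (snd z)) w) $ k *\<^sub>R S (pnt n (snd z)) w $ k) \<in> meas (F (pnt n (snd z)))" by measurable
  moreover have "x v* A = (\<Sum>k\<in>UNIV. x $ k *\<^sub>R A $ k)" for x :: "real^'d" and A :: "real^'m^'d"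
   by (simp add: vector_matrix_mult_def vec_eq_iff mult.commute)
  ultimately show ?thesis unfolding approx_integrand_def by simp
 qed
 obtain C where C: "C >= 0" "!!z h. norm (\<phi> (z + h) - \<phi> z) <= C * norm h" using test_fun_lipschitz[OF tf] by blast
 obtain B where B: "!!z. norm (\<phi> z) <= B" using pderivs_bounded[OF tf, of "[]"] by auto
 have "norm (approx_integrand n l z w) <= (B + C * (T / 2 ^ l)) * L" if w: "w \<in> space M" for w
 proof -
  have "0 < T / 2 ^ l" using T_pos by simp
  then have ne: "pnt l (fst z) \<in> {pnt l (fst z)..<nxt l (fst z)}" using pnt_nxt_diff[of l "fst z"] by auto
  have "norm (mean_field l (fst z) x) <= B + C * (T / 2 ^ l)" for x
   using mean_field_near[OF C(2,1) ne, of x] B[of "(pnt l (fst z), x)"] norm_triangle_sub[of "mean_field l (fst z) x" "\<phi> (pnt l (fst z), x)"] by linarith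
  then show ?thesis unfolding approx_integrand_def
   by (intro order_trans[OF norm_vector_matrix_mult_le] mult_mono S_bound[OF t w]) (auto intro: order_trans[OF norm_ge_zero])
 qed
 then show "0 <= pnt n (snd z) \<and> pnt n (snd z) <= nxt n (snd z) \<and> nxt n (snd z) <= T \<and> approx_integrand n l z \<in> meas (F (pnt n (snd z))) \<and>
   (\<exists>C. \<forall>w\<in>space M. norm (approx_integrand n l z w) <= C)"
  using b m by blast
qed

lemma approx_measurable: "l <= n ==> approx n l \<phi> \<in> meas M"
 using simple_integral_measurable[OF approx_adapted] unfolding approx_eq_simple_integral[abs_def] by blast

end

end

section \<open>Expected energies and almost sure summability of the scheme\<close>

context driven
begin

lemma grid_energy_measurable:
 assumes "l <= n"
 shows "grid_energy s n l \<in> meas M"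
 unfolding grid_energy_def using grid_bounds[OF assms] by (intro borel_measurable_sum energy_measurable) auto

lemma grid_energy_expectation:
 assumes l: "l <= n"
 shows "(\<integral>\<^sup>+w. grid_energy s n l w \<partial>M) <= ennreal (L^2 * T) * weight_mass TYPE(real^'d) s"
proof -
 let ?q0 = "L^2 * (T / 2 ^ l)"
 have "(\<integral>\<^sup>+w. grid_energy s n l w \<partial>M) = (\<Sum>j<2 ^ l. \<integral>\<^sup>+w. energy s (grid n l j) (site (pnt n) w) (coeff (pnt n) (nxt n) w) \<partial>M)"
  unfolding grid_energy_def using grid_bounds[OF l] by (intro nn_integral_sum energy_measurable) auto
 also have "... <= (\<Sum>j<(2::nat) ^ l. ennreal ?q0 * weight_mass TYPE(real^'d) s)"
 proof (rule sum_mono)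
  fix j :: nat assume "j \<in> {..<2 ^ l}"
  then have j: "j < 2 ^ l" by simp
  show "(\<integral>\<^sup>+w. energy s (grid n l j) (site (pnt n) w) (coeff (pnt n) (nxt n) w) \<partial>M) <= ennreal ?q0 * weight_mass TYPE(real^'d) s"
   using energy_expectation[OF grid_bounds[OF l j] dyadic_tiling[OF l], where s=s] unfolding grid_length[OF l] .
 qed
 also have "... = ennreal (L^2 * T) * weight_mass TYPE(real^'d) s"
 proof -
  have "of_nat (2 ^ l) * ennreal ?q0 = ennreal (2 ^ l * ?q0)"
   using T_pos by (subst ennreal_mult) (auto simp: ennreal_of_nat_eq_real_of_nat)
  also have "2 ^ l * ?q0 = L^2 * T" by simp
  finally show ?thesis by (simp add: mult.assoc[symmetric])
 qed
 finally show ?thesis .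
qed

text \<open>Cells that meet and are shorter than \<eta> have left end points closer than \<eta>, so
  the modulus of \<open>wave\<close> bounds every relevant pair.\<close>

lemma grid_diff_energy_expectation:
 assumes l: "l <= n" "l <= n'" and e: "e >= 0"
  and \<eta>: "!!t t'. t \<in> {0..T} ==> t' \<in> {0..T} ==> \<bar>t - t'\<bar> < \<eta> ==> wave_dist s t t' <= ennreal e"
  and n: "T / 2 ^ n < \<eta>" "T / 2 ^ n' < \<eta>"
 shows "grid_diff_energy s n n' l \<in> meas M" (is ?C1) "(\<integral>\<^sup>+w. grid_diff_energy s n n' l w \<partial>M) <= ennreal (e * T)"
proof -
 let ?q0 = "e * (T / 2 ^ l)"
 let ?q1 = "%n n'. \<integral>\<^sup>+w. grid_diff_energy s n n' l w \<partial>M"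
 have D: "(%w. diff_energy s (grid n' l j) (pnt n') (nxt n') (grid n l j) (pnt n) (nxt n) w) \<in> meas M \<and>
  (\<integral>\<^sup>+w. diff_energy s (grid n' l j) (pnt n') (nxt n') (grid n l j) (pnt n) (nxt n) w \<partial>M) <= ennreal ?q0" if j: "j < 2 ^ l" for j
 proof -
  have cl: "wave_dist s (pnt n' i) (pnt n i') <= ennreal e"
   if i: "i \<in> grid n' l j" "i' \<in> grid n l j" and ne: "{pnt n' i..<nxt n' i} \<inter> {pnt n i'..<nxt n i'} ~= {}" for i i'
  proof (rule \<eta>)
   show "pnt n' i \<in> {0..T}" using grid_bounds[OF l(2) j i(1)] by auto
   show "pnt n i' \<in> {0..T}" using grid_bounds[OF l(1) j i(2)] by auto
   obtain r where "r \<in> {pnt n' i..<nxt n' i}" "r \<in> {pnt n i'..<nxt n i'}" using ne by blast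
   then show "\<bar>pnt n' i - pnt n i'\<bar> < \<eta>" using n pnt_nxt_diff[of n' i] pnt_nxt_diff[of n i'] by auto
  qed
  show ?thesis
   using diff_energy_expectation[OF grid_bounds[OF l(2) j] dyadic_tiling[OF l(2)] grid_bounds[OF l(1) j] dyadic_tiling[OF l(1)] cl e]
   unfolding grid_length[OF l(2)] by blast
 qed
 show ?C1
  unfolding grid_diff_energy_def using D by (intro borel_measurable_sum) auto
 have "(?q1 n n') = (\<Sum>j<2 ^ l. \<integral>\<^sup>+w. diff_energy s (grid n' l j) (pnt n') (nxt n') (grid n l j) (pnt n) (nxt n) w \<partial>M)"
  unfolding grid_diff_energy_def using D by (intro nn_integral_sum) auto
 also have "... <= (\<Sum>j<(2::nat) ^ l. ennreal ?q0)"
  using D by (intro sum_mono) auto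
 also have "... = ennreal (e * T)"
 proof -
  have "(\<Sum>j<(2::nat) ^ l. ennreal ?q0) = ennreal (2 ^ l * ?q0)"
   using T_pos e by (subst ennreal_mult) (auto simp: ennreal_of_nat_eq_real_of_nat)
  also have "2 ^ l * ?q0 = e * T" by simp
  finally show ?thesis .
 qed
 finally show "(?q1 n n') <= ennreal (e * T)" .
qed

text \<open>A bound with parameter th * r becomes one with parameter th after r is given to the
  energy. Each level may thus choose its own balance between energy and norm while th stays common
  to all.\<close>

lemma ennreal_scaled_young:
 fixes y r k th :: real and E H :: ennreal
 assumes b: "ennreal (2 * \<bar>y\<bar>) <= ennreal (th * r) * E + ennreal (k / th) * H" and p: "th > 0" "r >= 0" "k >= 0"
 shows "ennreal (2 * \<bar>y\<bar>) <= (ennreal r * E + ennreal k) * (ennreal th + H / ennreal th)"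
proof -
 let ?q0 = "ennreal r * E + ennreal k"
 have 1: "ennreal (th * r) * E <= ?q0 * ennreal th"
 proof -
  have "ennreal (th * r) * E = (ennreal r * E) * ennreal th" using p by (simp add: ennreal_mult mult_ac)
  also have "... <= ?q0 * ennreal th" by (intro mult_right_mono) auto
  finally show ?thesis .
 qed
 have "ennreal (k / th) * H = ennreal k * (H / ennreal th)"
  using p by (simp add: divide_ennreal_def divide_inverse ennreal_mult inverse_ennreal mult_ac)
 also have "... <= ?q0 * (H / ennreal th)"
  by (simp add: distrib_right)
 finally have 2: "ennreal (k / th) * H <= ?q0 * (H / ennreal th)" .
 show ?thesis using b add_mono[OF 1 2] by (simp add: distrib_left)
qed

text \<open>The increments of the approximating functionals are summable, uniformly over the unit ball: halving the
 averaging intervals costs a factor \<open>2 powr (1/2 - s1)\<close> per level, and the spatial grids are refined fast enough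
 for the remaining increments to be summable as well.\<close>

lemma approx_scheme:
 assumes s1: "1/2 < s1" and s2: "s2 > real CARD('d) / 2"
 obtains \<nu> :: "nat => nat" and v :: "nat => 'w => ennreal" where
  "!!k. k < \<nu> k" "!!k. v k \<in> meas M" "AE w in M. (\<Sum>k. v k w) < \<infinity>"
  "!!a c \<phi> w th. test_fun a c \<phi> ==> a < 0 ==> T < c ==> th > 0 ==>
   ennreal (2 * \<bar>approx (\<nu> 0) 0 \<phi> w\<bar>) <= v 0 w * (ennreal th + Hbold_norm2 a c s1 s2 \<phi> / ennreal th)"
  "!!a c \<phi> w th k. test_fun a c \<phi> ==> a < 0 ==> T < c ==> th > 0 ==>
   ennreal (2 * \<bar>approx (\<nu> (Suc k)) (Suc k) \<phi> w - approx (\<nu> k) k \<phi> w\<bar>) <= v (Suc k) w * (ennreal th + Hbold_norm2 a c s1 s2 \<phi> / ennreal th)"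
proof -
 let ?q0 = "%k \<nu> w. ennreal (4 ^ k) * grid_diff_energy s2 (\<nu> k) (\<nu> (Suc k)) (Suc k) w + ennreal (2 / T * (1/2) ^ k)"
 let ?q1 = "%\<nu> k M. \<integral>\<^sup>+w. grid_diff_energy s2 (\<nu> k) (\<nu> (Suc k)) (Suc k) w \<partial>M"
 \<comment> \<open>Tolerance 8^-k leaves room for the weight 4^k in \<open>u\<close>: the product
   2^-k is summable, and the matching coefficient of the norm, 2^(k+1) / (T * 4^k), is (2 / T) *
   2^-k.\<close>
 have "\<forall>k. \<exists>\<eta>>0. \<forall>t\<in>{0..T}. \<forall>t'\<in>{0..T}. \<bar>t - t'\<bar> < \<eta> --> wave_dist s2 t t' <= ennreal ((1/8) ^ k)"
  using wave_modulus[OF s2] by simp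
 from choice[OF this] obtain \<eta> where \<eta>: "\<forall>k. \<eta> k > 0 \<and> (\<forall>t\<in>{0..T}. \<forall>t'\<in>{0..T}. \<bar>t - t'\<bar> < \<eta> k --> wave_dist s2 t t' <= ennreal ((1/8) ^ k))" ..
 have "\<forall>k. \<exists>n. T / 2 ^ n < \<eta> k"
 proof
  fix k
  have "(%n. T * (1/2) ^ n) \<longlonglongrightarrow> T * 0" by (intro tendsto_mult tendsto_const LIMSEQ_power_zero) simp
  then have "\<forall>\<^sub>F n in sequentially. T * (1/2) ^ n < \<eta> k" using \<eta> by (intro order_tendstoD(2)) auto
  then show "\<exists>n. T / 2 ^ n < \<eta> k" by (auto simp: eventually_sequentially power_one_over)
 qed
 from choice[OF this] obtain n0 where n0: "\<forall>k. T / 2 ^ n0 k < \<eta> k" ..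
 \<comment> \<open>The cumulative sum makes \<open>\<nu> k\<close> fine enough for every earlier
   tolerance too, since the grids \<open>\<nu> k\<close> and \<open>\<nu> (Suc k)\<close> must both
   respect \<open>\<eta> k\<close>. The summand \<open>Suc k\<close> keeps the grid finer than the
   averaging intervals at levels k and k + 1.\<close>
 define \<nu> where "\<nu> k = (\<Sum>m\<le>k. n0 m) + Suc k" for k
 have \<nu>: "k < \<nu> k" for k unfolding \<nu>_def by simp
 have \<nu>\<eta>: "T / 2 ^ \<nu> k < \<eta> m" if "m <= k" for k m
 proof -
  have "n0 m <= (\<Sum>m\<le>k. n0 m)" using that by (intro member_le_sum) auto
  then have "n0 m <= \<nu> k" unfolding \<nu>_def by simp
  then have "(2::real) ^ n0 m <= 2 ^ \<nu> k" by (intro power_increasing) auto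
  then have "T / 2 ^ \<nu> k <= T / 2 ^ n0 m" using T_pos by (intro divide_left_mono) auto
  also have "... < \<eta> m" using n0 by simp
  finally show ?thesis .
 qed
 \<comment> \<open>Halving the intervals of length h = T / 2^k has norm coefficient 2 h^(2 s1 - 1) =
   C * r^(2 k). One factor r^k is traded to the energy and one stays, so both sums are
   geometric.\<close>
 define r where "r = 2 powr (1/2 - s1)"
 have r: "0 < r" "r < 1" unfolding r_def using s1 by (auto simp: powr_less_one)
 define C where "C = 2 * T powr (2 * s1 - 1)"
 have C: "C >= 0" unfolding C_def by simp
 define u where "u k w = (?q0 k \<nu> w)
   + (ennreal (r ^ k) * grid_energy s2 (\<nu> k) (Suc k) w + ennreal (C * r ^ k))" for k w
 define v where "v k w = (case k of 0 => ennreal 1 * grid_energy s2 (\<nu> 0) 0 w + ennreal (1 / T) | Suc k => u k w)" for k w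
 have le: "Suc k <= \<nu> k" "Suc k <= \<nu> (Suc k)" "0 <= \<nu> 0" for k using \<nu>[of k] \<nu>[of "Suc k"] by auto
 have GD: "grid_diff_energy s2 (\<nu> k) (\<nu> (Suc k)) (Suc k) \<in> meas M \<and>
   (?q1 \<nu> k M) <= ennreal ((1/8) ^ k * T)" for k
 proof -
  have \<eta>k: "t \<in> {0..T} ==> t' \<in> {0..T} ==> \<bar>t - t'\<bar> < \<eta> k ==> wave_dist s2 t t' <= ennreal ((1/8) ^ k)" for t t' using \<eta> by blast
  show ?thesis using grid_diff_energy_expectation[OF le(1) le(2) _ \<eta>k \<nu>\<eta> \<nu>\<eta>] by auto
 qed
 note [measurable] = GD[THEN conjunct1] grid_energy_measurable[OF le(1)] grid_energy_measurable[OF le(3)]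
 have um[measurable]: "u k \<in> meas M" for k unfolding u_def by measurable
 have vm: "v k \<in> meas M" for k unfolding v_def by (cases k) auto
 define Q where "Q = ennreal (L^2 * T) * weight_mass TYPE(real^'d) s2"
 have "weight_mass TYPE(real^'d) s2 < \<infinity>" by (rule weight_mass_finite) (use s2 in simp)
 then obtain Q' where Q': "Q = ennreal Q'" "Q' >= 0" unfolding Q_def
  by (metis ennreal_cases ennreal_mult_less_top ennreal_less_top infinity_ennreal_def less_irrefl)
 have ui: "(\<integral>\<^sup>+w. u k w \<partial>M) <= ennreal (T * (1/2) ^ k + 2 / T * (1/2) ^ k + (Q' + C) * r ^ k)" for k
 proof -
  have "(\<integral>\<^sup>+w. u k w \<partial>M) = (ennreal (4 ^ k) * (?q1 \<nu> k M) + ennreal (2 / T * (1/2) ^ k))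
   + (ennreal (r ^ k) * (\<integral>\<^sup>+w. grid_energy s2 (\<nu> k) (Suc k) w \<partial>M) + ennreal (C * r ^ k))"
   unfolding u_def by (simp add: nn_integral_add nn_integral_cmult emeasure_space_1)
  also have "... <= (ennreal (4 ^ k) * ennreal ((1/8) ^ k * T) + ennreal (2 / T * (1/2) ^ k)) + (ennreal (r ^ k) * Q + ennreal (C * r ^ k))"
   unfolding Q_def using GD[of k] grid_energy_expectation[OF le(1), where s=s2] by (intro add_mono mult_left_mono) auto
  also have "... = ennreal ((4 ^ k * ((1/8) ^ k * T) + 2 / T * (1/2) ^ k) + (r ^ k * Q' + C * r ^ k))"
   unfolding Q' using T_pos r C Q'(2) by (simp add: ennreal_mult)
  also have "(4 ^ k * ((1/8) ^ k * T) + 2 / T * (1/2) ^ k) + (r ^ k * Q' + C * r ^ k) = T * (1/2) ^ k + 2 / T * (1/2) ^ k + (Q' + C) * r ^ k"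
  proof -
   have "(4::real) ^ k * (1/8) ^ k = (1/2) ^ k" by (simp add: power_mult_distrib[symmetric])
   then show ?thesis by (simp add: algebra_simps)
  qed
  finally show ?thesis .
 qed
 have "(\<integral>\<^sup>+w. (\<Sum>k. v k w) \<partial>M) = (\<Sum>k. \<integral>\<^sup>+w. v k w \<partial>M)" by (rule nn_integral_suminf[OF vm])
 also have "... <= (\<Sum>k. ennreal (case k of 0 => Q' + 1 / T | Suc k => T * (1/2) ^ k + 2 / T * (1/2) ^ k + (Q' + C) * r ^ k))"
 proof (intro suminf_le allI)
  fix k
  show "(\<integral>\<^sup>+w. v k w \<partial>M) <= ennreal (case k of 0 => Q' + 1 / T | Suc k => T * (1/2) ^ k + 2 / T * (1/2) ^ k + (Q' + C) * r ^ k)"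
  proof (cases k)
   case 0
   have "(\<integral>\<^sup>+w. grid_energy s2 (\<nu> 0) 0 w \<partial>M) <= ennreal Q'" using grid_energy_expectation[OF le(3), where s=s2] Q'(1) unfolding Q_def by simp
   then have "(\<integral>\<^sup>+w. v 0 w \<partial>M) <= ennreal Q' + ennreal (1 / T)"
    unfolding v_def by (simp add: nn_integral_add emeasure_space_1)
   then show ?thesis using 0 Q'(2) T_pos by (simp add: ennreal_plus)
  next
   case (Suc j) then show ?thesis using ui[of j] unfolding v_def by simp
  qed
 qed auto
 also have "... < \<infinity>"
 proof -
  have "summable (%k. T * (1/2) ^ k + 2 / T * (1/2) ^ k + (Q' + C) * r ^ k)"
   using r by (intro summable_add summable_mult summable_geometric) auto
  then have sm: "summable (%k. case k of 0 => Q' + 1 / T | Suc k => T * (1/2) ^ k + 2 / T * (1/2) ^ k + (Q' + C) * r ^ k)"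
   by (subst summable_Suc_iff[symmetric]) simp
  have nn: "0 <= (case k of 0 => Q' + 1 / T | Suc k => T * (1/2) ^ k + 2 / T * (1/2) ^ k + (Q' + C) * r ^ k)" for k
   using T_pos r C Q'(2) by (auto split: nat.split intro!: add_nonneg_nonneg mult_nonneg_nonneg)
  show ?thesis unfolding suminf_ennreal2[OF nn sm] by simp
 qed
 finally have "(\<integral>\<^sup>+w. (\<Sum>k. v k w) \<partial>M) < \<infinity>" .
 \<comment> \<open>A finite expectation leaves one null set, chosen before any test
   function.\<close>
 then have ae: "AE w in M. (\<Sum>k. v k w) < \<infinity>"
  using nn_integral_PInf_AE[of "%w. \<Sum>k. v k w" M] vm by (auto simp: less_top)
 have b0: "ennreal (2 * \<bar>approx (\<nu> 0) 0 \<phi> w\<bar>) <= v 0 w * (ennreal th + Hbold_norm2 a c s1 s2 \<phi> / ennreal th)"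
  if "test_fun a c \<phi>" "a < 0" "T < c" "th > 0" for a c \<phi> w th
  unfolding v_def nat.case
 proof (rule ennreal_scaled_young)
  show "ennreal (2 * \<bar>approx (\<nu> 0) 0 \<phi> w\<bar>) <= ennreal (th * 1) * grid_energy s2 (\<nu> 0) 0 w + ennreal (1 / T / th) * Hbold_norm2 a c s1 s2 \<phi>"
   using approx_bound[OF that(1-3) le(3) that(4), where w=w and ?s2.0=s2 and ?s1.0=s1] by simp
 qed (use that(4) T_pos in auto)
 have bS: "ennreal (2 * \<bar>approx (\<nu> (Suc k)) (Suc k) \<phi> w - approx (\<nu> k) k \<phi> w\<bar>) <= v (Suc k) w * (ennreal th + Hbold_norm2 a c s1 s2 \<phi> / ennreal th)"
  if t: "test_fun a c \<phi>" "a < 0" "T < c" "th > 0" for a c \<phi> w th k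
 proof -
  let ?H = "Hbold_norm2 a c s1 s2 \<phi>"
  have e1: "1 / (T / 2 ^ Suc k * (th * 4 ^ k)) = 2 / T * (1/2) ^ k / th"
  proof -
   have "(4::real) ^ k = 2 ^ k * 2 ^ k" by (simp add: power_mult_distrib[symmetric])
   then show ?thesis using t(4) T_pos by (simp add: power_one_over field_simps)
  qed
  have A: "ennreal (2 * \<bar>approx (\<nu> (Suc k)) (Suc k) \<phi> w - approx (\<nu> k) (Suc k) \<phi> w\<bar>)
   <= (?q0 k \<nu> w) * (ennreal th + ?H / ennreal th)"
  proof (rule ennreal_scaled_young)
   have "th * 4 ^ k > 0" using t(4) by simp
   from approx_grid_change[OF t(1-3) le(1)[of k] le(2)[of k] this, where w=w and ?s2.0=s2 and ?s1.0=s1]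
   show "ennreal (2 * \<bar>approx (\<nu> (Suc k)) (Suc k) \<phi> w - approx (\<nu> k) (Suc k) \<phi> w\<bar>)
    <= ennreal (th * 4 ^ k) * grid_diff_energy s2 (\<nu> k) (\<nu> (Suc k)) (Suc k) w + ennreal (2 / T * (1/2) ^ k / th) * ?H"
    unfolding e1 .
  qed (use t(4) T_pos in auto)
  have e2: "(T / 2 ^ k) powr (1 + 2 * s1) / ((T / 2 ^ k) * (T / 2 ^ Suc k) * (th * r ^ k)) = C * r ^ k / th"
  proof -
   define h where "h = T / 2 ^ k"
   have h: "h > 0" unfolding h_def using T_pos by simp
   have hs: "T / 2 ^ Suc k = h / 2" unfolding h_def by simp
   have "h powr (1 + 2 * s1) = h powr 2 * h powr (2 * s1 - 1)" by (simp add: powr_add[symmetric])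
   also have "h powr 2 = h * h" using h by (simp add: power2_eq_square)
   finally have 1: "h powr (1 + 2 * s1) = h * h * h powr (2 * s1 - 1)" .
   have "h powr (2 * s1 - 1) = T powr (2 * s1 - 1) / (2 ^ k) powr (2 * s1 - 1)" unfolding h_def using T_pos by (simp add: powr_divide)
   also have "(2 ^ k) powr (2 * s1 - 1) = (2::real) powr (real k * (2 * s1 - 1))" by (simp add: powr_powr powr_realpow[symmetric])
   also have "... = inverse (r ^ k * r ^ k)"
   proof -
    have "r ^ k * r ^ k = (2 powr (1/2 - s1)) powr real k * (2 powr (1/2 - s1)) powr real k" using r unfolding r_def by (simp add: powr_realpow)
    also have "... = 2 powr (- (real k * (2 * s1 - 1)))" unfolding powr_powr powr_add[symmetric] by (simp add: algebra_simps)
    finally show ?thesis by (simp add: powr_minus)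
   qed
   finally have 2: "h powr (2 * s1 - 1) = T powr (2 * s1 - 1) * (r ^ k * r ^ k)" by (simp add: divide_inverse)
   have "r ^ k > 0" using r by simp
   then show ?thesis unfolding hs h_def[symmetric] 1 2 C_def using h t(4) by (simp add: field_simps)
  qed
  have B: "ennreal (2 * \<bar>approx (\<nu> k) (Suc k) \<phi> w - approx (\<nu> k) k \<phi> w\<bar>)
   <= (ennreal (r ^ k) * grid_energy s2 (\<nu> k) (Suc k) w + ennreal (C * r ^ k)) * (ennreal th + ?H / ennreal th)"
  proof (rule ennreal_scaled_young)
   have "th * r ^ k > 0" using t(4) r by simp
   from approx_level_change[OF t(1-3) le(1)[of k] this, where ?s1.0=s1 and w=w and ?s2.0=s2]
   show "ennreal (2 * \<bar>approx (\<nu> k) (Suc k) \<phi> w - approx (\<nu> k) k \<phi> w\<bar>)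
    <= ennreal (th * r ^ k) * grid_energy s2 (\<nu> k) (Suc k) w + ennreal (C * r ^ k / th) * ?H"
    unfolding e2 using s1 by simp
  qed (use t(4) r C in auto)
  have "ennreal (2 * \<bar>approx (\<nu> (Suc k)) (Suc k) \<phi> w - approx (\<nu> k) k \<phi> w\<bar>)
   <= ennreal (2 * \<bar>approx (\<nu> (Suc k)) (Suc k) \<phi> w - approx (\<nu> k) (Suc k) \<phi> w\<bar> + 2 * \<bar>approx (\<nu> k) (Suc k) \<phi> w - approx (\<nu> k) k \<phi> w\<bar>)"
   using abs_triangle_ineq[of "approx (\<nu> (Suc k)) (Suc k) \<phi> w - approx (\<nu> k) (Suc k) \<phi> w" "approx (\<nu> k) (Suc k) \<phi> w - approx (\<nu> k) k \<phi> w"]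
   by (intro ennreal_leI) simp
  also have "... = ennreal (2 * \<bar>approx (\<nu> (Suc k)) (Suc k) \<phi> w - approx (\<nu> k) (Suc k) \<phi> w\<bar>) + ennreal (2 * \<bar>approx (\<nu> k) (Suc k) \<phi> w - approx (\<nu> k) k \<phi> w\<bar>)"
   by (rule ennreal_plus) auto
  also have "... <= u k w * (ennreal th + ?H / ennreal th)"
   unfolding u_def distrib_right[of _ _ "ennreal th + ?H / ennreal th"] using add_mono[OF A B] by (simp only: distrib_right)
  finally show ?thesis unfolding v_def by simp
 qed
 show ?thesis by (rule that[OF \<nu> vm ae b0 bS])
qed

text \<open>The scheme bounds all increments by the same summable random sequence times th + H / th.
  On the event \<open>G\<close> where the sum is finite the functionals telescope to a limit for
  every test function at once, and optimising th turns the summed bound into a quadratic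
  one.\<close>

theorem pathwise_ito_functional:
 assumes s1: "1/2 < s1" and s2: "s2 > real CARD('d) / 2"
 obtains \<nu> :: "nat => nat" and V :: "'w => real" and G :: "'w set" where
  "!!k. k < \<nu> k" "G \<in> sets M" "AE w in M. w \<in> G"
  "!!a c \<phi> w. test_fun a c \<phi> ==> a < 0 ==> T < c ==> s1 < 1 ==> w \<in> G ==> convergent (%k. approx (\<nu> k) k \<phi> w)"
  "!!a c \<phi> w. test_fun a c \<phi> ==> a < 0 ==> T < c ==> s1 < 1 ==> w \<in> G ==>
   ennreal ((lim (%k. approx (\<nu> k) k \<phi> w))^2) <= ennreal (V w) * Hbold_norm2 a c s1 s2 \<phi>"
proof -
 obtain \<nu> :: "nat => nat" and v :: "nat => 'w => ennreal" where
  \<nu>: "!!k. k < \<nu> k" and vm[measurable]: "!!k. v k \<in> meas M" and ae: "AE w in M. (\<Sum>k. v k w) < \<infinity>" and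
  b0: "!!a c \<phi> w th. test_fun a c \<phi> ==> a < 0 ==> T < c ==> th > 0 ==>
   ennreal (2 * \<bar>approx (\<nu> 0) 0 \<phi> w\<bar>) <= v 0 w * (ennreal th + Hbold_norm2 a c s1 s2 \<phi> / ennreal th)" and
  bS: "!!a c \<phi> w th k. test_fun a c \<phi> ==> a < 0 ==> T < c ==> th > 0 ==>
   ennreal (2 * \<bar>approx (\<nu> (Suc k)) (Suc k) \<phi> w - approx (\<nu> k) k \<phi> w\<bar>) <= v (Suc k) w * (ennreal th + Hbold_norm2 a c s1 s2 \<phi> / ennreal th)"
  using approx_scheme[OF s1 s2] by blast
 define G where "G = {w\<in>space M. (\<Sum>k. v k w) < \<infinity>}"
 \<comment> \<open>The summand 1 makes the constant strictly positive, as the optimisation in th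
   requires.\<close>
 define V where "V w = enn2real (\<Sum>k. v k w) + 1" for w
 have Gm: "G \<in> sets M" unfolding G_def by measurable
 have Gae: "AE w in M. w \<in> G" using ae AE_space by eventually_elim (simp add: G_def)
 have main: "convergent (%k. approx (\<nu> k) k \<phi> w) \<and> ennreal ((lim (%k. approx (\<nu> k) k \<phi> w))^2) <= ennreal ((V w)^2) * Hbold_norm2 a c s1 s2 \<phi>"
  if t: "test_fun a c \<phi>" "a < 0" "T < c" and s1': "s1 < 1" and w: "w \<in> G" for a c \<phi> w
 proof -
  define H where "H = Hbold_norm2 a c s1 s2 \<phi>"
  have "H < \<infinity>" unfolding H_def by (rule Hbold_norm2_finite[OF t(1) s1'])
  then obtain h where h: "H = ennreal h" "h >= 0" by (metis ennreal_cases infinity_ennreal_def less_irrefl)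
  have fin: "(\<Sum>k. v k w) < \<infinity>" using w unfolding G_def by simp
  define vr where "vr k = enn2real (v k w)" for k
  have vk: "v k w = ennreal (vr k)" for k
  proof -
   have "v k w <= (\<Sum>k. v k w)" using sum_le_suminf[of "%k. v k w" "{k}"] by simp
   then show ?thesis unfolding vr_def using fin by (auto simp: ennreal_enn2real_if)
  qed
  have vr0: "vr k >= 0" for k unfolding vr_def by simp
  have sv: "summable vr" by (rule summable_suminf_not_top) (use vr0 fin in \<open>simp_all add: vk[symmetric] less_top[symmetric]\<close>)
  have Veq: "V w = (\<Sum>k. vr k) + 1"
  proof -
   have "(\<Sum>k. v k w) = ennreal (\<Sum>k. vr k)" unfolding vk by (rule suminf_ennreal2[OF vr0 sv])
   then show ?thesis unfolding V_def using suminf_nonneg[OF sv vr0] by simp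
  qed
  define x where "x k = approx (\<nu> k) k \<phi> w" for k
  \<comment> \<open>Starting with x 0 itself makes the partial sums equal to x, so one series
    carries both the convergence and the bound.\<close>
  define d where "d k = (case k of 0 => x 0 | Suc k => x (Suc k) - x k)" for k
  have db: "2 * \<bar>d k\<bar> <= vr k * (th + h / th)" if th: "th > 0" for k th
  proof -
   have "ennreal (2 * \<bar>d k\<bar>) <= v k w * (ennreal th + H / ennreal th)"
    unfolding d_def x_def H_def using b0[OF t th] bS[OF t th] by (cases k) auto
   also have "... = ennreal (vr k * (th + h / th))"
    unfolding vk h using th h(2) vr0 by (simp add: divide_ennreal ennreal_mult)
   finally show ?thesis using th h(2) vr0 by (simp add: ennreal_le_iff)
  qed
  have xd: "x k = (\<Sum>i\<le>k. d i)" for k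
   by (induction k) (simp_all add: d_def)
  have dn: "norm (d k) <= vr k * (1 + h)" for k using db[of 1 k] abs_ge_zero[of "d k"] by (simp only: real_norm_def) simp
  have sd: "summable d" by (rule summable_comparison_test'[OF summable_mult2[OF sv, of "1 + h"], of 0]) (rule dn)
  have xl: "x \<longlonglongrightarrow> (\<Sum>k. d k)"
   using summable_LIMSEQ'[OF sd] unfolding xd[abs_def] .
  have "ennreal (2 * \<bar>\<Sum>k. d k\<bar>) <= ennreal (V w) * (ennreal th + H / ennreal th)" if th: "th > 0" for th
  proof -
   have sn: "summable (%k. norm (d k))" by (rule summable_comparison_test'[OF summable_mult2[OF sv, of "1 + h"], of 0]) (use dn in simp)
   have "2 * \<bar>\<Sum>k. d k\<bar> <= 2 * (\<Sum>k. \<bar>d k\<bar>)" using summable_rabs[of d] sn by simp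
   also have "... = (\<Sum>k. 2 * \<bar>d k\<bar>)" using sn by (simp add: suminf_mult)
   also have "... <= (\<Sum>k. vr k * (th + h / th))"
    using sn sv db[OF th] by (intro suminf_le summable_mult summable_mult2) auto
   also have "... = (\<Sum>k. vr k) * (th + h / th)" by (rule suminf_mult2[symmetric, OF sv])
   also have "... <= V w * (th + h / th)" unfolding Veq using th h(2) by (intro mult_right_mono) auto
   finally have "ennreal (2 * \<bar>\<Sum>k. d k\<bar>) <= ennreal (V w * (th + h / th))" by (rule ennreal_leI)
   also have "... = ennreal (V w) * (ennreal th + H / ennreal th)"
    unfolding h using th h(2) suminf_nonneg[OF sv vr0] Veq by (simp add: divide_ennreal ennreal_mult)
   finally show ?thesis .
  qed
  then have "ennreal ((\<Sum>k. d k)^2) <= ennreal ((V w)^2) * H"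
   using suminf_nonneg[OF sv vr0] Veq by (intro young_optimise_ennreal) auto
  then show ?thesis using xl limI[OF xl] unfolding H_def x_def convergent_def by auto
 qed
 show ?thesis by (rule that[of \<nu> G "%w. (V w)^2"]) (use \<nu> Gm Gae main in auto)
qed

end

section \<open>Convergence in probability along partitions\<close>

context prob_space
begin

text \<open>Convergence to 0 in probability, bundled with measurability so that it is closed under
  the algebra below.\<close>

definition vanishing :: "(nat => 'a => real) => bool" where
 "vanishing Z \<longleftrightarrow> (\<forall>n. Z n \<in> meas M) \<and> (\<forall>e>0. (%n. prob {w\<in>space M. \<bar>Z n w\<bar> > e}) \<longlonglongrightarrow> 0)"

lemma vanishing_measurable: "vanishing Z ==> Z n \<in> meas M"
 unfolding vanishing_def by blast

lemma vanishingD: "vanishing Z ==> e > 0 ==> (%n. prob {w\<in>space M. \<bar>Z n w\<bar> > e}) \<longlonglongrightarrow> 0"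
 unfolding vanishing_def by blast

lemma vanishingI:
 assumes m: "!!n. Z n \<in> meas M"
  and b: "!!e. e > 0 ==> \<exists>g. g \<longlonglongrightarrow> 0 \<and> (\<forall>n. prob {w\<in>space M. \<bar>Z n w\<bar> > e} <= g n)"
 shows "vanishing Z"
 unfolding vanishing_def
proof (intro conjI allI impI m)
 fix e :: real assume "e > 0"
 then obtain g where g: "g \<longlonglongrightarrow> 0" "!!n. prob {w\<in>space M. \<bar>Z n w\<bar> > e} <= g n" using b by blast
 show "(%n. prob {w\<in>space M. \<bar>Z n w\<bar> > e}) \<longlonglongrightarrow> 0"
  by (rule tendsto_sandwich[OF _ _ tendsto_const g(1)]) (use g(2) in auto)
qed

text \<open>If a large value of Z forces a large value of X or of Y, the probabilities add; sums,
  products, square roots and domination all reduce to this.\<close>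

lemma vanishing_union_bound:
 assumes X: "vanishing X" and Y: "vanishing Y" and m: "!!n. Z n \<in> meas M"
  and s: "!!e. e > 0 ==> \<exists>d>0. \<forall>n. \<forall>w\<in>space M. \<bar>Z n w\<bar> > e --> \<bar>X n w\<bar> > d \<or> \<bar>Y n w\<bar> > d"
 shows "vanishing Z"
proof (rule vanishingI[OF m])
 fix e :: real assume "e > 0"
 then obtain d where d: "d > 0" "!!n w. w \<in> space M ==> \<bar>Z n w\<bar> > e ==> \<bar>X n w\<bar> > d \<or> \<bar>Y n w\<bar> > d" using s by blast
 let ?g = "%n. prob {w\<in>space M. \<bar>X n w\<bar> > d} + prob {w\<in>space M. \<bar>Y n w\<bar> > d}"
 have [measurable]: "X n \<in> meas M" "Y n \<in> meas M" for n using X Y unfolding vanishing_def by auto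
 have "?g \<longlonglongrightarrow> 0 + 0" using vanishingD[OF X d(1)] vanishingD[OF Y d(1)] by (intro tendsto_add)
 moreover have "prob {w\<in>space M. \<bar>Z n w\<bar> > e} <= ?g n" for n
 proof -
  have "prob {w\<in>space M. \<bar>Z n w\<bar> > e} <= prob ({w\<in>space M. \<bar>X n w\<bar> > d} \<union> {w\<in>space M. \<bar>Y n w\<bar> > d})"
   using d(2) by (intro finite_measure_mono) auto
  also have "... <= ?g n" by (rule measure_Un_le) measurable
  finally show ?thesis .
 qed
 ultimately show "\<exists>g. g \<longlonglongrightarrow> 0 \<and> (\<forall>n. prob {w\<in>space M. \<bar>Z n w\<bar> > e} <= g n)" by auto
qed

lemma vanishing_dominated:
 assumes Y: "vanishing Y" and m: "!!n. Z n \<in> meas M"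
  and b: "!!n w. w \<in> space M ==> \<bar>Z n w\<bar> <= \<bar>Y n w\<bar>"
 shows "vanishing Z"
 by (rule vanishing_union_bound[OF Y Y m]) (use b in \<open>force intro: less_le_trans\<close>)

lemma vanishing_add:
 assumes X: "vanishing X" and Y: "vanishing Y"
 shows "vanishing (%n w. X n w + Y n w)"
proof (rule vanishing_union_bound[OF X Y])
 note [measurable] = vanishing_measurable[OF X] vanishing_measurable[OF Y]
 show "(%w. X n w + Y n w) \<in> meas M" for n by measurable
 fix e :: real assume "e > 0"
 then show "\<exists>d>0. \<forall>n. \<forall>w\<in>space M. \<bar>X n w + Y n w\<bar> > e --> \<bar>X n w\<bar> > d \<or> \<bar>Y n w\<bar> > d"
  by (intro exI[of _ "e / 2"]) auto
qed

lemma vanishing_mult: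
 assumes X: "vanishing X" and Y: "vanishing Y"
 shows "vanishing (%n w. X n w * Y n w)"
proof (rule vanishing_union_bound[OF X Y])
 note [measurable] = vanishing_measurable[OF X] vanishing_measurable[OF Y]
 show "(%w. X n w * Y n w) \<in> meas M" for n by measurable
 fix e :: real assume e: "e > 0"
 have "\<bar>x\<bar> > sqrt e \<or> \<bar>y\<bar> > sqrt e" if "\<bar>x * y\<bar> > e" for x y :: real
 proof (rule ccontr)
  assume "\<not> ?thesis"
  then have "\<bar>x\<bar> * \<bar>y\<bar> <= sqrt e * sqrt e" using e by (intro mult_mono) auto
  then show False using that e by (simp add: abs_mult)
 qed
 then show "\<exists>d>0. \<forall>n. \<forall>w\<in>space M. \<bar>X n w * Y n w\<bar> > e --> \<bar>X n w\<bar> > d \<or> \<bar>Y n w\<bar> > d"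
  using e by (intro exI[of _ "sqrt e"]) auto
qed

lemma vanishing_sqrt:
 assumes X: "vanishing X"
 shows "vanishing (%n w. sqrt \<bar>X n w\<bar>)"
proof (rule vanishing_union_bound[OF X X])
 note [measurable] = vanishing_measurable[OF X]
 show "(%w. sqrt \<bar>X n w\<bar>) \<in> meas M" for n by measurable
 fix e :: real assume e: "e > 0"
 then show "\<exists>d>0. \<forall>n. \<forall>w\<in>space M. \<bar>sqrt \<bar>X n w\<bar>\<bar> > e --> \<bar>X n w\<bar> > d \<or> \<bar>X n w\<bar> > d"
 proof (intro exI[of _ "e^2"] conjI allI ballI impI disjI1)
  fix n w assume "\<bar>sqrt \<bar>X n w\<bar>\<bar> > e"
  then have "e^2 < (sqrt \<bar>X n w\<bar>)^2" using e by (intro power_strict_mono) auto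
  then show "\<bar>X n w\<bar> > e^2" by simp
 qed simp
qed

lemma vanishing_cmult:
 assumes X: "vanishing X"
 shows "vanishing (%n w. c * X n w)"
proof (rule vanishing_union_bound[OF X X])
 note [measurable] = vanishing_measurable[OF X]
 show "(%w. c * X n w) \<in> meas M" for n by measurable
 fix e :: real assume e: "e > 0"
 have "\<bar>x\<bar> > e / (\<bar>c\<bar> + 1)" if "\<bar>c * x\<bar> > e" for x
 proof -
  have "\<bar>c * x\<bar> <= (\<bar>c\<bar> + 1) * \<bar>x\<bar>" by (simp add: abs_mult distrib_right)
  then have "e < (\<bar>c\<bar> + 1) * \<bar>x\<bar>" using that by linarith
  moreover have "0 < \<bar>c\<bar> + 1" by linarith
  ultimately show ?thesis by (simp add: pos_divide_less_eq mult.commute)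
 qed
 then show "\<exists>d>0. \<forall>n. \<forall>w\<in>space M. \<bar>c * X n w\<bar> > e --> \<bar>X n w\<bar> > d \<or> \<bar>X n w\<bar> > d"
  using e by (intro exI[of _ "e / (\<bar>c\<bar> + 1)"]) auto
qed

lemma vanishing_sum:
 "finite A ==> (!!i. i \<in> A ==> vanishing (X i)) ==> vanishing (%n w. \<Sum>i\<in>A. X i n w)"
proof (induction A rule: finite_induct)
 case empty then show ?case by (auto simp: vanishing_def)
next
 case (insert i A) then show ?case using vanishing_add by simp
qed

lemma markov_prob:
 assumes i: "integrable M Y" and nn: "!!w. w \<in> space M ==> 0 <= Y w" and k: "k > 0"
 shows "prob {w\<in>space M. Y w > k} <= expectation Y / k"
proof -
 have [measurable]: "Y \<in> meas M" using i by simp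
 have "prob {w\<in>space M. Y w > k} <= prob {w\<in>space M. Y w >= k}" by (intro finite_measure_mono) auto
 also have "... <= expectation Y / k" using integral_Markov_inequality_measure[OF i _ _ k, of "{}"] nn by auto
 finally show ?thesis .
qed

lemma vanishing_L1:
 assumes i: "!!n. integrable M (Z n)" and l: "(%n. expectation (%w. \<bar>Z n w\<bar>)) \<longlonglongrightarrow> 0"
 shows "vanishing Z"
proof (rule vanishingI)
 show "Z n \<in> meas M" for n using i[of n] by simp
 fix e :: real assume e: "e > 0"
 have "(%n. expectation (%w. \<bar>Z n w\<bar>) / e) \<longlonglongrightarrow> 0 / e" using l e by (intro tendsto_divide) auto
 moreover have "prob {w\<in>space M. \<bar>Z n w\<bar> > e} <= expectation (%w. \<bar>Z n w\<bar>) / e" for n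
  using i[of n] e by (intro markov_prob) auto
 ultimately show "\<exists>g. g \<longlonglongrightarrow> 0 \<and> (\<forall>n. prob {w\<in>space M. \<bar>Z n w\<bar> > e} <= g n)" by auto
qed

lemma vanishing_L2:
 assumes m: "!!n. Z n \<in> meas M" and i: "!!n. integrable M (%w. (Z n w)^2)"
  and l: "(%n. expectation (%w. (Z n w)^2)) \<longlonglongrightarrow> 0"
 shows "vanishing Z"
proof (rule vanishing_dominated[OF vanishing_sqrt[OF vanishing_L1[OF i]] m])
 show "(%n. expectation (%w. \<bar>(Z n w)\<^sup>2\<bar>)) \<longlonglongrightarrow> 0" using l by simp
qed auto

lemma vanishing_AE:
 assumes m: "!!n. Z n \<in> meas M" and l: "AE w in M. (%n. Z n w) \<longlonglongrightarrow> 0"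
 shows "vanishing Z"
 unfolding vanishing_def
proof (intro conjI allI impI m)
 fix e :: real assume e: "e > 0"
 note [measurable] = m
 have "(%n. expectation (%w. indicator {w\<in>space M. \<bar>Z n w\<bar> > e} w :: real)) \<longlonglongrightarrow> expectation (%w. 0)"
 proof (rule integral_dominated_convergence[where w="%_. 1"])
  show "AE w in M. (%n. indicator {w\<in>space M. \<bar>Z n w\<bar> > e} w :: real) \<longlonglongrightarrow> 0"
   using l
  proof eventually_elim
   fix w assume "(%n. Z n w) \<longlonglongrightarrow> 0"
   then have "(%n. \<bar>Z n w\<bar>) \<longlonglongrightarrow> 0" by (rule tendsto_rabs_zero)
   then have "\<forall>\<^sub>F n in sequentially. \<bar>Z n w\<bar> < e" using e by (rule order_tendstoD(2))
   then have "\<forall>\<^sub>F n in sequentially. (indicator {w\<in>space M. \<bar>Z n w\<bar> > e} w :: real) = 0"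
    by eventually_elim (auto simp: indicator_def)
   then show "(%n. indicator {w\<in>space M. \<bar>Z n w\<bar> > e} w :: real) \<longlonglongrightarrow> 0" by (rule tendsto_eventually)
  qed
 qed (auto simp: indicator_def)
 then show "(%n. prob {w\<in>space M. \<bar>Z n w\<bar> > e}) \<longlonglongrightarrow> 0" by simp
qed

text \<open>A sequence bounded in L1 is bounded in probability, and that is enough for a vanishing
  factor to win. It is used where quadratic variations stay bounded without tending to 0.\<close>

lemma vanishing_mult_L1_bounded:
 assumes X: "vanishing X" and i: "!!n. integrable M (Y n)" and C: "!!n. expectation (%w. \<bar>Y n w\<bar>) <= C"
 shows "vanishing (%n w. X n w * Y n w)"
 unfolding vanishing_def
proof (intro conjI allI impI)
 have [measurable]: "X n \<in> meas M" "Y n \<in> meas M" for n using X i[of n] unfolding vanishing_def by auto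
 show "(%w. X n w * Y n w) \<in> meas M" for n by measurable
 fix e :: real assume e: "e > 0"
 have C0: "C >= 0" using C[of 0] by (rule order_trans[rotated]) auto
 show "(%n. prob {w\<in>space M. \<bar>X n w * Y n w\<bar> > e}) \<longlonglongrightarrow> 0"
 proof (rule LIMSEQ_I)
  fix r :: real assume r: "r > 0"
  \<comment> \<open>Markov's inequality gives P(|Y n| > K) <= C / K <= r / 2; the summand 1 keeps K
    positive.\<close>
  define K where "K = 2 * (C + 1) / r"
  have K: "K > 0" unfolding K_def using r C0 by simp
  have "(%n. prob {w\<in>space M. \<bar>X n w\<bar> > e / K}) \<longlonglongrightarrow> 0" using e K by (intro vanishingD[OF X]) auto
  then have "\<forall>\<^sub>F n in sequentially. prob {w\<in>space M. \<bar>X n w\<bar> > e / K} < r / 2" using r by (intro order_tendstoD(2)) auto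
  then obtain N where N: "!!n. n >= N ==> prob {w\<in>space M. \<bar>X n w\<bar> > e / K} < r / 2" by (auto simp: eventually_sequentially)
  have "prob {w\<in>space M. \<bar>X n w * Y n w\<bar> > e} < r" if n: "n >= N" for n
  proof -
   have sub: "\<bar>x\<bar> > e / K \<or> \<bar>y\<bar> > K" if "\<bar>x * y\<bar> > e" for x y :: real
   proof (rule ccontr)
    assume "\<not> ?thesis"
    then have "\<bar>x\<bar> * \<bar>y\<bar> <= e / K * K" using K by (intro mult_mono) auto
    then show False using that K by (simp add: abs_mult)
   qed
   have "prob {w\<in>space M. \<bar>X n w * Y n w\<bar> > e} <= prob ({w\<in>space M. \<bar>X n w\<bar> > e / K} \<union> {w\<in>space M. \<bar>Y n w\<bar> > K})"
    using sub by (intro finite_measure_mono) auto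
   also have "... <= prob {w\<in>space M. \<bar>X n w\<bar> > e / K} + prob {w\<in>space M. \<bar>Y n w\<bar> > K}" by (rule measure_Un_le) measurable
   also have "prob {w\<in>space M. \<bar>Y n w\<bar> > K} <= expectation (%w. \<bar>Y n w\<bar>) / K" using i[of n] K by (intro markov_prob) auto
   also have "... <= C / K" using C K by (intro divide_right_mono) auto
   also have "... <= r / 2" unfolding K_def using C0 r by (simp add: field_simps)
   finally show ?thesis using N[OF n] by linarith
  qed
  then show "\<exists>N. \<forall>n\<ge>N. norm (prob {w\<in>space M. \<bar>X n w * Y n w\<bar> > e} - 0) < r" by auto
 qed
qed

text \<open>Truncation at 1 turns convergence in probability into convergence in L1, which has an
  almost surely convergent subsequence; in the limit the truncation is inactive.\<close>

lemma vanishing_AE_subseq: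
 assumes Z: "vanishing Z"
 obtains r :: "nat => nat" where "AE w in M. (%n. Z (r n) w) \<longlonglongrightarrow> 0"
proof -
 let ?q0 = "%u n. %w. norm (u n w)"
 have [measurable]: "Z n \<in> meas M" for n using Z unfolding vanishing_def by auto
 define u where "u n w = min \<bar>Z n w\<bar> 1" for n w
 have ui: "integrable M (u n)" for n unfolding u_def by (intro integrable_const_bound[where B=1]) auto
 have "(%n. expectation (?q0 u n)) \<longlonglongrightarrow> 0"
 proof (rule LIMSEQ_I)
  fix e :: real assume e: "e > 0"
  have "(%n. prob {w\<in>space M. \<bar>Z n w\<bar> > e / 2}) \<longlonglongrightarrow> 0" using e by (intro vanishingD[OF Z]) auto
  then have "\<forall>\<^sub>F n in sequentially. prob {w\<in>space M. \<bar>Z n w\<bar> > e / 2} < e / 2" using e by (intro order_tendstoD(2)) auto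
  then obtain N where N: "!!n. n >= N ==> prob {w\<in>space M. \<bar>Z n w\<bar> > e / 2} < e / 2" by (auto simp: eventually_sequentially)
  have "expectation (?q0 u n) < e" if n: "n >= N" for n
  proof -
   have "expectation (?q0 u n) <= expectation (%w. e / 2 + indicator {w\<in>space M. \<bar>Z n w\<bar> > e / 2} w)"
   proof (rule integral_mono)
    show "integrable M (?q0 u n)" using ui by simp
    have "{w\<in>space M. \<bar>Z n w\<bar> > e / 2} \<in> sets M" by measurable
    then show "integrable M (%w. e / 2 + indicator {w\<in>space M. \<bar>Z n w\<bar> > e / 2} w)"
     by (intro Bochner_Integration.integrable_add integrable_const integrable_real_indicator) (auto simp: less_top[symmetric])
    fix w assume w: "w \<in> space M"
    show "norm (u n w) <= e / 2 + indicator {w\<in>space M. \<bar>Z n w\<bar> > e / 2} w"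
    proof (cases "\<bar>Z n w\<bar> > e / 2")
     case True
     then have "indicator {w\<in>space M. \<bar>Z n w\<bar> > e / 2} w = (1::real)" using w by (simp add: indicator_def)
     moreover have "norm (u n w) <= 1" unfolding u_def by auto
     ultimately show ?thesis using e by linarith
    next
     case False
     then have "indicator {w\<in>space M. \<bar>Z n w\<bar> > e / 2} w = (0::real)" by (simp add: indicator_def)
     moreover have "norm (u n w) <= \<bar>Z n w\<bar>" unfolding u_def by auto
     ultimately show ?thesis using False by linarith
    qed
   qed
   also have "... = e / 2 + prob {w\<in>space M. \<bar>Z n w\<bar> > e / 2}"
   proof -
    have "expectation (%w. e / 2 + indicator A w) = e / 2 + prob A" if "A \<in> events" for A
     using that by (subst Bochner_Integration.integral_add) (auto simp: prob_space less_top[symmetric])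
    then show ?thesis by measurable
   qed
   also have "... < e" using N[OF n] by simp
   finally show ?thesis .
  qed
  moreover have "0 <= expectation (?q0 u n)" for n by simp
  ultimately show "\<exists>N. \<forall>n\<ge>N. norm (expectation (?q0 u n) - 0) < e" by auto
 qed
 from tendsto_L1_AE_subseq[OF ui this] obtain r where r: "AE w in M. (%n. u (r n) w) \<longlonglongrightarrow> 0" by blast
 have "AE w in M. (%n. Z (r n) w) \<longlonglongrightarrow> 0"
  using r
 proof eventually_elim
  fix w assume l: "(%n. u (r n) w) \<longlonglongrightarrow> 0"
  then have "\<forall>\<^sub>F n in sequentially. u (r n) w < 1" by (intro order_tendstoD(2)) auto
  then have "\<forall>\<^sub>F n in sequentially. u (r n) w = \<bar>Z (r n) w\<bar>" by eventually_elim (auto simp: u_def min_def split: if_splits)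
  with l have "(%n. \<bar>Z (r n) w\<bar>) \<longlonglongrightarrow> 0" by (rule Lim_transform_eventually)
  then show "(%n. Z (r n) w) \<longlonglongrightarrow> 0" by (rule tendsto_rabs_zero_cancel)
 qed
 then show ?thesis by (rule that)
qed

text \<open>Fatou's lemma along an almost surely convergent subsequence. It carries second-moment
  bounds to limits that are only known in probability.\<close>

lemma vanishing_L2_limit:
 assumes v: "vanishing (%n w. Z n w - Y w)" and m: "!!n. Z n \<in> meas M" and Y: "Y \<in> meas M"
  and i: "!!n. integrable M (%w. (Z n w)^2)" and B: "!!n. expectation (%w. (Z n w)^2) <= B"
 shows "integrable M (%w. (Y w)^2)" "expectation (%w. (Y w)^2) <= B" (is ?C1)
proof -
 let ?q0 = "%r w. %n. ennreal ((Z (r n) w)^2)"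
 let ?q1 = "%M. \<integral>\<^sup>+w. ennreal ((Y w)^2) \<partial>M"
 note [measurable] = m Y
 obtain r :: "nat => nat" where r: "AE w in M. (%n. Z (r n) w - Y w) \<longlonglongrightarrow> 0" using vanishing_AE_subseq[OF v] .
 have B0: "0 <= B" using B[of 0] by (rule order_trans[rotated]) auto
 have "(?q1 M) = (\<integral>\<^sup>+w. liminf (?q0 r w) \<partial>M)"
 proof (rule nn_integral_cong_AE, use r in eventually_elim)
  fix w assume "(%n. Z (r n) w - Y w) \<longlonglongrightarrow> 0"
  then have "(%n. Z (r n) w) \<longlonglongrightarrow> Y w" by (rule LIM_zero_cancel)
  then have "(?q0 r w) \<longlonglongrightarrow> ennreal ((Y w)^2)" by (intro tendsto_ennrealI tendsto_power)
  then show "ennreal ((Y w)^2) = liminf (?q0 r w)" by (intro lim_imp_Liminf[symmetric]) simp_all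
 qed
 also have "... <= liminf (%n. \<integral>\<^sup>+w. ennreal ((Z (r n) w)^2) \<partial>M)" by (rule nn_integral_liminf) measurable
 also have "... <= liminf (%n::nat. ennreal B)"
  using i B by (intro Liminf_mono always_eventually allI) (simp add: nn_integral_eq_integral ennreal_leI)
 also have "... = ennreal B" by (simp add: Liminf_const)
 finally have le: "(?q1 M) <= ennreal B" .
 then show int: "integrable M (%w. (Y w)^2)" by (intro integrableI_bounded) (auto simp: le_less_trans[OF _ ennreal_less_top])
 show ?C1 using le B0 by (simp add: nn_integral_eq_integral[OF int])
qed

end

section \<open>Partitions, and convergence along sequences of them\<close>

lemma mesh_less_iff:
 assumes e: "e > 0"
 shows "mesh p < e \<longleftrightarrow> (\<forall>i<length p - 1. p ! Suc i - p ! i < e)"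
proof -
 have "foldr max xs 0 < e \<longleftrightarrow> (\<forall>x\<in>set xs. x < e)" for xs :: "real list"
  using e by (induction xs) auto
 then show ?thesis unfolding mesh_def by auto
qed

lemma partition_nth:
 assumes p: "partition_of a c p"
 shows "length p > 0" "p ! 0 = a" "p ! (length p - 1) = c" "!!i j. i < j ==> j < length p ==> p ! i < p ! j"
 using p unfolding partition_of_def by (auto simp: hd_conv_nth last_conv_nth sorted_wrt_iff_nth_less)

lemma partition_bounds:
 assumes p: "partition_of a c p" and i: "i < length p - 1"
 shows "a <= p ! i" "p ! i < p ! Suc i" "p ! Suc i <= c"
proof -
 note P = partition_nth[OF p]
 show "p ! i < p ! Suc i" using P(4)[of i "Suc i"] i by auto
 show "a <= p ! i" using P(2) P(4)[of 0 i] i by (cases "i = 0") (auto intro: less_imp_le)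
 show "p ! Suc i <= c" using P(3) P(4)[of "Suc i" "length p - 1"] i by (cases "Suc i = length p - 1") (auto intro: less_imp_le)
qed

lemma partition_sum_length:
 assumes p: "partition_of a c p"
 shows "(\<Sum>i<length p - 1. p ! Suc i - p ! i) = c - a"
 using sum_lessThan_telescope[of "%i. p ! i" "length p - 1"] partition_nth[OF p] by simp

lemma conv_in_prob_seqD:
 assumes c: "conv_in_prob M a c S Y" and p: "!!n. partition_of a c (p n)" and m: "(%n. mesh (p n)) \<longlonglongrightarrow> 0" and e: "e > 0"
 shows "(%n. measure M {w\<in>space M. dist (S (p n) w) (Y w) > e}) \<longlonglongrightarrow> 0"
proof (rule LIMSEQ_I)
 fix r :: real assume r: "r > 0"
 obtain \<eta> where \<eta>: "\<eta> > 0" "!!p. partition_of a c p ==> mesh p < \<eta> ==> measure M {w\<in>space M. dist (S p w) (Y w) > e} < r"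
 proof -
  have "\<forall>e>0. \<forall>\<delta>>0. \<exists>\<eta>>0. \<forall>p. partition_of a c p \<and> mesh p < \<eta> --> measure M {w\<in>space M. dist (S p w) (Y w) > e} < \<delta>"
   using c unfolding conv_in_prob_def by (rule conjunct2)
  from this[rule_format, OF e r] show ?thesis using that by (elim exE conjE) simp
 qed
 have "\<forall>\<^sub>F n in sequentially. mesh (p n) < \<eta>" using m \<eta>(1) by (intro order_tendstoD(2)) auto
 then obtain N where "!!n. n >= N ==> mesh (p n) < \<eta>" by (auto simp: eventually_sequentially)
 then have "measure M {w\<in>space M. dist (S (p n) w) (Y w) > e} < r" if "n >= N" for n using that by (intro \<eta>(2) p)
 then show "\<exists>N. \<forall>n\<ge>N. norm (measure M {w\<in>space M. dist (S (p n) w) (Y w) > e} - 0) < r" by (intro exI[of _ N]) simp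
qed

text \<open>If the convergence failed, partitions of mesh below 1 / (n + 1) would form a sequence
  that violates the hypothesis. From here on a single sequence of partitions can be fixed.\<close>

lemma conv_in_prob_seqI:
 assumes Y: "Y \<in> meas M"
  and s: "!!p e. (!!n. partition_of a c (p n)) ==> (%n. mesh (p n)) \<longlonglongrightarrow> 0 ==> e > 0 ==>
   (%n. measure M {w\<in>space M. dist (S (p n) w) (Y w) > e}) \<longlonglongrightarrow> 0"
 shows "conv_in_prob M a c S Y"
 unfolding conv_in_prob_def
proof (intro conjI allI impI Y, rule ccontr)
 fix e \<delta> :: real assume ed: "e > 0" "\<delta> > 0"
 assume n: "\<not> (\<exists>\<eta>>0. \<forall>p. partition_of a c p \<and> mesh p < \<eta> --> measure M {w\<in>space M. dist (S p w) (Y w) > e} < \<delta>)"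
 then have neg: "\<exists>p. partition_of a c p \<and> mesh p < \<eta> \<and> \<not> measure M {w\<in>space M. dist (S p w) (Y w) > e} < \<delta>" if "\<eta> > 0" for \<eta>
  using that by blast
 have "\<forall>n. \<exists>p. partition_of a c p \<and> mesh p < 1 / real (Suc n) \<and> \<not> measure M {w\<in>space M. dist (S p w) (Y w) > e} < \<delta>"
  using neg by simp
 from choice[OF this] obtain p where p: "\<forall>n. partition_of a c (p n) \<and> mesh (p n) < 1 / real (Suc n) \<and> \<not> measure M {w\<in>space M. dist (S (p n) w) (Y w) > e} < \<delta>" ..
 have mnn: "0 <= mesh q" for q
 proof -
  have "0 <= foldr max xs (0::real)" for xs by (induction xs) auto
  then show ?thesis unfolding mesh_def by simp
 qed
 have "(%n. mesh (p n)) \<longlonglongrightarrow> 0"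
 proof (rule tendsto_sandwich[OF _ _ tendsto_const])
  show "(%n. 1 / real (Suc n)) \<longlonglongrightarrow> 0" using LIMSEQ_inverse_real_of_nat by (simp add: divide_inverse)
  show "\<forall>\<^sub>F n in sequentially. mesh (p n) <= 1 / real (Suc n)" using p by (intro always_eventually) (auto simp: less_imp_le simp del: of_nat_Suc)
 qed (use mnn in auto)
 then have "(%n. measure M {w\<in>space M. dist (S (p n) w) (Y w) > e}) \<longlonglongrightarrow> 0" using p ed by (intro s) auto
 then have "\<forall>\<^sub>F n in sequentially. measure M {w\<in>space M. dist (S (p n) w) (Y w) > e} < \<delta>" using ed by (intro order_tendstoD(2)) auto
 then show False using p by (auto simp: eventually_sequentially)
qed

lemma (in brownian) partition_tiling:
 assumes p: "partition_of a c p"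
 shows "tiling {..<length p - 1} (%i. p ! i) (%i. p ! Suc i) {a..<c}"
proof -
 note P = partition_nth[OF p] and B = partition_bounds[OF p]
 have "disjoint_family_on (%i. {p ! i..<p ! Suc i}) {..<length p - 1}"
 proof -
  have *: "{p ! i..<p ! Suc i} \<inter> {p ! j..<p ! Suc j} = {}" if "i < j" "j < length p - 1" for i j
  proof -
   have "p ! Suc i <= p ! j" using P(4)[of "Suc i" j] that by (cases "Suc i = j") (auto intro: less_imp_le)
   then show ?thesis by auto
  qed
  show ?thesis unfolding disjoint_family_on_def
  proof (intro ballI impI)
   fix m n assume "m \<in> {..<length p - 1}" "n \<in> {..<length p - 1}" "m ~= n"
   then show "{p ! m..<p ! Suc m} \<inter> {p ! n..<p ! Suc n} = {}" using *[of m n] *[of n m] by (cases "m < n") auto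
  qed
 qed
 moreover have "(\<Union>i<length p - 1. {p ! i..<p ! Suc i}) = {a..<c}"
 proof -
  have "(\<Union>i<k. {p ! i..<p ! Suc i}) = {p ! 0..<p ! k}" if "k <= length p - 1" for k
   using that
  proof (induction k)
   case (Suc k)
   have "p ! 0 <= p ! k" "p ! k <= p ! Suc k" using P(2) B[of k] Suc.prems by auto
   then show ?case using Suc by (auto simp: lessThan_Suc)
  qed simp
  from this[of "length p - 1"] show ?thesis using P(2,3) by simp
 qed
 ultimately show ?thesis unfolding tiling_def using B(2) by (auto intro: less_imp_le)
qed

section \<open>Increments of an Ito process\<close>

lemma has_bounded_range_on_interval:
 fixes f :: "real => 'a::real_normed_vector"
 assumes "continuous_on {0..T} f"
 obtains B where "B >= 0" "!!t. t \<in> {0..T} ==> norm (f t) <= B"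
proof -
 have "bounded (f ` {0..T})" by (rule compact_imp_bounded[OF compact_continuous_image[OF assms]]) simp
 then obtain B where B: "!!y. y \<in> f ` {0..T} ==> norm y <= B" unfolding bounded_iff by blast
 show ?thesis by (rule that[of "max B 0"]) (use B in \<open>auto intro: le_max_iff_disj[THEN iffD2]\<close>)
qed

text \<open>n + 2 points, hence n + 1 cells: n = 0 already gives a genuine partition and no division
  by 0 arises.\<close>

definition uniform_partition :: "real => real => nat => real list" where
 "uniform_partition r t n = map (%i. r + real i * ((t - r) / real (Suc n))) [0..<n + 2]"

lemma uniform_partition_nth: "i < n + 2 ==> uniform_partition r t n ! i = r + real i * ((t - r) / real (Suc n))"
 unfolding uniform_partition_def by (simp del: upt_Suc)

lemma uniform_partition_length: "length (uniform_partition r t n) = n + 2"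
 unfolding uniform_partition_def by simp

lemma uniform_partition_partition:
 assumes "r < t"
 shows "partition_of r t (uniform_partition r t n)"
proof -
 let ?p = "uniform_partition r t n"
 have ne: "?p ~= []" using uniform_partition_length[of r t n] by auto
 have "sorted_wrt (<) ?p"
  unfolding sorted_wrt_iff_nth_less uniform_partition_length using assms
  by (auto simp del: of_nat_Suc times_divide_eq_right simp: uniform_partition_nth intro!: mult_strict_right_mono divide_pos_pos)
 moreover have "hd ?p = r" using ne by (simp add: hd_conv_nth uniform_partition_nth)
 moreover have "last ?p = t" using ne by (simp add: last_conv_nth uniform_partition_nth uniform_partition_length)
 ultimately show ?thesis unfolding partition_of_def using ne by blast
qed

text \<open>\<open>tl q\<close> drops the common point r, which would otherwise break strict
  monotonicity. Cell k of q becomes cell length p - 1 + k.\<close>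

lemma partition_append:
 assumes p: "partition_of a r p" and q: "partition_of r t q"
 shows "partition_of a t (p @ tl q)" (is ?C1)
  "!!i. i < length p ==> (p @ tl q) ! i = p ! i"
  "!!k. k < length q ==> (p @ tl q) ! (length p - 1 + k) = q ! k"
  "length (p @ tl q) - 1 = (length p - 1) + (length q - 1)"
proof -
 note P = partition_nth[OF p] and Q = partition_nth[OF q]
 show 1: "(p @ tl q) ! i = p ! i" if "i < length p" for i using that by (simp add: nth_append)
 show 2: "(p @ tl q) ! (length p - 1 + k) = q ! k" if k: "k < length q" for k
 proof (cases k)
  case 0 then show ?thesis using P Q by (simp add: nth_append)
 next
  case (Suc j)
  have "length p - 1 + k = length p + j" using Suc P(1) by simp
  then have "(p @ tl q) ! (length p - 1 + k) = tl q ! j" by (simp add: nth_append)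
  then show ?thesis using Suc k by (simp add: nth_tl)
 qed
 show 3: "length (p @ tl q) - 1 = (length p - 1) + (length q - 1)" using P(1) Q(1) by (cases p) auto
 have ne: "p @ tl q ~= []" using P(1) by auto
 have "sorted_wrt (<) (p @ tl q)"
  unfolding sorted_wrt_append
 proof (intro conjI ballI)
  show "sorted_wrt (<) p" using p unfolding partition_of_def by blast
  show "sorted_wrt (<) (tl q)" using q unfolding partition_of_def by (cases q) auto
  fix x y assume x: "x \<in> set p" and y: "y \<in> set (tl q)"
  have "x <= r"
  proof -
   obtain i where i: "i < length p" "x = p ! i" using x by (metis in_set_conv_nth)
   then show ?thesis using P(3) P(4)[of i "length p - 1"] by (cases "i = length p - 1") (auto intro: less_imp_le)
  qed
  moreover have "r < y"
  proof -
   obtain i where i: "i < length (tl q)" "y = tl q ! i" using y by (metis in_set_conv_nth)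
   then show ?thesis using Q(2) Q(4)[of 0 "Suc i"] by (simp add: nth_tl)
  qed
  ultimately show "x < y" by simp
 qed
 moreover have "hd (p @ tl q) = a" using P(1,2) 1[of 0] ne by (simp add: hd_conv_nth)
 moreover have "last (p @ tl q) = t"
  by (subst last_conv_nth[OF ne], subst 3, rule trans[OF 2 Q(3)]) (use Q(1) in simp)
 ultimately show ?C1 unfolding partition_of_def using ne by blast
qed

lemma sum_lessThan_plus:
 fixes f :: "nat => 'a::comm_monoid_add"
 shows "(\<Sum>i<m + n. f i) = (\<Sum>i<m. f i) + (\<Sum>k<n. f (m + k))"
 by (induction n) (simp_all add: add.assoc)

lemma borel_measurable_vecI:
 fixes f :: "'a => real^'n"
 assumes "!!k. (%x. f x $ k) \<in> meas M"
 shows "f \<in> meas M"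
 by (rule borel_measurable_euclidean_space[THEN iffD2]) (use assms in \<open>auto simp: Basis_vec_def inner_axis\<close>)

lemma ito_sum_append:
 assumes p: "partition_of a r p" and q: "partition_of r t q"
 shows "ito_sum H W (p @ tl q) w = ito_sum H W p w + ito_sum H W q w"
proof -
 note A = partition_append[OF p q]
 let ?l = "p @ tl q" and ?m = "length p - 1"
 let ?f = "%l i. H (l ! i) w *v (W (l ! Suc i) w - W (l ! i) w)"
 have "ito_sum H W ?l w = (\<Sum>i<?m. ?f ?l i) + (\<Sum>k<length q - 1. ?f ?l (?m + k))"
  unfolding ito_sum_def A(4) by (rule sum_lessThan_plus)
 also have "(\<Sum>i<?m. ?f ?l i) = ito_sum H W p w"
  unfolding ito_sum_def by (intro sum.cong refl) (simp add: A(2))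
 also have "(\<Sum>k<length q - 1. ?f ?l (?m + k)) = ito_sum H W q w"
  unfolding ito_sum_def
 proof (intro sum.cong refl)
  fix k assume k: "k \<in> {..<length q - 1}"
  have "?l ! (?m + k) = q ! k" "?l ! (?m + Suc k) = q ! Suc k" using A(3)[of k] A(3)[of "Suc k"] k by auto
  then show "?f ?l (?m + k) = ?f q k" by simp
 qed
 finally show ?thesis .
qed

lemma mesh_append_less:
 assumes p: "partition_of a r p" and q: "partition_of r t q" and e: "e > 0" "mesh p < e" "mesh q < e"
 shows "mesh (p @ tl q) < e"
 unfolding mesh_less_iff[OF e(1)] partition_append(4)[OF p q]
proof (intro allI impI)
 note A = partition_append[OF p q]
 fix i assume i: "i < length p - 1 + (length q - 1)"
 show "(p @ tl q) ! Suc i - (p @ tl q) ! i < e"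
 proof (cases "i < length p - 1")
  case True
  then have "p ! Suc i - p ! i < e" using e(2) unfolding mesh_less_iff[OF e(1)] by blast
  then show ?thesis using True A(2)[of i] A(2)[of "Suc i"] by simp
 next
  case False
  define k where "k = i - (length p - 1)"
  have k: "i = length p - 1 + k" "k < length q - 1" unfolding k_def using False i by auto
  have "(p @ tl q) ! i = q ! k" "(p @ tl q) ! Suc i = q ! Suc k" using A(3)[of k] A(3)[of "Suc k"] k by auto
  moreover have "q ! Suc k - q ! k < e" using e(3) k(2) unfolding mesh_less_iff[OF e(1)] by blast
  ultimately show ?thesis by simp
 qed
qed

lemma mesh_nonneg: "0 <= mesh q"
proof -
 have "0 <= foldr max xs (0::real)" for xs by (induction xs) auto
 then show ?thesis unfolding mesh_def by simp
qed

lemma mesh_uniform_tendsto: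
 assumes "r < t"
 shows "(%n. mesh (uniform_partition r t n)) \<longlonglongrightarrow> 0"
proof (rule LIMSEQ_I)
 fix e :: real assume e: "e > 0"
 have "(%n. (t - r) * (1 / real (Suc n))) \<longlonglongrightarrow> (t - r) * 0"
  by (intro tendsto_mult tendsto_const) (use LIMSEQ_inverse_real_of_nat in \<open>simp add: divide_inverse\<close>)
 then have "\<forall>\<^sub>F n in sequentially. (t - r) * (1 / real (Suc n)) < e" using e by (intro order_tendstoD(2)) auto
 then obtain N where N: "!!n. n >= N ==> (t - r) * (1 / real (Suc n)) < e" by (auto simp: eventually_sequentially)
 have "mesh (uniform_partition r t n) < e" if "n >= N" for n
  unfolding mesh_less_iff[OF e] uniform_partition_length
 proof (intro allI impI)
  fix i assume "i < n + 2 - 1"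
  then have "uniform_partition r t n ! Suc i - uniform_partition r t n ! i
    = (real (Suc i) - real i) * ((t - r) / real (Suc n))"
   unfolding left_diff_distrib by (simp add: uniform_partition_nth del: of_nat_Suc times_divide_eq_right)
  also have "... = (t - r) * (1 / real (Suc n))" by simp
  finally show "uniform_partition r t n ! Suc i - uniform_partition r t n ! i < e" using N[OF that] by simp
 qed
 then show "\<exists>N. \<forall>n\<ge>N. norm (mesh (uniform_partition r t n) - 0) < e" using mesh_nonneg by auto
qed

lemma integral_over_partition:
 fixes f :: "real => 'b::banach"
 assumes p: "partition_of r t p" and f: "continuous_on {r..t} f"
 shows "integral {r..t} f = (\<Sum>i<length p - 1. integral {p ! i..p ! Suc i} f)"
proof -
 note P = partition_nth[OF p]
 have "integral {r..p ! j} f = (\<Sum>i<j. integral {p ! i..p ! Suc i} f)" if "j <= length p - 1" for j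
  using that
 proof (induction j)
  case 0 then show ?case using P by simp
 next
  case (Suc j)
  then have j: "j < length p - 1" by simp
  note B = partition_bounds[OF p j]
  have "integral {r..p ! j} f + integral {p ! j..p ! Suc j} f = integral {r..p ! Suc j} f"
   by (rule Henstock_Kurzweil_Integration.integral_combine)
    (use B in \<open>auto intro!: integrable_continuous_interval continuous_on_subset[OF f]\<close>)
  then show ?case using Suc by simp
 qed
 from this[of "length p - 1"] show ?thesis using P by simp
qed

text \<open>Uniform continuity makes f almost constant on each cell, and the cell errors add up to d
  times the length of the interval.\<close>

lemma riemann_sum_tendsto:
 fixes f :: "real => 'b::banach"
 assumes p: "!!n. partition_of r t (p n)" and m: "(%n. mesh (p n)) \<longlonglongrightarrow> 0" and f: "continuous_on {r..t} f"
 shows "(%n. \<Sum>i<length (p n) - 1. (p n ! Suc i - p n ! i) *\<^sub>R f (p n ! i)) \<longlonglongrightarrow> integral {r..t} f"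
proof (rule LIMSEQ_I)
 fix e :: real assume e: "e > 0"
 have rt: "0 <= t - r"
  unfolding partition_sum_length[OF p[of 0], symmetric] using partition_bounds(2)[OF p[of 0]]
  by (intro sum_nonneg) (auto intro: less_imp_le)
 define d where "d = e / (t - r + 1)"
 have d: "d > 0" unfolding d_def using e rt by simp
 have "uniformly_continuous_on {r..t} f" by (rule compact_uniformly_continuous[OF f]) simp
 then obtain \<eta> where \<eta>: "\<eta> > 0" "!!x y. x \<in> {r..t} ==> y \<in> {r..t} ==> dist y x < \<eta> ==> dist (f y) (f x) < d"
  unfolding uniformly_continuous_on_def using d by blast
 have "\<forall>\<^sub>F n in sequentially. mesh (p n) < \<eta>" using m \<eta>(1) by (intro order_tendstoD(2)) auto
 then obtain N where N: "!!n. n >= N ==> mesh (p n) < \<eta>" by (auto simp: eventually_sequentially)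
 show "\<exists>N. \<forall>n\<ge>N. norm ((\<Sum>i<length (p n) - 1. (p n ! Suc i - p n ! i) *\<^sub>R f (p n ! i)) - integral {r..t} f) < e"
 proof (intro exI allI impI)
  fix n assume n: "n >= N"
  let ?p = "p n"
  have *: "norm ((?p ! Suc i - ?p ! i) *\<^sub>R f (?p ! i) - integral {?p ! i..?p ! Suc i} f) <= d * (?p ! Suc i - ?p ! i)"
   if i: "i < length ?p - 1" for i
  proof -
   note B = partition_bounds[OF p i]
   have sub: "{?p ! i..?p ! Suc i} \<subseteq> {r..t}" using B by auto
   have c: "continuous_on {?p ! i..?p ! Suc i} f" by (rule continuous_on_subset[OF f sub])
   have l: "?p ! Suc i - ?p ! i < \<eta>" using N[OF n] i unfolding mesh_less_iff[OF \<eta>(1)] by blast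
   have "integral {?p ! i..?p ! Suc i} (%x. f (?p ! i) - f x)
     = (?p ! Suc i - ?p ! i) *\<^sub>R f (?p ! i) - integral {?p ! i..?p ! Suc i} f"
    using B by (subst Henstock_Kurzweil_Integration.integral_diff) (auto intro!: integrable_continuous_interval c)
   moreover have "norm (integral {?p ! i..?p ! Suc i} (%x. f (?p ! i) - f x)) <= d * (?p ! Suc i - ?p ! i)"
   proof (rule integral_bound)
    show "?p ! i <= ?p ! Suc i" using B by simp
    show "continuous_on {?p ! i..?p ! Suc i} (%x. f (?p ! i) - f x)" by (intro continuous_intros c)
    fix x assume x: "x \<in> {?p ! i..?p ! Suc i}"
    then have "dist (f (?p ! i)) (f x) < d" using \<eta>(2)[of x "?p ! i"] sub l B by (auto simp: dist_real_def)
    then show "norm (f (?p ! i) - f x) <= d" by (simp add: dist_norm)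
   qed
   ultimately show ?thesis by simp
  qed
  have "norm ((\<Sum>i<length ?p - 1. (?p ! Suc i - ?p ! i) *\<^sub>R f (?p ! i)) - integral {r..t} f)
    <= (\<Sum>i<length ?p - 1. d * (?p ! Suc i - ?p ! i))"
   unfolding integral_over_partition[OF p[of n] f] sum_subtractf[symmetric]
   by (rule order_trans[OF norm_sum sum_mono]) (use * in simp)
  also have "... = d * (t - r)" unfolding sum_distrib_left[symmetric] partition_sum_length[OF p] ..
  also have "... < d * (t - r + 1)" using d by simp
  also have "... = e" unfolding d_def using rt by simp
  finally show "norm ((\<Sum>i<length ?p - 1. (?p ! Suc i - ?p ! i) *\<^sub>R f (?p ! i)) - integral {r..t} f) < e" .
 qed
qed

text \<open>\<open>sol\<close> gives each time t its own limit I, fixed up to a null set depending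
  on t; nothing relates the limits at different times.\<close>

locale ito_process = driven M F T W X S L for M :: "'w measure" and F T and W :: "real => 'w => real^'m"
  and X :: "real => 'w => real^'d" and S L +
 fixes \<beta> :: "real => 'w => real^'d" and \<epsilon> :: real and x0 :: "real^'d"
 assumes \<beta>_M: "!!t. t \<in> {0..T} ==> \<beta> t \<in> meas M"
  and \<beta>_cont: "!!w. w \<in> space M ==> continuous_on {0..T} (%t. \<beta> t w)"
  and sol: "!!t. t \<in> {0..T} ==> \<exists>I. conv_in_prob M 0 t (ito_sum S W) I \<and>
   (AE w in M. X t w = x0 + integral {0..t} (%s. \<beta> s w) + \<epsilon> *\<^sub>R I w)"
begin

definition drift :: "real => real => 'w => real^'d" where
 "drift r t w = integral {r..t} (%s. \<beta> s w)"

text \<open>Defined from the continuous paths of X and the drift, so that increments exist for every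
  outcome and add up exactly.\<close>

definition mart :: "real => real => 'w => real^'d" where
 "mart r t w = X t w - X r w - drift r t w"

definition uniform_sum :: "real => real => nat => 'w => real^'d" where
 "uniform_sum r t n w = ito_sum S W (uniform_partition r t n) w"

lemma ito_sum_measurable:
 assumes p: "partition_of r t p" and r: "0 <= r" "t <= T"
 shows "ito_sum S W p \<in> meas M"
 unfolding ito_sum_def
proof (rule borel_measurable_sum)
 fix i assume "i \<in> {..<length p - 1}"
 then have i: "i < length p - 1" by simp
 note B = partition_bounds[OF p i]
 have [measurable]: "S (p ! i) \<in> meas M" using B r by (intro S_M) auto
 have [measurable]: "inc (p ! i) (p ! Suc i) \<in> meas M" using B r by (intro inc_M) auto
 have e: "(S (p ! i) w *v (W (p ! Suc i) w - W (p ! i) w)) $ k = S (p ! i) w $ k \<bullet> inc (p ! i) (p ! Suc i) w" for w k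
  unfolding inc_def by (simp add: matrix_vector_mul_component)
 show "(%w. S (p ! i) w *v (W (p ! Suc i) w - W (p ! i) w)) \<in> meas M"
  by (rule borel_measurable_vecI) (unfold e, measurable)
qed

lemma integral_path_measurable:
 fixes f :: "real => 'w => 'b::{banach, second_countable_topology}"
 assumes rt: "0 <= r" "r <= t" "t <= T" and m: "!!s. s \<in> {0..T} ==> f s \<in> meas M"
  and c: "!!w. w \<in> space M ==> continuous_on {0..T} (%s. f s w)"
 shows "(%w. integral {r..t} (%s. f s w)) \<in> meas M"
proof (cases "r = t")
 case True then show ?thesis by simp
next
 case False
 with rt have r: "r < t" by simp
 let ?p = "uniform_partition r t"
 note p = uniform_partition_partition[OF r]
 show ?thesis
 proof (rule borel_measurable_LIMSEQ_metric[where f="%n w. \<Sum>i<length (?p n) - 1. (?p n ! Suc i - ?p n ! i) *\<^sub>R f (?p n ! i) w"])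
  show "(%w. \<Sum>i<length (?p n) - 1. (?p n ! Suc i - ?p n ! i) *\<^sub>R f (?p n ! i) w) \<in> meas M" for n
  proof (rule borel_measurable_sum)
   fix i assume "i \<in> {..<length (?p n) - 1}"
   then have "?p n ! i \<in> {0..T}" using partition_bounds[OF p[of n], of i] rt by auto
   from m[OF this] show "(%w. (?p n ! Suc i - ?p n ! i) *\<^sub>R f (?p n ! i) w) \<in> meas M" by measurable
  qed
  fix w assume "w \<in> space M"
  then show "(%n. \<Sum>i<length (?p n) - 1. (?p n ! Suc i - ?p n ! i) *\<^sub>R f (?p n ! i) w) \<longlonglongrightarrow> integral {r..t} (%s. f s w)"
   by (intro riemann_sum_tendsto p mesh_uniform_tendsto r continuous_on_subset[OF c]) (use rt in auto)
 qed
qed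

lemma drift_M: "0 <= r ==> r <= t ==> t <= T ==> drift r t \<in> meas M"
 unfolding drift_def[abs_def] by (rule integral_path_measurable[OF _ _ _ \<beta>_M \<beta>_cont])

lemma mart_M: "0 <= r ==> r <= t ==> t <= T ==> mart r t \<in> meas M"
 unfolding mart_def[abs_def] by (intro borel_measurable_diff X_M drift_M) auto

text \<open>The limits for [0, t] and [0, r] are unrelated, but gluing a partition of [0, r] to one
  of [r, t] makes the Ito sums differ by exactly the sum over [r, t]; the two limits can then be
  subtracted.\<close>

lemma mart_limit:
 assumes r: "0 <= r" "r < t" "t <= T"
 shows "vanishing (%n w. norm (\<epsilon> *\<^sub>R uniform_sum r t n w - mart r t w))"
proof -
 let ?q0 = "%w. %s. \<beta> s w"
 \<comment> \<open>For r = 0 the interval is a point and its only partition is [0], with empty Ito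
   sum.\<close>
 define B where "B n = (if r = 0 then [0] else uniform_partition 0 r n)" for n
 have B: "partition_of 0 r (B n)" for n
  unfolding B_def using r uniform_partition_partition[of 0 r n] by (auto simp: partition_of_def)
 have mB: "(%n. mesh (B n)) \<longlonglongrightarrow> 0"
  unfolding B_def using r mesh_uniform_tendsto[of 0 r] by (cases "r = 0") (auto simp: mesh_def)
 define U where "U = uniform_partition r t"
 have U: "partition_of r t (U n)" for n unfolding U_def by (rule uniform_partition_partition[OF r(2)])
 have mU: "(%n. mesh (U n)) \<longlonglongrightarrow> 0" unfolding U_def by (rule mesh_uniform_tendsto[OF r(2)])
 define A where "A n = B n @ tl (U n)" for n
 have A: "partition_of 0 t (A n)" for n unfolding A_def by (rule partition_append(1)[OF B U])
 have mA: "(%n. mesh (A n)) \<longlonglongrightarrow> 0"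
 proof (rule LIMSEQ_I)
  fix e :: real assume e: "e > 0"
  have "\<forall>\<^sub>F n in sequentially. mesh (B n) < e \<and> mesh (U n) < e"
   using order_tendstoD(2)[OF mB e] order_tendstoD(2)[OF mU e] by eventually_elim simp
  then have "\<forall>\<^sub>F n in sequentially. mesh (A n) < e"
   by eventually_elim (simp add: A_def mesh_append_less[OF B U e])
  then show "\<exists>N. \<forall>n\<ge>N. norm (mesh (A n) - 0) < e" using mesh_nonneg by (simp add: eventually_sequentially)
 qed
 have tr: "t \<in> {0..T}" "r \<in> {0..T}" using r by auto
 obtain I where I: "conv_in_prob M 0 t (ito_sum S W) I" "AE w in M. X t w = x0 + integral {0..t} (?q0 w) + \<epsilon> *\<^sub>R I w"
  using sol[OF tr(1)] by blast
 obtain K where K: "conv_in_prob M 0 r (ito_sum S W) K" "AE w in M. X r w = x0 + integral {0..r} (?q0 w) + \<epsilon> *\<^sub>R K w"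
  using sol[OF tr(2)] by blast
 have IK[measurable]: "I \<in> meas M" "K \<in> meas M"
  using conjunct1[OF I(1)[unfolded conv_in_prob_def]] conjunct1[OF K(1)[unfolded conv_in_prob_def]] by simp_all
 have Am[measurable]: "ito_sum S W (A n) \<in> meas M" "ito_sum S W (B n) \<in> meas M"
  "ito_sum S W (U n) \<in> meas M" for n
  by (rule ito_sum_measurable[OF A] ito_sum_measurable[OF B] ito_sum_measurable[OF U]; use r in auto)+
 have [measurable]: "mart r t \<in> meas M" using r by (intro mart_M) auto
 have vI: "vanishing (%n w. dist (ito_sum S W (A n) w) (I w))"
  unfolding vanishing_def using conv_in_prob_seqD[OF I(1) A mA] by simp
 have vK: "vanishing (%n w. dist (ito_sum S W (B n) w) (K w))"
  unfolding vanishing_def using conv_in_prob_seqD[OF K(1) B mB] by simp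
 have mk: "AE w in M. mart r t w = \<epsilon> *\<^sub>R (I w - K w)"
  using I(2) K(2) AE_space
 proof eventually_elim
  case (elim w)
  have "integral {0..r} (?q0 w) + integral {r..t} (?q0 w) = integral {0..t} (?q0 w)"
   by (rule Henstock_Kurzweil_Integration.integral_combine)
    (use r in \<open>auto intro!: integrable_continuous_interval continuous_on_subset[OF \<beta>_cont[OF elim(3)]]\<close>)
  then show ?case using elim unfolding mart_def drift_def by (simp add: algebra_simps)
 qed
 have bnd: "norm (\<epsilon> *\<^sub>R uniform_sum r t n w - \<epsilon> *\<^sub>R (I w - K w))
   <= \<bar>\<bar>\<epsilon>\<bar> * (dist (ito_sum S W (A n) w) (I w) + dist (ito_sum S W (B n) w) (K w))\<bar>" for n w
 proof -
  have "uniform_sum r t n w = ito_sum S W (U n) w" unfolding uniform_sum_def U_def ..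
  then have e: "uniform_sum r t n w = ito_sum S W (A n) w - ito_sum S W (B n) w"
   unfolding A_def ito_sum_append[OF B U] by simp
  have "norm (\<epsilon> *\<^sub>R uniform_sum r t n w - \<epsilon> *\<^sub>R (I w - K w))
   = \<bar>\<epsilon>\<bar> * norm ((ito_sum S W (A n) w - I w) - (ito_sum S W (B n) w - K w))"
   unfolding e scaleR_diff_right[symmetric] norm_scaleR by (simp add: algebra_simps)
  also have "... <= \<bar>\<epsilon>\<bar> * (dist (ito_sum S W (A n) w) (I w) + dist (ito_sum S W (B n) w) (K w))"
   unfolding dist_norm by (intro mult_left_mono norm_triangle_ineq4) simp
  also have "... <= \<bar>...\<bar>" by simp
  finally show ?thesis .
 qed
 have us: "uniform_sum r t n \<in> meas M" for n using Am(3)[of n] unfolding uniform_sum_def[abs_def] U_def .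
 note [measurable] = us
 have "vanishing (%n w. norm (\<epsilon> *\<^sub>R uniform_sum r t n w - \<epsilon> *\<^sub>R (I w - K w)))"
  by (rule vanishing_dominated[OF vanishing_cmult[OF vanishing_add[OF vI vK], of "\<bar>\<epsilon>\<bar>"]])
   (simp, use bnd in simp)
 moreover have "prob {w\<in>space M. \<bar>norm (\<epsilon> *\<^sub>R uniform_sum r t n w - mart r t w)\<bar> > e}
  = prob {w\<in>space M. \<bar>norm (\<epsilon> *\<^sub>R uniform_sum r t n w - \<epsilon> *\<^sub>R (I w - K w))\<bar> > e}" for n e
  by (rule prob_eq_AE) (use mk in eventually_elim, auto)
 ultimately show ?thesis unfolding vanishing_def by simp
qed

lemma uniform_sum_measurable: "0 <= r ==> r < t ==> t <= T ==> uniform_sum r t n \<in> meas M"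
 unfolding uniform_sum_def[abs_def] by (rule ito_sum_measurable[OF uniform_partition_partition])

end

lemma borel_measurable_vector_matrix_mult:
 fixes f :: "'a => real^'d" and g :: "'a => real^'m^'d"
 assumes [measurable]: "f \<in> meas M" "g \<in> meas M"
 shows "(%x. f x v* g x) \<in> meas M"
proof -
 have "x v* A = (\<Sum>k\<in>UNIV. x $ k *\<^sub>R A $ k)" for x :: "real^'d" and A :: "real^'m^'d"
  by (simp add: vector_matrix_mult_def vec_eq_iff mult.commute)
 then show ?thesis by simp
qed

context ito_process
begin

lemma inc_telescope:
 assumes p: "partition_of r t p"
 shows "(\<Sum>i<length p - 1. inc (p ! i) (p ! Suc i) w) = inc r t w"
 using sum_lessThan_telescope[of "%i. W (p ! i) w" "length p - 1"] partition_nth[OF p] unfolding inc_def by simp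

text \<open>On each cell the martingale part is the limit in probability of Ito sums along uniform refinements; the isometry
 bounds these sums uniformly, and the bound passes to the limit by Fatou's lemma.\<close>

lemma mart_approx:
 fixes h :: "nat => 'w => real^'d"
 assumes p: "partition_of 0 T p" and A: "A \<subseteq> {..<length p - 1}"
  and hm: "!!i. i \<in> A ==> h i \<in> meas (F (p ! i))"
  and hb: "!!i w. i \<in> A ==> w \<in> space M ==> norm (h i w) <= C" and C: "C >= 0"
  and \<eta>: "!!s t. s \<in> {0..T} ==> t \<in> {0..T} ==> \<bar>s - t\<bar> < \<eta> ==> expectation (%w. (norm (S s w - S t w))^2) <= e"
  and m: "!!i. i \<in> A ==> p ! Suc i - p ! i < \<eta>"
 defines "Y \<equiv> %w. \<Sum>i\<in>A. h i w \<bullet> (mart (p ! i) (p ! Suc i) w - \<epsilon> *\<^sub>R (S (p ! i) w *v inc (p ! i) (p ! Suc i) w))"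
 shows "integrable M (%w. (Y w)^2)" (is ?C1)
  "expectation (%w. (Y w)^2) <= \<epsilon>^2 * (C^2 * e * (\<Sum>i\<in>A. p ! Suc i - p ! i))"
proof -
 let ?q0 = "%A. \<Sum>i\<in>A. p ! Suc i - p ! i"
 let ?q1 = "%i n w. \<epsilon> *\<^sub>R uniform_sum (p ! i) (p ! Suc i) n w - mart (p ! i) (p ! Suc i) w"
 let ?q2 = "%i n w. uniform_sum (p ! i) (p ! Suc i) n w - S (p ! i) w *v inc (p ! i) (p ! Suc i) w"
 let ?q3 = "%g n z. %w. (norm (g n z w))^2"
 have fin: "finite A" using finite_subset[OF A] by simp
 have Ai: "i < length p - 1" if "i \<in> A" for i using A that by auto
 note B = partition_bounds[OF p Ai]
 define q where "q n i = uniform_partition (p ! i) (p ! Suc i) n" for n i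
 have q: "partition_of (p ! i) (p ! Suc i) (q n i)" if "i \<in> A" for i n
  unfolding q_def by (rule uniform_partition_partition) (rule B(2)[OF that])
 have lq: "length (q n i) - 1 = Suc n" for n i unfolding q_def uniform_partition_length by simp
 have qb: "p ! i <= q n i ! k" "q n i ! k < q n i ! Suc k" "q n i ! Suc k <= p ! Suc i" if "i \<in> A" "k < Suc n" for i k n
  using partition_bounds[OF q[OF that(1)], of k n] that(2) unfolding lq by simp_all
 define I where "I n = A \<times> {..<Suc n}" for n
 define a where "a n z = q n (fst z) ! snd z" for n z
 define b where "b n z = q n (fst z) ! Suc (snd z)" for n z
 \<comment> \<open>Subtracting the coefficient frozen at the left end of the large cell leaves only
   the oscillation of S inside that cell, which is at most e in mean square.\<close>
 define g where "g n z w = h (fst z) w v* (S (a n z) w - S (p ! fst z) w)" for n z w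
 have bnds: "0 <= p ! fst z" "p ! fst z <= a n z" "a n z <= b n z" "b n z <= p ! Suc (fst z)" "b n z <= T" "a n z < b n z" if "z \<in> I n" for z n
 proof -
  have z: "fst z \<in> A" "snd z < Suc n" using that unfolding I_def by auto
  show "0 <= p ! fst z" "p ! fst z <= a n z" "a n z <= b n z" "b n z <= p ! Suc (fst z)" "b n z <= T" "a n z < b n z"
   using B[OF z(1)] qb[OF z] unfolding a_def b_def by simp_all
 qed
 have gm: "g n z \<in> meas (F (a n z))" if z: "z \<in> I n" for n z
 proof -
  note b = bnds[OF z]
  have zA: "fst z \<in> A" using z unfolding I_def by auto
  have 1: "S (a n z) \<in> meas (F (a n z))" using b by (intro S_adapted) auto
  have 2: "S (p ! fst z) \<in> meas (F (a n z))"
   using b by (intro F_measurable_mono[OF S_adapted]) auto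
  have "h (fst z) \<in> meas (F (a n z))" using b by (intro F_measurable_mono[OF hm[OF zA]]) auto
  then show ?thesis unfolding g_def by (intro borel_measurable_vector_matrix_mult borel_measurable_diff 1 2)
 qed
 have gb: "norm (g n z w) <= C * norm (S (a n z) w - S (p ! fst z) w)" if z: "z \<in> I n" and w: "w \<in> space M" for n z w
 proof -
  have zA: "fst z \<in> A" using z unfolding I_def by auto
  show ?thesis unfolding g_def
   by (rule order_trans[OF norm_vector_matrix_mult_le]) (intro mult_right_mono hb[OF zA w] norm_ge_zero)
 qed
 have pT: "a n z \<in> {0..T}" "p ! fst z \<in> {0..T}" if "z \<in> I n" for z n using bnds[OF that] by auto
 have SL: "norm (S s w - S t w) <= 2 * L" if "s \<in> {0..T}" "t \<in> {0..T}" "w \<in> space M" for s t w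
  using norm_triangle_ineq4[of "S s w" "S t w"] S_bound[OF that(1,3)] S_bound[OF that(2,3)] by linarith
 have ad: "adapted_family (I n) (a n) (b n) (g n)" for n
  unfolding adapted_family_def
 proof (intro ballI conjI)
  fix z assume z: "z \<in> I n"
  show "0 <= a n z" "a n z <= b n z" "b n z <= T" using bnds[OF z] by auto
  show "g n z \<in> meas (F (a n z))" by (rule gm[OF z])
  show "\<exists>C. \<forall>w\<in>space M. norm (g n z w) <= C"
   by (intro exI[of _ "C * (2 * L)"] ballI order_trans[OF gb[OF z]] mult_left_mono SL pT[OF z] C)
 qed
 have ti: "tiling (I n) (a n) (b n) (\<Union>z\<in>I n. {a n z..<b n z})" for n
  unfolding tiling_def
 proof (intro conjI refl ballI)
  show "finite (I n)" unfolding I_def using fin by simp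
  show "a n z <= b n z" if "z \<in> I n" for z using bnds[OF that] by simp
  show "disjoint_family_on (%z. {a n z..<b n z}) (I n)"
   unfolding disjoint_family_on_def
  proof (intro ballI impI)
   fix z z' assume z: "z \<in> I n" "z' \<in> I n" "z ~= z'"
   then have zA: "fst z \<in> A" "fst z' \<in> A" "snd z < Suc n" "snd z' < Suc n" unfolding I_def by auto
   show "{a n z..<b n z} \<inter> {a n z'..<b n z'} = {}"
   proof (cases "fst z = fst z'")
    case True
    then have ne: "snd z ~= snd z'" using z(3) by (simp add: prod_eq_iff)
    have "disjoint_family_on (%k. {q n (fst z) ! k..<q n (fst z) ! Suc k}) {..<Suc n}"
     using partition_tiling[OF q[OF zA(1)], of n] unfolding tiling_def lq by simp
    then show ?thesis using ne zA(3,4) True unfolding disjoint_family_on_def a_def b_def by simp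
   next
    case False
    have "disjoint_family_on (%i. {p ! i..<p ! Suc i}) {..<length p - 1}"
     using partition_tiling[OF p] unfolding tiling_def by simp
    then have "{p ! fst z..<p ! Suc (fst z)} \<inter> {p ! fst z'..<p ! Suc (fst z')} = {}"
     using False Ai[OF zA(1)] Ai[OF zA(2)] unfolding disjoint_family_on_def by simp
    moreover have "{a n z..<b n z} \<subseteq> {p ! fst z..<p ! Suc (fst z)}" "{a n z'..<b n z'} \<subseteq> {p ! fst z'..<p ! Suc (fst z')}"
     using bnds[OF z(1)] bnds[OF z(2)] by auto
    ultimately show ?thesis by blast
   qed
  qed
 qed
 define Z where "Z n w = \<epsilon> * simple_integral (I n) (a n) (b n) (g n) w" for n w
 have Zm: "Z n \<in> meas M" for n
  unfolding Z_def[abs_def] by (intro borel_measurable_times borel_measurable_const simple_integral_measurable[OF ad])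
 note iso = simple_integral_isometry[OF ad ti]
 have Zi: "integrable M (%w. (Z n w)^2)" for n unfolding Z_def power_mult_distrib using iso(1)[of n] by simp
 have gi: "expectation (?q3 g n z) <= C^2 * e" if z: "z \<in> I n" for n z
 proof -
  have zA: "fst z \<in> A" using z unfolding I_def by auto
  have "\<bar>a n z - p ! fst z\<bar> < \<eta>" using bnds[OF z] m[OF zA] by auto
  from \<eta>[OF pT[OF z] this] have 1: "expectation (%w. (norm (S (a n z) w - S (p ! fst z) w))^2) <= e" .
  have i: "integrable M (%w. (norm (S (a n z) w - S (p ! fst z) w))^2)"
   by (rule integrable_norm_diff_sq[OF S_M[OF pT(1)[OF z]] S_M[OF pT(2)[OF z]] S_bound[OF pT(1)[OF z]] S_bound[OF pT(2)[OF z]]])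
  have "expectation (?q3 g n z) <= expectation (%w. C^2 * (norm (S (a n z) w - S (p ! fst z) w))^2)"
  proof (rule integral_mono_AE')
   show "integrable M (%w. C^2 * (norm (S (a n z) w - S (p ! fst z) w))^2)" using i by simp
   show "AE w in M. (norm (g n z w))^2 <= C^2 * (norm (S (a n z) w - S (p ! fst z) w))^2"
    unfolding power_mult_distrib[symmetric] by (intro AE_I2 power_mono gb[OF z] norm_ge_zero)
  qed simp
  also have "... <= C^2 * e" using 1 by (simp add: mult_left_mono)
  finally show ?thesis .
 qed
 have sumI: "(\<Sum>z\<in>I n. b n z - a n z) = (?q0 A)" for n
 proof -
  have "(\<Sum>z\<in>I n. b n z - a n z) = (\<Sum>i\<in>A. \<Sum>k<Suc n. q n i ! Suc k - q n i ! k)"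
   unfolding I_def a_def b_def by (simp only: sum.cartesian_product split_def)
  also have "... = (?q0 A)"
   using partition_sum_length[OF q] unfolding lq by (intro sum.cong refl) simp
  finally show ?thesis .
 qed
 have ZB: "expectation (%w. (Z n w)^2) <= \<epsilon>^2 * (C^2 * e * (?q0 A))" for n
 proof -
  have "expectation (%w. (Z n w)^2) = \<epsilon>^2 * (\<Sum>z\<in>I n. (b n z - a n z) * expectation (?q3 g n z))"
   unfolding Z_def power_mult_distrib using iso(2)[of n] by simp
  also have "... <= \<epsilon>^2 * (\<Sum>z\<in>I n. (b n z - a n z) * (C^2 * e))"
   using bnds by (intro mult_left_mono sum_mono gi) auto
  also have "... = \<epsilon>^2 * (C^2 * e * (?q0 A))" unfolding sum_distrib_right[symmetric] sumI by simp
  finally show ?thesis .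
 qed
 have mm: "mart (p ! i) (p ! Suc i) \<in> meas M" if "i \<in> A" for i using B[OF that] by (intro mart_M) auto
 have hM: "h i \<in> meas M" if "i \<in> A" for i using B[OF that] by (intro F_measurable_M[OF hm[OF that]]) auto
 have coefM: "S (p ! i) \<in> meas M" "inc (p ! i) (p ! Suc i) \<in> meas M" if "i \<in> A" for i
  using B[OF that] by (auto intro!: S_M inc_M)
 have Ym: "Y \<in> meas M" unfolding Y_def
 proof (rule borel_measurable_sum)
  fix i assume i: "i \<in> A"
  note [measurable] = mm[OF i] hM[OF i] coefM[OF i]
  have [measurable]: "(%w. S (p ! i) w *v inc (p ! i) (p ! Suc i) w) \<in> meas M"
  proof (rule borel_measurable_vecI)
   fix k show "(%w. (S (p ! i) w *v inc (p ! i) (p ! Suc i) w) $ k) \<in> meas M"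
    unfolding matrix_vector_mul_component by measurable
  qed
  show "(%w. h i w \<bullet> (mart (p ! i) (p ! Suc i) w - \<epsilon> *\<^sub>R (S (p ! i) w *v inc (p ! i) (p ! Suc i) w))) \<in> meas M"
   by measurable
 qed
 have id: "Z n w - Y w = (\<Sum>i\<in>A. h i w \<bullet> (?q1 i n w))" for n w
 proof -
  have 1: "(\<Sum>k<Suc n. g n (i, k) w \<bullet> inc (a n (i, k)) (b n (i, k)) w)
    = h i w \<bullet> (?q2 i n w)" if i: "i \<in> A" for i
  proof -
   have t: "inc (p ! i) (p ! Suc i) w = (\<Sum>k<Suc n. inc (q n i ! k) (q n i ! Suc k) w)"
    using inc_telescope[OF q[OF i], of n w] unfolding lq ..
   have u: "uniform_sum (p ! i) (p ! Suc i) n w = (\<Sum>k<Suc n. S (q n i ! k) w *v inc (q n i ! k) (q n i ! Suc k) w)"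
    unfolding uniform_sum_def ito_sum_def inc_def using lq[of n i] unfolding q_def by simp
   show ?thesis unfolding t u g_def a_def b_def fst_conv snd_conv dot_lmul_matrix
     linear_sum[OF matrix_vector_mul_linear] sum_subtractf[symmetric] inner_sum_right matrix_vector_mult_diff_rdistrib ..
  qed
  have "simple_integral (I n) (a n) (b n) (g n) w = (\<Sum>i\<in>A. \<Sum>k<Suc n. g n (i, k) w \<bullet> inc (a n (i, k)) (b n (i, k)) w)"
   unfolding simple_integral_def I_def by (simp only: sum.cartesian_product split_def prod.collapse)
  also have "... = (\<Sum>i\<in>A. h i w \<bullet> (?q2 i n w))"
   by (intro sum.cong refl 1)
  finally show ?thesis unfolding Z_def Y_def
   by (simp add: sum_distrib_left sum_subtractf[symmetric] inner_diff_right right_diff_distrib)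
 qed
 have "vanishing (%n w. Z n w - Y w)"
  unfolding id
 proof (rule vanishing_sum[OF fin])
  fix i assume i: "i \<in> A"
  note bi = B[OF i]
  have u: "uniform_sum (p ! i) (p ! Suc i) n \<in> meas M" for n using bi by (intro uniform_sum_measurable) auto
  note [measurable] = mm[OF i] hM[OF i] u
  show "vanishing (%n w. h i w \<bullet> (?q1 i n w))"
  proof (rule vanishing_dominated[OF vanishing_cmult[OF mart_limit, of "p ! i" "p ! Suc i" C]])
   show "0 <= p ! i" "p ! i < p ! Suc i" "p ! Suc i <= T" using bi by auto
   fix n w assume w: "w \<in> space M"
   let ?v = "\<epsilon> *\<^sub>R uniform_sum (p ! i) (p ! Suc i) n w - mart (p ! i) (p ! Suc i) w"
   have "\<bar>h i w \<bullet> ?v\<bar> <= norm (h i w) * norm ?v" by (rule Cauchy_Schwarz_ineq2)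
   also have "... <= C * norm ?v" by (intro mult_right_mono hb[OF i w]) simp
   also have "... <= \<bar>C * norm ?v\<bar>" by simp
   finally show "\<bar>h i w \<bullet> ?v\<bar> <= \<bar>C * norm ?v\<bar>" .
  qed measurable
 qed
 from vanishing_L2_limit[OF this Zm Ym Zi ZB] show ?C1
  "expectation (%w. (Y w)^2) <= \<epsilon>^2 * (C^2 * e * (?q0 A))" .
qed

end

text \<open>Pairing A x with itself moves A to the other factor, where the bound for the transposed
  product applies.\<close>

lemma norm_matrix_vector_mult_le: "norm ((A::real^'m^'n) *v x) <= norm A * norm x"
proof (cases "A *v x = 0")
 case False
 have "norm (A *v x) * norm (A *v x) = ((A *v x) v* A) \<bullet> x"
  unfolding dot_lmul_matrix by (simp add: power2_norm_eq_inner[symmetric] power2_eq_square)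
 also have "... <= norm ((A *v x) v* A) * norm x" by (rule norm_cauchy_schwarz)
 also have "... <= (norm (A *v x) * norm A) * norm x" by (intro mult_right_mono norm_vector_matrix_mult_le norm_ge_zero)
 finally have "norm (A *v x) * norm (A *v x) <= norm (A *v x) * (norm A * norm x)" by (simp add: mult.assoc)
 then show ?thesis using False by (simp add: mult_le_cancel_left)
qed simp

section \<open>Increments along a fixed sequence of partitions\<close>

locale ito_mesh = ito_process M F T W X S L \<beta> \<epsilon> x0
 for M :: "'w measure" and F T and W :: "real => 'w => real^'m"
  and X :: "real => 'w => real^'d" and S L \<beta> \<epsilon> x0 +
 fixes p :: "nat => real list"
 assumes p: "!!n. partition_of 0 T (p n)" and mesh_p: "(%n. mesh (p n)) \<longlonglongrightarrow> 0"
begin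

definition cells :: "nat => nat set" where "cells n = {..<length (p n) - 1}"
definition pt :: "nat => nat => real" where "pt n i = p n ! i"
definition len :: "nat => nat => real" where "len n i = pt n (Suc i) - pt n i"
definition dX :: "nat => nat => 'w => real^'d" where "dX n i w = X (pt n (Suc i)) w - X (pt n i) w"
definition dW :: "nat => nat => 'w => real^'m" where "dW n i = inc (pt n i) (pt n (Suc i))"
definition dA :: "nat => nat => 'w => real^'d" where "dA n i = drift (pt n i) (pt n (Suc i))"
text \<open>The noise with coefficient frozen at the left end: the leading part of
  \<open>dX\<close>. The error of freezing is \<open>dG\<close>, and \<open>er\<close> collects all
  that is negligible in quadratic mean, so that dX = dm + er.\<close>

definition dm :: "nat => nat => 'w => real^'d" where "dm n i w = \<epsilon> *\<^sub>R (S (pt n i) w *v dW n i w)"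
definition dG :: "nat => nat => 'w => real^'d" where "dG n i w = mart (pt n i) (pt n (Suc i)) w - dm n i w"
definition er :: "nat => nat => 'w => real^'d" where "er n i w = dA n i w + dG n i w"

lemma finite_cells[simp]: "finite (cells n)" unfolding cells_def by simp

lemma cell_bounds:
 assumes "i \<in> cells n"
 shows "0 <= pt n i" "pt n i < pt n (Suc i)" "pt n (Suc i) <= T" "pt n i \<in> {0..T}" "pt n (Suc i) \<in> {0..T}" "0 < len n i"
 using partition_bounds[OF p, of i n] assms unfolding cells_def pt_def len_def by auto

lemma cells_nonempty: "cells n ~= {}"
proof -
 have "length (p n) ~= 1" using partition_nth[OF p[of n]] T_pos by auto
 then have "0 < length (p n) - 1" using partition_nth(1)[OF p[of n]] by linarith
 then have "0 \<in> cells n" unfolding cells_def by simp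
 then show ?thesis by blast
qed

lemma sum_len: "(\<Sum>i\<in>cells n. len n i) = T"
 using partition_sum_length[OF p[of n]] unfolding cells_def len_def pt_def by simp

lemma len_small: "e > 0 ==> \<exists>n0. \<forall>n\<ge>n0. \<forall>i\<in>cells n. len n i < e"
proof -
 assume e: "e > 0"
 have "\<forall>\<^sub>F n in sequentially. mesh (p n) < e" using mesh_p e by (intro order_tendstoD(2)) auto
 then show ?thesis unfolding eventually_sequentially mesh_less_iff[OF e] cells_def len_def pt_def by (simp add: Ball_def)
qed

lemma dX_split: "dX n i w = dm n i w + er n i w"
 unfolding dX_def er_def dG_def dA_def mart_def by simp

lemma path_oscillation:
 fixes f :: "real => 'b::real_normed_vector"
 assumes f: "continuous_on {0..T} f" and e: "e > 0"
 shows "\<exists>n0. \<forall>n\<ge>n0. \<forall>i\<in>cells n. \<forall>u\<in>{pt n i..pt n (Suc i)}. norm (f u - f (pt n i)) < e"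
proof -
 have "uniformly_continuous_on {0..T} f" by (rule compact_uniformly_continuous[OF f]) simp
 then obtain \<eta> where \<eta>: "\<eta> > 0" "!!x y. x \<in> {0..T} ==> y \<in> {0..T} ==> dist y x < \<eta> ==> dist (f y) (f x) < e"
  unfolding uniformly_continuous_on_def using e by blast
 obtain n0 where n0: "!!n i. n >= n0 ==> i \<in> cells n ==> len n i < \<eta>" using len_small[OF \<eta>(1)] by blast
 show ?thesis
 proof (intro exI allI impI ballI)
  fix n i u assume n: "n >= n0" and i: "i \<in> cells n" and u: "u \<in> {pt n i..pt n (Suc i)}"
  have "dist u (pt n i) < \<eta>" using n0[OF n i] u unfolding len_def by (auto simp: dist_real_def)
  moreover have "u \<in> {0..T}" using u cell_bounds[OF i] by auto
  ultimately show "norm (f u - f (pt n i)) < e" using \<eta>(2)[OF cell_bounds(4)[OF i]] unfolding dist_norm by blast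
 qed
qed

lemma increments_M:
 assumes i: "i \<in> cells n"
 shows "dX n i \<in> meas M" "dW n i \<in> meas M" "dA n i \<in> meas M"
  "dm n i \<in> meas M" "dG n i \<in> meas M" "er n i \<in> meas M" (is ?C1)
proof -
 note B = cell_bounds[OF i]
 show 1: "dX n i \<in> meas M" unfolding dX_def[abs_def] by (intro borel_measurable_diff X_M B)
 show 2: "dW n i \<in> meas M" unfolding dW_def using B by (intro inc_M) auto
 show 3: "dA n i \<in> meas M" unfolding dA_def using B by (intro drift_M) auto
 show 4: "dm n i \<in> meas M" unfolding dm_def[abs_def]
 proof (intro borel_measurable_scaleR borel_measurable_const borel_measurable_vecI)
  note [measurable] = S_M[OF B(4)] 2
  fix k show "(%w. (S (pt n i) w *v dW n i w) $ k) \<in> meas M"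
   unfolding matrix_vector_mul_component by measurable
 qed
 have "mart (pt n i) (pt n (Suc i)) \<in> meas M" using B by (intro mart_M) auto
 then show 5: "dG n i \<in> meas M" unfolding dG_def[abs_def] using 4 by (rule borel_measurable_diff)
 show ?C1 unfolding er_def[abs_def] using 3 5 by (rule borel_measurable_add)
qed

lemma sum_sq_M:
 "(%w. \<Sum>i\<in>cells n. (norm (dA n i w))^2) \<in> meas M"
 "(%w. \<Sum>i\<in>cells n. (norm (dm n i w))^2) \<in> meas M"
 "(%w. \<Sum>i\<in>cells n. (norm (dG n i w))^2) \<in> meas M"
 "(%w. \<Sum>i\<in>cells n. (norm (er n i w))^2) \<in> meas M"
proof -
 have *: "(%w. \<Sum>i\<in>cells n. (norm (f i w))^2) \<in> meas M" if "!!i. i \<in> cells n ==> f i \<in> meas M"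
  for f :: "nat => 'w => real^'d"
  by (rule borel_measurable_sum) (intro borel_measurable_power measurable_compose[OF that borel_measurable_norm])
 show "(%w. \<Sum>i\<in>cells n. (norm (dA n i w))^2) \<in> meas M" by (rule *[OF increments_M(3)])
 show "(%w. \<Sum>i\<in>cells n. (norm (dm n i w))^2) \<in> meas M" by (rule *[OF increments_M(4)])
 show "(%w. \<Sum>i\<in>cells n. (norm (dG n i w))^2) \<in> meas M" by (rule *[OF increments_M(5)])
 show "(%w. \<Sum>i\<in>cells n. (norm (er n i w))^2) \<in> meas M" by (rule *[OF increments_M(6)])
qed

definition max_step :: "nat => 'w => real" where
 "max_step n w = Max ((%i. norm (dX n i w)) ` cells n)"

lemma max_step_ge: "i \<in> cells n ==> norm (dX n i w) <= max_step n w"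
 unfolding max_step_def by (intro Max_ge) auto

lemma max_step_nonneg: "0 <= max_step n w"
proof -
 obtain i where "i \<in> cells n" using cells_nonempty by blast
 from max_step_ge[OF this] show ?thesis using norm_ge_zero order_trans by blast
qed

lemma max_step_vanishing: "vanishing max_step"
proof (rule vanishing_AE)
 show "max_step n \<in> meas M" for n
  unfolding max_step_def[abs_def] by (rule borel_measurable_Max[where f="%i w. norm (dX n i w)"], simp, rule measurable_compose[OF increments_M(1) borel_measurable_norm], assumption)
 show "AE w in M. (%n. max_step n w) \<longlonglongrightarrow> 0"
 proof (rule AE_I2)
  fix w assume w: "w \<in> space M"
  show "(%n. max_step n w) \<longlonglongrightarrow> 0"
  proof (rule LIMSEQ_I)
   fix e :: real assume e: "e > 0"
   obtain n0 where n0: "!!n i u. n >= n0 ==> i \<in> cells n ==> u \<in> {pt n i..pt n (Suc i)} ==> norm (X u w - X (pt n i) w) < e"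
    using path_oscillation[OF X_cont[OF w] e] by blast
   have "max_step n w < e" if n: "n >= n0" for n
   proof -
    have "norm (dX n i w) < e" if i: "i \<in> cells n" for i
     unfolding dX_def using cell_bounds(2)[OF i] by (intro n0[OF n i]) simp
    then show ?thesis unfolding max_step_def using cells_nonempty[of n] by (subst Max_less_iff) simp_all
   qed
   then show "\<exists>n0. \<forall>n\<ge>n0. norm (max_step n w - 0) < e" using max_step_nonneg by auto
  qed
 qed
qed

lemma drift_sq_vanishing: "vanishing (%n w. \<Sum>i\<in>cells n. (norm (dA n i w))^2)"
proof (rule vanishing_AE[OF sum_sq_M(1)], rule AE_I2)
 fix w assume w: "w \<in> space M"
 obtain B where B: "B >= 0" "!!t. t \<in> {0..T} ==> norm (\<beta> t w) <= B"
  using has_bounded_range_on_interval[OF \<beta>_cont[OF w]] by blast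
 have dA: "norm (dA n i w) <= B * len n i" if i: "i \<in> cells n" for n i
  unfolding dA_def drift_def len_def
 proof (rule integral_bound)
  note C = cell_bounds[OF i]
  show "pt n i <= pt n (Suc i)" using C by simp
  show "continuous_on {pt n i..pt n (Suc i)} (%s. \<beta> s w)" by (rule continuous_on_subset[OF \<beta>_cont[OF w]]) (use C in auto)
  show "norm (\<beta> t w) <= B" if "t \<in> {pt n i..pt n (Suc i)}" for t using B(2) that C by auto
 qed
 show "(%n. \<Sum>i\<in>cells n. (norm (dA n i w))^2) \<longlonglongrightarrow> 0"
 proof (rule LIMSEQ_I)
  fix e :: real assume e: "e > 0"
  define d where "d = e / (B^2 * T + 1)"
  have pos: "B^2 * T + 1 > 0" using T_pos by (simp add: add_nonneg_pos)
  have d: "d > 0" unfolding d_def using e pos by simp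
  obtain n0 where n0: "!!n i. n >= n0 ==> i \<in> cells n ==> len n i < d" using len_small[OF d] by blast
  have "(\<Sum>i\<in>cells n. (norm (dA n i w))^2) < e" if n: "n >= n0" for n
  proof -
   have "(\<Sum>i\<in>cells n. (norm (dA n i w))^2) <= (\<Sum>i\<in>cells n. B^2 * d * len n i)"
   proof (rule sum_mono)
    fix i assume i: "i \<in> cells n"
    have "(norm (dA n i w))^2 <= (B * len n i)^2" by (intro power_mono dA[OF i]) simp
    also have "... = B^2 * (len n i * len n i)" by (simp add: power_mult_distrib power2_eq_square)
    also have "... <= B^2 * (d * len n i)" using n0[OF n i] cell_bounds(6)[OF i] by (intro mult_left_mono mult_right_mono) auto
    finally show "(norm (dA n i w))^2 <= B^2 * d * len n i" by simp
   qed
   also have "... = d * (B^2 * T)" unfolding sum_distrib_left[symmetric] sum_len by simp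
   also have "... < d * (B^2 * T + 1)" using d by simp
   also have "... = e" unfolding d_def using pos by simp
   finally show ?thesis .
  qed
  then show "\<exists>n0. \<forall>n\<ge>n0. norm ((\<Sum>i\<in>cells n. (norm (dA n i w))^2) - 0) < e" by (auto simp: sum_nonneg)
 qed
qed

text \<open>Arbitrary sets A of cells are allowed so that one statement serves both A =
  \<open>cells n\<close>, for weighted sums, and A = {i}, for single squares.\<close>

lemma noise_functional:
 fixes h :: "nat => nat => 'w => real^'d"
 assumes hm: "!!n i. i \<in> cells n ==> h n i \<in> meas (F (pt n i))"
  and hb: "!!n i w. i \<in> cells n ==> w \<in> space M ==> norm (h n i w) <= C" and C: "C >= 0" and e: "e > 0"
 obtains n0 where "!!n A. n >= n0 ==> A \<subseteq> cells n ==> integrable M (%w. (\<Sum>i\<in>A. h n i w \<bullet> dG n i w)^2)"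
  "!!n A. n >= n0 ==> A \<subseteq> cells n ==> expectation (%w. (\<Sum>i\<in>A. h n i w \<bullet> dG n i w)^2) <= e * (\<Sum>i\<in>A. len n i)"
proof -
 let ?q0 = "%A n. %w. (\<Sum>i\<in>A. h n i w \<bullet> dG n i w)^2"
 let ?q1 = "%A n. \<Sum>i\<in>A. len n i"
 let ?q2 = "\<epsilon>^2 * C^2 + 1"
 \<comment> \<open>The isometry costs the factor eps^2 * C^2; adding 1 avoids division by 0.\<close>
 define e' where "e' = e / ?q2"
 have pos: "\<epsilon>^2 * C^2 + 1 > 0" by (simp add: add_nonneg_pos)
 have e': "e' > 0" unfolding e'_def using e pos by simp
 obtain \<eta> where \<eta>: "\<eta> > 0" "!!s t. s \<in> {0..T} ==> t \<in> {0..T} ==> \<bar>s - t\<bar> < \<eta> ==> expectation (%w. (norm (S s w - S t w))^2) <= e'"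
  using mean_square_modulus[of T S, OF S_M S_cont S_bound e'] by blast
 obtain n0 where n0: "!!n i. n >= n0 ==> i \<in> cells n ==> len n i < \<eta>" using len_small[OF \<eta>(1)] by blast
 have *: "integrable M (?q0 A n) \<and>
   expectation (?q0 A n) <= e * (?q1 A n)" if n: "n >= n0" and A: "A \<subseteq> cells n" for n A
 proof
  have AA: "A \<subseteq> {..<length (p n) - 1}" using A unfolding cells_def .
  have iA: "i \<in> cells n" if "i \<in> A" for i using A that by blast
  have mA: "p n ! Suc i - p n ! i < \<eta>" if "i \<in> A" for i using n0[OF n iA[OF that]] unfolding len_def pt_def .
  note m = mart_approx[OF p AA hm[OF iA, unfolded pt_def] hb[OF iA] C \<eta>(2) mA]
  show "integrable M (?q0 A n)"
   using m(1) unfolding dG_def dm_def dW_def pt_def .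
  have "expectation (?q0 A n) <= \<epsilon>^2 * (C^2 * e' * (?q1 A n))"
   using m(2) unfolding dG_def dm_def dW_def pt_def len_def .
  also have "... = (\<epsilon>^2 * C^2) * e' * (?q1 A n)" by simp
  also have "... <= ?q2 * e' * (?q1 A n)"
   using e' cell_bounds(6)[OF iA] by (intro mult_right_mono sum_nonneg) (auto intro: less_imp_le)
  also have "... = e * (?q1 A n)" unfolding e'_def using pos by simp
  finally show "expectation (?q0 A n) <= e * (?q1 A n)" .
 qed
 show ?thesis by (rule that[of n0]) (use * in blast)+
qed

text \<open>Second moments are demanded only from some index on, because the isometry bounds hold
  only for meshes below the modulus of the coefficients.\<close>

lemma vanishing_L2_eventually:
 assumes m: "!!n. Z n \<in> meas M"
  and b: "!!e. e > 0 ==> \<exists>n0. \<forall>n\<ge>n0. integrable M (%w. (Z n w)^2) \<and> expectation (%w. (Z n w)^2) <= e"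
 shows "vanishing Z"
 unfolding vanishing_def
proof (intro conjI allI impI m)
 fix k :: real assume k: "k > 0"
 show "(%n. prob {w\<in>space M. \<bar>Z n w\<bar> > k}) \<longlonglongrightarrow> 0"
 proof (rule LIMSEQ_I)
  fix r :: real assume r: "r > 0"
  have "r / 2 * k^2 > 0" using r k by simp
  from b[OF this] obtain n0 where n0: "!!n. n >= n0 ==> integrable M (%w. (Z n w)^2)" "!!n. n >= n0 ==> expectation (%w. (Z n w)^2) <= r / 2 * k^2"
   by blast
  have "prob {w\<in>space M. \<bar>Z n w\<bar> > k} < r" if n: "n >= n0" for n
  proof -
   note [measurable] = m
   have "prob {w\<in>space M. \<bar>Z n w\<bar> > k} <= prob {w\<in>space M. (Z n w)^2 > k^2}"
   proof (rule finite_measure_mono)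
    have "k^2 < x^2" if "k < \<bar>x\<bar>" for x using power_strict_mono[OF that, of 2] k by simp
    then show "{w\<in>space M. \<bar>Z n w\<bar> > k} \<subseteq> {w\<in>space M. (Z n w)^2 > k^2}" by auto
   qed measurable
   also have "... <= expectation (%w. (Z n w)^2) / k^2" using k by (intro markov_prob n0(1)[OF n]) auto
   also have "... <= r / 2" using n0(2)[OF n] k by (simp add: pos_divide_le_eq)
   also have "... < r" using r by simp
   finally show ?thesis .
  qed
  then show "\<exists>n0. \<forall>n\<ge>n0. norm (prob {w\<in>space M. \<bar>Z n w\<bar> > k} - 0) < r" by auto
 qed
qed

lemma vanishing_L1_eventually:
 assumes m: "!!n. Z n \<in> meas M" and nn: "!!n w. 0 <= Z n w"
  and b: "!!e. e > 0 ==> \<exists>n0. \<forall>n\<ge>n0. integrable M (Z n) \<and> expectation (Z n) <= e"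
 shows "vanishing Z"
proof -
 have "vanishing (%n w. sqrt (Z n w))"
  by (rule vanishing_L2_eventually) (use m nn b in \<open>auto simp: real_sqrt_pow2\<close>)
 from vanishing_mult[OF this this] show ?thesis using nn by simp
qed

text \<open>The previous functional is applied to single cells with unit coordinate vectors as
  coefficients: each squared component is at most d * len in mean, and the lengths add up to
  T.\<close>

lemma noise_sq_vanishing: "vanishing (%n w. \<Sum>i\<in>cells n. (norm (dG n i w))^2)"
proof (rule vanishing_L1_eventually[OF sum_sq_M(3)])
 show "0 <= (\<Sum>i\<in>cells n. (norm (dG n i w))^2)" for n w by (intro sum_nonneg) simp
 fix e :: real assume e: "e > 0"
 define d where "d = e / (real CARD('d) * T)"
 have d: "d > 0" unfolding d_def using e T_pos by simp
 have "\<forall>k::'d. \<exists>n0. \<forall>n\<ge>n0. \<forall>i\<in>cells n. integrable M (%w. (dG n i w $ k)^2) \<and> expectation (%w. (dG n i w $ k)^2) <= d * len n i"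
 proof
  fix k :: 'd
  obtain n0 where n0: "!!n A. n >= n0 ==> A \<subseteq> cells n ==> integrable M (%w. (\<Sum>i\<in>A. (axis k 1 :: real^'d) \<bullet> dG n i w)^2)"
   "!!n A. n >= n0 ==> A \<subseteq> cells n ==> expectation (%w. (\<Sum>i\<in>A. (axis k 1 :: real^'d) \<bullet> dG n i w)^2) <= d * (\<Sum>i\<in>A. len n i)"
   by (rule noise_functional[of "%n i w. axis k 1 :: real^'d" 1 d]) (use d in auto)
  show "\<exists>n0. \<forall>n\<ge>n0. \<forall>i\<in>cells n. integrable M (%w. (dG n i w $ k)^2) \<and> expectation (%w. (dG n i w $ k)^2) <= d * len n i"
  proof (intro exI allI impI ballI)
   fix n i assume n: "n >= n0" and i: "i \<in> cells n"
   then show "integrable M (%w. (dG n i w $ k)^2) \<and> expectation (%w. (dG n i w $ k)^2) <= d * len n i"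
    using n0[OF n, of "{i}"] by (simp add: inner_axis')
  qed
 qed
 then obtain n0 where n0: "!!k n i. n >= n0 k ==> i \<in> cells n ==> integrable M (%w. (dG n i w $ k)^2)"
  "!!k n i. n >= n0 k ==> i \<in> cells n ==> expectation (%w. (dG n i w $ k)^2) <= d * len n i"
  unfolding choice_iff by blast
 have nr: "(norm v)^2 = (\<Sum>k\<in>UNIV. (v $ k)^2)" for v :: "real^'d"
  unfolding power2_norm_eq_inner inner_vec_def by (simp add: power2_eq_square)
 show "\<exists>n0. \<forall>n\<ge>n0. integrable M (%w. \<Sum>i\<in>cells n. (norm (dG n i w))^2) \<and>
   expectation (%w. \<Sum>i\<in>cells n. (norm (dG n i w))^2) <= e"
 proof (intro exI allI impI)
  fix n assume "n >= Max (range n0)"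
  then have n: "n >= n0 k" for k by (rule order_trans[rotated]) (intro Max_ge, auto)
  have I: "integrable M (%w. \<Sum>k\<in>UNIV. (dG n i w $ k)^2)" if "i \<in> cells n" for i
   by (intro Bochner_Integration.integrable_sum n0(1)[OF n that])
  have "expectation (%w. \<Sum>i\<in>cells n. (norm (dG n i w))^2) = (\<Sum>i\<in>cells n. \<Sum>k\<in>UNIV. expectation (%w. (dG n i w $ k)^2))"
   unfolding nr using I n0(1)[OF n] by (simp add: Bochner_Integration.integral_sum)
  also have "... <= (\<Sum>i\<in>cells n. \<Sum>k\<in>(UNIV::'d set). d * len n i)" by (intro sum_mono n0(2)[OF n])
  also have "... = real CARD('d) * d * (\<Sum>i\<in>cells n. len n i)" by (simp add: sum_distrib_left mult.assoc)
  also have "... = e" unfolding sum_len d_def using T_pos by simp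
  finally show "integrable M (%w. \<Sum>i\<in>cells n. (norm (dG n i w))^2) \<and>
   expectation (%w. \<Sum>i\<in>cells n. (norm (dG n i w))^2) <= e" unfolding nr using I by simp
 qed
qed

lemma er_sq_vanishing: "vanishing (%n w. \<Sum>i\<in>cells n. (norm (er n i w))^2)"
proof (rule vanishing_dominated[OF vanishing_cmult[OF vanishing_add[OF drift_sq_vanishing noise_sq_vanishing], of 2] sum_sq_M(4)])
 fix n w assume "w \<in> space M"
 have "(norm (er n i w))^2 <= 2 * (norm (dA n i w))^2 + 2 * (norm (dG n i w))^2" for i
 proof -
  have "(norm (er n i w))^2 <= (norm (dA n i w) + norm (dG n i w))^2"
   unfolding er_def by (intro power_mono norm_triangle_ineq) simp
  also have "... <= 2 * (norm (dA n i w))^2 + 2 * (norm (dG n i w))^2"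
   using zero_le_power2[of "norm (dA n i w) - norm (dG n i w)"] by (simp add: power2_sum power2_diff)
  finally show ?thesis .
 qed
 then have "(\<Sum>i\<in>cells n. (norm (er n i w))^2) <= (\<Sum>i\<in>cells n. 2 * (norm (dA n i w))^2 + 2 * (norm (dG n i w))^2)" by (intro sum_mono)
 also have "... = 2 * ((\<Sum>i\<in>cells n. (norm (dA n i w))^2) + (\<Sum>i\<in>cells n. (norm (dG n i w))^2))"
  by (simp add: sum.distrib sum_distrib_left)
 finally show "\<bar>\<Sum>i\<in>cells n. (norm (er n i w))^2\<bar> <= \<bar>2 * ((\<Sum>i\<in>cells n. (norm (dA n i w))^2) + (\<Sum>i\<in>cells n. (norm (dG n i w))^2))\<bar>"
  by (simp add: sum_nonneg)
qed

text \<open>The quadratic variation of the leading part does not vanish; an L1 bound independent of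
  n is exactly what \<open>vanishing_mult_L1_bounded\<close> consumes.\<close>

lemma noise_sq_L1:
 "integrable M (%w. \<Sum>i\<in>cells n. (norm (dm n i w))^2)"
 "expectation (%w. \<bar>\<Sum>i\<in>cells n. (norm (dm n i w))^2\<bar>) <= \<epsilon>^2 * L^2 * real CARD('m) * T"
proof -
 let ?q0 = "%i. %w. (norm (dW n i w))^2"
 let ?q1 = "%w. \<bar>\<Sum>i\<in>cells n. (norm (dm n i w))^2\<bar>"
 let ?q2 = "%w. \<Sum>i\<in>cells n. (norm (dm n i w))^2"
 have nr: "(norm v)^2 = (\<Sum>k\<in>UNIV. v $ k * v $ k)" for v :: "real^'m"
  unfolding power2_norm_eq_inner inner_vec_def by simp
 let ?f = "%w. \<epsilon>^2 * L^2 * (\<Sum>i\<in>cells n. (norm (dW n i w))^2)"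
 have Wi: "integrable M (?q0 i)" "expectation (?q0 i) = real CARD('m) * len n i" if i: "i \<in> cells n" for i
 proof -
  note B = cell_bounds[OF i]
  have b: "0 <= pt n i" "pt n i <= pt n (Suc i)" "pt n (Suc i) <= T" using B by auto
  show "integrable M (?q0 i)" unfolding nr dW_def by (intro Bochner_Integration.integrable_sum inc_moment2(1)[OF b])
  show "expectation (?q0 i) = real CARD('m) * len n i"
   unfolding nr dW_def by (subst Bochner_Integration.integral_sum) (use inc_moment2[OF b] in \<open>auto simp: len_def\<close>)
 qed
 have fi: "integrable M ?f" using Wi(1) by (intro integrable_mult_right Bochner_Integration.integrable_sum)
 have le: "(\<Sum>i\<in>cells n. (norm (dm n i w))^2) <= ?f w" if w: "w \<in> space M" for w
  unfolding sum_distrib_left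
 proof (rule sum_mono)
  fix i assume i: "i \<in> cells n"
  have "norm (S (pt n i) w *v dW n i w) <= L * norm (dW n i w)"
   using norm_matrix_vector_mult_le[of "S (pt n i) w" "dW n i w"] mult_right_mono[OF S_bound[OF cell_bounds(4)[OF i] w] norm_ge_zero[of "dW n i w"]] by linarith
  then have "norm (dm n i w) <= \<bar>\<epsilon>\<bar> * (L * norm (dW n i w))" unfolding dm_def norm_scaleR by (intro mult_left_mono) auto
  then have "(norm (dm n i w))^2 <= (\<bar>\<epsilon>\<bar> * (L * norm (dW n i w)))^2" by (intro power_mono) auto
  then show "(norm (dm n i w))^2 <= \<epsilon>^2 * L^2 * (norm (dW n i w))^2" by (simp add: power_mult_distrib)
 qed
 show i: "integrable M ?q2"
  by (rule Bochner_Integration.integrable_bound[OF fi sum_sq_M(2)])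
   (use le in \<open>auto simp: sum_nonneg intro!: AE_I2 order_trans[OF le]\<close>)
 have "expectation ?q1 = expectation ?q2"
  by (simp add: sum_nonneg)
 also have "... <= expectation ?f" by (intro integral_mono i fi le)
 also have "... = \<epsilon>^2 * L^2 * real CARD('m) * T"
  using Wi by (simp add: Bochner_Integration.integral_sum sum_distrib_left[symmetric] sum_len)
 finally show "expectation ?q1 <= \<epsilon>^2 * L^2 * real CARD('m) * T" .
qed

end

section \<open>Convergence of the Stratonovich sums\<close>

lemma norm_column_le: "norm (column j (A::real^'m^'d)) <= norm A"
 using norm_matrix_vector_mult_le[of A "axis j 1"] by (simp add: matrix_vector_mult_basis)

lemma borel_measurable_column:
 fixes f :: "'a => real^'m^'d"
 assumes [measurable]: "f \<in> meas M"
 shows "(%x. column j (f x)) \<in> meas M"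
 by (rule borel_measurable_vecI) (simp add: column_def)

section \<open>Gradient terms and the Ito correction\<close>

context ito_process
begin

definition grad :: "(real \<times> (real^'d) => real^'d) => real => real^'d => real^'d => real^'d" where
 "grad \<phi> t x h = (\<Sum>b\<in>Basis. (h \<bullet> b) *\<^sub>R pderivs [(0, b)] \<phi> (t, x))"

text \<open>Coefficient (i, j) of the quadratic form that sends v to the inner product of the
  derivative of \<open>\<phi>\<close> in direction S v with S v. Its trace is the density of the Ito
  correction.\<close>

definition qcoef :: "(real \<times> (real^'d) => real^'d) => 'm => 'm => real => 'w => real" where
 "qcoef \<phi> i j t w = grad \<phi> t (X t w) (column j (S t w)) \<bullet> column i (S t w)"

definition drift_functional :: "(real \<times> (real^'d) => real^'d) => 'w => real" where
 "drift_functional \<phi> w = integral {0..T} (%u. \<phi> (u, X u w) \<bullet> \<beta> u w)"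

definition correction :: "(real \<times> (real^'d) => real^'d) => 'w => real" where
 "correction \<phi> w = integral {0..T} (%u. \<Sum>i\<in>UNIV. qcoef \<phi> i i u w)"

lemma linear_grad: "linear (grad \<phi> t x)"
 unfolding grad_def
 by (intro linearI) (simp_all add: inner_add_left scaleR_left.add sum.distrib scaleR_sum_right)

lemma grad_quadratic:
 "grad \<phi> t (X t w) (S t w *v v) \<bullet> (S t w *v v) = (\<Sum>i\<in>UNIV. \<Sum>j\<in>UNIV. qcoef \<phi> i j t w * (v $ i * v $ j))"
proof -
 have e: "S t w *v v = (\<Sum>i\<in>UNIV. v $ i *\<^sub>R column i (S t w))"
  by (simp add: matrix_mult_sum scalar_mult_eq_scaleR)
 have g: "grad \<phi> t (X t w) (S t w *v v) = (\<Sum>j\<in>UNIV. v $ j *\<^sub>R grad \<phi> t (X t w) (column j (S t w)))"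
  unfolding e by (simp add: linear_sum[OF linear_grad] linear_cmul[OF linear_grad])
 show ?thesis unfolding g qcoef_def unfolding e
  by (simp add: inner_sum_left inner_sum_right sum_distrib_left mult_ac)
qed

context
 fixes a c :: real and \<phi> :: "real \<times> (real^'d) => real^'d"
 assumes tf: "test_fun a c \<phi>"
begin

lemma partial_continuous: "b \<in> Basis ==> continuous_on UNIV (pderivs [(0, b :: real^'d)] \<phi>)"
 by (rule pderivs_continuous[OF tf]) (auto simp: Basis_prod_def)

lemma grad_bound: obtains C where "C >= 0" "!!t x h. norm (grad \<phi> t x h) <= C * norm h"
proof -
 have "\<exists>B\<ge>0. \<forall>z. norm (pderivs [(0, b)] \<phi> z) <= B" if "b \<in> Basis" for b :: "real^'d"
  by (rule pderivs_bounded[OF tf]) (use that in \<open>auto simp: Basis_prod_def\<close>)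
 then have "\<forall>b\<in>Basis. \<exists>B\<ge>0. \<forall>z. norm (pderivs [(0, b :: real^'d)] \<phi> z) <= B" by blast
 from bchoice[OF this] obtain B where B: "!!b. b \<in> Basis ==> 0 <= B b" "!!b z. b \<in> Basis ==> norm (pderivs [(0, b :: real^'d)] \<phi> z) <= B b" by blast
 show ?thesis
 proof (rule that[of "sum B Basis"])
  show "0 <= sum B Basis" using B by (intro sum_nonneg)
  fix t x h
  show "norm (grad \<phi> t x h) <= sum B Basis * norm h"
   unfolding grad_def sum_distrib_right
  proof (intro order_trans[OF norm_sum sum_mono])
   fix b :: "real^'d" assume b: "b \<in> Basis"
   have "\<bar>h \<bullet> b\<bar> * norm (pderivs [(0, b)] \<phi> (t, x)) <= norm h * B b"
    by (intro mult_mono Basis_le_norm B b) auto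
   then show "norm ((h \<bullet> b) *\<^sub>R pderivs [(0, b)] \<phi> (t, x)) <= B b * norm h" by (simp add: mult.commute del: pderivs.simps)
  qed
 qed
qed

lemma path_phi_continuous: "w \<in> space M ==> continuous_on {0..T} (%t. \<phi> (t, X t w))"
 by (rule continuous_on_compose2[OF test_fun_continuous[OF tf]]) (auto intro!: continuous_intros X_cont)

lemma path_qcoef_continuous:
 assumes w: "w \<in> space M"
 shows "continuous_on {0..T} (%t. qcoef \<phi> i j t w)"
proof -
 have c: "continuous_on {0..T} (%t. column j (S t w))" for j
  unfolding column_def by (intro continuous_on_vec_lambda continuous_on_component S_cont w)
 have "continuous_on {0..T} (%t. pderivs [(0, b)] \<phi> (t, X t w))" if "b \<in> Basis" for b
  by (rule continuous_on_compose2[OF partial_continuous[OF that]]) (auto intro!: continuous_intros X_cont w)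
 then show ?thesis unfolding qcoef_def grad_def by (intro continuous_intros c)
qed

lemma phi_adapted: "t \<in> {0..T} ==> (%w. \<phi> (t, X t w)) \<in> meas (F t)"
proof -
 assume t: "t \<in> {0..T}"
 note [measurable] = X_adapted[OF t]
 have "(%w. (t, X t w)) \<in> F t \<rightarrow>\<^sub>M borel" unfolding borel_prod[symmetric] by measurable
 from measurable_compose[OF this test_fun_measurable[OF tf]] show ?thesis .
qed

lemma qcoef_adapted:
 assumes t: "t \<in> {0..T}"
 shows "qcoef \<phi> i j t \<in> meas (F t)"
proof -
 note [measurable] = X_adapted[OF t] borel_measurable_column[OF S_adapted[OF t]]
 have p: "(%w. (t, X t w)) \<in> F t \<rightarrow>\<^sub>M borel" unfolding borel_prod[symmetric] by measurable
 have "(%w. pderivs [(0, b)] \<phi> (t, X t w)) \<in> meas (F t)" if "b \<in> Basis" for b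
  by (rule measurable_compose[OF p borel_measurable_continuous_onI[OF partial_continuous[OF that]]])
 then have "(%w. \<Sum>b\<in>Basis. (column j (S t w) \<bullet> b) *\<^sub>R pderivs [(0, b)] \<phi> (t, X t w)) \<in> meas (F t)"
  by (intro borel_measurable_sum borel_measurable_scaleR) (simp_all del: pderivs.simps)
 then show ?thesis unfolding qcoef_def[abs_def] grad_def by (rule borel_measurable_inner) measurable
qed

lemma qcoef_bound: obtains C where "C >= 0" "!!i j t w. t \<in> {0..T} ==> w \<in> space M ==> \<bar>qcoef \<phi> i j t w\<bar> <= C"
proof -
 obtain C where C: "C >= 0" "!!t x h. norm (grad \<phi> t x h) <= C * norm h" by (rule grad_bound) blast
 show ?thesis
 proof (rule that[of "C * L * L"])
  show "0 <= C * L * L" using C(1) L_nonneg by simp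
  fix i j t w assume t: "t \<in> {0..T}" and w: "w \<in> space M"
  have n: "norm (column k (S t w)) <= L" for k using norm_column_le[of k "S t w"] S_bound[OF t w] by linarith
  have "\<bar>qcoef \<phi> i j t w\<bar> <= norm (grad \<phi> t (X t w) (column j (S t w))) * norm (column i (S t w))"
   unfolding qcoef_def by (rule Cauchy_Schwarz_ineq2)
  also have "... <= (C * L) * L"
   using C L_nonneg n by (intro mult_mono order_trans[OF C(2)] mult_left_mono) auto
  finally show "\<bar>qcoef \<phi> i j t w\<bar> <= C * L * L" .
 qed
qed

lemma drift_functional_M: "drift_functional \<phi> \<in> meas M"
 unfolding drift_functional_def[abs_def]
proof (rule integral_path_measurable)
 fix s assume s: "s \<in> {0..T}"
 have "(%w. \<phi> (s, X s w)) \<in> meas M" using F_measurable_M[OF phi_adapted[OF s]] s by simp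
 then show "(%w. \<phi> (s, X s w) \<bullet> \<beta> s w) \<in> meas M" using \<beta>_M[OF s] by (rule borel_measurable_inner)
next
 fix w assume "w \<in> space M"
 then show "continuous_on {0..T} (%s. \<phi> (s, X s w) \<bullet> \<beta> s w)" by (intro continuous_intros path_phi_continuous \<beta>_cont)
qed (use T_pos in auto)

lemma correction_M: "correction \<phi> \<in> meas M"
 unfolding correction_def[abs_def]
proof (rule integral_path_measurable)
 fix s assume s: "s \<in> {0..T}"
 have "qcoef \<phi> i i s \<in> meas M" for i using F_measurable_M[OF qcoef_adapted[OF s]] s by simp
 then show "(%w. \<Sum>i\<in>UNIV. qcoef \<phi> i i s w) \<in> meas M" by (rule borel_measurable_sum)
next
 fix w assume "w \<in> space M"
 then show "continuous_on {0..T} (%s. \<Sum>i\<in>UNIV. qcoef \<phi> i i s w)" by (intro continuous_intros path_qcoef_continuous)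
qed (use T_pos in auto)

end

end

section \<open>Limits of the individual terms\<close>

context ito_mesh
begin

text \<open>The centred products are orthogonal in L2 across cells, and by the fourth moments each
  has variance of order len^2. The sum of these is at most the mesh times T, up to a
  constant.\<close>

lemma quadratic_variation_vanishing:
 fixes Q :: "nat => nat => 'w => real"
 assumes Qm: "!!n i. i \<in> cells n ==> Q n i \<in> meas (F (pt n i))"
  and Qb: "!!n i w. i \<in> cells n ==> w \<in> space M ==> \<bar>Q n i w\<bar> <= C"
 shows "vanishing (%n w. \<Sum>i\<in>cells n. Q n i w * (dW n i w $ j * dW n i w $ k - (if j = k then len n i else 0)))"
proof -
 let ?q0 = "%n f. %w. (\<Sum>i\<in>cells n. f n i w)^2"
 let ?q1 = "%n. \<Sum>i\<in>cells n. C^2 * (8 * (len n i)^2)"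
 let ?q2 = "%f n i. %w. (f n i w)^2"
 let ?q3 = "%g n i. %w. (g n i (dW n i w))^2"
 let ?q4 = "%n i. if j = k then len n i else 0"
 define g where "g n i x = x $ j * x $ k - (?q4 n i)" for n i and x :: "real^'m"
 have gm[measurable]: "g n i \<in> meas borel" for n i unfolding g_def by measurable
 define f where "f n i w = Q n i w * g n i (dW n i w)" for n i w
 have b: "0 <= pt n i" "pt n i <= pt n (Suc i)" "pt n (Suc i) <= T" if "i \<in> cells n" for n i using cell_bounds[OF that] by auto
 have QM: "Q n i \<in> meas M" if i: "i \<in> cells n" for n i using F_measurable_M[OF Qm[OF i]] cell_bounds[OF i] by simp
 have gi: "integrable M (%w. g n i (dW n i w))" "expectation (%w. g n i (dW n i w)) = 0" if i: "i \<in> cells n" for n i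
  unfolding g_def dW_def using inc_moment2[OF b[OF i], of j k] by (auto simp: prob_space len_def)
 \<comment> \<open>8 = 3 + 3 + 2: two fourth moments 3 * len^2 and the square of the centring,
   counted twice.\<close>
 have g2: "integrable M (?q3 g n i)" "expectation (?q3 g n i) <= 8 * (len n i)^2" if i: "i \<in> cells n" for n i
 proof -
  let ?h = "%w. (dW n i w $ j)^4 + (dW n i w $ k)^4 + 2 * (len n i)^2"
  note m4 = inc_moment4[OF b[OF i], folded dW_def]
  have hi: "integrable M ?h" using m4(1) by (intro Bochner_Integration.integrable_add) auto
  have le: "(g n i x)^2 <= (x $ j)^4 + (x $ k)^4 + 2 * (len n i)^2" for x
  proof -
   have "(g n i x)^2 <= 2 * (x $ j * x $ k)^2 + 2 * (?q4 n i)^2"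
    unfolding g_def using zero_le_power2[of "x $ j * x $ k + (?q4 n i)"] by (simp only: power2_sum power2_diff)
   moreover have "2 * (x $ j * x $ k)^2 <= (x $ j)^4 + (x $ k)^4"
    using zero_le_power2[of "(x $ j)^2 - (x $ k)\<^sup>2"] by (simp add: power2_diff power_mult_distrib)
   moreover have "2 * (?q4 n i)^2 <= 2 * (len n i)^2" by simp
   ultimately show ?thesis by linarith
  qed
  note [measurable] = increments_M(2)[OF i]
  show i2: "integrable M (?q3 g n i)"
   by (rule Bochner_Integration.integrable_bound[OF hi]) (use le in \<open>auto intro!: AE_I2 order_trans[OF le]\<close>)
  have "expectation (?q3 g n i) <= expectation ?h" by (intro integral_mono i2 hi le)
  also have "... = 8 * (len n i)^2" using m4 by (simp add: prob_space len_def)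
  finally show "expectation (?q3 g n i) <= 8 * (len n i)^2" .
 qed
 have fM: "f n i \<in> meas M" if i: "i \<in> cells n" for n i
  unfolding f_def[abs_def] using QM[OF i] increments_M(2)[OF i] by measurable
 have fi: "integrable M (f n i)" if i: "i \<in> cells n" for n i
  unfolding f_def[abs_def] by (rule integrable_mult_bounded[OF gi(1)[OF i] QM[OF i] Qb[OF i]])
 have diag: "integrable M (?q2 f n i)" "expectation (?q2 f n i) <= C^2 * (8 * (len n i)^2)" if i: "i \<in> cells n" for n i
 proof -
  have Q2: "(Q n i w)^2 <= C^2" if "w \<in> space M" for w using power_mono[OF Qb[OF i that], of 2] by simp
  show I: "integrable M (?q2 f n i)"
   unfolding f_def power_mult_distrib
   by (rule integrable_mult_bounded[OF g2(1)[OF i], of _ "C^2"]) (use QM[OF i] Q2 in auto)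
  have "expectation (?q2 f n i) <= expectation (%w. C^2 * (g n i (dW n i w))^2)"
   using Q2 by (intro integral_mono I integrable_mult_right g2(1)[OF i]) (auto simp: f_def power_mult_distrib intro!: mult_right_mono)
  also have "... <= C^2 * (8 * (len n i)^2)" using g2(2)[OF i] by (simp add: mult_left_mono)
  finally show "expectation (?q2 f n i) <= C^2 * (8 * (len n i)^2)" .
 qed
 \<comment> \<open>The earlier term and both weights are known at the left end of the later cell,
   whose centred increment product has mean 0.\<close>
 have off: "integrable M (%w. f n i w * f n l w) \<and> expectation (%w. f n i w * f n l w) = 0" if i: "i \<in> cells n" and l: "l \<in> cells n" and il: "i < l" for n i l
 proof -
  have pl: "pt n (Suc i) <= pt n l"
  proof (cases "Suc i = l")
   case False
   then show ?thesis using partition_nth(4)[OF p[of n], of "Suc i" l] il l unfolding cells_def pt_def by (auto intro: less_imp_le)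
  qed simp
  let ?Y = "%w. Q n l w * f n i w"
  have Qi: "Q n i \<in> meas (F (pt n l))" using pl b[OF i] b[OF l] by (intro F_measurable_mono[OF Qm[OF i]]) auto
  have Wi: "dW n i \<in> meas (F (pt n l))"
   unfolding dW_def using pl b[OF i] b[OF l] by (intro F_measurable_mono[OF inc_F]) auto
  note [measurable] = Qi Wi Qm[OF l]
  have Ym: "?Y \<in> meas (F (pt n l))" unfolding f_def by measurable
  have Yi: "integrable M ?Y" by (rule integrable_mult_bounded[OF fi[OF i] QM[OF l] Qb[OF l]])
  have e: "f n i w * f n l w = ?Y w * g n l (inc (pt n l) (pt n (Suc l)) w)" for w unfolding f_def dW_def by simp
  show ?thesis unfolding e
   using inc_mult_expectation[OF b[OF l] Ym gm Yi gi(1)[OF l, unfolded dW_def]] gi(2)[OF l] unfolding dW_def by simp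
 qed
 have off': "integrable M (%w. f n i w * f n l w) \<and> (i ~= l --> expectation (%w. f n i w * f n l w) = 0)" if i: "i \<in> cells n" and l: "l \<in> cells n" for n i l
 proof (rule linorder_cases[of i l])
  assume "i < l" then show ?thesis using off[OF i l] by simp
 next
  assume "i = l" then show ?thesis using diag(1)[OF i] by (simp add: power2_eq_square)
 next
  assume "l < i" then show ?thesis using off[OF l i] by (simp add: mult.commute)
 qed
 have main: "integrable M (?q0 n f)" "expectation (?q0 n f) <= (?q1 n)" for n
 proof -
  have sq: "(\<Sum>i\<in>cells n. f n i w)^2 = (\<Sum>i\<in>cells n. \<Sum>l\<in>cells n. f n i w * f n l w)" for w
   by (simp add: power2_eq_square sum_product)
  show "integrable M (?q0 n f)" unfolding sq using off' by (intro Bochner_Integration.integrable_sum) blast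
  have "expectation (?q0 n f) = (\<Sum>i\<in>cells n. \<Sum>l\<in>cells n. expectation (%w. f n i w * f n l w))"
   unfolding sq using off' by (simp add: Bochner_Integration.integral_sum Bochner_Integration.integrable_sum)
  also have "... = (\<Sum>i\<in>cells n. \<Sum>l\<in>cells n. if l = i then expectation (?q2 f n i) else 0)"
   using off' by (intro sum.cong refl) (auto simp: power2_eq_square)
  also have "... = (\<Sum>i\<in>cells n. expectation (?q2 f n i))" by (intro sum.cong refl) (simp add: sum.delta)
  also have "... <= (?q1 n)" by (intro sum_mono diag(2))
  finally show "expectation (?q0 n f) <= (?q1 n)" .
 qed
 have "vanishing (%n w. \<Sum>i\<in>cells n. f n i w)"
 proof (rule vanishing_L2_eventually)
  show "(%w. \<Sum>i\<in>cells n. f n i w) \<in> meas M" for n by (rule borel_measurable_sum) (rule fM)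
  fix e :: real assume e: "e > 0"
  define d where "d = e / (C^2 * 8 * T + 1)"
  have pos: "C^2 * 8 * T + 1 > 0" using T_pos by (simp add: add_nonneg_pos)
  have d: "d > 0" unfolding d_def using e pos by simp
  obtain n0 where n0: "!!n i. n >= n0 ==> i \<in> cells n ==> len n i < d" using len_small[OF d] by blast
  have "(?q1 n) <= e" if n: "n >= n0" for n
  proof -
   have "(?q1 n) <= (\<Sum>i\<in>cells n. C^2 * (8 * (d * len n i)))"
    unfolding power2_eq_square[of "len n _"]
    using n0[OF n] cell_bounds(6) by (intro sum_mono mult_left_mono mult_right_mono) (auto intro: less_imp_le)
   also have "... = C^2 * 8 * d * (\<Sum>i\<in>cells n. len n i)" by (simp add: sum_distrib_left mult_ac)
   also have "... = d * (C^2 * 8 * T)" unfolding sum_len by simp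
   also have "... <= d * (C^2 * 8 * T + 1)" using d by simp
   also have "... = e" unfolding d_def using pos by simp
   finally show ?thesis .
  qed
  then show "\<exists>n0. \<forall>n\<ge>n0. integrable M (?q0 n f) \<and> expectation (?q0 n f) <= e"
   using main order_trans by blast
 qed
 then show ?thesis unfolding f_def g_def .
qed

end

context ito_mesh
begin

lemma weighted_integral_sums:
 fixes f g :: "real => 'b::euclidean_space"
 assumes f: "continuous_on {0..T} f" and g: "continuous_on {0..T} g"
 shows "(%n. \<Sum>i\<in>cells n. f (pt n i) \<bullet> integral {pt n i..pt n (Suc i)} g) \<longlonglongrightarrow> integral {0..T} (%u. f u \<bullet> g u)"
proof (rule LIMSEQ_I)
 fix e :: real assume e: "e > 0"
 obtain B where B: "B >= 0" "!!t. t \<in> {0..T} ==> norm (g t) <= B" using has_bounded_range_on_interval[OF g] by blast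
 define d where "d = e / (B * T + 1)"
 have pos: "B * T + 1 > 0" using B T_pos by (simp add: add_nonneg_pos)
 have d: "d > 0" unfolding d_def using e pos by simp
 obtain n0 where n0: "!!n i u. n >= n0 ==> i \<in> cells n ==> u \<in> {pt n i..pt n (Suc i)} ==> norm (f u - f (pt n i)) < d"
  using path_oscillation[OF f d] by blast
 show "\<exists>n0. \<forall>n\<ge>n0. norm ((\<Sum>i\<in>cells n. f (pt n i) \<bullet> integral {pt n i..pt n (Suc i)} g) - integral {0..T} (%u. f u \<bullet> g u)) < e"
 proof (intro exI allI impI)
  fix n assume n: "n >= n0"
  have *: "norm (f (pt n i) \<bullet> integral {pt n i..pt n (Suc i)} g - integral {pt n i..pt n (Suc i)} (%u. f u \<bullet> g u)) <= d * B * len n i"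
   if i: "i \<in> cells n" for i
  proof -
   note b = cell_bounds[OF i]
   let ?I = "{pt n i..pt n (Suc i)}"
   have sub: "?I \<subseteq> {0..T}" using b by auto
   note c = continuous_on_subset[OF f sub] continuous_on_subset[OF g sub]
   have "f (pt n i) \<bullet> integral ?I g = integral ?I (%u. f (pt n i) \<bullet> g u)"
    using integral_linear[OF integrable_continuous_interval[OF c(2)] bounded_linear_inner_right, of "f (pt n i)"] by (simp add: o_def)
   then have "f (pt n i) \<bullet> integral ?I g - integral ?I (%u. f u \<bullet> g u) = integral ?I (%u. (f (pt n i) - f u) \<bullet> g u)"
    unfolding inner_diff_left
    by (subst Henstock_Kurzweil_Integration.integral_diff) (auto intro!: integrable_continuous_interval continuous_intros c)
   also have "norm ... <= d * B * (pt n (Suc i) - pt n i)"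
   proof (rule integral_bound)
    show "pt n i <= pt n (Suc i)" using b by simp
    show "continuous_on ?I (%u. (f (pt n i) - f u) \<bullet> g u)" by (intro continuous_intros c)
    fix u assume u: "u \<in> ?I"
    have "norm ((f (pt n i) - f u) \<bullet> g u) <= norm (f (pt n i) - f u) * norm (g u)" using Cauchy_Schwarz_ineq2 by simp
    also have "... <= d * B" using n0[OF n i u] B(2)[of u] u sub d
     by (intro mult_mono) (auto simp: norm_minus_commute)
    finally show "norm ((f (pt n i) - f u) \<bullet> g u) <= d * B" .
   qed
   finally show ?thesis unfolding len_def .
  qed
  have io: "integral {0..T} (%u. f u \<bullet> g u) = (\<Sum>i\<in>cells n. integral {pt n i..pt n (Suc i)} (%u. f u \<bullet> g u))"
   unfolding cells_def pt_def by (rule integral_over_partition[OF p]) (intro continuous_intros f g)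
  have "norm ((\<Sum>i\<in>cells n. f (pt n i) \<bullet> integral {pt n i..pt n (Suc i)} g) - integral {0..T} (%u. f u \<bullet> g u)) <= (\<Sum>i\<in>cells n. d * B * len n i)"
   unfolding io sum_subtractf[symmetric] by (intro order_trans[OF norm_sum sum_mono] *)
  also have "... = d * (B * T)" unfolding sum_distrib_left[symmetric] sum_len by simp
  also have "... < d * (B * T + 1)" using d by simp
  also have "... = e" unfolding d_def using pos by simp
  finally show "norm ((\<Sum>i\<in>cells n. f (pt n i) \<bullet> integral {pt n i..pt n (Suc i)} g) - integral {0..T} (%u. f u \<bullet> g u)) < e" .
 qed
qed

context
 fixes a c :: real and \<phi> :: "real \<times> (real^'d) => real^'d"
 assumes tf: "test_fun a c \<phi>"
begin

definition test_at :: "nat => nat => 'w => real^'d" where "test_at n i w = \<phi> (pt n i, X (pt n i) w)"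

definition grad_at :: "nat => nat => 'w => real^'d => real^'d" where "grad_at n i w h = grad \<phi> (pt n i) (X (pt n i) w) h"

lemma test_at_F: "i \<in> cells n ==> test_at n i \<in> meas (F (pt n i))"
 unfolding test_at_def[abs_def] by (intro phi_adapted[OF tf] cell_bounds)

lemma test_at_M: "i \<in> cells n ==> test_at n i \<in> meas M"
 using F_measurable_M[OF test_at_F] cell_bounds by simp

lemma test_next_M: "i \<in> cells n ==> test_at n (Suc i) \<in> meas M"
 unfolding test_at_def[abs_def] using F_measurable_M[OF phi_adapted[OF tf]] cell_bounds(3,5) by simp

lemma grad_at_M:
 assumes i: "i \<in> cells n" and h: "h \<in> meas M"
 shows "(%w. grad_at n i w (h w)) \<in> meas M"
proof -
 note [measurable] = X_M[OF cell_bounds(4)[OF i]] h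
 have p: "(%w. (pt n i, X (pt n i) w)) \<in> M \<rightarrow>\<^sub>M borel" unfolding borel_prod[symmetric] by measurable
 have "(%w. pderivs [(0, b)] \<phi> (pt n i, X (pt n i) w)) \<in> meas M" if "b \<in> Basis" for b
  by (rule measurable_compose[OF p borel_measurable_continuous_onI[OF partial_continuous[OF tf that]]])
 then show ?thesis unfolding grad_at_def grad_def
  by (intro borel_measurable_sum borel_measurable_scaleR) (simp_all del: pderivs.simps)
qed

lemma drift_term_vanishing:
 "vanishing (%n w. (\<Sum>i\<in>cells n. test_at n i w \<bullet> dA n i w) - drift_functional \<phi> w)"
proof (rule vanishing_AE)
 show "(%w. (\<Sum>i\<in>cells n. test_at n i w \<bullet> dA n i w) - drift_functional \<phi> w) \<in> meas M" for n
  by (intro borel_measurable_diff drift_functional_M[OF tf], rule borel_measurable_sum)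
   (rule borel_measurable_inner[OF test_at_M increments_M(3)])
 show "AE w in M. (%n. (\<Sum>i\<in>cells n. test_at n i w \<bullet> dA n i w) - drift_functional \<phi> w) \<longlonglongrightarrow> 0"
  unfolding test_at_def dA_def drift_def drift_functional_def
  by (intro AE_I2 LIM_zero weighted_integral_sums path_phi_continuous[OF tf] \<beta>_cont)
qed

lemma noise_term_vanishing: "vanishing (%n w. \<Sum>i\<in>cells n. test_at n i w \<bullet> dG n i w)"
proof (rule vanishing_L2_eventually)
 show "(%w. \<Sum>i\<in>cells n. test_at n i w \<bullet> dG n i w) \<in> meas M" for n
  by (rule borel_measurable_sum) (rule borel_measurable_inner[OF test_at_M increments_M(5)])
 fix e :: real assume e: "e > 0"
 obtain B where B: "B >= 0" "!!z. norm (\<phi> z) <= B" using pderivs_bounded[OF tf, of "[]"] by auto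
 obtain n0 where n0: "!!n A. n >= n0 ==> A \<subseteq> cells n ==> integrable M (%w. (\<Sum>i\<in>A. test_at n i w \<bullet> dG n i w)^2)"
   "!!n A. n >= n0 ==> A \<subseteq> cells n ==> expectation (%w. (\<Sum>i\<in>A. test_at n i w \<bullet> dG n i w)^2) <= e / T * (\<Sum>i\<in>A. len n i)"
  by (rule noise_functional[OF test_at_F _ B(1), of "e / T"]) (use B(2) e T_pos in \<open>auto simp: test_at_def\<close>)
 show "\<exists>n0. \<forall>n\<ge>n0. integrable M (%w. (\<Sum>i\<in>cells n. test_at n i w \<bullet> dG n i w)^2) \<and>
   expectation (%w. (\<Sum>i\<in>cells n. test_at n i w \<bullet> dG n i w)^2) <= e"
 proof (intro exI allI impI)
  fix n assume n: "n >= n0"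
  show "integrable M (%w. (\<Sum>i\<in>cells n. test_at n i w \<bullet> dG n i w)^2) \<and>
   expectation (%w. (\<Sum>i\<in>cells n. test_at n i w \<bullet> dG n i w)^2) <= e"
   using n0[OF n order_refl] T_pos unfolding sum_len by simp
 qed
qed

text \<open>The largest increment tends to 0 by path continuity and multiplies a sum that is bounded
  in probability: an L1-bounded part from \<open>dm\<close> and a vanishing part from
  \<open>er\<close>.\<close>

lemma increment_sq_cubic_vanishing:
 assumes C: "C >= 0"
 shows "vanishing (%n w. max_step n w * (C * (T + T^2 + (\<Sum>i\<in>cells n. (norm (dX n i w))^2))))"
proof -
 let ?m = "%n w. \<Sum>i\<in>cells n. (norm (dm n i w))^2" and ?e = "%n w. \<Sum>i\<in>cells n. (norm (er n i w))^2"
 let ?q0 = "%n w. C * (T + T^2 + (\<Sum>i\<in>cells n. (norm (dX n i w))^2))"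
 let ?q1 = "%n w. (T + T^2) * max_step n w + (2 * (max_step n w * ?m n w) + 2 * (max_step n w * ?e n w))"
 have le: "(\<Sum>i\<in>cells n. (norm (dX n i w))^2) <= 2 * ?m n w + 2 * ?e n w" for n w
 proof -
  have "(norm (dX n i w))^2 <= 2 * (norm (dm n i w))^2 + 2 * (norm (er n i w))^2" for i
  proof -
   have "(norm (dX n i w))^2 <= (norm (dm n i w) + norm (er n i w))^2"
    unfolding dX_split by (intro power_mono norm_triangle_ineq) simp
   also have "... <= 2 * (norm (dm n i w))^2 + 2 * (norm (er n i w))^2"
    using zero_le_power2[of "norm (dm n i w) - norm (er n i w)"] by (simp add: power2_sum power2_diff)
   finally show ?thesis .
  qed
  then have "(\<Sum>i\<in>cells n. (norm (dX n i w))^2) <= (\<Sum>i\<in>cells n. 2 * (norm (dm n i w))^2 + 2 * (norm (er n i w))^2)" by (intro sum_mono)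
  also have "... = 2 * ?m n w + 2 * ?e n w" by (simp add: sum.distrib sum_distrib_left)
  finally show ?thesis .
 qed
 have v: "vanishing (%n w. C * (?q1 n w))"
  by (intro vanishing_cmult vanishing_add vanishing_mult_L1_bounded[OF max_step_vanishing noise_sq_L1]
    vanishing_mult[OF max_step_vanishing er_sq_vanishing] max_step_vanishing)
 show ?thesis
 proof (rule vanishing_dominated[OF v])
  fix n
  have [measurable]: "max_step n \<in> meas M" by (rule vanishing_measurable[OF max_step_vanishing])
  have [measurable]: "(%w. \<Sum>i\<in>cells n. (norm (dX n i w))^2) \<in> meas M"
   by (rule borel_measurable_sum) (intro borel_measurable_power measurable_compose[OF increments_M(1) borel_measurable_norm])
  show "(%w. max_step n w * (?q0 n w)) \<in> meas M" by measurable
  fix w assume "w \<in> space M"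
  have "max_step n w * (?q0 n w) <= max_step n w * (C * (T + T^2 + (2 * ?m n w + 2 * ?e n w)))"
   using le by (intro mult_left_mono add_left_mono C max_step_nonneg)
  also have "... = C * (?q1 n w)"
   by (simp add: algebra_simps)
  finally have "max_step n w * (?q0 n w) <= ..." .
  moreover have "0 <= max_step n w * (?q0 n w)"
   using C T_pos by (intro mult_nonneg_nonneg max_step_nonneg add_nonneg_nonneg sum_nonneg) auto
  ultimately show "\<bar>max_step n w * (?q0 n w)\<bar>
   <= \<bar>C * (?q1 n w)\<bar>" by linarith
 qed
qed

text \<open>The Taylor remainder is multiplied by one more increment, which is estimated by
  \<open>max_step\<close>; the remainder itself sums to a multiple of T + T^2 plus the quadratic
  variation.\<close>

lemma taylor_term_vanishing:
 "vanishing (%n w. \<Sum>i\<in>cells n. (test_at n (Suc i) w - test_at n i w - grad_at n i w (dX n i w)) \<bullet> dX n i w)"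
proof -
 let ?q0 = "%n i w. test_at n (Suc i) w - test_at n i w - grad_at n i w (dX n i w)"
 let ?q1 = "%n i w. len n i + T * len n i + (norm (dX n i w))^2"
 let ?q2 = "%n w. \<Sum>i\<in>cells n. (norm (dX n i w))^2"
 obtain C where C: "C >= 0" "!!t x s h. norm (\<phi> (t + s, x + h) - \<phi> (t, x) - grad \<phi> t x h) <= C * (\<bar>s\<bar> + s^2 + (norm h)^2)"
  using test_fun_taylor[OF tf] unfolding grad_def by blast
 show ?thesis
 proof (rule vanishing_dominated[OF increment_sq_cubic_vanishing[OF C(1)]])
  show "(%w. \<Sum>i\<in>cells n. (?q0 n i w) \<bullet> dX n i w) \<in> meas M" for n
   by (rule borel_measurable_sum) (intro borel_measurable_inner borel_measurable_diff test_at_M test_next_M grad_at_M increments_M)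
  fix n w assume "w \<in> space M"
  have "\<bar>(?q0 n i w) \<bullet> dX n i w\<bar>
    <= max_step n w * (C * (?q1 n i w))" if i: "i \<in> cells n" for i
  proof -
   have e: "pt n i + len n i = pt n (Suc i)" "X (pt n i) w + dX n i w = X (pt n (Suc i)) w" unfolding len_def dX_def by simp_all
   have "len n i <= T" using cell_bounds[OF i] unfolding len_def by simp
   then have l: "(len n i)^2 <= T * len n i" unfolding power2_eq_square using cell_bounds(6)[OF i] by (intro mult_right_mono) auto
   have "norm (?q0 n i w) <= C * (\<bar>len n i\<bar> + (len n i)^2 + (norm (dX n i w))^2)"
    using C(2)[of "pt n i" "len n i" "X (pt n i) w" "dX n i w"] unfolding e test_at_def grad_at_def .
   also have "... <= C * (?q1 n i w)" using l cell_bounds(6)[OF i] by (intro mult_left_mono C(1)) auto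
   finally have *: "norm (?q0 n i w) <= ..." .
   have "\<bar>(?q0 n i w) \<bullet> dX n i w\<bar>
    <= norm (?q0 n i w) * norm (dX n i w)" by (rule Cauchy_Schwarz_ineq2)
   also have "... <= C * (?q1 n i w) * max_step n w"
    using * order_trans[OF norm_ge_zero *] by (intro mult_mono max_step_ge[OF i]) auto
   finally show ?thesis by (simp add: mult.commute)
  qed
  then have "\<bar>\<Sum>i\<in>cells n. (?q0 n i w) \<bullet> dX n i w\<bar>
   <= (\<Sum>i\<in>cells n. max_step n w * (C * (?q1 n i w)))"
   by (intro order_trans[OF sum_abs sum_mono])
  also have "... = max_step n w * (C * ((\<Sum>i\<in>cells n. len n i) + T * (\<Sum>i\<in>cells n. len n i) + (?q2 n w)))"
   by (simp only: sum_distrib_left[symmetric] sum.distrib)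
  also have "... = max_step n w * (C * (T + T^2 + (?q2 n w)))" unfolding sum_len by (simp add: power2_eq_square)
  also have "... <= \<bar>...\<bar>" by simp
  finally show "\<bar>\<Sum>i\<in>cells n. (?q0 n i w) \<bullet> dX n i w\<bar>
   <= \<bar>max_step n w * (C * (T + T^2 + (?q2 n w)))\<bar>" .
 qed
qed

text \<open>Expanding the bilinear form at dX = dm + er leaves cross terms. By Cauchy-Schwarz they
  are controlled by the square root of a vanishing sum times an L1-bounded one.\<close>

lemma replacement_term_vanishing:
 "vanishing (%n w. \<Sum>i\<in>cells n. grad_at n i w (dX n i w) \<bullet> dX n i w - grad_at n i w (dm n i w) \<bullet> dm n i w)"
proof -
 let ?q0 = "%n i w. 2 * (norm (er n i w) * norm (dm n i w)) + (norm (er n i w))^2"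
 obtain C where C: "C >= 0" "!!t x h. norm (grad \<phi> t x h) <= C * norm h" by (rule grad_bound[OF tf]) blast
 let ?m = "%n w. \<Sum>i\<in>cells n. (norm (dm n i w))^2" and ?e = "%n w. \<Sum>i\<in>cells n. (norm (er n i w))^2"
 have v: "vanishing (%n w. C * (2 * sqrt \<bar>?e n w * ?m n w\<bar> + ?e n w))"
  by (intro vanishing_cmult vanishing_add vanishing_sqrt vanishing_mult_L1_bounded[OF er_sq_vanishing noise_sq_L1] er_sq_vanishing)
 show ?thesis
 proof (rule vanishing_dominated[OF v])
  show "(%w. \<Sum>i\<in>cells n. grad_at n i w (dX n i w) \<bullet> dX n i w - grad_at n i w (dm n i w) \<bullet> dm n i w) \<in> meas M" for n
   by (rule borel_measurable_sum) (intro borel_measurable_inner borel_measurable_diff grad_at_M increments_M)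
  fix n w assume "w \<in> space M"
  have t: "\<bar>grad_at n i w (dX n i w) \<bullet> dX n i w - grad_at n i w (dm n i w) \<bullet> dm n i w\<bar>
    <= C * (?q0 n i w)" for i
  proof -
   let ?G = "grad_at n i w" and ?f = "er n i w" and ?d = "dm n i w"
   have G: "norm (?G h) <= C * norm h" for h unfolding grad_at_def by (rule C(2))
   have Gb: "\<bar>?G h \<bullet> k\<bar> <= C * (norm h * norm k)" for h k
    using Cauchy_Schwarz_ineq2[of "?G h" k] mult_right_mono[OF G[of h] norm_ge_zero[of k]] by (simp add: mult.assoc)
   have "?G (dX n i w) = ?G ?d + ?G ?f" unfolding dX_split grad_at_def by (rule linear_add[OF linear_grad])
   then have "?G (dX n i w) \<bullet> dX n i w - ?G ?d \<bullet> ?d = ?G ?d \<bullet> ?f + ?G ?f \<bullet> ?d + ?G ?f \<bullet> ?f"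
    unfolding dX_split by (simp add: inner_add_left inner_add_right)
   then have "\<bar>?G (dX n i w) \<bullet> dX n i w - ?G ?d \<bullet> ?d\<bar> <= C * (norm ?d * norm ?f) + C * (norm ?f * norm ?d) + C * (norm ?f * norm ?f)"
    using Gb[of ?d ?f] Gb[of ?f ?d] Gb[of ?f ?f] by linarith
   also have "... = C * (2 * (norm ?f * norm ?d) + (norm ?f)^2)" by (simp add: power2_eq_square algebra_simps)
   finally show ?thesis .
  qed
  have "\<bar>\<Sum>i\<in>cells n. grad_at n i w (dX n i w) \<bullet> dX n i w - grad_at n i w (dm n i w) \<bullet> dm n i w\<bar>
   <= (\<Sum>i\<in>cells n. C * (?q0 n i w))"
   by (intro order_trans[OF sum_abs sum_mono] t)
  also have "... = C * (2 * (\<Sum>i\<in>cells n. norm (er n i w) * norm (dm n i w)) + ?e n w)"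
   by (simp only: sum_distrib_left[symmetric] sum.distrib)
  also have "... <= C * (2 * sqrt \<bar>?e n w * ?m n w\<bar> + ?e n w)"
  proof -
   have "(\<Sum>i\<in>cells n. norm (er n i w) * norm (dm n i w)) <= sqrt (\<Sum>i\<in>cells n. (norm (er n i w))^2) * sqrt (\<Sum>i\<in>cells n. (norm (dm n i w))^2)"
    using sum_prod_le_sqrt[of "cells n" "%i. norm (er n i w)" "%i. norm (dm n i w)"] by simp
   also have "... = sqrt \<bar>?e n w * ?m n w\<bar>" by (simp add: real_sqrt_mult sum_nonneg)
   finally show ?thesis by (intro mult_left_mono C(1)) auto
  qed
  also have "... <= \<bar>...\<bar>" by simp
  finally show "\<bar>\<Sum>i\<in>cells n. grad_at n i w (dX n i w) \<bullet> dX n i w - grad_at n i w (dm n i w) \<bullet> dm n i w\<bar>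
    <= \<bar>C * (2 * sqrt \<bar>?e n w * ?m n w\<bar> + ?e n w)\<bar>" .
 qed
qed

text \<open>The squared Brownian increments are split into the centred part, which vanishes, and the
  cell lengths on the diagonal, which form a Riemann sum.\<close>

lemma correction_term_vanishing:
 "vanishing (%n w. (\<Sum>i\<in>cells n. grad_at n i w (dm n i w) \<bullet> dm n i w) - \<epsilon>\<^sup>2 * correction \<phi> w)"
proof -
 let ?q0 = "%n w. \<Sum>i\<in>cells n. len n i *\<^sub>R (\<Sum>j\<in>UNIV. qcoef \<phi> j j (pt n i) w)"
 let ?q1 = "%n i w. \<Sum>j\<in>UNIV. \<Sum>k\<in>UNIV. qcoef \<phi> j k (pt n i) w * (dW n i w $ j * dW n i w $ k)"
 obtain C where C: "C >= 0" "!!i j t w. t \<in> {0..T} ==> w \<in> space M ==> \<bar>qcoef \<phi> i j t w\<bar> <= C" by (rule qcoef_bound[OF tf]) blast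
 let ?E = "%j k n w. \<Sum>i\<in>cells n. qcoef \<phi> j k (pt n i) w * (dW n i w $ j * dW n i w $ k - (if j = k then len n i else 0))"
 have 1: "vanishing (?E j k)" for j k
  by (rule quadratic_variation_vanishing[of "%n i. qcoef \<phi> j k (pt n i)" C]) (use C(2) cell_bounds(4) in \<open>auto intro: qcoef_adapted[OF tf]\<close>)
 have 2: "vanishing (%n w. (?q0 n w) - correction \<phi> w)"
 proof (rule vanishing_AE)
  have qM: "qcoef \<phi> j k (pt n i) \<in> meas M" if i: "i \<in> cells n" for j k n i
   using F_measurable_M[OF qcoef_adapted[OF tf]] cell_bounds[OF i] by simp
  show "(%w. (?q0 n w) - correction \<phi> w) \<in> meas M" for n
   by (intro borel_measurable_diff correction_M[OF tf], rule borel_measurable_sum)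
    (intro borel_measurable_scaleR borel_measurable_const borel_measurable_sum qM)
  show "AE w in M. (%n. (?q0 n w) - correction \<phi> w) \<longlonglongrightarrow> 0"
   unfolding correction_def len_def pt_def cells_def
   by (intro AE_I2 LIM_zero riemann_sum_tendsto p mesh_p continuous_on_sum path_qcoef_continuous[OF tf])
 qed
 have e: "(\<Sum>i\<in>cells n. grad_at n i w (dm n i w) \<bullet> dm n i w) - \<epsilon>\<^sup>2 * correction \<phi> w
  = \<epsilon>^2 * ((\<Sum>j\<in>UNIV. \<Sum>k\<in>UNIV. ?E j k n w) + ((?q0 n w) - correction \<phi> w))" for n w
 proof -
  have g: "grad_at n i w (dm n i w) \<bullet> dm n i w = \<epsilon>^2 * (?q1 n i w)" for i
   unfolding dm_def grad_at_def linear_cmul[OF linear_grad] using grad_quadratic[of \<phi> "pt n i" w "dW n i w"] by (simp add: power2_eq_square)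
  have s: "(?q1 n i w)
   = (\<Sum>j\<in>UNIV. \<Sum>k\<in>UNIV. qcoef \<phi> j k (pt n i) w * (dW n i w $ j * dW n i w $ k - (if j = k then len n i else 0)))
    + len n i *\<^sub>R (\<Sum>j\<in>UNIV. qcoef \<phi> j j (pt n i) w)" for i
  proof -
   have "len n i *\<^sub>R (\<Sum>j\<in>UNIV. qcoef \<phi> j j (pt n i) w) = (\<Sum>j\<in>UNIV. \<Sum>k\<in>UNIV. qcoef \<phi> j k (pt n i) w * (if j = k then len n i else 0))"
    by (simp add: sum_distrib_left if_distrib sum.delta' mult.commute cong: if_cong)
   then show ?thesis by (simp only: right_diff_distrib sum_subtractf)
  qed
  have sw: "(\<Sum>i\<in>cells n. \<Sum>j\<in>UNIV. \<Sum>k\<in>UNIV. qcoef \<phi> j k (pt n i) w * (dW n i w $ j * dW n i w $ k - (if j = k then len n i else 0)))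
   = (\<Sum>j\<in>UNIV. \<Sum>k\<in>UNIV. ?E j k n w)"
   by (subst sum.swap, rule sum.cong[OF refl], rule sum.swap)
  show ?thesis unfolding g s sum_distrib_left[symmetric] sum.distrib sw by (simp only: right_diff_distrib distrib_left add_diff_eq)
 qed
 have fin: "finite (UNIV :: 'm set)" by simp
 show ?thesis unfolding e
  by (rule vanishing_cmult[OF vanishing_add[OF vanishing_sum[OF fin vanishing_sum[OF fin 1]] 2]])
qed

end

end

section \<open>Identification of the Ito term and of the Stratonovich limit\<close>

context ito_mesh
begin

text \<open>The left-point sums and the approximants are both simple integrals over tilings of [0,
  T), so the isometry compares them without any reference to K. For fixed n one lets k tend to
  infinity, where K enters through Fatou's lemma, and only then refines the partition.\<close>

lemma ito_term_vanishing:
 assumes tf: "test_fun a c \<phi>" and U: "a < 0" "T < c" and \<nu>: "!!k. k < \<nu> k" and K[measurable]: "K \<in> meas M"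
  and lim: "AE w in M. (%k. approx (\<nu> k) k \<phi> w) \<longlonglongrightarrow> K w"
 shows "vanishing (%n w. (\<Sum>i\<in>cells n. test_at \<phi> n i w \<bullet> (S (pt n i) w *v dW n i w)) - K w)"
proof -
 let ?q0 = "%I n. %w. (I n w - K w)^2"
 define Y where "Y t w = \<phi> (t, X t w) v* S t w" for t w
 obtain B where B: "B >= 0" "!!z. norm (\<phi> z) <= B" using pderivs_bounded[OF tf, of "[]"] by auto
 obtain C where C: "C >= 0" "!!z h. norm (\<phi> (z + h) - \<phi> z) <= C * norm h" using test_fun_lipschitz[OF tf] by blast
 have YF: "Y t \<in> meas (F t)" if "t \<in> {0..T}" for t
  unfolding Y_def[abs_def] by (intro borel_measurable_vector_matrix_mult phi_adapted[OF tf] S_adapted that)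
 have YM: "Y t \<in> meas M" if "t \<in> {0..T}" for t using F_measurable_M[OF YF[OF that]] that by simp
 have Yb: "norm (Y t w) <= B * L" if t: "t \<in> {0..T}" and w: "w \<in> space M" for t w
  unfolding Y_def by (intro order_trans[OF norm_vector_matrix_mult_le] mult_mono B S_bound[OF t w] norm_ge_zero)
 have Yc: "continuous_on {0..T} (%t. Y t w)" if w: "w \<in> space M" for w
  unfolding Y_def by (rule bounded_bilinear.continuous_on[OF bounded_bilinear_vector_matrix path_phi_continuous[OF tf w] S_cont[OF w]])
 define I where "I n = simple_integral (cells n) (pt n) (%i. pt n (Suc i)) (%i. Y (pt n i))" for n
 have Ie: "(\<Sum>i\<in>cells n. test_at \<phi> n i w \<bullet> (S (pt n i) w *v dW n i w)) = I n w" for n w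
  unfolding I_def simple_integral_def test_at_def[OF tf] dW_def Y_def dot_lmul_matrix ..
 have Iad: "adapted_family (cells n) (pt n) (%i. pt n (Suc i)) (%i. Y (pt n i))" for n
  unfolding adapted_family_def using cell_bounds[of _ n] YF Yb by (meson less_imp_le)
 have Iti: "tiling (cells n) (pt n) (%i. pt n (Suc i)) {0..<T}" for n
  using partition_tiling[OF p[of n]] unfolding cells_def pt_def .
 have Im[measurable]: "I n \<in> meas M" for n unfolding I_def by (rule simple_integral_measurable[OF Iad])
 let ?A = "%k. SIGMA j:{..<2 ^ k}. grid (\<nu> k) k j"
 let ?a = "%k z. pnt (\<nu> k) (snd z)" and ?b = "%k z. nxt (\<nu> k) (snd z)"
 define g where "g k = approx_integrand \<phi> (\<nu> k) k" for k
 have \<nu>': "k <= \<nu> k" for k using \<nu>[of k] by simp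
 note tU = tf U
 have Aad: "adapted_family (?A k) (?a k) (?b k) (g k)" for k unfolding g_def by (rule approx_adapted) (use tU \<nu>' in auto)
 have Ati: "tiling (?A k) (?a k) (?b k) {0..<T}" for k by (rule approx_tiling) (use tU \<nu>' in auto)
 have Ae: "approx (\<nu> k) k \<phi> = simple_integral (?A k) (?a k) (?b k) (g k)" for k
  unfolding g_def by (rule ext, rule approx_eq_simple_integral) (use tU in auto)
 have near: "norm (g k z w - Y (?a k z) w) <= C * (T / 2 ^ k) * L" if z: "z \<in> ?A k" and w: "w \<in> space M" for k z w
 \<comment> \<open>Averaging \<open>\<phi>\<close> over a coarse cell that contains the time in
   question costs only its Lipschitz constant times T / 2^k.\<close>
 proof -
  have z': "fst z < 2 ^ k" "snd z \<in> grid (\<nu> k) k (fst z)" using z by auto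
  have t: "?a k z \<in> {0..T}" using grid_bounds[OF \<nu>' z'] by auto
  have "?a k z \<in> {?a k z..<?b k z}" using pnt_nxt_diff[of "\<nu> k" "snd z"] T_pos by (simp add: algebra_simps)
  then have "?a k z \<in> {pnt k (fst z)..<nxt k (fst z)}"
   using dyadic_tiling[OF \<nu>'[of k], of "fst z"] z'(2) unfolding tiling_def by blast
  then have n: "norm (mean_field \<phi> k (fst z) (X (?a k z) w) - \<phi> (?a k z, X (?a k z) w)) <= C * (T / 2 ^ k)"
   by (intro mean_field_near) (use tU C in auto)
  have e: "g k z w - Y (?a k z) w = (mean_field \<phi> k (fst z) (X (?a k z) w) - \<phi> (?a k z, X (?a k z) w)) v* S (?a k z) w"
   unfolding g_def approx_integrand_def[OF tf U] Y_def
   by (simp add: bounded_bilinear.diff_left[OF bounded_bilinear_vector_matrix])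
  show ?thesis unfolding e
   by (rule order_trans[OF norm_vector_matrix_mult_le], rule mult_mono[OF n S_bound[OF t w]]) (use C(1) T_pos in auto)
 qed
 have "vanishing (%n w. I n w - K w)"
 proof (rule vanishing_L2_eventually)
  show "(%w. I n w - K w) \<in> meas M" for n by measurable
  fix e :: real assume e: "e > 0"
  \<comment> \<open>The isometry yields 4 * d * T: a factor 2 from splitting the square and two
    errors of size d each.\<close>
  define d where "d = e / (4 * T)"
  have d: "d > 0" unfolding d_def using e T_pos by simp
  obtain \<eta> where \<eta>: "\<eta> > 0" "!!s t. s \<in> {0..T} ==> t \<in> {0..T} ==> \<bar>s - t\<bar> < \<eta> ==> expectation (%w. (norm (Y s w - Y t w))^2) <= d"
   using mean_square_modulus[of T Y, OF YM Yc Yb d] by blast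
  obtain n0 where n0: "!!n i. n >= n0 ==> i \<in> cells n ==> len n i < \<eta>" using len_small[OF \<eta>(1)] by blast
  have half: "(%k. T / 2 ^ k) \<longlonglongrightarrow> 0"
   using tendsto_mult_right_zero[OF LIMSEQ_realpow_zero[of "1/2"], of T] by (simp add: power_divide)
  have "(%k. (C * (T / 2 ^ k) * L)^2) \<longlonglongrightarrow> (C * 0 * L)^2" by (intro tendsto_intros half)
  then have "\<forall>\<^sub>F k in sequentially. (C * (T / 2 ^ k) * L)^2 < d" using d by (intro order_tendstoD(2)) auto
  from eventually_conj[OF this order_tendstoD(2)[OF half \<eta>(1)]]
  have "\<forall>\<^sub>F k in sequentially. (C * (T / 2 ^ k) * L)^2 < d \<and> T / 2 ^ k < \<eta>" .
  then obtain k0 where k0: "!!k. k >= k0 ==> (C * (T / 2 ^ k) * L)^2 <= d" "!!k. k >= k0 ==> T / 2 ^ k < \<eta>"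
   by (auto simp: eventually_sequentially intro: less_imp_le)
  have key: "expectation (%w. (norm (g k z w - Y (pt n i) w))^2) <= 4 * d"
   if n: "n >= n0" and k: "k >= k0" and z: "z \<in> ?A k" and i: "i \<in> cells n"
    and ov: "overlap (?a k z) (?b k z) (pt n i) (pt n (Suc i)) ~= 0" for n k z i
  proof -
   have z': "fst z < 2 ^ k" "snd z \<in> grid (\<nu> k) k (fst z)" using z by auto
   have t: "?a k z \<in> {0..T}" using grid_bounds[OF \<nu>' z'] by auto
   have "T / 2 ^ \<nu> k <= T / 2 ^ k" using \<nu>'[of k] T_pos by (intro divide_left_mono power_increasing) auto
   then have l1: "?b k z - ?a k z < \<eta>" using k0(2)[OF k] unfolding pnt_nxt_diff by linarith
   have l2: "pt n (Suc i) - pt n i < \<eta>" using n0[OF n i] unfolding len_def .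
   \<comment> \<open>Two overlapping cells, both shorter than \<eta>, have left ends within
     \<eta>.\<close>
   have "\<bar>?a k z - pt n i\<bar> < \<eta>" using ov l1 l2 \<eta>(1) unfolding overlap_eq by (auto simp: max_def min_def split: if_splits)
   then have mod: "expectation (%w. (norm (Y (?a k z) w - Y (pt n i) w))^2) <= d" by (intro \<eta>(2) t cell_bounds(4)[OF i])
   have int: "integrable M (%w. (norm (Y (?a k z) w - Y (pt n i) w))^2)"
    by (rule integrable_norm_diff_sq[OF YM[OF t] YM[OF cell_bounds(4)[OF i]] Yb[OF t] Yb[OF cell_bounds(4)[OF i]]])
   have "expectation (%w. (norm (g k z w - Y (pt n i) w))^2) <= expectation (%w. 2 * d + 2 * (norm (Y (?a k z) w - Y (pt n i) w))^2)"
   proof (rule integral_mono_AE')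
    show "integrable M (%w. 2 * d + 2 * (norm (Y (?a k z) w - Y (pt n i) w))^2)" using int by simp
    show "AE w in M. (norm (g k z w - Y (pt n i) w))^2 <= 2 * d + 2 * (norm (Y (?a k z) w - Y (pt n i) w))^2"
    proof (rule AE_I2)
     fix w assume w: "w \<in> space M"
     let ?u = "norm (g k z w - Y (?a k z) w)" and ?v = "norm (Y (?a k z) w - Y (pt n i) w)"
     have "(norm (g k z w - Y (pt n i) w))^2 <= (?u + ?v)^2"
      using norm_triangle_ineq[of "g k z w - Y (?a k z) w" "Y (?a k z) w - Y (pt n i) w"] by (intro power_mono) auto
     also have "... <= 2 * ?u^2 + 2 * ?v^2" using zero_le_power2[of "?u - ?v"] by (simp add: power2_sum power2_diff)
     also have "?u^2 <= (C * (T / 2 ^ k) * L)^2" by (intro power_mono near[OF z w]) simp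
     also have "... <= d" by (rule k0(1)[OF k])
     finally show "(norm (g k z w - Y (pt n i) w))^2 <= 2 * d + 2 * ?v^2" by simp
    qed
   qed (use d in simp)
   also have "... <= 4 * d" using int mod by (simp add: prob_space)
   finally show ?thesis .
  qed
  have L2: "integrable M (%w. (I n w - approx (\<nu> k) k \<phi> w)^2) \<and> expectation (%w. (I n w - approx (\<nu> k) k \<phi> w)^2) <= e"
   if n: "n >= n0" and k: "k >= k0" for n k
  proof -
   note iso = simple_integral_diff_isometry[OF Aad[of k] Ati[of k] Iad[of n] Iti[of n], folded Ae I_def]
   have "expectation (%w. (approx (\<nu> k) k \<phi> w - I n w)^2)
    = (\<Sum>z\<in>?A k. \<Sum>i\<in>cells n. overlap (?a k z) (?b k z) (pt n i) (pt n (Suc i)) * expectation (%w. (norm (g k z w - Y (pt n i) w))^2))"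
    by (rule iso(2))
   also have "... <= (\<Sum>z\<in>?A k. \<Sum>i\<in>cells n. overlap (?a k z) (?b k z) (pt n i) (pt n (Suc i)) * (4 * d))"
   proof (intro sum_mono)
    fix z i assume z: "z \<in> ?A k" and i: "i \<in> cells n"
    have "0 <= overlap (?a k z) (?b k z) (pt n i) (pt n (Suc i))" unfolding overlap_def by simp
    then show "overlap (?a k z) (?b k z) (pt n i) (pt n (Suc i)) * expectation (%w. (norm (g k z w - Y (pt n i) w))^2)
      <= overlap (?a k z) (?b k z) (pt n i) (pt n (Suc i)) * (4 * d)"
     using key[OF n k z i] by (cases "overlap (?a k z) (?b k z) (pt n i) (pt n (Suc i)) = 0") (auto intro: mult_left_mono)
   qed
   also have "... = (\<Sum>i\<in>cells n. \<Sum>z\<in>?A k. overlap (pt n i) (pt n (Suc i)) (?a k z) (?b k z)) * (4 * d)"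
    unfolding sum_distrib_right[symmetric] by (subst sum.swap) (simp only: overlap_commute)
   also have "(\<Sum>i\<in>cells n. \<Sum>z\<in>?A k. overlap (pt n i) (pt n (Suc i)) (?a k z) (?b k z)) = (\<Sum>i\<in>cells n. len n i)"
   proof (rule sum.cong[OF refl])
    fix i assume i: "i \<in> cells n"
    show "(\<Sum>z\<in>?A k. overlap (pt n i) (pt n (Suc i)) (?a k z) (?b k z)) = len n i"
     unfolding len_def by (rule tiling_sum_overlap[OF Ati]) (use cell_bounds[OF i] in auto)
   qed
   also have "... * (4 * d) = e" unfolding sum_len d_def using T_pos by simp
   finally have "expectation (%w. (approx (\<nu> k) k \<phi> w - I n w)^2) <= e" .
   moreover have "(approx (\<nu> k) k \<phi> w - I n w)^2 = (I n w - approx (\<nu> k) k \<phi> w)^2" for w by (rule power2_commute)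
   ultimately show ?thesis using iso(1) by simp
  qed
  have am[measurable]: "approx (\<nu> k) k \<phi> \<in> meas M" for k unfolding Ae by (rule simple_integral_measurable[OF Aad])
  show "\<exists>n0. \<forall>n\<ge>n0. integrable M (?q0 I n) \<and> expectation (?q0 I n) <= e"
  proof (intro exI allI impI)
   fix n assume n: "n >= n0"
   \<comment> \<open>Shifting k by k0 makes the L2 bound hold for every member of the sequence, as
     the Fatou step requires.\<close>
   have v: "vanishing (%k w. (I n w - approx (\<nu> (k + k0)) (k + k0) \<phi> w) - (I n w - K w))"
   proof (rule vanishing_AE)
    show "(%w. (I n w - approx (\<nu> (k + k0)) (k + k0) \<phi> w) - (I n w - K w)) \<in> meas M" for k by measurable
    show "AE w in M. (%k. (I n w - approx (\<nu> (k + k0)) (k + k0) \<phi> w) - (I n w - K w)) \<longlonglongrightarrow> 0"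
     using lim
    proof eventually_elim
     fix w assume "(%k. approx (\<nu> k) k \<phi> w) \<longlonglongrightarrow> K w"
     from LIMSEQ_ignore_initial_segment[OF this, of k0]
     have "(%k. K w - approx (\<nu> (k + k0)) (k + k0) \<phi> w) \<longlonglongrightarrow> K w - K w" by (intro tendsto_diff tendsto_const)
     then show "(%k. (I n w - approx (\<nu> (k + k0)) (k + k0) \<phi> w) - (I n w - K w)) \<longlonglongrightarrow> 0" by simp
    qed
   qed
   have m1: "(%w. I n w - approx (\<nu> (k + k0)) (k + k0) \<phi> w) \<in> meas M" for k by measurable
   have m2: "(%w. I n w - K w) \<in> meas M" by measurable
   have i: "integrable M (%w. (I n w - approx (\<nu> (k + k0)) (k + k0) \<phi> w)^2)" "expectation (%w. (I n w - approx (\<nu> (k + k0)) (k + k0) \<phi> w)^2) <= e" for k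
    using L2[OF n, of "k + k0"] by simp_all
   from vanishing_L2_limit[OF v m1 m2 i] show "integrable M (?q0 I n) \<and> expectation (?q0 I n) <= e" by simp
  qed
 qed
 then show ?thesis unfolding Ie .
qed

lemma strat_sum_decomposition:
 assumes tf: "test_fun a c \<phi>"
 shows "strat_sum \<phi> X (p n) w = (\<Sum>i\<in>cells n. test_at \<phi> n i w \<bullet> dA n i w) + (\<Sum>i\<in>cells n. test_at \<phi> n i w \<bullet> dG n i w)
  + \<epsilon> * (\<Sum>i\<in>cells n. test_at \<phi> n i w \<bullet> (S (pt n i) w *v dW n i w))
  + 1/2 * (\<Sum>i\<in>cells n. (test_at \<phi> n (Suc i) w - test_at \<phi> n i w - grad_at \<phi> n i w (dX n i w)) \<bullet> dX n i w)
  + 1/2 * (\<Sum>i\<in>cells n. grad_at \<phi> n i w (dX n i w) \<bullet> dX n i w - grad_at \<phi> n i w (dm n i w) \<bullet> dm n i w)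
  + 1/2 * (\<Sum>i\<in>cells n. grad_at \<phi> n i w (dm n i w) \<bullet> dm n i w)"
proof -
 let ?q0 = "%i. (test_at \<phi> n (Suc i) w - test_at \<phi> n i w - grad_at \<phi> n i w (dX n i w)) \<bullet> dX n i w"
 let ?q1 = "%i. (test_at \<phi> n i w + test_at \<phi> n (Suc i) w) /\<^sub>R 2"
 let ?q2 = "%i. test_at \<phi> n i w \<bullet> (S (pt n i) w *v dW n i w)"
 let ?q3 = "%i. grad_at \<phi> n i w (dX n i w) \<bullet> dX n i w - grad_at \<phi> n i w (dm n i w) \<bullet> dm n i w"
 let ?q4 = "%i. grad_at \<phi> n i w (dm n i w) \<bullet> dm n i w"
 have "strat_sum \<phi> X (p n) w = (\<Sum>i\<in>cells n. (?q1 i) \<bullet> dX n i w)"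
  unfolding strat_sum_def test_at_def[OF tf] dX_def cells_def pt_def ..
 also have "... = (\<Sum>i\<in>cells n. test_at \<phi> n i w \<bullet> dA n i w + test_at \<phi> n i w \<bullet> dG n i w
  + \<epsilon> * (?q2 i)
  + 1/2 * (?q0 i)
  + 1/2 * (?q3 i)
  + 1/2 * (?q4 i))"
 proof (rule sum.cong[OF refl])
  fix i
  have "test_at \<phi> n i w \<bullet> dX n i w = test_at \<phi> n i w \<bullet> dA n i w + test_at \<phi> n i w \<bullet> dG n i w + \<epsilon> * (?q2 i)"
   unfolding dX_split er_def dm_def by (simp add: inner_add_right)
  \<comment> \<open>The mean of the two end values is the left value plus half the increment of
    \<open>\<phi>\<close>, which is its linear part plus the Taylor remainder.\<close>
  moreover have "(?q1 i) \<bullet> dX n i w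
   = test_at \<phi> n i w \<bullet> dX n i w + 1/2 * (?q0 i)
    + 1/2 * (grad_at \<phi> n i w (dX n i w) \<bullet> dX n i w)"
   by (simp add: inner_add_left inner_diff_left field_simps)
  ultimately show "(?q1 i) \<bullet> dX n i w = test_at \<phi> n i w \<bullet> dA n i w + test_at \<phi> n i w \<bullet> dG n i w
  + \<epsilon> * (?q2 i)
  + 1/2 * (?q0 i)
  + 1/2 * (?q3 i)
  + 1/2 * (?q4 i)" by (simp only: right_diff_distrib)
 qed
 finally show ?thesis by (simp only: sum.distrib sum_distrib_left)
qed

lemma strat_sum_vanishing:
 assumes tf: "test_fun a c \<phi>" and U: "a < 0" "T < c" and \<nu>: "!!k. k < \<nu> k" and K: "K \<in> meas M"
  and lim: "AE w in M. (%k. approx (\<nu> k) k \<phi> w) \<longlonglongrightarrow> K w"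
 shows "vanishing (%n w. strat_sum \<phi> X (p n) w - (drift_functional \<phi> w + \<epsilon> * K w + \<epsilon>^2 / 2 * correction \<phi> w))"
proof -
 have alg: "A + G + \<epsilon> * I + 1/2 * R + 1/2 * P + 1/2 * V - (D + \<epsilon> * k + \<epsilon>^2 / 2 * Q)
  = ((A - D) + G) + (\<epsilon> * (I - k) + 1/2 * (R + (P + (V - \<epsilon>\<^sup>2 * Q))))" for A G I R P V D k Q :: real
  by (simp add: algebra_simps)
 show ?thesis unfolding strat_sum_decomposition[OF tf] alg
  by (intro vanishing_add vanishing_cmult drift_term_vanishing[OF tf] noise_term_vanishing[OF tf] ito_term_vanishing[OF tf U \<nu> K lim]
    taylor_term_vanishing[OF tf] replacement_term_vanishing[OF tf] correction_term_vanishing[OF tf])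
qed

end

theorem (in ito_process) strat_sum_converges:
 assumes tf: "test_fun a c \<phi>" and U: "a < 0" "T < c" and \<nu>: "!!k. k < \<nu> k" and K: "K \<in> meas M"
  and lim: "AE w in M. (%k. approx (\<nu> k) k \<phi> w) \<longlonglongrightarrow> K w"
 shows "conv_in_prob M 0 T (strat_sum \<phi> X) (%w. drift_functional \<phi> w + \<epsilon> * K w + \<epsilon>^2 / 2 * correction \<phi> w)"
proof (rule conv_in_prob_seqI)
 show "(%w. drift_functional \<phi> w + \<epsilon> * K w + \<epsilon>^2 / 2 * correction \<phi> w) \<in> meas M"
  by (intro borel_measurable_add borel_measurable_times borel_measurable_const K drift_functional_M[OF tf] correction_M[OF tf])
 fix p e assume p: "!!n. partition_of 0 T (p n)" "(%n. mesh (p n)) \<longlonglongrightarrow> 0" and e: "(e::real) > 0"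
 interpret ito_mesh M F T W X S L \<beta> \<epsilon> x0 p by unfold_locales (use p in auto)
 show "(%n. prob {w \<in> space M. e < dist (strat_sum \<phi> X (p n) w) (drift_functional \<phi> w + \<epsilon> * K w + \<epsilon>^2 / 2 * correction \<phi> w)}) \<longlonglongrightarrow> 0"
  using vanishingD[OF strat_sum_vanishing[OF tf U \<nu> K lim] e] unfolding dist_real_def .
qed

section \<open>Pathwise bounds and linearity\<close>

lemma ennreal_square_sum_bound:
 fixes x \<kappa> :: "'i => real"
 assumes fin: "finite K" and \<kappa>: "!!k. k \<in> K ==> 0 <= \<kappa> k"
  and b: "!!k. k \<in> K ==> ennreal ((x k)^2) <= ennreal (\<kappa> k) * H"
 shows "ennreal ((\<Sum>k\<in>K. x k)^2) <= ennreal (real (card K) * (\<Sum>k\<in>K. \<kappa> k)) * H"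
proof -
 have "ennreal ((\<Sum>k\<in>K. x k)^2) <= ennreal (real (card K) * (\<Sum>k\<in>K. (x k)^2))"
  using sum_squared_le_sum_of_squares[of x K] by (intro ennreal_leI) (simp add: mult.commute)
 also have "... = ennreal (real (card K)) * (\<Sum>k\<in>K. ennreal ((x k)^2))"
  by (simp add: ennreal_mult sum_nonneg)
 also have "... <= ennreal (real (card K)) * (\<Sum>k\<in>K. ennreal (\<kappa> k) * H)"
  by (intro mult_left_mono sum_mono b) auto
 also have "... = ennreal (real (card K) * (\<Sum>k\<in>K. \<kappa> k)) * H"
  using \<kappa> by (simp add: ennreal_mult sum_nonneg sum_distrib_right[symmetric] mult.assoc)
 finally show ?thesis .
qed

text \<open>Expand the nonnegative integral of (g - m)^2, where m is the mean of g.\<close>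

lemma square_integral_le:
 fixes g :: "real => real"
 assumes g: "continuous_on {0..T} g" and T: "0 < T"
 shows "(integral {0..T} g)^2 <= T * integral {0..T} (%u. (g u)^2)"
proof -
 let ?q0 = "%u. (g u)^2"
 define m where "m = integral {0..T} g / T"
 have i: "g integrable_on {0..T}" "?q0 integrable_on {0..T}"
  by (intro integrable_continuous_interval continuous_intros g)+
 have j: "(%u. 2 * m * g u) integrable_on {0..T}" by (intro integrable_continuous_interval continuous_intros g)
 have "0 <= integral {0..T} (%u. (g u - m)^2)"
  by (rule Henstock_Kurzweil_Integration.integral_nonneg) (auto intro!: integrable_continuous_interval continuous_intros g)
 also have "(%u. (g u - m)^2) = (%u. ((g u)^2 - 2 * m * g u) + m^2)" by (simp add: power2_diff fun_eq_iff algebra_simps)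
 also have "integral {0..T} ... = (integral {0..T} ?q0 - 2 * m * integral {0..T} g) + T * m^2"
  unfolding Henstock_Kurzweil_Integration.integral_add[OF Henstock_Kurzweil_Integration.integrable_diff[OF i(2) j] integrable_const_ivl]
   Henstock_Kurzweil_Integration.integral_diff[OF i(2) j] using T by simp
 also have "... = integral {0..T} ?q0 - (integral {0..T} g)\<^sup>2 / T"
  unfolding m_def using T by (simp add: power2_eq_square field_simps)
 finally show ?thesis using T by (simp add: pos_divide_le_eq mult.commute)
qed

lemma ennreal_square_integral_bound:
 fixes g :: "real => real"
 assumes g: "continuous_on {0..T} g" and T: "0 < T" and U: "a < 0" "T < c" and k: "0 <= \<kappa>"
  and b: "!!u. u \<in> {0..T} ==> ennreal ((g u)^2) <= ennreal \<kappa> * h u" and h[measurable]: "h \<in> meas borel"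
  and H: "(\<integral>\<^sup>+ u\<in>{a<..<c}. h u \<partial>lborel) <= H"
 shows "ennreal ((integral {0..T} g)^2) <= ennreal (T * \<kappa>) * H"
proof -
 let ?q0 = "%u. (g u)^2"
 let ?q1 = "integral {0..T} ?q0"
 have i: "(?q0 has_integral integral {0..T} ?q0) {0..T}"
  by (intro integrable_integral integrable_continuous_interval continuous_intros g)
 have "ennreal ?q1 = (\<integral>\<^sup>+ u. ennreal (indicator {0..T} u * (g u)^2) \<partial>lborel)"
  by (rule nn_integral_has_integral_lebesgue[OF _ i, symmetric]) simp
 also have "... <= (\<integral>\<^sup>+ u. ennreal \<kappa> * (h u * indicator {a<..<c} u) \<partial>lborel)"
  using b U by (intro nn_integral_mono) (auto simp: indicator_def)
 also have "... = ennreal \<kappa> * (\<integral>\<^sup>+ u\<in>{a<..<c}. h u \<partial>lborel)" by (rule nn_integral_cmult) measurable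
 also have "... <= ennreal \<kappa> * H" by (intro mult_left_mono H) simp
 finally have 1: "ennreal ?q1 <= ennreal \<kappa> * H" .
 have "ennreal ((integral {0..T} g)^2) <= ennreal T * ennreal ?q1"
  using square_integral_le[OF g T] T by (simp add: ennreal_mult'[symmetric] ennreal_leI)
 also have "... <= ennreal T * (ennreal \<kappa> * H)" by (intro mult_left_mono 1) simp
 also have "... = ennreal (T * \<kappa>) * H" using T k by (simp add: ennreal_mult mult.assoc)
 finally show ?thesis .
qed

context ito_process
begin

lemma Hbold_ge: "(\<integral>\<^sup>+ u\<in>{a<..<c}. Hs_norm2 s2 (%y. \<phi> (u, y)) \<partial>lborel) <= Hbold_norm2 a c s1 s2 \<phi>"
 unfolding Hbold_norm2_def by simp

text \<open>For one outcome the drift is continuous, hence bounded on [0, T]; Sobolev embedding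
  bounds the integrand at each time, and the constant depends on the outcome but not on
  \<open>\<phi>\<close>.\<close>

lemma drift_functional_bounded:
 assumes w: "w \<in> space M" and U: "a < 0" "T < c" and s2: "s2 > real CARD('d) / 2"
 shows "\<exists>\<kappa>\<ge>0. \<forall>\<phi>. test_fun a c \<phi> --> ennreal ((drift_functional \<phi> w)^2) <= ennreal \<kappa> * Hbold_norm2 a c s1 s2 \<phi>"
proof -
 obtain B where B: "B >= 0" "!!t. t \<in> {0..T} ==> norm (\<beta> t w) <= B" using has_bounded_range_on_interval[OF \<beta>_cont[OF w]] by blast
 have "weight_mass TYPE(real^'d) s2 < \<infinity>" using s2 by (intro weight_mass_finite) simp
 then obtain m where m: "m >= 0" "weight_mass TYPE(real^'d) s2 = ennreal m" by (cases "weight_mass TYPE(real^'d) s2") auto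
 show ?thesis
 proof (intro exI[of _ "T * (B^2 * m)"] conjI allI impI)
  show "0 <= T * (B^2 * m)" using T_pos m by simp
  fix \<phi> :: "real \<times> (real^'d) => real^'d" assume tf: "test_fun a c \<phi>"
  show "ennreal ((drift_functional \<phi> w)^2) <= ennreal (T * (B^2 * m)) * Hbold_norm2 a c s1 s2 \<phi>"
   unfolding drift_functional_def
  proof (rule ennreal_square_integral_bound[OF _ T_pos U _ _ _ Hbold_ge])
   show "continuous_on {0..T} (%u. \<phi> (u, X u w) \<bullet> \<beta> u w)" by (intro continuous_intros path_phi_continuous[OF tf w] \<beta>_cont[OF w])
   show "0 <= B^2 * m" using m by simp
   show "(%u. Hs_norm2 s2 (%y. \<phi> (u, y))) \<in> meas borel" by (rule Hs_norm2_slice_measurable1[OF tf])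
   fix u assume u: "u \<in> {0..T}"
   have "ennreal ((\<phi> (u, X u w) \<bullet> \<beta> u w)^2) <= Hs_norm2 s2 (%y. \<phi> (u, y)) * (ennreal ((norm (\<beta> u w))^2) * weight_mass TYPE(real^'d) s2)"
    using test_fun_point_bound[OF tf, of "\<beta> u w"] by (simp add: inner_commute)
   also have "... <= Hs_norm2 s2 (%y. \<phi> (u, y)) * (ennreal (B^2) * ennreal m)"
    unfolding m(2) by (intro mult_left_mono mult_right_mono ennreal_leI power_mono B(2)[OF u]) auto
   also have "... = ennreal (B^2 * m) * Hs_norm2 s2 (%y. \<phi> (u, y))" using m by (simp add: ennreal_mult mult.commute)
   finally show "ennreal ((\<phi> (u, X u w) \<bullet> \<beta> u w)^2) <= ennreal (B^2 * m) * Hs_norm2 s2 (%y. \<phi> (u, y))" .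
  qed
 qed
qed

lemma correction_bounded:
 assumes w: "w \<in> space M" and U: "a < 0" "T < c" and s2: "s2 > real CARD('d) / 2 + 1"
 shows "\<exists>\<kappa>\<ge>0. \<forall>\<phi>. test_fun a c \<phi> --> ennreal ((correction \<phi> w)^2) <= ennreal \<kappa> * Hbold_norm2 a c s1 s2 \<phi>"
proof -
 let ?q0 = "%\<phi> u. %y. \<phi> (u, y)"
 let ?q1 = "%m. ennreal (L^2 * (2 * pi)^2) * ennreal m"
 have "weight_mass TYPE(real^'d) (s2 - 1) < \<infinity>" using s2 by (intro weight_mass_finite) simp
 then obtain m where m: "m >= 0" "weight_mass TYPE(real^'d) (s2 - 1) = ennreal m" by (cases "weight_mass TYPE(real^'d) (s2 - 1)") auto
 let ?I = "UNIV \<times> Basis :: ('m \<times> (real^'d)) set"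
 define k0 where "k0 = L^2 * (L^2 * (2 * pi)^2 * m)"
 have k0: "0 <= k0" unfolding k0_def using m by simp
 define \<kappa> where "\<kappa> = real (card ?I) * (\<Sum>z\<in>?I. k0)"
 show ?thesis
 proof (intro exI[of _ "T * \<kappa>"] conjI allI impI)
  show "0 <= T * \<kappa>" unfolding \<kappa>_def using T_pos k0 by simp
  fix \<phi> :: "real \<times> (real^'d) => real^'d" assume tf: "test_fun a c \<phi>"
  show "ennreal ((correction \<phi> w)^2) <= ennreal (T * \<kappa>) * Hbold_norm2 a c s1 s2 \<phi>"
   unfolding correction_def
  proof (rule ennreal_square_integral_bound[OF _ T_pos U _ _ _ Hbold_ge])
   show "continuous_on {0..T} (%u. \<Sum>i\<in>UNIV. qcoef \<phi> i i u w)" by (intro continuous_intros path_qcoef_continuous[OF tf w])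
   show "0 <= \<kappa>" unfolding \<kappa>_def using k0 by simp
   show "(%u. Hs_norm2 s2 (?q0 \<phi> u)) \<in> meas borel" by (rule Hs_norm2_slice_measurable1[OF tf])
   fix u assume u: "u \<in> {0..T}"
   let ?col = "%i. column i (S u w)"
   \<comment> \<open>The trace is flattened into finitely many products of a coordinate of a column
     and a directional derivative, each controlled by \<open>test_fun_partial_bound\<close>. The
     derivative is why \<open>s2 - 1\<close> must exceed d / 2.\<close>
   define x where "x z = (?col (fst z) \<bullet> snd z) * (?col (fst z) \<bullet> pderivs [(0, snd z)] \<phi> (u, X u w))" for z
   have e: "(\<Sum>i\<in>UNIV. qcoef \<phi> i i u w) = (\<Sum>z\<in>?I. x z)"
    unfolding qcoef_def grad_def x_def inner_sum_left sum.cartesian_product split_def fst_conv snd_conv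
    by (intro sum.cong refl) (simp add: inner_commute del: pderivs.simps)
   show "ennreal ((\<Sum>i\<in>UNIV. qcoef \<phi> i i u w)^2) <= ennreal \<kappa> * Hs_norm2 s2 (?q0 \<phi> u)"
    unfolding e \<kappa>_def
   proof (rule ennreal_square_sum_bound)
    fix z assume z: "z \<in> ?I"
    have cn: "(norm (?col i))^2 <= L^2" for i using norm_column_le[of i "S u w"] S_bound[OF u w] by (intro power_mono) auto
    have "\<bar>?col (fst z) \<bullet> snd z\<bar> <= norm (?col (fst z))" using z by (intro Basis_le_norm) auto
    then have "\<bar>?col (fst z) \<bullet> snd z\<bar>\<^sup>2 <= (norm (?col (fst z)))^2" by (rule power_mono) simp
    then have c1: "(?col (fst z) \<bullet> snd z)^2 <= L^2" unfolding power2_abs using cn[of "fst z"] by (rule order_trans)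
    have "ennreal ((x z)^2) = ennreal ((?col (fst z) \<bullet> snd z)^2) * ennreal ((?col (fst z) \<bullet> pderivs [(0, snd z)] \<phi> (u, X u w))^2)"
     unfolding x_def power_mult_distrib by (rule ennreal_mult) auto
    also have "... <= ennreal (L^2) * (Hs_norm2 s2 (?q0 \<phi> u) * (ennreal ((norm (?col (fst z)))^2 * (2 * pi)^2) * weight_mass TYPE(real^'d) (s2 - 1)))"
     using z by (intro mult_mono ennreal_leI c1 test_fun_partial_bound[OF tf]) auto
    also have "... <= ennreal (L^2) * (Hs_norm2 s2 (?q0 \<phi> u) * (?q1 m))"
     unfolding m(2) by (intro mult_left_mono mult_right_mono ennreal_leI cn) auto
    also have "... = ennreal k0 * Hs_norm2 s2 (?q0 \<phi> u)"
    proof -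
     have "ennreal k0 = ennreal (L^2) * (?q1 m)"
      unfolding k0_def using m(1) by (subst ennreal_mult, simp, simp, subst ennreal_mult, simp_all)
     then show ?thesis by (simp only: mult_ac)
    qed
    finally show "ennreal ((x z)^2) <= ennreal k0 * Hs_norm2 s2 (?q0 \<phi> u)" .
   qed (use k0 in auto)
  qed
 qed
qed

lemma approx_add:
 assumes tf: "test_fun a c \<phi>" and tg: "test_fun a c \<psi>"
 shows "approx n l (%z. \<phi> z + \<psi> z) w = approx n l \<phi> w + approx n l \<psi> w"
proof -
 have "point_functional A x e (%y. \<phi> (u, y) + \<psi> (u, y)) = point_functional A x e (%y. \<phi> (u, y)) + point_functional A x e (%y. \<psi> (u, y))"
  for A :: "nat set" and x e u unfolding point_functional_def by (simp add: inner_add_right sum.distrib)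
 then show ?thesis unfolding approx_def
  by (simp add: set_integral_add[OF point_functional_slice_integrable[OF tf] point_functional_slice_integrable[OF tg]] distrib_left sum.distrib add_divide_distrib)
qed

lemma approx_scale: "approx n l (%z. r *\<^sub>R \<phi> z) w = r * approx n l \<phi> w"
proof -
 have "point_functional A x e (%y. r *\<^sub>R \<phi> (u, y)) = r * point_functional A x e (%y. \<phi> (u, y))"
  for A :: "nat set" and x e u unfolding point_functional_def by (simp add: sum_distrib_left)
 then show ?thesis unfolding approx_def sum_distrib_left by (intro sum.cong refl) (simp add: mult_ac)
qed

lemma drift_functional_add:
 assumes w: "w \<in> space M" and tf: "test_fun a c \<phi>" and tg: "test_fun a c \<psi>"
 shows "drift_functional (%z. \<phi> z + \<psi> z) w = drift_functional \<phi> w + drift_functional \<psi> w"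
 unfolding drift_functional_def inner_add_left
 by (intro Henstock_Kurzweil_Integration.integral_add integrable_continuous_interval continuous_intros
   path_phi_continuous[OF tf w] path_phi_continuous[OF tg w] \<beta>_cont[OF w])

lemma drift_functional_scale: "drift_functional (%z. r *\<^sub>R \<phi> z) w = r * drift_functional \<phi> w"
 unfolding drift_functional_def by simp

lemma qcoef_add:
 assumes tf: "test_fun a c \<phi>" and tg: "test_fun a c \<psi>"
 shows "qcoef (%z. \<phi> z + \<psi> z) i j u w = qcoef \<phi> i j u w + qcoef \<psi> i j u w"
proof -
 have "grad (%z. \<phi> z + \<psi> z) t x h = grad \<phi> t x h + grad \<psi> t x h" for t x h
  unfolding grad_def sum.distrib[symmetric] scaleR_right_distrib[symmetric]
  by (intro sum.cong refl arg_cong2[where f=scaleR] pderivs_add_test_fun[OF tf tg]) (auto simp: Basis_prod_def)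
 then show ?thesis unfolding qcoef_def by (simp add: inner_add_left)
qed

lemma qcoef_scale:
 assumes tf: "test_fun a c \<phi>"
 shows "qcoef (%z. r *\<^sub>R \<phi> z) i j u w = r * qcoef \<phi> i j u w"
proof -
 let ?q0 = "%z. r *\<^sub>R \<phi> z"
 have "pderivs [(0, b)] ?q0 (t, x) = r *\<^sub>R pderivs [(0, b)] \<phi> (t, x)" if "b \<in> Basis" for b t x
  by (rule pderivs_scale_test_fun[OF tf]) (use that in \<open>auto simp: Basis_prod_def\<close>)
 then have "grad ?q0 t x h = r *\<^sub>R grad \<phi> t x h" for t x h
  unfolding grad_def scaleR_sum_right by (intro sum.cong refl) (simp add: mult.commute del: pderivs.simps)
 then show ?thesis unfolding qcoef_def by simp
qed

lemma correction_add:
 assumes w: "w \<in> space M" and tf: "test_fun a c \<phi>" and tg: "test_fun a c \<psi>"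
 shows "correction (%z. \<phi> z + \<psi> z) w = correction \<phi> w + correction \<psi> w"
 unfolding correction_def qcoef_add[OF tf tg] sum.distrib
 by (intro Henstock_Kurzweil_Integration.integral_add integrable_continuous_interval continuous_on_sum
   path_qcoef_continuous[OF tf w] path_qcoef_continuous[OF tg w])

lemma correction_scale: "test_fun a c \<phi> ==> correction (%z. r *\<^sub>R \<phi> z) w = r * correction \<phi> w"
 unfolding correction_def by (simp add: qcoef_scale sum_distrib_left[symmetric])

text \<open>The three parts are bounded path by path and linear in \<open>\<phi>\<close>, and their
  sum is the limit of the Stratonovich sums for each fixed \<open>\<phi>\<close>.\<close>

theorem pathwise_stratonovich_current:
 assumes U: "a < 0" "T < c" and s1: "1/2 < s1" "s1 < 1" and s2: "s2 > real CARD('d) / 2 + 1"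
 shows "\<exists>J :: 'w => ((real \<times> (real^'d) => real^'d) => real).
   (\<forall>w\<in>space M. Hneg a c s1 s2 (J w)) \<and>
   (\<forall>\<phi>. test_fun a c \<phi> --> conv_in_prob M 0 T (strat_sum \<phi> X) (%w. J w \<phi>))"
proof -
 have s2': "s2 > real CARD('d) / 2" using s2 by simp
 obtain \<nu> :: "nat => nat" and V :: "'w => real" and G :: "'w set" where \<nu>: "!!k. k < \<nu> k"
  and GM[measurable]: "G \<in> sets M" and Gae: "AE w in M. w \<in> G"
  and cv: "!!a c \<phi> w. test_fun a c \<phi> ==> a < 0 ==> T < c ==> s1 < 1 ==> w \<in> G ==> convergent (%k. approx (\<nu> k) k \<phi> w)"
  and bd: "!!a c \<phi> w. test_fun a c \<phi> ==> a < 0 ==> T < c ==> s1 < 1 ==> w \<in> G ==>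
   ennreal ((lim (%k. approx (\<nu> k) k \<phi> w))^2) <= ennreal (V w) * Hbold_norm2 a c s1 s2 \<phi>"
  by (rule pathwise_ito_functional[OF s1(1) s2']) (rule that; assumption)
 \<comment> \<open>The value 0 off the good event keeps the functional linear and bounded for every
   outcome, and not just almost every one.\<close>
 define K where "K \<phi> w = (if w \<in> G then lim (%k. approx (\<nu> k) k \<phi> w) else 0)" for \<phi> w
 have Kl: "(%k. approx (\<nu> k) k \<phi> w) \<longlonglongrightarrow> K \<phi> w" if "test_fun a c \<phi>" "w \<in> G" for \<phi> w
  using cv[OF that(1) U s1(2) that(2)] that(2) unfolding K_def by (simp add: convergent_LIMSEQ_iff)
 have KM: "K \<phi> \<in> meas M" if tf: "test_fun a c \<phi>" for \<phi>
 proof (rule borel_measurable_LIMSEQ_real[where u="%k w. indicator G w * approx (\<nu> k) k \<phi> w"])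
  have [measurable]: "approx (\<nu> k) k \<phi> \<in> meas M" for k
   by (rule approx_measurable) (use tf U \<nu>[of k] in auto)
  show "(%w. indicator G w * approx (\<nu> k) k \<phi> w) \<in> meas M" for k by measurable
  fix w show "(%k. indicator G w * approx (\<nu> k) k \<phi> w) \<longlonglongrightarrow> K \<phi> w"
   using Kl[OF tf, of w] by (cases "w \<in> G") (auto simp: K_def)
 qed
 define J where "J w \<phi> = drift_functional \<phi> w + \<epsilon> * K \<phi> w + \<epsilon>^2 / 2 * correction \<phi> w" for w \<phi>
 have "Hneg a c s1 s2 (J w)" if w: "w \<in> space M" for w
  unfolding Hneg_def
 proof (intro conjI allI impI)
  fix \<phi> \<psi> :: "real \<times> (real^'d) => real^'d" assume "test_fun a c \<phi> \<and> test_fun a c \<psi>"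
  then have tf: "test_fun a c \<phi>" and tg: "test_fun a c \<psi>" by auto
  have "K (%z. \<phi> z + \<psi> z) w = K \<phi> w + K \<psi> w"
  proof (cases "w \<in> G")
   case True
   have "lim (%k. approx (\<nu> k) k (%z. \<phi> z + \<psi> z) w) = K \<phi> w + K \<psi> w"
    unfolding approx_add[OF tf tg] by (intro limI tendsto_add Kl tf tg True)
   then show ?thesis unfolding K_def[of "%z. \<phi> z + \<psi> z"] using True by simp
  qed (simp add: K_def)
  then show "J w (%z. \<phi> z + \<psi> z) = J w \<phi> + J w \<psi>"
   unfolding J_def drift_functional_add[OF w tf tg] correction_add[OF w tf tg] by (simp add: algebra_simps)
 next
  fix \<phi> :: "real \<times> (real^'d) => real^'d" and r :: real assume tf: "test_fun a c \<phi>"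
  have "K (%z. r *\<^sub>R \<phi> z) w = r * K \<phi> w"
  proof (cases "w \<in> G")
   case True
   have "lim (%k. approx (\<nu> k) k (%z. r *\<^sub>R \<phi> z) w) = r * K \<phi> w"
    unfolding approx_scale by (intro limI tendsto_mult_left Kl tf True)
   then show ?thesis unfolding K_def[of "%z. r *\<^sub>R \<phi> z"] using True by simp
  qed (simp add: K_def)
  then show "J w (%z. r *\<^sub>R \<phi> z) = r * J w \<phi>"
   unfolding J_def drift_functional_scale correction_scale[OF tf] by (simp add: algebra_simps)
 next
  obtain k1 where k1: "k1 >= 0" "!!\<phi>. test_fun a c \<phi> ==> ennreal ((drift_functional \<phi> w)^2) <= ennreal k1 * Hbold_norm2 a c s1 s2 \<phi>"
   using drift_functional_bounded[OF w U s2', of s1] by blast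
  obtain k2 where k2: "k2 >= 0" "!!\<phi>. test_fun a c \<phi> ==> ennreal ((correction \<phi> w)^2) <= ennreal k2 * Hbold_norm2 a c s1 s2 \<phi>"
   using correction_bounded[OF w U s2, of s1] by blast
  \<comment> \<open>No sign of V is known here; replacing it by its positive part leaves its
    \<open>ennreal\<close> value unchanged.\<close>
  have kK: "ennreal ((K \<phi> w)^2) <= ennreal (max 0 (V w)) * Hbold_norm2 a c s1 s2 \<phi>" if tf: "test_fun a c \<phi>" for \<phi>
   using bd[OF tf U s1(2), of w] unfolding K_def by (cases "w \<in> G") (auto simp: max_def ennreal_neg)
  have scale: "ennreal ((r * x)^2) <= ennreal (r^2 * k) * H" if "k >= 0" "ennreal (x^2) <= ennreal k * H" for r x k :: real and H
   using mult_left_mono[OF that(2), of "ennreal (r^2)"] that(1) by (simp add: power_mult_distrib ennreal_mult mult.assoc)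
  define x where "x \<phi> k = (if k = (0::nat) then drift_functional \<phi> w else if k = 1 then \<epsilon> * K \<phi> w else \<epsilon>\<^sup>2 / 2 * correction \<phi> w)" for \<phi> k
  define \<kappa> where "\<kappa> k = (if k = (0::nat) then k1 else if k = 1 then \<epsilon>\<^sup>2 * max 0 (V w) else (\<epsilon>^2 / 2)\<^sup>2 * k2)" for k
  show "\<exists>C. \<forall>\<phi>. test_fun a c \<phi> --> ennreal ((J w \<phi>)^2) <= ennreal C * Hbold_norm2 a c s1 s2 \<phi>"
  proof (intro exI allI impI)
   fix \<phi> :: "real \<times> (real^'d) => real^'d" assume tf: "test_fun a c \<phi>"
   have J: "J w \<phi> = (\<Sum>k\<in>{0, 1, 2}. x \<phi> k)" unfolding J_def x_def by simp
   show "ennreal ((J w \<phi>)^2) <= ennreal (real (card {0::nat, 1, 2}) * (\<Sum>k\<in>{0, 1, 2}. \<kappa> k)) * Hbold_norm2 a c s1 s2 \<phi>"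
    unfolding J
   proof (rule ennreal_square_sum_bound)
    fix k :: nat
    show "0 <= \<kappa> k" unfolding \<kappa>_def using k1(1) k2(1) by auto
    show "ennreal ((x \<phi> k)^2) <= ennreal (\<kappa> k) * Hbold_norm2 a c s1 s2 \<phi>"
     unfolding x_def \<kappa>_def using k1(2)[OF tf] scale[OF _ kK[OF tf], of \<epsilon>] scale[OF k2(1) k2(2)[OF tf], of "\<epsilon>^2 / 2"]
     by (simp split: if_split)
   qed simp
  qed
 qed
 moreover have "conv_in_prob M 0 T (strat_sum \<phi> X) (%w. J w \<phi>)" if tf: "test_fun a c \<phi>" for \<phi>
  unfolding J_def by (rule strat_sum_converges[OF tf U \<nu> KM[OF tf]]) (use Gae in eventually_elim, use Kl[OF tf] in simp)
 ultimately show ?thesis by blast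
qed

end

section \<open>Empirical measures and the particle system\<close>

lemma strat_sum_measurable:
 assumes tf: "test_fun a c \<phi>" and X: "!!t. t \<in> {0..T} ==> X t \<in> meas M" and p: "partition_of 0 T p"
 shows "strat_sum \<phi> X p \<in> meas M"
 unfolding strat_sum_def[abs_def]
proof (rule borel_measurable_sum)
 fix i assume "i \<in> {..<length p - 1}"
 then have i: "i < length p - 1" by simp
 have t: "p ! i \<in> {0..T}" "p ! Suc i \<in> {0..T}" using partition_bounds[OF p i] by auto
 have phi: "(%w. \<phi> (t, X t w)) \<in> meas M" if "t \<in> {0..T}" for t
 proof -
  note [measurable] = X[OF that]
  have "(%w. (t, X t w)) \<in> M \<rightarrow>\<^sub>M borel" unfolding borel_prod[symmetric] by measurable
  from measurable_compose[OF this test_fun_measurable[OF tf]] show ?thesis .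
 qed
 note [measurable] = X[OF t(1)] X[OF t(2)] phi[OF t(1)] phi[OF t(2)]
 show "(%w. ((\<phi> (p ! i, X (p ! i) w) + \<phi> (p ! Suc i, X (p ! Suc i) w)) /\<^sub>R 2) \<bullet> (X (p ! Suc i) w - X (p ! i) w)) \<in> meas M"
  by measurable
qed

lemma (in prob_space) conv_in_prob_cmult_sum:
 fixes S :: "'i => real list => 'a => real"
 assumes A: "finite A" and c: "!!j. j \<in> A ==> conv_in_prob M a c (S j) (Y j)"
  and m: "!!j p. j \<in> A ==> partition_of a c p ==> S j p \<in> meas M"
 shows "conv_in_prob M a c (%p w. r * (\<Sum>j\<in>A. S j p w)) (%w. r * (\<Sum>j\<in>A. Y j w))"
proof (rule conv_in_prob_seqI)
 have Y: "Y j \<in> meas M" if "j \<in> A" for j by (rule conjunct1[OF c[OF that, unfolded conv_in_prob_def]])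
 then show "(%w. r * (\<Sum>j\<in>A. Y j w)) \<in> meas M" by (intro borel_measurable_times borel_measurable_const borel_measurable_sum)
 fix p e assume p: "!!n. partition_of a c (p n)" "(%n. mesh (p n)) \<longlonglongrightarrow> 0" and e: "(e::real) > 0"
 have "vanishing (%n w. S j (p n) w - Y j w)" if j: "j \<in> A" for j
  unfolding vanishing_def
  using conv_in_prob_seqD[OF c[OF j] p] Y[OF j] m[OF j p(1)] unfolding dist_real_def by (blast intro: borel_measurable_diff)
 from vanishing_cmult[OF vanishing_sum[OF A this], where c=r]
 have "vanishing (%n w. r * (\<Sum>j\<in>A. S j (p n) w) - r * (\<Sum>j\<in>A. Y j w))"
  by (simp add: sum_subtractf right_diff_distrib)
 from vanishingD[OF this e]
 show "(%n. prob {w\<in>space M. e < dist (r * (\<Sum>j\<in>A. S j (p n) w)) (r * (\<Sum>j\<in>A. Y j w))}) \<longlonglongrightarrow> 0"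
  unfolding dist_real_def .
qed

lemma Hneg_cmult_sum:
 fixes G :: "'i => (real \<times> (real^'d) => real^'d) => real"
 assumes A: "finite A" and G: "!!j. j \<in> A ==> Hneg a c s1 s2 (G j)"
 shows "Hneg a c s1 s2 (%\<phi>. r * (\<Sum>j\<in>A. G j \<phi>))"
 unfolding Hneg_def
proof (intro conjI allI impI)
 note D = G[unfolded Hneg_def]
 fix \<phi> \<psi> :: "real \<times> (real^'d) => real^'d" assume "test_fun a c \<phi> \<and> test_fun a c \<psi>"
 then have "G j (%z. \<phi> z + \<psi> z) = G j \<phi> + G j \<psi>" if "j \<in> A" for j using D[OF that] by blast
 then show "r * (\<Sum>j\<in>A. G j (%z. \<phi> z + \<psi> z)) = r * (\<Sum>j\<in>A. G j \<phi>) + r * (\<Sum>j\<in>A. G j \<psi>)"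
  by (simp add: sum.distrib distrib_left)
next
 note D = G[unfolded Hneg_def]
 fix \<phi> :: "real \<times> (real^'d) => real^'d" and q :: real assume "test_fun a c \<phi>"
 then have "G j (%z. q *\<^sub>R \<phi> z) = q * G j \<phi>" if "j \<in> A" for j using D[OF that] by blast
 then show "r * (\<Sum>j\<in>A. G j (%z. q *\<^sub>R \<phi> z)) = q * (r * (\<Sum>j\<in>A. G j \<phi>))"
  by (simp add: sum_distrib_left mult_ac)
next
 note D = G[unfolded Hneg_def]
 have "\<forall>j\<in>A. \<exists>C. \<forall>\<phi>. test_fun a c \<phi> --> ennreal ((G j \<phi>)^2) <= ennreal C * Hbold_norm2 a c s1 s2 \<phi>" using D by blast
 from bchoice[OF this] obtain C where C: "!!j \<phi>. j \<in> A ==> test_fun a c \<phi> ==> ennreal ((G j \<phi>)^2) <= ennreal (C j) * Hbold_norm2 a c s1 s2 \<phi>"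
  by blast
 show "\<exists>C. \<forall>\<phi>. test_fun a c \<phi> --> ennreal ((r * (\<Sum>j\<in>A. G j \<phi>))^2) <= ennreal C * Hbold_norm2 a c s1 s2 \<phi>"
 proof (intro exI allI impI)
  fix \<phi> :: "real \<times> (real^'d) => real^'d" assume tf: "test_fun a c \<phi>"
  \<comment> \<open>The constants provided by \<open>Hneg\<close> may be negative, in which case
    \<open>ennreal\<close> reads them as 0; the maximum makes them honest nonnegative reals.\<close>
  have mx: "ennreal (max 0 x) = ennreal x" for x by (auto simp: max_def ennreal_neg)
  show "ennreal ((r * (\<Sum>j\<in>A. G j \<phi>))^2) <= ennreal (real (card A) * (\<Sum>j\<in>A. r^2 * max 0 (C j))) * Hbold_norm2 a c s1 s2 \<phi>"
   unfolding sum_distrib_left[of r]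
  proof (rule ennreal_square_sum_bound[OF A])
   fix j assume j: "j \<in> A"
   show "0 <= r^2 * max 0 (C j)" by simp
   have "ennreal ((r * G j \<phi>)^2) = ennreal (r^2) * ennreal ((G j \<phi>)^2)" unfolding power_mult_distrib by (rule ennreal_mult) auto
   also have "... <= ennreal (r^2) * (ennreal (max 0 (C j)) * Hbold_norm2 a c s1 s2 \<phi>)"
    unfolding mx by (intro mult_left_mono C[OF j tf]) simp
   also have "... = ennreal (r^2 * max 0 (C j)) * Hbold_norm2 a c s1 s2 \<phi>" by (simp add: ennreal_mult mult.assoc)
   finally show "ennreal ((r * G j \<phi>)^2) <= ennreal (r^2 * max 0 (C j)) * Hbold_norm2 a c s1 s2 \<phi>" .
  qed
 qed
qed

section \<open>Empirical measures and regularity of the interacting coefficients\<close>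

lemma empirical_integral:
 fixes x :: "nat => 'a::euclidean_space" and f :: "'a => real"
 assumes N: "N >= 1" and f: "f \<in> meas borel"
 shows "integrable (empirical N x) f" (is ?C1) "integral\<^sup>L (empirical N x) f = (\<Sum>j=1..N. f (x j)) / real N" (is ?C2)
proof -
 have x: "x \<in> uniform_count_measure {1..N} \<rightarrow>\<^sub>M borel" by (rule measurableI) (auto simp: space_uniform_count_measure)
 show ?C1
  unfolding empirical_def integrable_distr_eq[OF x f] unfolding uniform_count_measure_def
  by (rule integrable_point_measure_finite) simp
 show ?C2
  unfolding empirical_def integral_distr[OF x f] using integral_uniform_count_measure[of "{1..N}" "%j. f (x j)"] by simp
qed

lemma empirical_in_P1:
 assumes N: "N >= 1"
 shows "empirical N x \<in> P1"
proof -
 have x: "x \<in> uniform_count_measure {1..N} \<rightarrow>\<^sub>M borel" by (rule measurableI) (auto simp: space_uniform_count_measure)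
 have "prob_space (uniform_count_measure {1..N})" by (rule prob_space_uniform_count_measure) (use N in auto)
 from prob_space.prob_space_distr[OF this x] show ?thesis
  unfolding P1_def using empirical_integral(1)[OF N, of norm x] by (simp add: empirical_def)
qed

text \<open>Pairing the k-th atoms is a coupling: a 1-Lipschitz function changes by at most the
  distance within each pair.\<close>

lemma W1_empirical_le:
 assumes N: "N >= 1"
 shows "W1 (empirical N x) (empirical N y) <= (\<Sum>k=1..N. dist (x k) (y k)) / real N"
 unfolding W1_def
proof (rule cSUP_least)
 have "1-lipschitz_on UNIV (%_::'a. 0::real)" by (rule lipschitz_onI) auto
 then show "{f::'a => real. 1-lipschitz_on UNIV f} ~= {}" by blast
 fix f :: "'a => real" assume "f \<in> {f. 1-lipschitz_on UNIV f}"
 then have f: "1-lipschitz_on UNIV f" by simp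
 have fm: "f \<in> meas borel" by (rule borel_measurable_continuous_onI[OF lipschitz_on_continuous_on[OF f]])
 have "\<bar>(\<Sum>j=1..N. f (x j)) - (\<Sum>j=1..N. f (y j))\<bar> <= (\<Sum>k=1..N. dist (x k) (y k))"
  unfolding sum_subtractf[symmetric]
  using lipschitz_onD[OF f] by (intro order_trans[OF sum_abs sum_mono]) (auto simp: dist_real_def)
 then show "\<bar>integral\<^sup>L (empirical N x) f - integral\<^sup>L (empirical N y) f\<bar> <= (\<Sum>k=1..N. dist (x k) (y k)) / real N"
  unfolding empirical_integral(2)[OF N fm] diff_divide_distrib[symmetric] abs_divide using N by (simp add: divide_right_mono)
qed

text \<open>The coefficient of one particle depends on the positions of all of them through the
  empirical measure. A Lipschitz bound in finitely many coordinates yields path continuity without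
  any topology on measures.\<close>

lemma lipschitz_coordinates_continuous:
 fixes g :: "('i => 'a::metric_space) => 'b::real_normed_vector" and x :: "'t::topological_space => 'i => 'a"
 assumes g: "!!x y. norm (g x - g y) <= C * (\<Sum>k\<in>K. dist (x k) (y k))"
  and x: "!!k. k \<in> K ==> continuous_on A (%t. x t k)"
 shows "continuous_on A (%t. g (x t))"
 unfolding continuous_on_def
proof
 fix t assume t: "t \<in> A"
 have "((%s. C * (\<Sum>k\<in>K. dist (x s k) (x t k))) \<longlongrightarrow> C * (\<Sum>k\<in>K. dist (x t k) (x t k))) (at t within A)"
  using x t unfolding continuous_on_def by (intro tendsto_intros) auto
 then have "((%s. C * (\<Sum>k\<in>K. dist (x s k) (x t k))) \<longlongrightarrow> 0) (at t within A)" by simp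
 then have "((%s. g (x s) - g (x t)) \<longlongrightarrow> 0) (at t within A)"
  by (rule Lim_null_comparison[OF always_eventually, rotated]) (use g in blast)
 then show "((%s. g (x s)) \<longlongrightarrow> g (x t)) (at t within A)" by (rule LIM_zero_cancel)
qed

lemma lipschitz_coordinates_measurable:
 fixes g :: "(nat => 'a::euclidean_space) => 'b::euclidean_space" and x :: "nat => 'w => 'a"
 assumes g: "!!x y. norm (g x - g y) <= C * (\<Sum>k\<in>K. dist (x k) (y k))"
  and x: "!!k. k \<in> K ==> x k \<in> meas M"
 shows "(%w. g (%k. x k w)) \<in> meas M"
proof -
 \<comment> \<open>Coordinates outside K carry no measurability information. They are set to 0,
   which by the Lipschitz bound does not change the value of g.\<close>
 define y where "y w k = (if k \<in> K then x k w else 0)" for w k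
 have e: "g (%k. x k w) = g (y w)" for w using g[of "%k. x k w" "y w"] unfolding y_def by simp
 have "continuous_on UNIV (%z. g z)" by (rule lipschitz_coordinates_continuous[OF g continuous_on_product_coordinates])
 then have gm: "g \<in> meas borel" by (rule borel_measurable_continuous_onI)
 have ym: "y \<in> meas M"
 proof (rule measurable_coordinatewise_then_product)
  show "(%w. y w i) \<in> meas M" for i using x[of i] unfolding y_def by (cases "i \<in> K") auto
 qed
 show ?thesis unfolding e by (rule measurable_compose[OF ym gm])
qed

theorem mainTheorem1:
  fixes M :: "'w measure" and F :: "real \<Rightarrow> 'w measure" and T a c :: real
    and W :: "nat \<Rightarrow> real \<Rightarrow> 'w \<Rightarrow> real^'m"
    and b :: "real^'d \<Rightarrow> (real^'d) measure \<Rightarrow> real^'d"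
    and \<sigma> :: "real^'d \<Rightarrow> (real^'d) measure \<Rightarrow> real^'m^'d"
    and eps :: "nat \<Rightarrow> real"
    and x :: "nat \<Rightarrow> nat \<Rightarrow> real^'d"
    and X :: "nat \<Rightarrow> nat \<Rightarrow> real \<Rightarrow> 'w \<Rightarrow> real^'d"
  assumes T_pos: "0 < T"
    and U: "a < 0" "T < c"
    and filt: "usual_filtered_prob_space M F T"
    and BM: "\<And>j. F_brownian M F T (W j)"
    and BM_indep: "prob_space.indep_vars M (\<lambda>_. Pi\<^sub>M UNIV (\<lambda>_. borel))
                     (\<lambda>j \<omega> t. W j t \<omega>) UNIV"
    and eps: "\<And>N. 0 < eps N \<and> eps N \<le> 1" "antimono eps" "eps \<longlonglongrightarrow> 0"
    and sol: "\<And>N. N \<ge> 1 \<Longrightarrow> particle_system M F T W b \<sigma> (eps N) (x N) N (X N)"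
    and condA: "\<exists>L::real. \<forall>y z \<mu> \<nu>. \<mu> \<in> P1 \<and> \<nu> \<in> P1 \<longrightarrow>
                   norm (b y \<mu> - b z \<nu>) + norm (\<sigma> y \<mu> - \<sigma> z \<nu>) \<le> L * (dist y z + W1 \<mu> \<nu>)
                   \<and> norm (\<sigma> y \<mu>) \<le> L"
    and condB1: "\<exists>\<mu>0. prob_space \<mu>0 \<and> sets \<mu>0 = sets borel \<and>
                   weak_conv (\<lambda>N. empirical N (x N)) \<mu>0"
    and condB2: "bdd_above (range (\<lambda>N. (1 / real N) * (\<Sum>j=1..N. (norm (x N j))\<^sup>2)))"
  shows "\<forall>N\<ge>1. \<forall>s1 s2. 1/2 < s1 \<and> s1 < 1 \<and> s2 > real CARD('d) / 2 + 1 \<longrightarrow>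
           (\<exists>J :: 'w \<Rightarrow> ((real \<times> (real^'d) \<Rightarrow> real^'d) \<Rightarrow> real).
              (\<forall>\<omega>\<in>space M. Hneg a c s1 s2 (J \<omega>)) \<and>
              (\<forall>\<phi>. test_fun a c \<phi> \<longrightarrow>
                 (\<lambda>\<omega>. J \<omega> \<phi>) \<in> borel_measurable M \<and>
                 conv_in_prob M 0 T
                   (\<lambda>p \<omega>. (1 / real N) * (\<Sum>j=1..N. strat_sum \<phi> (X N j) p \<omega>))
                   (\<lambda>\<omega>. J \<omega> \<phi>)))"
proof (intro allI impI)
  fix N :: nat and s1 s2 :: real
  assume N: "N \<ge> 1" and s: "1/2 < s1 \<and> s1 < 1 \<and> s2 > real CARD('d) / 2 + 1"
  interpret prob_space M by (rule filt[unfolded usual_filtered_prob_space_def, THEN conjunct1])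
  obtain L :: real where L: "\<And>y z \<mu> \<nu>. \<mu> \<in> P1 \<Longrightarrow> \<nu> \<in> P1 \<Longrightarrow>
      norm (b y \<mu> - b z \<nu>) + norm (\<sigma> y \<mu> - \<sigma> z \<nu>) \<le> L * (dist y z + W1 \<mu> \<nu>)"
    "\<And>y \<mu>. \<mu> \<in> P1 \<Longrightarrow> norm (\<sigma> y \<mu>) \<le> L" using condA by blast
  note emp = empirical_in_P1[OF N]
  have L0: "0 \<le> L" using L(2)[OF emp] norm_ge_zero order_trans by blast
  \<comment> \<open>The displacement of particle j and the distance of the empirical measures are
    each at most the sum of all displacements, hence the factor 2.\<close>
  have coef: "norm (b (y j) (empirical N y) - b (z j) (empirical N z)) \<le> 2 * L * (\<Sum>k\<in>{1..N}. dist (y k) (z k))"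
    "norm (\<sigma> (y j) (empirical N y) - \<sigma> (z j) (empirical N z)) \<le> 2 * L * (\<Sum>k\<in>{1..N}. dist (y k) (z k))" if j: "j \<in> {1..N}" for j y z
  proof -
    let ?S = "\<Sum>k\<in>{1..N}. dist (y k) (z k)"
    have "0 \<le> ?S" by (intro sum_nonneg) simp
    then have "?S / real N \<le> ?S / 1" using N by (intro divide_left_mono) auto
    then have "W1 (empirical N y) (empirical N z) \<le> ?S" using W1_empirical_le[OF N, of y z] by simp
    moreover have "dist (y j) (z j) \<le> ?S" using j by (intro member_le_sum) auto
    ultimately have "L * (dist (y j) (z j) + W1 (empirical N y) (empirical N z)) \<le> L * (2 * ?S)" by (intro mult_left_mono L0) simp
    then show "norm (b (y j) (empirical N y) - b (z j) (empirical N z)) \<le> 2 * L * ?S"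
      "norm (\<sigma> (y j) (empirical N y) - \<sigma> (z j) (empirical N z)) \<le> 2 * L * ?S"
      using L(1)[OF emp emp, of "y j" y "z j" z] norm_ge_zero[of "b (y j) (empirical N y) - b (z j) (empirical N z)"]
        norm_ge_zero[of "\<sigma> (y j) (empirical N y) - \<sigma> (z j) (empirical N z)"] by linarith+
  qed
  define S where "S j t \<omega> = \<sigma> (X N j t \<omega>) (empirical N (\<lambda>k. X N k t \<omega>))" for j t \<omega>
  define \<beta> where "\<beta> j t \<omega> = b (X N j t \<omega>) (empirical N (\<lambda>k. X N k t \<omega>))" for j t \<omega>
  note sys = sol[OF N, unfolded particle_system_def, rule_format]
  have Xa: "X N j t \<in> borel_measurable (F t)" if "j \<in> {1..N}" "t \<in> {0..T}" for j t using sys[OF that(1)] that(2) by blast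
  have Xc: "continuous_on {0..T} (\<lambda>t. X N j t \<omega>)" if "j \<in> {1..N}" "\<omega> \<in> space M" for j \<omega> using sys[OF that(1)] that(2) by blast
  \<comment> \<open>Particles are treated one by one: the interaction survives only in the random,
    adapted and continuous coefficients \<open>S j\<close> and \<open>\<beta> j\<close>.\<close>
  have proc: "ito_process M F T (W j) (X N j) (S j) L (\<beta> j) (eps N) (x N j)" if j: "j \<in> {1..N}" for j
  proof -
    have brow: "brownian M F T (W j)" by unfold_locales (use filt BM T_pos in auto)
    have Sa: "S j t \<in> borel_measurable (F t)" and ba: "\<beta> j t \<in> borel_measurable (F t)" if t: "t \<in> {0..T}" for t
    proof -
      show "S j t \<in> borel_measurable (F t)" unfolding S_def[abs_def]
        by (rule lipschitz_coordinates_measurable[where g="\<lambda>y. \<sigma> (y j) (empirical N y)" and K="{1..N}", OF coef(2)[OF j]]) (rule Xa[OF _ t])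
      show "\<beta> j t \<in> borel_measurable (F t)" unfolding \<beta>_def[abs_def]
        by (rule lipschitz_coordinates_measurable[where g="\<lambda>y. b (y j) (empirical N y)" and K="{1..N}", OF coef(1)[OF j]]) (rule Xa[OF _ t])
    qed
    have Sc: "continuous_on {0..T} (\<lambda>t. S j t \<omega>)" and bc: "continuous_on {0..T} (\<lambda>t. \<beta> j t \<omega>)" if w: "\<omega> \<in> space M" for \<omega>
    proof -
      show "continuous_on {0..T} (\<lambda>t. S j t \<omega>)" unfolding S_def
        by (rule lipschitz_coordinates_continuous[where g="\<lambda>y. \<sigma> (y j) (empirical N y)" and K="{1..N}", OF coef(2)[OF j]]) (rule Xc[OF _ w])
      show "continuous_on {0..T} (\<lambda>t. \<beta> j t \<omega>)" unfolding \<beta>_def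
        by (rule lipschitz_coordinates_continuous[where g="\<lambda>y. b (y j) (empirical N y)" and K="{1..N}", OF coef(1)[OF j]]) (rule Xc[OF _ w])
    qed
    have bM: "\<beta> j t \<in> borel_measurable M" if t: "t \<in> {0..T}" for t
      using brownian.F_measurable_M[OF brow ba[OF t]] t by simp
    have so: "\<exists>I. conv_in_prob M 0 t (ito_sum (S j) (W j)) I \<and>
       (AE \<omega> in M. X N j t \<omega> = x N j + integral {0..t} (\<lambda>s. \<beta> j s \<omega>) + eps N *\<^sub>R I \<omega>)" if t: "t \<in> {0..T}" for t
      using sys[OF j] t unfolding S_def[abs_def] \<beta>_def by blast
    have "driven M F T (W j) (X N j) (S j) L"
      unfolding driven_def driven_axioms_def
      using brow Xa[OF j] Xc[OF j] Sa Sc L(2)[OF emp] unfolding S_def by blast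
    then show ?thesis unfolding ito_process_def ito_process_axioms_def using bM bc so by blast
  qed
  have "\<forall>j\<in>{1..N}. \<exists>J :: 'w \<Rightarrow> ((real \<times> (real^'d) \<Rightarrow> real^'d) \<Rightarrow> real). (\<forall>\<omega>\<in>space M. Hneg a c s1 s2 (J \<omega>)) \<and>
      (\<forall>\<phi>. test_fun a c \<phi> \<longrightarrow> conv_in_prob M 0 T (strat_sum \<phi> (X N j)) (\<lambda>\<omega>. J \<omega> \<phi>))"
    using ito_process.pathwise_stratonovich_current[OF proc U] s by blast
  from bchoice[OF this] obtain J :: "nat \<Rightarrow> 'w \<Rightarrow> ((real \<times> (real^'d) \<Rightarrow> real^'d) \<Rightarrow> real)" where
    J: "\<And>j \<omega>. j \<in> {1..N} \<Longrightarrow> \<omega> \<in> space M \<Longrightarrow> Hneg a c s1 s2 (J j \<omega>)"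
      "\<And>j \<phi>. j \<in> {1..N} \<Longrightarrow> test_fun a c \<phi> \<Longrightarrow> conv_in_prob M 0 T (strat_sum \<phi> (X N j)) (\<lambda>\<omega>. J j \<omega> \<phi>)"
    by blast
  let ?J = "\<lambda>\<omega> \<phi>. (1 / real N) * (\<Sum>j=1..N. J j \<omega> \<phi>)"
  have conv: "conv_in_prob M 0 T (\<lambda>p \<omega>. (1 / real N) * (\<Sum>j=1..N. strat_sum \<phi> (X N j) p \<omega>)) (\<lambda>\<omega>. ?J \<omega> \<phi>)" if tf: "test_fun a c \<phi>" for \<phi>
  proof (rule conv_in_prob_cmult_sum)
    fix j p assume j: "j \<in> {1..N}" and p: "partition_of 0 T p"
    interpret P: ito_process M F T "W j" "X N j" "S j" L "\<beta> j" "eps N" "x N j" by (rule proc[OF j])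
    show "strat_sum \<phi> (X N j) p \<in> borel_measurable M" by (rule strat_sum_measurable[OF tf P.X_M p])
  qed (use J(2) tf in auto)
  show "\<exists>J :: 'w \<Rightarrow> ((real \<times> (real^'d) \<Rightarrow> real^'d) \<Rightarrow> real).
          (\<forall>\<omega>\<in>space M. Hneg a c s1 s2 (J \<omega>)) \<and>
          (\<forall>\<phi>. test_fun a c \<phi> \<longrightarrow> (\<lambda>\<omega>. J \<omega> \<phi>) \<in> borel_measurable M \<and>
             conv_in_prob M 0 T (\<lambda>p \<omega>. (1 / real N) * (\<Sum>j=1..N. strat_sum \<phi> (X N j) p \<omega>)) (\<lambda>\<omega>. J \<omega> \<phi>))"
  proof (intro exI[of _ ?J] conjI ballI allI impI)
    fix \<omega> assume "\<omega> \<in> space M"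
    then show "Hneg a c s1 s2 (?J \<omega>)" by (intro Hneg_cmult_sum J(1)) auto
  next
    fix \<phi> :: "real \<times> (real^'d) \<Rightarrow> real^'d" assume tf: "test_fun a c \<phi>"
    show "(\<lambda>\<omega>. ?J \<omega> \<phi>) \<in> borel_measurable M" by (rule conjunct1[OF conv[OF tf, unfolded conv_in_prob_def]])
    show "conv_in_prob M 0 T (\<lambda>p \<omega>. (1 / real N) * (\<Sum>j=1..N. strat_sum \<phi> (X N j) p \<omega>)) (\<lambda>\<omega>. ?J \<omega> \<phi>)" by (rule conv[OF tf])
  qed
qed

end
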